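(* Let $f\in L^1(\mathcal X)$ satisfy $f=\sum_{(k,\alpha,\beta)\in\mathscr I}\langle f,\psi^k_{\alpha,\beta}\rangle\psi^k_{\alpha,\beta}$ in $L^1(\mathcal X)$. Then the following are equivalent: (i) $f\in H^1_{\rm at}(\mathcal X)$; (ii) $\sum_{(k,\alpha,\beta)\in\mathscr I}\langle f,\psi^k_{\alpha,\beta}\rangle\psi^k_{\alpha,\beta}$ converges unconditionally in $L^1(\mathcal X)$; (iii) $\|f\|_{\rm (iii)}:=\big\|\{\sum_{\mathscr I}|\langle f,\psi^k_{\alpha,\beta}\rangle|^2|\psi^k_{\alpha,\beta}|^2\}^{1/2}\big\|_{L^1(\mathcal X)}<\infty$; (iv) $\|f\|_{\rm (iv)}:=\big\|\{\sum_{\mathscr I}|\langle f,\psi^k_{\alpha,\beta}\rangle|^2\chi_{Q^k_\alpha}/\mu(Q^k_\alpha)\}^{1/2}\big\|_{L^1(\mathcal X)}<\infty$; (v) $\|f\|_{\rm (v)}:=\big\|\{\sum_{\mathscr I}|\langle f,\psi^k_{\alpha,\beta}\rangle|^2[R^k_{\alpha,\beta}]^2\}^{1/2}\big\|_{L^1(\mathcal X)}<\infty$, where $R^k_{\alpha,\beta}:=\chi_{W^k_{\alpha,\beta}}/\sqrt{\mu(Q^k_\alpha)}$ and $W^k_{\alpha,\beta}:=B(y^k_\beta,\epsilon_0\delta^k)$. Moreover, $\|\cdot\|_{\rm (iii)}$, $\|\cdot\|_{\rm (iv)}$ and $\|\cdot\|_{\rm (v)}$ are norms on $H^1_{\rm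 at}(\mathcal X)$, each equivalent to $\|\cdot\|_{H^1_{\rm at}(\mathcal X)}$.
   Context: Setting. $(\mathcal X,d,\mu)$ is a metric measure space of homogeneous type: $d$ is a metric, $\mu$ is a nonnegative Borel measure, finite and positive on balls $B(x,r):=\{y:d(x,y)<r\}$, with $\mu(B(x,2r))\le C_{(\mathcal X)}\mu(B(x,r))$ for all $x,r$. Assume $\operatorname{diam}\mathcal X=\infty$ and $\mu(\{x\})=0$ for all $x$. $V(x,r):=\mu(B(x,r))$. Dyadic structure. Fix $\delta\in(0,1/1000]$. For each $k\in\mathbb Z$, $\{x^k_\alpha\}_{\alpha\in\mathscr A_k}$ are reference dyadic points: $\{x^0_\alpha\}$ is a maximal $1$-separated set; for $k\ge1$, $\{x^k_\alpha\}\supset\{x^{k-1}_\alpha\}$ is maximal $\delta^k$-separated in $\mathcal X$ and $\{x^{-k}_\alpha\}\subset\{x^{-(k-1)}_\alpha\}$ is maximal $\delta^{-k}$-separated in $\{x^{-(k-1)}_\alpha\}$; $\mathscr A_k\subset\mathscr A_{k+1}$ and $x^{k+1}_\alpha=x^k_\alpha$ for $\alpha\in\mathscr A_k$. $\{Q^k_\alpha\}$ is the associated Hytönen–Kairema dyadic cube system (each generation partitions $\mathcal X$; nested or disjoint across generations; $B(x^k_\alpha,\delta^k/3)\subset Q^k_\alpha\subset B(x^k_\alpha,4\delta^k)$). $L(k,\alpha):=\{\beta\in\mathscr A_{k+1}:Q^{k+1}_\beta\subset Q^k_\alpha\}$, $\tilde{\mathscr A}:=\{(k,\alpha):\#L(k,\alpha)>1\}$,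 $\tilde L(k,\alpha):=L(k,\alpha)\setminus\{\alpha\}$, $\mathscr I:=\{(k,\alpha,\beta):(k,\alpha)\in\tilde{\mathscr A},\beta\in\tilde L(k,\alpha)\}$, $y^k_\beta:=x^{k+1}_\beta$. Wavelets. $\{\psi^k_{\alpha,\beta}\}_{(k,\alpha,\beta)\in\mathscr I}$ is the Auscher–Hytönen orthonormal basis of regular real-valued wavelets of $L^2(\mathcal X)$: with $\mathscr G_k:=\mathscr A_{k+1}\setminus\mathscr A_k$, splines $s^k_\alpha$ ($\chi_{B(x^k_\alpha,\delta^k/8)}\le s^k_\alpha\le\chi_{B(x^k_\alpha,8\delta^k)}$, $s^k_\alpha(x^k_\beta)=\delta_{\alpha\beta}$, $\sum_\alpha s^k_\alpha=1$, $\eta$-Hölder at scale $\delta^k$) and $\tilde M$ the matrix on $\ell^2(\mathscr G_k)$ with entries $(s^{k+1}_\gamma,s^{k+1}_{\gamma'})_{L^2}/\sqrt{V(y^k_\gamma,\delta^k)V(y^k_{\gamma'},\delta^k)}$, $\psi^k_{\alpha,\beta}:=\sum_{\gamma\in\mathscr G_k}\tilde M^{-1/2}(\beta,\gamma)s^{k+1}_\gamma/\sqrt{V(x^{k+1}_\gamma,\delta^{k+1})}$. For constants $\eta\in(0,1]$, $\nu,C>0$: $|\psi^k_{\alpha,\beta}(x)|\le CV(y^k_\beta,\delta^k)^{-1/2}e^{-\nu\delta^{-k}d(y^k_\beta,x)}$; $|\psi^k_{\alpha,\beta}(x)-\psi^k_{\alpha,\beta}(y)|\le CV(y^k_\beta,\delta^k)^{-1/2}(d(x,y)/\delta^k)^\eta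 e^{-\nu\delta^{-k}d(y^k_\beta,x)}$ if $d(x,y)\le\delta^k$; $\int\psi^k_{\alpha,\beta}d\mu=0$. The constant $\epsilon_0\in(0,1)$ is fixed such that, for all $(k,\alpha,\beta)\in\mathscr I$, $B(y^k_\beta,\epsilon_0\delta^k)\subset Q^k_\alpha$ and $|\psi^k_{\alpha,\beta}(x)|\ge c\,\mu(Q^k_\alpha)^{-1/2}$ on $B(y^k_\beta,\epsilon_0\delta^k)$ for some $c>0$ independent of $k,\alpha,\beta$. Hardy space. For $q\in(1,\infty]$, a $(1,q)$-atom is a function $a$ supported in a ball $B$ with $\|a\|_{L^q}\le\mu(B)^{1/q-1}$ and $\int a\,d\mu=0$. $H^1_{\rm at}(\mathcal X)$ is the space of $f\in L^1$ with $f=\sum_j\lambda_ja_j$ in $L^1$, $a_j$ atoms, $\sum|\lambda_j|<\infty$, normed by $\inf\sum|\lambda_j|$ (independent of $q$; a Banach space). $\langle f,\psi^k_{\alpha,\beta}\rangle:=\int_{\mathcal X}f\psi^k_{\alpha,\beta}\,d\mu$ (defined for $f\in L^1$ since $\psi^k_{\alpha,\beta}\in L^\infty$). Unconditional convergence means convergence under every enumeration of the index set. *)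

theory Defs
  imports "HOL-Analysis.Analysis"
begin

definition homogeneous_type :: "'a::metric_space measure \<Rightarrow> bool" where
  "homogeneous_type M \<longleftrightarrow>
     sets M = sets borel \<and>
     (\<forall>z r. r > 0 \<longrightarrow> 0 < emeasure M (ball z r) \<and> emeasure M (ball z r) < \<infinity>) \<and>
     (\<exists>C::real. \<forall>z r. emeasure M (ball z (2 * r)) \<le> ennreal C * emeasure M (ball z r)) \<and>
     \<not> bounded (UNIV :: 'a set) \<and>
     (\<forall>z. emeasure M {z} = 0)"

definition V :: "'a::metric_space measure \<Rightarrow> 'a \<Rightarrow> real \<Rightarrow> real" where
  "V M z r = measure M (ball z r)"

definition dyadic_points :: "real \<Rightarrow> (int \<Rightarrow> 'i set) \<Rightarrow> (int \<Rightarrow> 'i \<Rightarrow> 'a::metric_space) \<Rightarrow> bool" where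
  "dyadic_points \<delta> A x \<longleftrightarrow>
     (\<forall>k. A k \<subseteq> A (k + 1)) \<and>
     (\<forall>k. \<forall>\<alpha>\<in>A k. x (k + 1) \<alpha> = x k \<alpha>) \<and>
     \<comment> \<open>delta^k-separation\<close>
     (\<forall>k. \<forall>\<alpha>\<in>A k. \<forall>\<beta>\<in>A k. \<alpha> \<noteq> \<beta> \<longrightarrow> dist (x k \<alpha>) (x k \<beta>) \<ge> \<delta> powi k) \<and>
     \<comment> \<open>maximality in X for k >= 0\<close>
     (\<forall>k\<ge>0. \<forall>y. \<exists>\<alpha>\<in>A k. dist y (x k \<alpha>) < \<delta> powi k) \<and>
     \<comment> \<open>maximality inside the points of generation k+1 for k < 0\<close>
     (\<forall>k<0. \<forall>\<beta>\<in>A (k + 1). \<exists>\<alpha>\<in>A k. dist (x (k + 1) \<beta>) (x k \<alpha>) < \<delta> powi k)"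

definition dyadic_cubes :: "'a::metric_space measure \<Rightarrow> real \<Rightarrow> (int \<Rightarrow> 'i set) \<Rightarrow> (int \<Rightarrow> 'i \<Rightarrow> 'a)
    \<Rightarrow> (int \<Rightarrow> 'i \<Rightarrow> 'a set) \<Rightarrow> bool" where
  "dyadic_cubes M \<delta> A x Q \<longleftrightarrow>
     (\<forall>k. \<forall>\<alpha>\<in>A k. Q k \<alpha> \<in> sets M) \<and>
     (\<forall>k. (\<Union>\<alpha>\<in>A k. Q k \<alpha>) = UNIV) \<and>
     (\<forall>k. \<forall>\<alpha>\<in>A k. \<forall>\<beta>\<in>A k. \<alpha> \<noteq> \<beta> \<longrightarrow> Q k \<alpha> \<inter> Q k \<beta> = {}) \<and>
     (\<forall>k l. k \<le> l \<longrightarrow> (\<forall>\<alpha>\<in>A k. \<forall>\<beta>\<in>A l. Q l \<beta> \<subseteq> Q k \<alpha> \<or> Q l \<beta> \<inter> Q k \<alpha> = {})) \<and>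
     (\<forall>k. \<forall>\<alpha>\<in>A k. ball (x k \<alpha>) (\<delta> powi k / 3) \<subseteq> Q k \<alpha> \<and> Q k \<alpha> \<subseteq> ball (x k \<alpha>) (4 * \<delta> powi k))"

definition Lset :: "(int \<Rightarrow> 'i set) \<Rightarrow> (int \<Rightarrow> 'i \<Rightarrow> 'a set) \<Rightarrow> int \<Rightarrow> 'i \<Rightarrow> 'i set" where
  "Lset A Q k \<alpha> = {\<beta> \<in> A (k + 1). Q (k + 1) \<beta> \<subseteq> Q k \<alpha>}"

definition more_than_one :: "'i set \<Rightarrow> bool" where
  "more_than_one S \<longleftrightarrow> (\<exists>a\<in>S. \<exists>b\<in>S. a \<noteq> b)"

definition wav_index :: "(int \<Rightarrow> 'i set) \<Rightarrow> (int \<Rightarrow> 'i \<Rightarrow> 'a set) \<Rightarrow> (int \<times> 'i \<times> 'i) set" where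
  "wav_index A Q = {(k, \<alpha>, \<beta>). \<alpha> \<in> A k \<and> more_than_one (Lset A Q k \<alpha>) \<and> \<beta> \<in> Lset A Q k \<alpha> - {\<alpha>}}"

definition wav :: "(int \<Rightarrow> 'i \<Rightarrow> 'i \<Rightarrow> 'a \<Rightarrow> real) \<Rightarrow> int \<times> 'i \<times> 'i \<Rightarrow> 'a \<Rightarrow> real" where
  "wav \<psi> = (\<lambda>(k, \<alpha>, \<beta>). \<psi> k \<alpha> \<beta>)"

section \<open>Wavelet system (properties of the Auscher--Hytonen wavelets)\<close>

definition AH_wavelets :: "'a::metric_space measure \<Rightarrow> real \<Rightarrow> (int \<Rightarrow> 'i set) \<Rightarrow> (int \<Rightarrow> 'i \<Rightarrow> 'a)
    \<Rightarrow> (int \<Rightarrow> 'i \<Rightarrow> 'a set) \<Rightarrow> (int \<Rightarrow> 'i \<Rightarrow> 'i \<Rightarrow> 'a \<Rightarrow> real) \<Rightarrow> real \<Rightarrow> bool" where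
  "AH_wavelets M \<delta> A x Q \<psi> \<epsilon>0 \<longleftrightarrow>
     \<comment> \<open>orthonormal basis of L^2\<close>
     (\<forall>i\<in>wav_index A Q. wav \<psi> i \<in> borel_measurable M \<and> integrable M (\<lambda>y. (wav \<psi> i y)\<^sup>2)) \<and>
     (\<forall>i\<in>wav_index A Q. \<forall>j\<in>wav_index A Q.
        (LINT y|M. wav \<psi> i y * wav \<psi> j y) = (if i = j then 1 else 0)) \<and>
     (\<forall>g\<in>borel_measurable M. integrable M (\<lambda>y. (g y)\<^sup>2) \<longrightarrow>
        (\<forall>i\<in>wav_index A Q. (LINT y|M. g y * wav \<psi> i y) = 0) \<longrightarrow> (AE y in M. g y = 0)) \<and>
     \<comment> \<open>size, regularity\<close>
     (\<exists>\<eta> \<nu> C. 0 < \<eta> \<and> \<eta> \<le> 1 \<and> 0 < \<nu> \<and> 0 < C \<and>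
        (\<forall>(k, \<alpha>, \<beta>)\<in>wav_index A Q. \<forall>z.
           \<bar>\<psi> k \<alpha> \<beta> z\<bar> \<le> C / sqrt (V M (x (k + 1) \<beta>) (\<delta> powi k))
              * exp (- \<nu> * dist (x (k + 1) \<beta>) z / \<delta> powi k)) \<and>
        (\<forall>(k, \<alpha>, \<beta>)\<in>wav_index A Q. \<forall>z w. dist z w \<le> \<delta> powi k \<longrightarrow>
           \<bar>\<psi> k \<alpha> \<beta> z - \<psi> k \<alpha> \<beta> w\<bar> \<le> C / sqrt (V M (x (k + 1) \<beta>) (\<delta> powi k))
              * (dist z w / \<delta> powi k) powr \<eta> * exp (- \<nu> * dist (x (k + 1) \<beta>) z / \<delta> powi k))) \<and>
     \<comment> \<open>cancellation\<close>
     (\<forall>i\<in>wav_index A Q. integrable M (wav \<psi> i) \<and> (LINT y|M. wav \<psi> i y) = 0) \<and>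
     \<comment> \<open>the constant epsilon_0\<close>
     0 < \<epsilon>0 \<and> \<epsilon>0 < 1 \<and>
     (\<exists>c>0. \<forall>(k, \<alpha>, \<beta>)\<in>wav_index A Q.
        ball (x (k + 1) \<beta>) (\<epsilon>0 * \<delta> powi k) \<subseteq> Q k \<alpha> \<and>
        (\<forall>z\<in>ball (x (k + 1) \<beta>) (\<epsilon>0 * \<delta> powi k). \<bar>\<psi> k \<alpha> \<beta> z\<bar> \<ge> c / sqrt (measure M (Q k \<alpha>))))"

definition coeff :: "'a measure \<Rightarrow> (int \<Rightarrow> 'i \<Rightarrow> 'i \<Rightarrow> 'a \<Rightarrow> real) \<Rightarrow> ('a \<Rightarrow> real) \<Rightarrow> int \<times> 'i \<times> 'i \<Rightarrow> real" where
  "coeff M \<psi> f i = (LINT y|M. f y * wav \<psi> i y)"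

definition L1_conv :: "'a measure \<Rightarrow> (nat \<Rightarrow> 'a \<Rightarrow> real) \<Rightarrow> ('a \<Rightarrow> real) \<Rightarrow> bool" where
  "L1_conv M S g \<longleftrightarrow> ((\<lambda>n. \<integral>\<^sup>+ y. ennreal \<bar>S n y - g y\<bar> \<partial>M) \<longlonglongrightarrow> 0)"

definition series_L1 :: "'a measure \<Rightarrow> ('j \<Rightarrow> 'a \<Rightarrow> real) \<Rightarrow> (nat \<Rightarrow> 'j) \<Rightarrow> ('a \<Rightarrow> real) \<Rightarrow> bool" where
  "series_L1 M u e g \<longleftrightarrow> L1_conv M (\<lambda>n y. \<Sum>j<n. u (e j) y) g"

definition uncond_L1 :: "'a measure \<Rightarrow> 'j set \<Rightarrow> ('j \<Rightarrow> 'a \<Rightarrow> real) \<Rightarrow> bool" where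
  "uncond_L1 M J u \<longleftrightarrow>
     (\<forall>e. bij_betw e (UNIV :: nat set) J \<longrightarrow> (\<exists>g. integrable M g \<and> series_L1 M u e g))"

definition atom :: "'a::metric_space measure \<Rightarrow> ('a \<Rightarrow> real) \<Rightarrow> bool" where
  "atom M a \<longleftrightarrow> (\<exists>z r. r > 0 \<and> a \<in> borel_measurable M \<and>
     (\<forall>y. y \<notin> ball z r \<longrightarrow> a y = 0) \<and>
     (AE y in M. \<bar>a y\<bar> \<le> 1 / measure M (ball z r)) \<and>
     integrable M a \<and> (LINT y|M. a y) = 0)"

definition H1_repr :: "'a::metric_space measure \<Rightarrow> ('a \<Rightarrow> real) \<Rightarrow> (nat \<Rightarrow> real) \<Rightarrow> (nat \<Rightarrow> 'a \<Rightarrow> real) \<Rightarrow> bool" where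
  "H1_repr M f lam a \<longleftrightarrow> (\<forall>j. atom M (a j)) \<and> summable (\<lambda>j. \<bar>lam j\<bar>) \<and>
     L1_conv M (\<lambda>n y. \<Sum>j<n. lam j * a j y) f"

definition in_H1 :: "'a::metric_space measure \<Rightarrow> ('a \<Rightarrow> real) \<Rightarrow> bool" where
  "in_H1 M f \<longleftrightarrow> integrable M f \<and> (\<exists>lam a. H1_repr M f lam a)"

definition H1_norm :: "'a::metric_space measure \<Rightarrow> ('a \<Rightarrow> real) \<Rightarrow> real" where
  "H1_norm M f = Inf {(\<Sum>j. \<bar>lam j\<bar>) | lam a. H1_repr M f lam a}"

text \<open>|| { sum_{i in J} (c_i)^2 w_i }^(1/2) ||_{L^1}; the (possibly infinite) nonnegative sum
  is the supremum of finite partial sums, and the square root is taken through the sup.\<close>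
definition sq_norm :: "'a measure \<Rightarrow> 'j set \<Rightarrow> ('j \<Rightarrow> real) \<Rightarrow> ('j \<Rightarrow> 'a \<Rightarrow> real) \<Rightarrow> ennreal" where
  "sq_norm M J c w = (\<integral>\<^sup>+ y. (SUP F\<in>{F. finite F \<and> F \<subseteq> J}. ennreal (sqrt (\<Sum>i\<in>F. (c i)\<^sup>2 * w i y))) \<partial>M)"

definition normIII :: "'a measure \<Rightarrow> (int \<Rightarrow> 'i set) \<Rightarrow> (int \<Rightarrow> 'i \<Rightarrow> 'a set)
    \<Rightarrow> (int \<Rightarrow> 'i \<Rightarrow> 'i \<Rightarrow> 'a \<Rightarrow> real) \<Rightarrow> ('a \<Rightarrow> real) \<Rightarrow> ennreal" where
  "normIII M A Q \<psi> f = sq_norm M (wav_index A Q) (coeff M \<psi> f) (\<lambda>i y. \<bar>wav \<psi> i y\<bar>\<^sup>2)"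

definition normIV :: "'a measure \<Rightarrow> (int \<Rightarrow> 'i set) \<Rightarrow> (int \<Rightarrow> 'i \<Rightarrow> 'a set)
    \<Rightarrow> (int \<Rightarrow> 'i \<Rightarrow> 'i \<Rightarrow> 'a \<Rightarrow> real) \<Rightarrow> ('a \<Rightarrow> real) \<Rightarrow> ennreal" where
  "normIV M A Q \<psi> f = sq_norm M (wav_index A Q) (coeff M \<psi> f)
     (\<lambda>(k, \<alpha>, \<beta>) y. indicator (Q k \<alpha>) y / measure M (Q k \<alpha>))"

text \<open>R^k_{alpha,beta} = chi_W / sqrt(mu(Q^k_alpha)), W = B(y^k_beta, eps0 delta^k), y^k_beta = x^{k+1}_beta\<close>
definition Rfun :: "'a::metric_space measure \<Rightarrow> real \<Rightarrow> (int \<Rightarrow> 'i \<Rightarrow> 'a) \<Rightarrow> (int \<Rightarrow> 'i \<Rightarrow> 'a set)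
    \<Rightarrow> real \<Rightarrow> int \<times> 'i \<times> 'i \<Rightarrow> 'a \<Rightarrow> real" where
  "Rfun M \<delta> x Q \<epsilon>0 = (\<lambda>(k, \<alpha>, \<beta>) y.
     indicator (ball (x (k + 1) \<beta>) (\<epsilon>0 * \<delta> powi k)) y / sqrt (measure M (Q k \<alpha>)))"

definition normV :: "'a::metric_space measure \<Rightarrow> real \<Rightarrow> (int \<Rightarrow> 'i set) \<Rightarrow> (int \<Rightarrow> 'i \<Rightarrow> 'a)
    \<Rightarrow> (int \<Rightarrow> 'i \<Rightarrow> 'a set) \<Rightarrow> (int \<Rightarrow> 'i \<Rightarrow> 'i \<Rightarrow> 'a \<Rightarrow> real) \<Rightarrow> real \<Rightarrow> ('a \<Rightarrow> real) \<Rightarrow> ennreal" where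
  "normV M \<delta> A x Q \<psi> \<epsilon>0 f = sq_norm M (wav_index A Q) (coeff M \<psi> f)
     (\<lambda>i y. (Rfun M \<delta> x Q \<epsilon>0 i y)\<^sup>2)"

definition equiv_H1_norm :: "'a::metric_space measure \<Rightarrow> (('a \<Rightarrow> real) \<Rightarrow> ennreal) \<Rightarrow> bool" where
  "equiv_H1_norm M N \<longleftrightarrow>
     (\<forall>f g. in_H1 M f \<longrightarrow> in_H1 M g \<longrightarrow> N (\<lambda>y. f y + g y) \<le> N f + N g) \<and>
     (\<forall>f c. in_H1 M f \<longrightarrow> N (\<lambda>y. c * f y) = ennreal \<bar>c\<bar> * N f) \<and>
     (\<forall>f. in_H1 M f \<longrightarrow> (N f = 0 \<longleftrightarrow> (AE y in M. f y = 0))) \<and>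
     (\<exists>C>0. \<forall>f. in_H1 M f \<longrightarrow>
        ennreal (H1_norm M f) \<le> ennreal C * N f \<and> N f \<le> ennreal C * ennreal (H1_norm M f))"

end

theory Submission
  imports Defs
begin

text \<open>
  Write \<open>S f\<close> for the square function built from \<open>R\<close>, which is dominated by the other two.

  \<^item> Atoms have square functions bounded in \<open>L\<^sup>1\<close>: near the atom by Bessel's inequality, away from it
    by the cancellation of the atom (large scales) and the decay of the wavelets (small scales).
  \<^item> Conversely, a \<^emph>\<open>finite\<close> wavelet sum has atomic norm at most a constant times the \<open>L\<^sup>1\<close> norm of its
    square function. Its terms are grouped by the level sets \<open>{S f > 2^j}\<close> and by maximal cubes.
    Each group is an \<open>L\<^sup>2\<close> function with exponential decay away from a cube; it is cut along all
    cubes of that generation, and each piece, minus its mean, is decomposed by dyadic stopping times.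
  \<^item> Applied to the tails of the series this shows, by dominated convergence, that the partial sums
    are Cauchy in the atomic norm along every enumeration. Completeness of the wavelets identifies
    the limit for square-integrable functions, and density extends this to all of \<open>H\<^sup>1\<close>.
  \<^item> Unconditional convergence bounds all signed partial sums; averaging over the signs with
    Khinchine's inequality bounds the square function built from the wavelets themselves.
\<close>

section \<open>Doubling measures\<close>

text \<open>The decay of the wavelets has to be matched against a measure known only to be doubling.
  Every volume comparison is therefore phrased as a loss of \<open>exp (s * t)\<close> with s at
  choice: distance costs an exponential, paid later out of the decay rate \<nu>. The estimates run
  over finite index sets, with constants that do not depend on the set, and pass to the series by
  monotone convergence and by completeness of the atomic norm; \<open>H1_le M f K\<close>, an atomic
  sum of total weight at most K, is the working form of that norm. Finiteness shapes the
  stopping-time argument too: a finite wavelet sum is uniformly continuous, hence nearly constant on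
  the cubes of a fine generation. This gives the pointwise bound off the stopping cubes and makes
  the induction finite. Level sets are tested on the balls W and not on the cubes: an index belongs
  to the level after which the level set no longer fills half of its ball. As W is comparable in
  measure to its cube, the square function then controls both the maximal cubes and the
  coefficients.\<close>

lemma ennreal_le_suminf: "f m \<le> (\<Sum>m. f m)" for f :: "nat \<Rightarrow> ennreal"
  using sum_le_suminf[of f "{m}"] by simp

locale doubling_space =
  fixes M :: "'a::metric_space measure" and Cd :: real
  assumes sets_M: "sets M = sets borel"
    and V_pos: "\<And>z r. r > 0 \<Longrightarrow> 0 < V M z r"
    and ball_finite: "\<And>z r. emeasure M (ball z r) < \<infinity>"
    and V_double: "\<And>z r. V M z (2 * r) \<le> Cd * V M z r"
    and Cd_ge_1: "1 \<le> Cd"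
begin

lemma space_M [simp]: "space M = UNIV"
  using sets_eq_imp_space_eq[OF sets_M] by simp

lemma ball_sets [measurable, simp]: "ball z r \<in> sets M"
  by (simp add: sets_M)

lemma measurable_M_borel: "f \<in> borel_measurable borel \<Longrightarrow> f \<in> borel_measurable M"
  using measurable_cong_sets[OF sets_M refl] by blast

lemma continuous_measurable_M: "continuous_on UNIV f \<Longrightarrow> f \<in> borel_measurable M"
  for f :: "'a \<Rightarrow> real"
  by (rule measurable_M_borel) (rule borel_measurable_continuous_onI)

lemma dist_measurable [measurable]: "(\<lambda>y. dist p y) \<in> borel_measurable M"
  by (rule continuous_measurable_M) (intro continuous_intros)

lemma emeasure_ball: "emeasure M (ball z r) = ennreal (V M z r)"
  unfolding V_def using ball_finite[of z r] by (simp add: emeasure_eq_ennreal_measure less_top)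

lemma V_nonneg [simp]: "0 \<le> V M z r"
  by (simp add: V_def)

lemma V_mono: "ball z r \<subseteq> ball w s \<Longrightarrow> V M z r \<le> V M w s"
  unfolding V_def using ball_finite[of w s] by (intro measure_mono_fmeasurable) (auto simp: fmeasurable_def)

lemma V_mono_ball:
  assumes "dist z w + r \<le> s"
  shows "V M z r \<le> V M w s"
proof (intro V_mono subsetI)
  fix u assume "u \<in> ball z r"
  then show "u \<in> ball w s"
    using assms dist_triangle[of w u z] by (simp add: dist_commute)
qed

lemma measure_subset_ball: "B \<in> sets M \<Longrightarrow> B \<subseteq> ball z r \<Longrightarrow> measure M B \<le> V M z r"
  unfolding V_def using ball_finite[of z r] by (intro measure_mono_fmeasurable) (auto simp: fmeasurable_def)

lemma finite_subset_ball: "B \<subseteq> ball z r \<Longrightarrow> emeasure M B < \<infinity>"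
  using emeasure_mono[of B "ball z r" M] ball_finite[of z r] by (auto simp: order_le_less_trans)

lemma V_pow2: "V M z (2 ^ m * r) \<le> Cd ^ m * V M z r"
proof (induction m)
  case (Suc m)
  have "V M z (2 ^ Suc m * r) \<le> Cd * V M z (2 ^ m * r)"
    using V_double[of z "2 ^ m * r"] by (simp add: mult.assoc)
  also have "\<dots> \<le> Cd * (Cd ^ m * V M z r)"
    using Suc Cd_ge_1 by (intro mult_left_mono) auto
  finally show ?case by (simp add: mult.assoc)
qed auto

text \<open>Doubling gives growth of the volume by a power of t, and every power of t is dominated
  by \<open>exp (s * t)\<close>. The free rate s lets each application choose how much of an
  exponential decay it spends.\<close>

lemma V_growth:
  assumes "s > 0"
  shows "\<exists>K>0. \<forall>z \<rho> t. 0 < \<rho> \<longrightarrow> 0 \<le> t \<longrightarrow> V M z (t * \<rho>) \<le> K * exp (s * t) * V M z \<rho>"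
proof -
  \<comment> \<open>An exponent q > 0 with Cd \<le> 2^q, an upper bound for the homogeneous
    dimension.\<close>
  obtain p :: nat where p: "Cd < 2 ^ p" using real_arch_pow[of 2 Cd] by auto
  define q where "q = Suc p"
  have "(2::real) ^ p \<le> 2 ^ q" unfolding q_def by (intro power_increasing) auto
  then have q: "Cd \<le> 2 ^ q" "q > 0" using p unfolding q_def by linarith+
  \<comment> \<open>From (2 t)^q = (2 q / s)^q (s t / q)^q and (s t / q)^q \<le> exp (s t). The
    factor 2^q is slack, and the maximum with 1 covers t \<le> 1.\<close>
  define K where "K = max 1 ((2 * q / s) ^ q * 2 ^ q)"
  show ?thesis
  proof (intro exI[of _ K] conjI allI impI)
    show "K > 0" by (simp add: K_def)
    fix z :: 'a and \<rho> t :: real assume \<rho>: "0 < \<rho>" and t: "0 \<le> t"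
    show "V M z (t * \<rho>) \<le> K * exp (s * t) * V M z \<rho>"
    proof (cases "t \<le> 1")
      case True
      have "V M z (t * \<rho>) \<le> V M z \<rho>"
        using \<rho> True by (intro V_mono subset_ball) auto
      also have "\<dots> \<le> (K * exp (s * t)) * V M z \<rho>"
      proof -
        have "1 * 1 \<le> K * exp (s * t)" using t assms by (intro mult_mono) (auto simp: K_def)
        then show ?thesis using mult_right_mono[of 1 "K * exp (s * t)" "V M z \<rho>"] by simp
      qed
      finally show ?thesis .
    next
      case False
      \<comment> \<open>The least dyadic power above t, so that 2^m \<le> 2 t and m doublings cost
        at most (2 t)^q.\<close>
      define m where "m = (LEAST m::nat. t \<le> 2 ^ m)"
      have ex: "\<exists>m::nat. t \<le> 2 ^ m" using real_arch_pow[of 2 t] by (auto intro: less_imp_le)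
      have m1: "t \<le> 2 ^ m" unfolding m_def using ex by (rule LeastI_ex)
      have "m > 0" using m1 False by (cases m) auto
      then have m2: "2 ^ (m - 1) < t"
        using not_less_Least[of "m - 1" "\<lambda>m. t \<le> 2 ^ m"] unfolding m_def by (auto simp: not_le)
      have m3: "2 ^ m \<le> 2 * t" using m2 \<open>m > 0\<close> by (cases m) auto
      have "V M z (t * \<rho>) \<le> V M z (2 ^ m * \<rho>)"
        using m1 \<rho> by (intro V_mono subset_ball) auto
      also have "\<dots> \<le> Cd ^ m * V M z \<rho>" by (rule V_pow2)
      finally have 1: "V M z (t * \<rho>) \<le> Cd ^ m * V M z \<rho>" .
      have "Cd ^ m \<le> (2 ^ q) ^ m"
        using q Cd_ge_1 by (intro power_mono) auto
      also have "\<dots> = ((2::real) ^ m) ^ q" by (simp add: power_mult[symmetric] mult.commute)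
      also have "\<dots> \<le> (2 * t) ^ q" using m3 by (intro power_mono) auto
      also have "2 * t = (2 * q / s) * (s * t / q)"
        using assms \<open>q > 0\<close> by simp
      also have "\<dots> ^ q = (2 * q / s) ^ q * (s * t / q) ^ q"
        by (rule power_mult_distrib)
      also have "\<dots> \<le> (2 * q / s) ^ q * (1 + s * t / q) ^ q"
      proof -
        have "0 \<le> s * t / q" using assms q t by simp
        then have "(s * t / q) ^ q \<le> (1 + s * t / q) ^ q" by (intro power_mono) linarith+
        then show ?thesis using assms by (intro mult_left_mono) auto
      qed
      also have "\<dots> \<le> (2 * q / s) ^ q * exp (s * t)"
      proof (intro mult_left_mono exp_ge_one_plus_x_over_n_power_n)
        have "0 \<le> s * t" using assms t by simp
        then show "- real q \<le> s * t" by linarith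
      qed (use assms q in auto)
      also have "\<dots> \<le> K * exp (s * t)"
      proof -
        have "(2 * q / s) ^ q * 1 \<le> (2 * q / s) ^ q * 2 ^ q"
          using assms by (intro mult_left_mono) auto
        then have "(2 * q / s) ^ q \<le> K" by (simp add: K_def)
        then show ?thesis by (rule mult_right_mono) simp
      qed
      finally have "Cd ^ m * V M z \<rho> \<le> K * exp (s * t) * V M z \<rho>"
        by (rule mult_right_mono[OF _ V_nonneg])
      with 1 show ?thesis by simp
    qed
  qed
qed

text \<open>The ball of radius \<rho> around p lies in the ball of radius (1 + dist p q / \<rho>)
  \<rho> around q. Changing the centre thus costs an exponential in the distance, measured in units
  of the radius.\<close>

lemma V_shift:
  assumes "s > 0"
  shows "\<exists>K>0. \<forall>p q \<rho>. 0 < \<rho> \<longrightarrow> V M p \<rho> \<le> K * exp (s * dist p q / \<rho>) * V M q \<rho>"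
proof -
  obtain K where K: "K > 0" "\<And>z \<rho> t. 0 < \<rho> \<Longrightarrow> 0 \<le> t \<Longrightarrow> V M z (t * \<rho>) \<le> K * exp (s * t) * V M z \<rho>"
    using V_growth[OF assms] by blast
  have "V M p \<rho> \<le> K * exp s * exp (s * dist p q / \<rho>) * V M q \<rho>" if \<rho>: "\<rho> > 0" for p q \<rho>
  proof -
    have "V M p \<rho> \<le> V M q ((1 + dist p q / \<rho>) * \<rho>)"
      using \<rho> by (intro V_mono_ball) (auto simp: field_simps)
    also have "\<dots> \<le> K * exp (s * (1 + dist p q / \<rho>)) * V M q \<rho>"
      using \<rho> by (intro K) auto
    finally show ?thesis by (simp add: exp_add ring_distribs mult.assoc)
  qed
  then show ?thesis using K(1) by (intro exI[of _ "K * exp s"]) auto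
qed

text \<open>Summation over the shells m \<rho> \<le> dist p y < (m + 1) \<rho>: volume growth at
  rate s / 2 against decay at rate s leaves a geometric series.\<close>

lemma nn_integral_exp_dist:
  assumes "s > 0"
  shows "\<exists>K>0. \<forall>p \<rho>. 0 < \<rho> \<longrightarrow>
    (\<integral>\<^sup>+ y. ennreal (exp (- s * dist p y / \<rho>)) \<partial>M) \<le> ennreal (K * V M p \<rho>)"
proof -
  obtain K where K: "K > 0" "\<And>z \<rho> t. 0 < \<rho> \<Longrightarrow> 0 \<le> t \<Longrightarrow> V M z (t * \<rho>) \<le> K * exp (s / 2 * t) * V M z \<rho>"
    using V_growth[of "s/2"] assms by auto
  define q where "q = exp (- s / 2)"
  have q: "0 < q" "q < 1" using assms by (auto simp: q_def)
  have summ: "summable (\<lambda>m. q ^ m)" using q by (intro summable_geometric) auto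
  define G where "G = (\<Sum>m. q ^ m)"
  have G: "G \<ge> 1" unfolding G_def using sum_le_suminf[OF summ, of "{0}"] q by auto
  have "(\<integral>\<^sup>+ y. ennreal (exp (- s * dist p y / \<rho>)) \<partial>M) \<le> ennreal (K * exp (s / 2) * G * V M p \<rho>)"
    if \<rho>: "\<rho> > 0" for p \<rho>
  proof -
    have "(\<integral>\<^sup>+ y. ennreal (exp (- s * dist p y / \<rho>)) \<partial>M)
        \<le> (\<integral>\<^sup>+ y. (\<Sum>m. ennreal (exp (- s * real m)) * indicator (ball p (real (Suc m) * \<rho>)) y) \<partial>M)"
    proof (rule nn_integral_mono)
      fix y
      define m where "m = nat \<lfloor>dist p y / \<rho>\<rfloor>"
      have m: "real m \<le> dist p y / \<rho>" "dist p y / \<rho> < real (Suc m)"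
        unfolding m_def using \<rho> real_of_int_floor_add_one_gt[of "dist p y / \<rho>"]
        by (auto simp: of_nat_nat add.commute)
      have "ennreal (exp (- s * dist p y / \<rho>)) \<le> ennreal (exp (- s * real m)) * indicator (ball p (real (Suc m) * \<rho>)) y"
        using m assms \<rho> by (auto simp: indicator_def mem_ball field_simps intro!: ennreal_leI)
      also have "\<dots> \<le> (\<Sum>m. ennreal (exp (- s * real m)) * indicator (ball p (real (Suc m) * \<rho>)) y)"
        by (rule ennreal_le_suminf)
      finally show "ennreal (exp (- s * dist p y / \<rho>)) \<le> (\<Sum>m. ennreal (exp (- s * real m)) * indicator (ball p (real (Suc m) * \<rho>)) y)" .
    qed
    also have "\<dots> = (\<Sum>m. (\<integral>\<^sup>+ y. ennreal (exp (- s * real m)) * indicator (ball p (real (Suc m) * \<rho>)) y \<partial>M))"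
      by (intro nn_integral_suminf) measurable
    also have "\<dots> = (\<Sum>m. ennreal (exp (- s * real m) * V M p (real (Suc m) * \<rho>)))"
      by (subst nn_integral_cmult_indicator) (auto simp: emeasure_ball ennreal_mult)
    also have "\<dots> \<le> (\<Sum>m. ennreal ((K * exp (s/2) * V M p \<rho>) * q ^ m))"
    proof (intro suminf_le ennreal_leI)
      fix m :: nat
      have "exp (- s * real m) * V M p (real (Suc m) * \<rho>) \<le> exp (- s * real m) * (K * exp (s / 2 * real (Suc m)) * V M p \<rho>)"
        using K(2)[of \<rho> "real (Suc m)" p] \<rho> by (intro mult_left_mono) auto
      also have "\<dots> = (K * exp (s/2) * V M p \<rho>) * (exp (- s * real m) * exp (s / 2 * real m))"
        by (simp add: ring_distribs exp_add)
      also have "exp (- s * real m) * exp (s / 2 * real m) = q ^ m"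
        unfolding q_def by (simp add: exp_add[symmetric] exp_of_nat_mult[symmetric] algebra_simps)
      finally show "exp (- s * real m) * V M p (real (Suc m) * \<rho>) \<le> (K * exp (s/2) * V M p \<rho>) * q ^ m" .
    qed auto
    also have "\<dots> = ennreal ((K * exp (s/2) * V M p \<rho>) * G)"
      unfolding G_def using K q summ
      by (subst suminf_ennreal2) (auto simp: suminf_mult summable_mult)
    finally show ?thesis by (simp add: mult_ac)
  qed
  then show ?thesis using K(1) G by (intro exI[of _ "K * exp (s/2) * G"]) auto
qed

text \<open>A sum over separated points is compared with an integral: the balls of radius \<theta>
  \<rho> / 2 are disjoint, and on each of them the kernel around y is nearly constant. One half of
  the rate s pays for comparing the volumes at \<open>pt i\<close> and at y, the other half keeps
  the integral finite.\<close>

lemma sum_exp_dist_separated: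
  fixes pt :: "'j \<Rightarrow> 'a"
  assumes s: "s > 0" and \<theta>: "\<theta> > 0"
  shows "\<exists>K>0. \<forall>\<rho> S (pt :: 'j \<Rightarrow> 'a) y. 0 < \<rho> \<longrightarrow> finite S \<longrightarrow>
     (\<forall>i\<in>S. \<forall>j\<in>S. i \<noteq> j \<longrightarrow> \<theta> * \<rho> \<le> dist (pt i) (pt j)) \<longrightarrow>
     (\<Sum>i\<in>S. exp (- s * dist (pt i) y / \<rho>)) \<le> K"
proof -
  obtain K1 where K1: "K1 > 0" "\<And>p q \<rho>. 0 < \<rho> \<Longrightarrow> V M p \<rho> \<le> K1 * exp (s / 2 * dist p q / \<rho>) * V M q \<rho>"
    using V_shift[of "s/2"] s by auto
  obtain K2 where K2: "K2 > 0" "\<And>z \<rho> t. 0 < \<rho> \<Longrightarrow> 0 \<le> t \<Longrightarrow> V M z (t * \<rho>) \<le> K2 * exp (1 * t) * V M z \<rho>"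
    using V_growth[of 1] by auto
  obtain K3 where K3: "K3 > 0" "\<And>p \<rho>. 0 < \<rho> \<Longrightarrow>
    (\<integral>\<^sup>+ y. ennreal (exp (- (s/2) * dist p y / \<rho>)) \<partial>M) \<le> ennreal (K3 * V M p \<rho>)"
    using nn_integral_exp_dist[of "s/2"] s by auto
  \<comment> \<open>\<open>exp (2 / \<theta>)\<close> comes from shrinking the radius \<rho> to
    \<theta> \<rho> / 2; \<open>exp (s * \<theta> / 4)\<close> makes up for the change of the kernel
    at rate s / 2 across a ball of that radius, which appears in \<open>two\<close>.\<close>
  define K4 where "K4 = K1 * K2 * exp (2 / \<theta>) * exp (s * \<theta> / 4)"
  have K4: "K4 > 0" using K1 K2 by (simp add: K4_def)
  have "(\<Sum>i\<in>S. exp (- s * dist (pt i) y / \<rho>)) \<le> K4 * K3"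
    if \<rho>: "\<rho> > 0" and S: "finite S"
      and sep: "\<forall>i\<in>S. \<forall>j\<in>S. i \<noteq> j \<longrightarrow> \<theta> * \<rho> \<le> dist (pt i) (pt j)" for \<rho> S y and pt :: "'j \<Rightarrow> 'a"
  proof -
    define B where "B i = ball (pt i) (\<theta> / 2 * \<rho>)" for i
    have disj: "disjoint_family_on B S"
    proof (unfold disjoint_family_on_def B_def, intro ballI impI)
      fix i j assume ij: "i \<in> S" "j \<in> S" "i \<noteq> j"
      show "ball (pt i) (\<theta> / 2 * \<rho>) \<inter> ball (pt j) (\<theta> / 2 * \<rho>) = {}"
      proof (rule ccontr)
        assume "\<not> ?thesis"
        then obtain u where "dist (pt i) u < \<theta> / 2 * \<rho>" "dist (pt j) u < \<theta> / 2 * \<rho>" by auto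
        then have "dist (pt i) (pt j) < \<theta> * \<rho>"
          using dist_triangle2[of "pt i" "pt j" u] by auto
        then show False using sep ij by fastforce
      qed
    qed
    have Vy: "V M y \<rho> > 0" using \<rho> by (rule V_pos)
    have one: "V M y \<rho> * exp (- s * dist (pt i) y / \<rho>) \<le> K4 * exp (- s * \<theta> / 4) * exp (- (s/2) * dist (pt i) y / \<rho>) * V M (pt i) (\<theta> / 2 * \<rho>)" for i
    proof -
      have "V M y \<rho> \<le> K1 * exp (s / 2 * dist y (pt i) / \<rho>) * V M (pt i) \<rho>"
        by (rule K1(2)[OF \<rho>])
      also have "V M (pt i) \<rho> = V M (pt i) (2 / \<theta> * (\<theta> / 2 * \<rho>))" using \<theta> by simp
      also have "\<dots> \<le> K2 * exp (1 * (2 / \<theta>)) * V M (pt i) (\<theta> / 2 * \<rho>)"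
        using \<rho> \<theta> by (intro K2(2)) auto
      finally have "V M y \<rho> \<le> K1 * exp (s / 2 * dist y (pt i) / \<rho>) * (K2 * exp (1 * (2 / \<theta>)) * V M (pt i) (\<theta> / 2 * \<rho>))"
        using K1 by (simp add: mult_left_mono)
      then have "V M y \<rho> * exp (- s * dist (pt i) y / \<rho>) \<le> K1 * exp (s / 2 * dist y (pt i) / \<rho>) * (K2 * exp (1 * (2 / \<theta>)) * V M (pt i) (\<theta> / 2 * \<rho>)) * exp (- s * dist (pt i) y / \<rho>)"
        by (intro mult_right_mono) auto
      also have "\<dots> = K1 * K2 * exp (2 / \<theta>) * (exp (s / 2 * dist y (pt i) / \<rho>) * exp (- s * dist (pt i) y / \<rho>)) * V M (pt i) (\<theta> / 2 * \<rho>)"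
        by simp
      also have "exp (s / 2 * dist y (pt i) / \<rho>) * exp (- s * dist (pt i) y / \<rho>) = exp (- (s/2) * dist (pt i) y / \<rho>)"
        using \<rho> by (simp add: exp_add[symmetric] dist_commute field_simps)
      also have "K1 * K2 * exp (2 / \<theta>) = K4 * exp (- s * \<theta> / 4)"
        unfolding K4_def by (simp add: exp_add[symmetric])
      finally show ?thesis .
    qed
    have two: "ennreal (exp (- s * \<theta> / 4) * exp (- (s/2) * dist (pt i) y / \<rho>) * V M (pt i) (\<theta> / 2 * \<rho>))
        \<le> (\<integral>\<^sup>+ u. ennreal (exp (- (s/2) * dist y u / \<rho>)) * indicator (B i) u \<partial>M)" for i
    proof -
      have "ennreal (exp (- s * \<theta> / 4) * exp (- (s/2) * dist (pt i) y / \<rho>) * V M (pt i) (\<theta> / 2 * \<rho>))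
         = (\<integral>\<^sup>+ u. ennreal (exp (- s * \<theta> / 4) * exp (- (s/2) * dist (pt i) y / \<rho>)) * indicator (B i) u \<partial>M)"
        unfolding B_def by (subst nn_integral_cmult_indicator) (auto simp: emeasure_ball ennreal_mult)
      also have "\<dots> \<le> (\<integral>\<^sup>+ u. ennreal (exp (- (s/2) * dist y u / \<rho>)) * indicator (B i) u \<partial>M)"
      proof (intro nn_integral_mono)
        fix u
        show "ennreal (exp (- s * \<theta> / 4) * exp (- (s/2) * dist (pt i) y / \<rho>)) * indicator (B i) u \<le> ennreal (exp (- (s/2) * dist y u / \<rho>)) * indicator (B i) u"
        proof (cases "u \<in> B i")
          case True
          then have "dist (pt i) u < \<theta> / 2 * \<rho>" by (simp add: B_def)
          then have "dist y u \<le> dist (pt i) y + \<theta> / 2 * \<rho>"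
            using dist_triangle[of y u "pt i"] by (simp add: dist_commute)
          then have "dist y u / \<rho> \<le> dist (pt i) y / \<rho> + \<theta> / 2"
            using \<rho> by (simp add: field_simps)
          then have "(s/2) * (dist y u / \<rho>) \<le> (s/2) * (dist (pt i) y / \<rho> + \<theta> / 2)"
            using s by (intro mult_left_mono) auto
          then have "exp (- s * \<theta> / 4) * exp (- (s/2) * dist (pt i) y / \<rho>) \<le> exp (- (s/2) * dist y u / \<rho>)"
            by (simp add: exp_add[symmetric] algebra_simps)
          then show ?thesis using True by (auto intro: ennreal_leI)
        qed auto
      qed
      finally show ?thesis .
    qed
    have "ennreal (\<Sum>i\<in>S. exp (- s * \<theta> / 4) * exp (- (s/2) * dist (pt i) y / \<rho>) * V M (pt i) (\<theta> / 2 * \<rho>))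
       = (\<Sum>i\<in>S. ennreal (exp (- s * \<theta> / 4) * exp (- (s/2) * dist (pt i) y / \<rho>) * V M (pt i) (\<theta> / 2 * \<rho>)))"
      by (subst sum_ennreal) auto
    also have "\<dots> \<le> (\<Sum>i\<in>S. \<integral>\<^sup>+ u. ennreal (exp (- (s/2) * dist y u / \<rho>)) * indicator (B i) u \<partial>M)"
      by (intro sum_mono two)
    also have "\<dots> = (\<integral>\<^sup>+ u. (\<Sum>i\<in>S. ennreal (exp (- (s/2) * dist y u / \<rho>)) * indicator (B i) u) \<partial>M)"
      by (subst nn_integral_sum) (auto simp: B_def)
    also have "\<dots> \<le> (\<integral>\<^sup>+ u. ennreal (exp (- (s/2) * dist y u / \<rho>)) \<partial>M)"
    proof (intro nn_integral_mono)
      fix u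
      have "(\<Sum>i\<in>S. ennreal (exp (- (s/2) * dist y u / \<rho>)) * indicator (B i) u) = ennreal (exp (- (s/2) * dist y u / \<rho>)) * (\<Sum>i\<in>S. indicator (B i) u)"
        by (simp add: sum_distrib_left)
      also have "(\<Sum>i\<in>S. indicator (B i) u :: ennreal) = indicator (\<Union>i\<in>S. B i) u"
        using indicator_UN_disjoint[OF S disj] by metis
      finally show "(\<Sum>i\<in>S. ennreal (exp (- (s/2) * dist y u / \<rho>)) * indicator (B i) u) \<le> ennreal (exp (- (s/2) * dist y u / \<rho>))"
        by (auto simp: indicator_def)
    qed
    also have "\<dots> \<le> ennreal (K3 * V M y \<rho>)" by (rule K3(2)[OF \<rho>])
    finally have three: "(\<Sum>i\<in>S. exp (- s * \<theta> / 4) * exp (- (s/2) * dist (pt i) y / \<rho>) * V M (pt i) (\<theta> / 2 * \<rho>)) \<le> K3 * V M y \<rho>"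
      using K3(1) by (subst (asm) ennreal_le_iff) auto
    have "V M y \<rho> * (\<Sum>i\<in>S. exp (- s * dist (pt i) y / \<rho>)) \<le> K4 * (\<Sum>i\<in>S. exp (- s * \<theta> / 4) * exp (- (s/2) * dist (pt i) y / \<rho>) * V M (pt i) (\<theta> / 2 * \<rho>))"
      unfolding sum_distrib_left using one by (intro sum_mono) (auto simp: mult.assoc)
    also have "\<dots> \<le> K4 * (K3 * V M y \<rho>)" using K4 three by (intro mult_left_mono) auto
    also have "\<dots> = V M y \<rho> * (K4 * K3)" by simp
    finally show ?thesis using Vy by (simp only: mult_le_cancel_left_pos)
  qed
  then show ?thesis using K4 K3(1) by (intro exI[of _ "K4 * K3"]) auto
qed

end

section \<open>Atomic sums\<close>

lemma summable_nonneg_le: "summable g \<Longrightarrow> (\<And>n. 0 \<le> f n) \<Longrightarrow> (\<And>n. f n \<le> g n) \<Longrightarrow> summable f"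
  for f g :: "nat \<Rightarrow> real"
  by (rule summable_comparison_test'[of g 0]) auto

lemma AE_summable_of_L1:
  fixes f :: "nat \<Rightarrow> 'b \<Rightarrow> real"
  assumes int: "\<And>n. integrable M (f n)" and summ: "summable (\<lambda>n. LINT y|M. \<bar>f n y\<bar>)"
  shows "AE y in M. summable (\<lambda>n. \<bar>f n y\<bar>)"
proof -
  have [measurable]: "f n \<in> borel_measurable M" for n using int[of n] by auto
  have "(\<integral>\<^sup>+ y. (\<Sum>n. ennreal \<bar>f n y\<bar>) \<partial>M) = (\<Sum>n. \<integral>\<^sup>+ y. ennreal \<bar>f n y\<bar> \<partial>M)"
    by (intro nn_integral_suminf) measurable
  also have "\<dots> = (\<Sum>n. ennreal (LINT y|M. \<bar>f n y\<bar>))"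
    using int by (intro suminf_cong nn_integral_eq_integral) auto
  also have "\<dots> \<noteq> \<infinity>"
    using summ by (subst suminf_ennreal2) (auto)
  finally have "AE y in M. (\<Sum>n. ennreal \<bar>f n y\<bar>) \<noteq> \<infinity>"
    by (intro nn_integral_PInf_AE) auto
  then show ?thesis
    by eventually_elim (intro summable_suminf_not_top, auto)
qed

lemma L1_conv_of_AE_sums:
  fixes f :: "nat \<Rightarrow> 'b \<Rightarrow> real"
  assumes int: "\<And>n. integrable M (f n)" and summ: "summable (\<lambda>n. LINT y|M. \<bar>f n y\<bar>)"
    and sums: "AE y in M. (\<lambda>n. f n y) sums g y" and g [measurable]: "g \<in> borel_measurable M"
  shows "integrable M g" "(LINT y|M. \<bar>g y\<bar>) \<le> (\<Sum>n. LINT y|M. \<bar>f n y\<bar>)"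
    "L1_conv M (\<lambda>n y. \<Sum>j<n. f j y) g"
proof -
  have [measurable]: "f n \<in> borel_measurable M" for n using int[of n] by auto
  have ae: "AE y in M. summable (\<lambda>n. \<bar>f n y\<bar>)" by (rule AE_summable_of_L1[OF int summ])
  \<comment> \<open>The L1 error after N terms is at most the sum of the remaining norms; N = 0
    gives integrability and the norm bound.\<close>
  have tail: "(\<integral>\<^sup>+ y. ennreal \<bar>(\<Sum>j<N. f j y) - g y\<bar> \<partial>M) \<le> ennreal (\<Sum>n. LINT y|M. \<bar>f (n + N) y\<bar>)" for N
  proof -
    have "(\<integral>\<^sup>+ y. ennreal \<bar>(\<Sum>j<N. f j y) - g y\<bar> \<partial>M) \<le> (\<integral>\<^sup>+ y. (\<Sum>n. ennreal \<bar>f (n + N) y\<bar>) \<partial>M)"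
    proof (intro nn_integral_mono_AE, use sums ae in eventually_elim)
      fix y assume s: "(\<lambda>n. f n y) sums g y" and a: "summable (\<lambda>n. \<bar>f n y\<bar>)"
      have a': "summable (\<lambda>n. \<bar>f (n + N) y\<bar>)" using a summable_iff_shift[of "\<lambda>n. \<bar>f n y\<bar>" N] by simp
      have "(\<lambda>n. f (n + N) y) sums (g y - (\<Sum>j<N. f j y))" by (rule sums_split_initial_segment[OF s])
      then have "\<bar>g y - (\<Sum>j<N. f j y)\<bar> \<le> (\<Sum>n. \<bar>f (n + N) y\<bar>)"
        using summable_rabs[OF a'] by (simp add: sums_iff)
      then show "ennreal \<bar>(\<Sum>j<N. f j y) - g y\<bar> \<le> (\<Sum>n. ennreal \<bar>f (n + N) y\<bar>)"
        using a' by (subst suminf_ennreal2) (auto intro!: ennreal_leI simp: abs_minus_commute)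
    qed
    also have "\<dots> = (\<Sum>n. \<integral>\<^sup>+ y. ennreal \<bar>f (n + N) y\<bar> \<partial>M)"
      by (intro nn_integral_suminf) measurable
    also have "\<dots> = (\<Sum>n. ennreal (LINT y|M. \<bar>f (n + N) y\<bar>))"
      using int by (intro suminf_cong nn_integral_eq_integral) auto
    also have "\<dots> = ennreal (\<Sum>n. LINT y|M. \<bar>f (n + N) y\<bar>)"
      using summ by (subst suminf_ennreal2) (auto simp: summable_iff_shift[of "\<lambda>n. LINT y|M. \<bar>f n y\<bar>"])
    finally show ?thesis .
  qed
  have "(\<integral>\<^sup>+ y. ennreal (norm (g y)) \<partial>M) \<le> ennreal (\<Sum>n. LINT y|M. \<bar>f n y\<bar>)"
    using tail[of 0] by simp
  then show i: "integrable M g"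
    unfolding integrable_iff_bounded by (auto simp: less_top[symmetric] top_unique)
  have "ennreal (LINT y|M. \<bar>g y\<bar>) = (\<integral>\<^sup>+ y. ennreal (norm (g y)) \<partial>M)"
    using i by (subst nn_integral_eq_integral) auto
  also have "\<dots> \<le> ennreal (\<Sum>n. LINT y|M. \<bar>f n y\<bar>)" using tail[of 0] by simp
  finally show "(LINT y|M. \<bar>g y\<bar>) \<le> (\<Sum>n. LINT y|M. \<bar>f n y\<bar>)"
    by (subst (asm) ennreal_le_iff) (auto intro!: suminf_nonneg summ)
  have lim: "(\<lambda>N. ennreal (\<Sum>n. LINT y|M. \<bar>f (n + N) y\<bar>)) \<longlonglongrightarrow> 0"
    using suminf_exist_split2[OF summ] by (simp add: tendsto_ennrealI[of _ 0, simplified])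
  show "L1_conv M (\<lambda>n y. \<Sum>j<n. f j y) g"
    unfolding L1_conv_def
    by (rule tendsto_sandwich[OF _ _ tendsto_const lim]) (use tail in auto)
qed

lemma L1_conv_unique:
  assumes S [measurable]: "\<And>n. S n \<in> borel_measurable M" and [measurable]: "f \<in> borel_measurable M" "g \<in> borel_measurable M"
    and "L1_conv M S f" "L1_conv M S g"
  shows "AE y in M. f y = g y"
proof -
  have "(\<lambda>n. (\<integral>\<^sup>+ y. ennreal \<bar>S n y - f y\<bar> \<partial>M) + (\<integral>\<^sup>+ y. ennreal \<bar>S n y - g y\<bar> \<partial>M)) \<longlonglongrightarrow> 0 + 0"
    using assms unfolding L1_conv_def by (intro tendsto_add) auto
  moreover have "(\<integral>\<^sup>+ y. ennreal \<bar>f y - g y\<bar> \<partial>M) \<le> (\<integral>\<^sup>+ y. ennreal \<bar>S n y - f y\<bar> \<partial>M) + (\<integral>\<^sup>+ y. ennreal \<bar>S n y - g y\<bar> \<partial>M)" for n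
    by (subst nn_integral_add[symmetric])
       (auto intro!: nn_integral_mono ennreal_leI simp: ennreal_plus[symmetric] simp del: ennreal_plus)
  ultimately have "(\<integral>\<^sup>+ y. ennreal \<bar>f y - g y\<bar> \<partial>M) \<le> 0"
    by (intro LIMSEQ_le_const[of _ 0]) auto
  then have "AE y in M. ennreal \<bar>f y - g y\<bar> = 0"
    by (subst nn_integral_0_iff_AE[symmetric]) auto
  then show ?thesis by eventually_elim auto
qed

text \<open>A quantitative form of membership that involves no infimum. The sum is taken almost
  everywhere instead of in L1, which turns countable sums of such functions into rearrangements of
  pointwise absolutely convergent series.\<close>

definition H1_le :: "'a::metric_space measure \<Rightarrow> ('a \<Rightarrow> real) \<Rightarrow> real \<Rightarrow> bool" where
  "H1_le M f K \<longleftrightarrow> f \<in> borel_measurable M \<and>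
     (\<exists>lam a. (\<forall>j. atom M (a j)) \<and> summable (\<lambda>j. \<bar>lam j\<bar>) \<and> (\<Sum>j. \<bar>lam j\<bar>) \<le> K \<and>
        (AE y in M. (\<lambda>j. lam j * a j y) sums f y))"

context doubling_space
begin

lemma atom_zero: "atom M (\<lambda>_. 0)"
  unfolding atom_def by (intro exI[of _ undefined] exI[of _ 1]) auto

lemma atom_integrable: "atom M a \<Longrightarrow> integrable M a"
  unfolding atom_def by auto

lemma atom_L1: assumes "atom M a" shows "(LINT y|M. \<bar>a y\<bar>) \<le> 1"
proof -
  obtain z r where r: "r > 0" and supp: "\<And>y. y \<notin> ball z r \<Longrightarrow> a y = 0"
    and bd: "AE y in M. \<bar>a y\<bar> \<le> 1 / V M z r" and int: "integrable M a"
    using assms unfolding atom_def V_def by blast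
  have "(LINT y|M. \<bar>a y\<bar>) \<le> (LINT y|M. indicator (ball z r) y * (1 / V M z r))"
  proof (intro integral_mono_AE)
    show "integrable M (\<lambda>y. indicator (ball z r) y * (1 / V M z r))"
      using ball_finite[of z r] by (intro integrable_mult_left integrable_real_indicator) auto
    show "AE y in M. \<bar>a y\<bar> \<le> indicator (ball z r) y * (1 / V M z r)"
      using bd supp by (auto simp: indicator_def elim!: eventually_mono)
  qed (use int in auto)
  also have "\<dots> = 1" using V_pos[OF r, of z] by (simp add: V_def)
  finally show ?thesis .
qed

text \<open>Atoms have L1 norm at most one, so the series converges absolutely in L1 and hands size
  and cancellation of the atoms on to its sum.\<close>

lemma H1_le_props:
  assumes "H1_le M f K"
  shows "integrable M f" "(LINT y|M. \<bar>f y\<bar>) \<le> K" "(LINT y|M. f y) = 0" "0 \<le> K"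
    and "\<exists>lam a. H1_repr M f lam a \<and> (\<Sum>j. \<bar>lam j\<bar>) \<le> K"
proof -
  obtain lam a where at: "\<And>j. atom M (a j)" and su: "summable (\<lambda>j. \<bar>lam j\<bar>)" and le: "(\<Sum>j. \<bar>lam j\<bar>) \<le> K"
    and ae: "AE y in M. (\<lambda>j. lam j * a j y) sums f y" and f: "f \<in> borel_measurable M"
    using assms unfolding H1_le_def by blast
  have int: "integrable M (\<lambda>y. lam j * a j y)" for j using at atom_integrable by auto
  have le1: "(LINT y|M. \<bar>lam j * a j y\<bar>) \<le> \<bar>lam j\<bar>" for j
    using mult_left_mono[OF atom_L1[OF at[of j]], of "\<bar>lam j\<bar>"] by (simp add: abs_mult)
  have su1: "summable (\<lambda>j. LINT y|M. \<bar>lam j * a j y\<bar>)"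
    by (rule summable_nonneg_le[OF su _ le1]) simp
  note c = L1_conv_of_AE_sums[OF int su1 ae f]
  show "integrable M f" by (rule c(1))
  have "(\<Sum>j. LINT y|M. \<bar>lam j * a j y\<bar>) \<le> (\<Sum>j. \<bar>lam j\<bar>)" using le1 su su1 by (intro suminf_le) auto
  then show le2: "(LINT y|M. \<bar>f y\<bar>) \<le> K" using c(2) le by linarith
  have "0 \<le> (LINT y|M. \<bar>f y\<bar>)" by simp
  then show "0 \<le> K" using le2 by linarith
  show "\<exists>lam a. H1_repr M f lam a \<and> (\<Sum>j. \<bar>lam j\<bar>) \<le> K"
    using at su le c(3) unfolding H1_repr_def by blast
  have z: "(LINT y|M. a j y) = 0" for j using at[of j] unfolding atom_def by auto
  have "(\<lambda>n. LINT y|M. (\<Sum>j<n. lam j * a j y)) \<longlonglongrightarrow> (LINT y|M. f y)"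
    using c(1,3) int unfolding L1_conv_def by (intro tendsto_L1_int) auto
  moreover have "(LINT y|M. (\<Sum>j<n. lam j * a j y)) = 0" for n
    using Bochner_Integration.integral_sum[of "{..<n}" M "\<lambda>j y. lam j * a j y", OF int] z by simp
  ultimately show "(LINT y|M. f y) = 0" by (simp add: LIMSEQ_const_iff)
qed

text \<open>Summable coefficients force absolute convergence of the atomic series almost everywhere.
  The pointwise sum is also an L1 limit, and L1 limits are unique.\<close>

lemma H1_repr_imp_H1_le:
  assumes r: "H1_repr M f lam a" and f [measurable]: "f \<in> borel_measurable M"
  shows "H1_le M f (\<Sum>j. \<bar>lam j\<bar>)"
proof -
  have at: "\<And>j. atom M (a j)" and su: "summable (\<lambda>j. \<bar>lam j\<bar>)"
    and c: "L1_conv M (\<lambda>n y. \<Sum>j<n. lam j * a j y) f"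
    using r unfolding H1_repr_def by auto
  have int: "integrable M (\<lambda>y. lam j * a j y)" for j using at atom_integrable by auto
  have [measurable]: "a j \<in> borel_measurable M" for j using at[of j] unfolding atom_def by auto
  have le1: "(LINT y|M. \<bar>lam j * a j y\<bar>) \<le> \<bar>lam j\<bar>" for j
    using mult_left_mono[OF atom_L1[OF at[of j]], of "\<bar>lam j\<bar>"] by (simp add: abs_mult)
  have su1: "summable (\<lambda>j. LINT y|M. \<bar>lam j * a j y\<bar>)"
    by (rule summable_nonneg_le[OF su _ le1]) simp
  define g where "g y = (\<Sum>j. lam j * a j y)" for y
  have [measurable]: "g \<in> borel_measurable M" unfolding g_def by measurable
  have ae: "AE y in M. (\<lambda>j. lam j * a j y) sums g y"
    using AE_summable_of_L1[OF int su1] by eventually_elim (auto simp: g_def intro!: summable_sums summable_rabs_cancel)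
  have "L1_conv M (\<lambda>n y. \<Sum>j<n. lam j * a j y) g"
    by (rule L1_conv_of_AE_sums[OF int su1 ae]) measurable
  then have "AE y in M. f y = g y" using c
    by (intro L1_conv_unique[of "\<lambda>n y. \<Sum>j<n. lam j * a j y"]) (simp_all add: f)
  with ae have "AE y in M. (\<lambda>j. lam j * a j y) sums f y" by eventually_elim auto
  then show ?thesis unfolding H1_le_def using at su f by blast
qed

lemma H1_le_imp_in_H1: "H1_le M f K \<Longrightarrow> in_H1 M f"
  using H1_le_props[of f K] unfolding in_H1_def by blast

lemma H1_norm_le:
  assumes "H1_le M f K" shows "H1_norm M f \<le> K"
proof -
  obtain lam a where "H1_repr M f lam a" "(\<Sum>j. \<bar>lam j\<bar>) \<le> K" using H1_le_props(5)[OF assms] by blast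
  moreover have "bdd_below {(\<Sum>j. \<bar>lam j\<bar>) | lam a. H1_repr M f lam a}"
    unfolding H1_repr_def by (intro bdd_belowI[of _ 0]) (auto intro!: suminf_nonneg)
  ultimately show ?thesis unfolding H1_norm_def by (intro cInf_lower2) auto
qed

lemma H1_norm_nonneg: "in_H1 M f \<Longrightarrow> 0 \<le> H1_norm M f"
  unfolding H1_norm_def
proof (rule cInf_greatest)
  assume "in_H1 M f"
  then show "{(\<Sum>j. \<bar>lam j\<bar>) | lam a. H1_repr M f lam a} \<noteq> {}" unfolding in_H1_def by auto
qed (auto simp: H1_repr_def intro!: suminf_nonneg)

text \<open>The infimum may not be attained, hence the slack e.\<close>

lemma in_H1_imp_H1_le:
  assumes f: "in_H1 M f" and "0 < e"
  shows "H1_le M f (H1_norm M f + e)"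
proof -
  let ?S = "{(\<Sum>j. \<bar>lam j\<bar>) | lam a. H1_repr M f lam a}"
  have "?S \<noteq> {}" using f unfolding in_H1_def by auto
  then obtain s where "s \<in> ?S" "s < H1_norm M f + e"
    using cInf_lessD[of ?S "H1_norm M f + e"] \<open>0 < e\<close> unfolding H1_norm_def by auto
  then obtain lam a where "H1_repr M f lam a" and s: "(\<Sum>j. \<bar>lam j\<bar>) < H1_norm M f + e" by auto
  moreover have "f \<in> borel_measurable M" using f unfolding in_H1_def by auto
  ultimately show ?thesis using H1_repr_imp_H1_le[of f lam a] unfolding H1_le_def by force
qed

lemma H1_le_mono: "H1_le M f K \<Longrightarrow> K \<le> L \<Longrightarrow> H1_le M f L"
  unfolding H1_le_def by force

lemma H1_le_zero: "0 \<le> K \<Longrightarrow> H1_le M (\<lambda>_. 0) K"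
  unfolding H1_le_def
  by (intro conjI exI[of _ "\<lambda>_. 0"] exI[of _ "\<lambda>_ _. 0"]) (auto intro: atom_zero)

lemma H1_le_cong_AE:
  assumes "H1_le M f K" "g \<in> borel_measurable M" and eq: "AE y in M. f y = g y"
  shows "H1_le M g K"
proof -
  have "AE y in M. (\<lambda>j. lam j * a j y) sums g y" if "AE y in M. (\<lambda>j. lam j * a j y) sums f y"
    for lam :: "nat \<Rightarrow> real" and a
    using that eq by eventually_elim simp
  then show ?thesis using assms(1,2) unfolding H1_le_def by blast
qed

lemma H1_le_cmult:
  assumes "H1_le M f K" shows "H1_le M (\<lambda>y. c * f y) (\<bar>c\<bar> * K)"
proof -
  obtain lam a where at: "\<And>j. atom M (a j)" and su: "summable (\<lambda>j. \<bar>lam j\<bar>)" and le: "(\<Sum>j. \<bar>lam j\<bar>) \<le> K"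
    and ae: "AE y in M. (\<lambda>j. lam j * a j y) sums f y" and f [measurable]: "f \<in> borel_measurable M"
    using assms unfolding H1_le_def by blast
  have "(\<Sum>j. \<bar>c * lam j\<bar>) = \<bar>c\<bar> * (\<Sum>j. \<bar>lam j\<bar>)" using suminf_mult[OF su] by (simp add: abs_mult)
  also have "\<dots> \<le> \<bar>c\<bar> * K" using le by (intro mult_left_mono) auto
  finally have 1: "(\<Sum>j. \<bar>c * lam j\<bar>) \<le> \<bar>c\<bar> * K" .
  have 2: "summable (\<lambda>j. \<bar>c * lam j\<bar>)" using summable_mult[OF su] by (simp add: abs_mult)
  have 3: "AE y in M. (\<lambda>j. c * lam j * a j y) sums (c * f y)"
    using ae by eventually_elim (auto dest: sums_mult[of _ _ c] simp: mult.assoc)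
  show ?thesis unfolding H1_le_def
    by (intro conjI exI[of _ "\<lambda>j. c * lam j"] exI[of _ a]) (use 1 2 3 at in auto)
qed

text \<open>Countable subadditivity of the atomic norm, the form in which completeness is used. The
  representations of all \<open>f n\<close> are merged by a pairing function; the merged series
  converges absolutely almost everywhere, since its L1 norms are summable, and this permits
  resummation by rows.\<close>

lemma H1_le_sums:
  assumes h: "\<And>n. H1_le M (f n) (K n)" and K: "summable K" and g [measurable]: "g \<in> borel_measurable M"
    and ae: "AE y in M. (\<lambda>n. f n y) sums g y"
  shows "H1_le M g (\<Sum>n. K n)"
proof -
  have "\<forall>n. \<exists>lam a. (\<forall>j. atom M (a j)) \<and> summable (\<lambda>j. \<bar>lam j\<bar>) \<and> (\<Sum>j. \<bar>lam j\<bar>) \<le> K n \<and>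
        (AE y in M. (\<lambda>j. lam j * a j y) sums f n y)"
    using h unfolding H1_le_def by blast
  from choice[OF this] obtain lam where "\<forall>n. \<exists>a. (\<forall>j. atom M (a j)) \<and> summable (\<lambda>j. \<bar>lam n j\<bar>) \<and> (\<Sum>j. \<bar>lam n j\<bar>) \<le> K n \<and>
        (AE y in M. (\<lambda>j. lam n j * a j y) sums f n y)" by blast
  from choice[OF this] obtain a where at: "\<And>n j. atom M (a n j)" and su: "\<And>n. summable (\<lambda>j. \<bar>lam n j\<bar>)"
    and le: "\<And>n. (\<Sum>j. \<bar>lam n j\<bar>) \<le> K n" and ae1: "\<And>n. AE y in M. (\<lambda>j. lam n j * a n j y) sums f n y"
    by blast
  have h1: "((\<lambda>j. \<bar>lam n j\<bar>) has_sum (\<Sum>j. \<bar>lam n j\<bar>)) UNIV" for n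
    using su[of n] by (intro norm_summable_imp_has_sum) (auto simp: summable_sums)
  have K1: "summable (\<lambda>n. \<Sum>j. \<bar>lam n j\<bar>)"
    by (rule summable_nonneg_le[OF K _ le]) (rule suminf_nonneg[OF su], simp)
  have h2: "((\<lambda>n. \<Sum>j. \<bar>lam n j\<bar>) has_sum (\<Sum>n. \<Sum>j. \<bar>lam n j\<bar>)) UNIV"
    using K1 su by (intro norm_summable_imp_has_sum) (auto simp: summable_sums suminf_nonneg)
  have so: "(\<lambda>(n, j). \<bar>lam n j\<bar>) summable_on (UNIV \<times> UNIV)"
    using h1 h2 by (intro summable_on_SigmaI[where g = "\<lambda>n. \<Sum>j. \<bar>lam n j\<bar>"]) (auto intro: has_sum_imp_summable)
  have hs: "((\<lambda>(n, j). \<bar>lam n j\<bar>) has_sum (\<Sum>n. \<Sum>j. \<bar>lam n j\<bar>)) (UNIV \<times> UNIV)"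
    using so h1 h2 by (intro has_sum_SigmaI[where g = "\<lambda>n. \<Sum>j. \<bar>lam n j\<bar>"]) auto
  define mu where "mu m = (case prod_decode m of (n, j) \<Rightarrow> lam n j)" for m
  define b where "b m = (case prod_decode m of (n, j) \<Rightarrow> a n j)" for m
  have bij: "bij_betw prod_decode UNIV (UNIV \<times> UNIV)"
    by (simp add: bij_prod_decode)
  have "((\<lambda>m. \<bar>mu m\<bar>) has_sum (\<Sum>n. \<Sum>j. \<bar>lam n j\<bar>)) UNIV"
    using hs has_sum_reindex_bij_betw[OF bij, of "\<lambda>(n, j). \<bar>lam n j\<bar>"]
    by (simp add: mu_def case_prod_unfold)
  then have mu: "(\<lambda>m. \<bar>mu m\<bar>) sums (\<Sum>n. \<Sum>j. \<bar>lam n j\<bar>)" by (rule has_sum_imp_sums)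
  have bat: "atom M (b m)" for m by (auto simp: b_def at split: prod.split)
  have int: "integrable M (\<lambda>y. mu j * b j y)" for j using bat atom_integrable by auto
  have le1: "(LINT y|M. \<bar>mu j * b j y\<bar>) \<le> \<bar>mu j\<bar>" for j
    using mult_left_mono[OF atom_L1[OF bat[of j]], of "\<bar>mu j\<bar>"] by (simp add: abs_mult)
  have su1: "summable (\<lambda>j. LINT y|M. \<bar>mu j * b j y\<bar>)"
    by (rule summable_nonneg_le[OF sums_summable[OF mu] _ le1]) simp
  have ae2: "AE y in M. summable (\<lambda>j. \<bar>mu j * b j y\<bar>)" by (rule AE_summable_of_L1[OF int su1])
  have ae3: "AE y in M. \<forall>n. (\<lambda>j. lam n j * a n j y) sums f n y"
    using ae1 by (simp add: AE_all_countable)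
  have "AE y in M. (\<lambda>m. mu m * b m y) sums g y"
    using ae2 ae3 ae
  proof eventually_elim
    fix y assume 1: "summable (\<lambda>j. \<bar>mu j * b j y\<bar>)" and 2: "\<forall>n. (\<lambda>j. lam n j * a n j y) sums f n y"
      and 3: "(\<lambda>n. f n y) sums g y"
    have "(\<lambda>m. norm (mu m * b m y)) summable_on UNIV"
      using 1 by (intro norm_summable_imp_summable_on) simp
    also have "(\<lambda>m. mu m * b m y) = (\<lambda>m. (\<lambda>(n, j). lam n j * a n j y) (prod_decode m))"
      by (auto simp: mu_def b_def case_prod_unfold)
    finally have 4: "(\<lambda>p. norm ((\<lambda>(n, j). lam n j * a n j y) p)) summable_on (UNIV \<times> UNIV)"
      using summable_on_reindex_bij_betw[OF bij, of "\<lambda>p. norm ((\<lambda>(n, j). lam n j * a n j y) p)"] by simp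
    define t where "t = infsum (\<lambda>(n, j). lam n j * a n j y) (UNIV \<times> UNIV)"
    have t: "((\<lambda>(n, j). lam n j * a n j y) has_sum t) (UNIV \<times> UNIV)"
      unfolding t_def using abs_summable_summable[OF 4] by (rule has_sum_infsum)
    \<comment> \<open>A row of a summable family has a sum, which must agree with the assumed
      ordinary sum \<open>f n y\<close>.\<close>
    have row: "((\<lambda>j. lam n j * a n j y) has_sum f n y) UNIV" for n
    proof -
      have "(\<lambda>j. lam n j * a n j y) summable_on UNIV"
        using summable_on_SigmaD1[OF abs_summable_summable[OF 4], of n] by simp
      then have "((\<lambda>j. lam n j * a n j y) has_sum (infsum (\<lambda>j. lam n j * a n j y) UNIV)) UNIV" by (rule has_sum_infsum)
      moreover from has_sum_imp_sums[OF this] have "infsum (\<lambda>j. lam n j * a n j y) UNIV = f n y"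
        using 2 sums_unique2 by blast
      ultimately show ?thesis by simp
    qed
    have "((\<lambda>n. f n y) has_sum t) UNIV"
      by (rule has_sum_SigmaD[OF t]) (use row in auto)
    then have "t = g y" using has_sum_imp_sums 3 sums_unique2 by blast
    moreover have "((\<lambda>m. mu m * b m y) has_sum t) UNIV"
      using t has_sum_reindex_bij_betw[OF bij, of "\<lambda>(n, j). lam n j * a n j y"]
      by (simp add: mu_def b_def case_prod_unfold)
    ultimately show "(\<lambda>m. mu m * b m y) sums g y" using has_sum_imp_sums by blast
  qed
  moreover have "(\<Sum>m. \<bar>mu m\<bar>) \<le> (\<Sum>n. K n)"
    using mu K K1 le by (auto simp: sums_iff intro!: suminf_le)
  ultimately show ?thesis unfolding H1_le_def using bat sums_summable[OF mu] g by blast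
qed

lemma H1_le_sum:
  assumes "finite F" "\<And>i. i \<in> F \<Longrightarrow> H1_le M (f i) (K i)"
  shows "H1_le M (\<lambda>y. \<Sum>i\<in>F. f i y) (\<Sum>i\<in>F. K i)"
proof -
  obtain e where e: "bij_betw e {..<card F} F" using ex_bij_betw_nat_finite[OF assms(1)] by (auto simp: atLeast0LessThan)
  let ?f = "\<lambda>n. if n < card F then f (e n) else (\<lambda>_. 0)" and ?K = "\<lambda>n. if n < card F then K (e n) else 0"
  have me: "e n \<in> F" if "n < card F" for n using e that by (auto simp: bij_betw_def)
  have [measurable]: "f i \<in> borel_measurable M" if "i \<in> F" for i using assms(2)[OF that] unfolding H1_le_def by auto
  have 1: "(\<lambda>n. ?f n y) sums (\<Sum>i\<in>F. f i y)" for y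
  proof -
    have "(\<lambda>n. ?f n y) sums (\<Sum>n<card F. ?f n y)" by (rule sums_finite) auto
    also have "(\<Sum>n<card F. ?f n y) = (\<Sum>n<card F. f (e n) y)" by (intro sum.cong) auto
    also have "\<dots> = (\<Sum>i\<in>F. f i y)" by (rule sum.reindex_bij_betw[OF e])
    finally show ?thesis .
  qed
  have 2: "?K sums (\<Sum>i\<in>F. K i)"
  proof -
    have "?K sums (\<Sum>n<card F. ?K n)" by (rule sums_finite) auto
    also have "(\<Sum>n<card F. ?K n) = (\<Sum>n<card F. K (e n))" by (intro sum.cong) auto
    also have "\<dots> = (\<Sum>i\<in>F. K i)" by (rule sum.reindex_bij_betw[OF e])
    finally show ?thesis .
  qed
  have "H1_le M (\<lambda>y. \<Sum>i\<in>F. f i y) (\<Sum>n. ?K n)"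
    by (rule H1_le_sums[where f = ?f]) (use me assms(2) 1 2 in \<open>auto simp: sums_iff H1_le_zero intro!: borel_measurable_sum\<close>)
  then show ?thesis using 2 by (simp add: sums_iff)
qed

lemma H1_le_add:
  assumes "H1_le M f K" "H1_le M g L"
  shows "H1_le M (\<lambda>y. f y + g y) (K + L)"
  using H1_le_sum[of "{True, False}" "\<lambda>b. if b then f else g" "\<lambda>b. if b then K else L"] assms by simp

text \<open>Division by c times the volume turns g into a single atom; c = 0 is split off for that
  reason.\<close>

lemma H1_le_bounded:
  assumes r: "0 < r" and g [measurable]: "g \<in> borel_measurable M" and supp: "\<And>y. y \<notin> ball z r \<Longrightarrow> g y = 0"
    and bd: "\<And>y. \<bar>g y\<bar> \<le> c" and int0: "(LINT y|M. g y) = 0"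
  shows "H1_le M g (c * V M z r)"
proof (cases "c = 0")
  case True
  then have "g = (\<lambda>_. 0)" using bd by auto
  then show ?thesis using True H1_le_zero by auto
next
  case False
  have c: "c > 0" using False bd[of z] by linarith
  let ?c = "c * V M z r"
  have cV: "?c > 0" using c V_pos[OF r] by auto
  have int: "integrable M g"
  proof (rule Bochner_Integration.integrable_bound[of M "\<lambda>y. c * indicator (ball z r) y"])
    show "integrable M (\<lambda>y. c * indicator (ball z r) y)"
      using ball_finite[of z r] by (intro integrable_mult_right integrable_real_indicator) auto
    show "AE y in M. norm (g y) \<le> norm (c * indicator (ball z r) y)"
      using bd supp c by (auto simp: indicator_def)
  qed measurable
  have at: "atom M (\<lambda>y. g y / ?c)"
    unfolding atom_def
  proof (intro exI[of _ z] exI[of _ r] conjI)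
    show "AE y in M. \<bar>g y / ?c\<bar> \<le> 1 / measure M (ball z r)"
      using bd c V_pos[OF r, of z] by (auto simp: V_def abs_mult field_simps)
  qed (use r supp int int0 in auto)
  have "H1_le M (\<lambda>y. g y / ?c) 1"
    unfolding H1_le_def
  proof (intro conjI exI[of _ "\<lambda>j. if j = (0::nat) then 1 else 0"] exI[of _ "\<lambda>j. (\<lambda>y. g y / ?c)"])
    show "summable (\<lambda>j. \<bar>if j = 0 then 1 else (0::real)\<bar>)" by (rule summable_finite[of "{0}"]) auto
    show "(\<Sum>j. \<bar>if j = 0 then 1 else (0::real)\<bar>) \<le> 1" by (subst suminf_finite[of "{0}"]) auto
    show "AE y in M. (\<lambda>j. (if j = 0 then 1 else 0) * (g y / ?c)) sums (g y / ?c)"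
    proof (rule AE_I2)
      fix y
      show "(\<lambda>j. (if j = 0 then 1 else 0) * (g y / ?c)) sums (g y / ?c)"
        using sums_finite[of "{0::nat}" "\<lambda>j. (if j = 0 then 1 else 0) * (g y / ?c)"] by simp
    qed
  qed (use at in auto)
  from H1_le_cmult[OF this, of ?c] have "H1_le M (\<lambda>y. ?c * (g y / ?c)) ?c" using cV by simp
  moreover have "(\<lambda>y. ?c * (g y / ?c)) = g"
  proof
    fix y show "?c * (g y / ?c) = g y" using cV times_divide_eq_right[of ?c "g y" ?c] by (metis less_irrefl nonzero_mult_div_cancel_left)
  qed
  ultimately show ?thesis by metis
qed

end

section \<open>Dyadic cubes and the Calderon--Zygmund decomposition\<close>

context doubling_space
begin

lemma integrable_indicator_bounded:
  fixes h :: "'a \<Rightarrow> real"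
  assumes "P \<in> sets M" "P \<subseteq> ball z r" "h \<in> borel_measurable M" "\<And>y. y \<in> P \<Longrightarrow> \<bar>h y\<bar> \<le> c"
  shows "integrable M (\<lambda>y. indicator P y * h y)"
proof (rule Bochner_Integration.integrable_bound[of M "\<lambda>y. c * indicator P y"])
  show "integrable M (\<lambda>y. c * indicator P y)"
    using finite_subset_ball[OF assms(2)] assms(1) by (intro integrable_mult_right integrable_real_indicator) auto
  show "AE y in M. norm (indicator P y * h y) \<le> norm (c * indicator P y)"
    using assms(4) by (intro AE_I2) (auto simp: indicator_def intro: order_trans[OF _ abs_ge_self])
qed (use assms(1,3) in measurable)

text \<open>Cauchy-Schwarz on P, from the nonnegative integral of (m h - a)^2 with m the measure of
  P and a the integral of h over P. This leaves m (m b - a^2) \<ge> 0 with b the integral of h^2,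
  and null sets are treated apart.\<close>

lemma integral_square_le:
  fixes h :: "'a \<Rightarrow> real"
  assumes P: "P \<in> sets M" "P \<subseteq> ball z r" and h: "h \<in> borel_measurable M" and c: "\<And>y. y \<in> P \<Longrightarrow> \<bar>h y\<bar> \<le> c"
  shows "(LINT y|M. indicator P y * h y)\<^sup>2 \<le> measure M P * (LINT y|M. indicator P y * (h y)\<^sup>2)"
proof -
  have i1: "integrable M (\<lambda>y. indicator P y * h y)"
    by (rule integrable_indicator_bounded[OF P h c])
  have i2: "integrable M (\<lambda>y. indicator P y * (h y)\<^sup>2)"
    by (rule integrable_indicator_bounded[OF P, of _ "c\<^sup>2"]) (use h c in \<open>auto simp: abs_le_square_iff[symmetric] intro: order_trans[OF c abs_ge_self]\<close>)
  have i0: "integrable M (\<lambda>y. indicator P y :: real)"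
    using finite_subset_ball[OF P(2)] P(1) by (intro integrable_real_indicator) auto
  let ?m = "measure M P" and ?a = "LINT y|M. indicator P y * h y" and ?b = "LINT y|M. indicator P y * (h y)\<^sup>2"
  have "0 \<le> (LINT y|M. ?m\<^sup>2 * (indicator P y * (h y)\<^sup>2) - 2 * ?m * ?a * (indicator P y * h y) + ?a\<^sup>2 * indicator P y)"
  proof (rule integral_nonneg_AE, rule AE_I2)
    fix y
    have "?m\<^sup>2 * (indicator P y * (h y)\<^sup>2) - 2 * ?m * ?a * (indicator P y * h y) + ?a\<^sup>2 * indicator P y = indicator P y * (?m * h y - ?a)\<^sup>2"
      by (simp add: power2_eq_square algebra_simps)
    then show "0 \<le> ?m\<^sup>2 * (indicator P y * (h y)\<^sup>2) - 2 * ?m * ?a * (indicator P y * h y) + ?a\<^sup>2 * indicator P y" by simp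
  qed
  also have "\<dots> = ?m\<^sup>2 * ?b - 2 * ?m * ?a * ?a + ?a\<^sup>2 * ?m"
    using i0 i1 i2 P(1) by simp
  also have "\<dots> = ?m * (?m * ?b - ?a\<^sup>2)" by (simp add: power2_eq_square algebra_simps)
  finally have 1: "0 \<le> ?m * (?m * ?b - ?a\<^sup>2)" .
  show ?thesis
  proof (cases "?m = 0")
    case True
    then have "emeasure M P = 0" using finite_subset_ball[OF P(2)] by (simp add: emeasure_eq_ennreal_measure less_top)
    then have "AE y in M. y \<notin> P" using P(1) by (intro AE_not_in) (auto simp: null_sets_def)
    then have "?a = 0" by (intro integral_eq_zero_AE) (auto elim!: eventually_mono)
    then show ?thesis using True by simp
  next
    case False
    then have "?m > 0" by (simp add: less_le)
    then show ?thesis using 1 by (simp add: zero_le_mult_iff)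
  qed
qed

end

locale dyadic_space = doubling_space M Cd for M :: "'a::metric_space measure" and Cd +
  fixes \<delta> :: real and A :: "int \<Rightarrow> 'i set" and x :: "int \<Rightarrow> 'i \<Rightarrow> 'a" and Q :: "int \<Rightarrow> 'i \<Rightarrow> 'a set"
  assumes \<delta>_pos: "0 < \<delta>" and \<delta>_le: "\<delta> \<le> 1 / 1000"
    and points: "dyadic_points \<delta> A x" and cubes: "dyadic_cubes M \<delta> A x Q"
begin

lemma scale_pos [simp]: "0 < \<delta> powi k"
  using \<delta>_pos by simp

lemma scale_nonneg [simp]: "0 \<le> \<delta> powi k"
  using \<delta>_pos by simp

lemma scale_Suc: "\<delta> powi (k + 1) = \<delta> * \<delta> powi k"
  using \<delta>_pos by (simp add: power_int_add)

lemma scale_mono: "k \<le> l \<Longrightarrow> \<delta> powi l \<le> \<delta> powi k"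
  using \<delta>_pos \<delta>_le by (intro power_int_decreasing) auto

lemma separated: "\<alpha> \<in> A k \<Longrightarrow> \<beta> \<in> A k \<Longrightarrow> \<alpha> \<noteq> \<beta> \<Longrightarrow> \<delta> powi k \<le> dist (x k \<alpha>) (x k \<beta>)"
  using points unfolding dyadic_points_def by blast

lemma cube_sets [measurable]: "\<alpha> \<in> A k \<Longrightarrow> Q k \<alpha> \<in> sets M"
  using cubes by (simp add: dyadic_cubes_def)

lemma cube_cover: "\<exists>\<alpha>\<in>A k. y \<in> Q k \<alpha>"
  using cubes unfolding dyadic_cubes_def by (metis UNIV_I UN_E)

lemma cube_unique: "\<alpha> \<in> A k \<Longrightarrow> \<beta> \<in> A k \<Longrightarrow> y \<in> Q k \<alpha> \<Longrightarrow> y \<in> Q k \<beta> \<Longrightarrow> \<alpha> = \<beta>"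
  using cubes unfolding dyadic_cubes_def by blast

lemma cube_nested: "k \<le> l \<Longrightarrow> \<alpha> \<in> A k \<Longrightarrow> \<beta> \<in> A l \<Longrightarrow> y \<in> Q k \<alpha> \<Longrightarrow> y \<in> Q l \<beta> \<Longrightarrow> Q l \<beta> \<subseteq> Q k \<alpha>"
  using cubes unfolding dyadic_cubes_def by (meson disjoint_iff)

lemma ball_subset_cube: "\<alpha> \<in> A k \<Longrightarrow> ball (x k \<alpha>) (\<delta> powi k / 3) \<subseteq> Q k \<alpha>"
  and cube_subset_ball: "\<alpha> \<in> A k \<Longrightarrow> Q k \<alpha> \<subseteq> ball (x k \<alpha>) (4 * \<delta> powi k)"
  using cubes unfolding dyadic_cubes_def by blast+

lemma center_in_cube: "\<alpha> \<in> A k \<Longrightarrow> x k \<alpha> \<in> Q k \<alpha>"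
  using ball_subset_cube[of \<alpha> k] by (auto simp: subset_iff)

lemma cube_finite: "\<alpha> \<in> A k \<Longrightarrow> emeasure M (Q k \<alpha>) < \<infinity>"
  using finite_subset_ball[OF cube_subset_ball] by blast

lemma cube_fmeasurable: "\<alpha> \<in> A k \<Longrightarrow> Q k \<alpha> \<in> fmeasurable M"
  using cube_finite cube_sets by (auto simp: fmeasurable_def)

lemma cube_diam:
  assumes "\<alpha> \<in> A k" "y \<in> Q k \<alpha>" "z \<in> Q k \<alpha>" shows "dist y z < 8 * \<delta> powi k"
proof -
  have "dist (x k \<alpha>) y < 4 * \<delta> powi k" "dist (x k \<alpha>) z < 4 * \<delta> powi k"
    using cube_subset_ball[OF assms(1)] assms(2,3) by auto
  then show ?thesis using dist_triangle3[of y z "x k \<alpha>"] by linarith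
qed

lemma cube_pos: assumes "\<alpha> \<in> A k" shows "0 < measure M (Q k \<alpha>)"
proof -
  have "0 < V M (x k \<alpha>) (\<delta> powi k / 3)" by (rule V_pos) simp
  also have "\<dots> \<le> measure M (Q k \<alpha>)"
    unfolding V_def using ball_subset_cube[OF assms] cube_fmeasurable[OF assms] by (intro measure_mono_fmeasurable) auto
  finally show ?thesis .
qed

lemma ancestor:
  assumes "k \<le> l" "\<beta> \<in> A l" shows "\<exists>\<alpha>\<in>A k. Q l \<beta> \<subseteq> Q k \<alpha>"
proof -
  obtain \<alpha> where "\<alpha> \<in> A k" "x l \<beta> \<in> Q k \<alpha>" using cube_cover by blast
  then show ?thesis using cube_nested[OF assms(1) _ assms(2)] center_in_cube[OF assms(2)] by blast
qed

lemma V_le_cube: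
  assumes "0 \<le> t"
  shows "\<exists>K>0. \<forall>k. \<forall>\<alpha>\<in>A k. \<forall>p\<in>Q k \<alpha>. V M p (t * \<delta> powi k) \<le> K * measure M (Q k \<alpha>)"
proof -
  obtain K where K: "K > 0" "\<And>z \<rho> t. 0 < \<rho> \<Longrightarrow> 0 \<le> t \<Longrightarrow> V M z (t * \<rho>) \<le> K * exp (1 * t) * V M z \<rho>"
    using V_growth[of 1] by auto
  \<comment> \<open>Around the centre of the cube the radius becomes (t + 4) \<delta>^k, which is 3
    (t + 4) times the radius of the ball contained in the cube.\<close>
  have "V M p (t * \<delta> powi k) \<le> K * exp (3 * (t + 4)) * measure M (Q k \<alpha>)" if \<alpha>: "\<alpha> \<in> A k" and p: "p \<in> Q k \<alpha>" for k \<alpha> p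
  proof -
    have "dist (x k \<alpha>) p < 4 * \<delta> powi k" using p cube_subset_ball[OF \<alpha>] by auto
    then have "V M p (t * \<delta> powi k) \<le> V M (x k \<alpha>) ((3 * (t + 4)) * (\<delta> powi k / 3))"
      by (intro V_mono_ball) (simp add: dist_commute algebra_simps)
    also have "\<dots> \<le> K * exp (1 * (3 * (t + 4))) * V M (x k \<alpha>) (\<delta> powi k / 3)"
      using assms by (intro K) auto
    also have "\<dots> \<le> K * exp (1 * (3 * (t + 4))) * measure M (Q k \<alpha>)"
      unfolding V_def using ball_subset_cube[OF \<alpha>] cube_fmeasurable[OF \<alpha>] K(1)
      by (intro mult_left_mono measure_mono_fmeasurable) auto
    finally show ?thesis by simp
  qed
  then show ?thesis using K(1) by (intro exI[of _ "K * exp (3 * (t + 4))"]) auto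
qed

text \<open>The parent lies in a ball around the centre of the child whose radius is 8 / \<delta>
  times the scale of the child. In the stopping-time argument this bounds the mean over a selected
  cube by the mean over its parent, which is still below the threshold.\<close>

lemma parent_measure:
  "\<exists>D\<ge>1. \<forall>k. \<forall>\<alpha>\<in>A k. \<forall>\<beta>\<in>A (k + 1). Q (k + 1) \<beta> \<subseteq> Q k \<alpha> \<longrightarrow> measure M (Q k \<alpha>) \<le> D * measure M (Q (k + 1) \<beta>)"
proof -
  obtain K where K: "K > 0" "\<And>k \<alpha> p. \<alpha> \<in> A k \<Longrightarrow> p \<in> Q k \<alpha> \<Longrightarrow> V M p (8 / \<delta> * \<delta> powi k) \<le> K * measure M (Q k \<alpha>)"
    using V_le_cube[of "8 / \<delta>"] \<delta>_pos by auto
  have "measure M (Q k \<alpha>) \<le> max 1 K * measure M (Q (k + 1) \<beta>)"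
    if \<alpha>: "\<alpha> \<in> A k" and \<beta>: "\<beta> \<in> A (k + 1)" and sub: "Q (k + 1) \<beta> \<subseteq> Q k \<alpha>" for k \<alpha> \<beta>
  proof -
    let ?p = "x (k + 1) \<beta>"
    have p: "?p \<in> Q (k + 1) \<beta>" by (rule center_in_cube[OF \<beta>])
    have "Q k \<alpha> \<subseteq> ball ?p (8 * \<delta> powi k)" using cube_diam[OF \<alpha>, of ?p] p sub by (auto simp: subset_iff)
    then have "measure M (Q k \<alpha>) \<le> V M ?p (8 * \<delta> powi k)" using \<alpha> by (intro measure_subset_ball) auto
    also have "8 * \<delta> powi k = 8 / \<delta> * \<delta> powi (k + 1)" using \<delta>_pos by (simp add: scale_Suc)
    also have "V M ?p \<dots> \<le> K * measure M (Q (k + 1) \<beta>)" using \<beta> p by (intro K) auto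
    also have "\<dots> \<le> max 1 K * measure M (Q (k + 1) \<beta>)" by (intro mult_right_mono) auto
    finally show ?thesis .
  qed
  then show ?thesis by (intro exI[of _ "max 1 K"]) auto
qed

lemma sum_exp_dist_points:
  assumes "s > 0"
  shows "\<exists>K>0. \<forall>k S y. finite S \<longrightarrow> S \<subseteq> A k \<longrightarrow> (\<Sum>\<alpha>\<in>S. exp (- s * dist (x k \<alpha>) y / \<delta> powi k)) \<le> K"
proof -
  obtain K where K: "K > 0" "\<And>\<rho> S (pt :: 'i \<Rightarrow> 'a) y. 0 < \<rho> \<Longrightarrow> finite S \<Longrightarrow>
     (\<forall>i\<in>S. \<forall>j\<in>S. i \<noteq> j \<longrightarrow> 1 * \<rho> \<le> dist (pt i) (pt j)) \<Longrightarrow>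
     (\<Sum>i\<in>S. exp (- s * dist (pt i) y / \<rho>)) \<le> K"
    using sum_exp_dist_separated[OF assms, of 1, where ?'j = 'i] by auto
  show ?thesis using K(1) separated by (intro exI[of _ K] conjI allI impI K(2)) auto
qed

text \<open>Each point within distance r contributes at least
  \<open>exp (- s * r / \<delta> powi k)\<close> to a sum that is uniformly bounded.\<close>

lemma count_points:
  assumes "s > 0"
  shows "\<exists>K>0. \<forall>k S y r. S \<subseteq> {\<alpha> \<in> A k. dist (x k \<alpha>) y \<le> r} \<longrightarrow> finite S \<and> real (card S) \<le> K * exp (s * r / \<delta> powi k)"
proof -
  obtain K where K: "K > 0" "\<And>k S y. finite S \<Longrightarrow> S \<subseteq> A k \<Longrightarrow> (\<Sum>\<alpha>\<in>S. exp (- s * dist (x k \<alpha>) y / \<delta> powi k)) \<le> K"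
    using sum_exp_dist_points[OF assms] by blast
  have fin: "real (card S) \<le> K * exp (s * r / \<delta> powi k)" if S: "finite S" "S \<subseteq> {\<alpha> \<in> A k. dist (x k \<alpha>) y \<le> r}" for k S y r
  proof -
    have "real (card S) * exp (- s * r / \<delta> powi k) = (\<Sum>\<alpha>\<in>S. exp (- s * r / \<delta> powi k))" by simp
    also have "\<dots> \<le> (\<Sum>\<alpha>\<in>S. exp (- s * dist (x k \<alpha>) y / \<delta> powi k))"
    proof (rule sum_mono)
      fix \<alpha> assume "\<alpha> \<in> S"
      then have "dist (x k \<alpha>) y \<le> r" using S(2) by auto
      then have "s * dist (x k \<alpha>) y / \<delta> powi k \<le> s * r / \<delta> powi k"
        using assms by (intro divide_right_mono mult_left_mono) auto
      then show "exp (- s * r / \<delta> powi k) \<le> exp (- s * dist (x k \<alpha>) y / \<delta> powi k)" by simp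
    qed
    also have "\<dots> \<le> K" using S by (intro K) auto
    finally show ?thesis by (simp add: exp_minus field_simps)
  qed
  have "finite S" if S: "S \<subseteq> {\<alpha> \<in> A k. dist (x k \<alpha>) y \<le> r}" for k S y r
  proof (rule ccontr)
    assume inf: "infinite S"
    obtain n :: nat where n: "K * exp (s * r / \<delta> powi k) < real n" using reals_Archimedean2 by blast
    obtain T where "T \<subseteq> S" "finite T" "card T = n" using infinite_arbitrarily_large[OF inf] by blast
    then show False using fin[of T k y r] S n by auto
  qed
  then show ?thesis using K(1) fin by (intro exI[of _ K]) blast
qed

text \<open>Serves to list the cubes of one generation in a sequence when a function is cut along
  them.\<close>

lemma countable_points: "countable (A k)"
proof -
  obtain K where K: "\<forall>k S y r. S \<subseteq> {\<alpha> \<in> A k. dist (x k \<alpha>) y \<le> r} \<longrightarrow> finite S \<and> real (card S) \<le> K * exp (1 * r / \<delta> powi k)"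
    using count_points[of 1] by auto
  have "finite {\<alpha> \<in> A k. dist (x k \<alpha>) undefined \<le> real n}" for n :: nat
    using K[rule_format, of "{\<alpha> \<in> A k. dist (x k \<alpha>) undefined \<le> real n}" k undefined "real n"] by simp
  then have "countable (\<Union>n::nat. {\<alpha> \<in> A k. dist (x k \<alpha>) undefined \<le> real n})"
    by (intro countable_UN[OF countableI_type] countable_finite)
  moreover have "A k \<subseteq> (\<Union>n::nat. {\<alpha> \<in> A k. dist (x k \<alpha>) undefined \<le> real n})"
  proof
    fix \<alpha> assume "\<alpha> \<in> A k"
    moreover obtain n :: nat where "dist (x k \<alpha>) undefined \<le> real n" using real_arch_simple by blast
    ultimately show "\<alpha> \<in> (\<Union>n::nat. {\<alpha> \<in> A k. dist (x k \<alpha>) undefined \<le> real n})" by blast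
  qed
  ultimately show ?thesis by (rule countable_subset[rotated])
qed

text \<open>Makes the family of stopping cubes between two generations finite.\<close>

lemma finite_subcubes: "\<alpha> \<in> A k \<Longrightarrow> finite {\<beta> \<in> A l. Q l \<beta> \<subseteq> Q k \<alpha>}"
proof -
  assume \<alpha>: "\<alpha> \<in> A k"
  obtain K where K: "\<forall>k S y r. S \<subseteq> {\<alpha> \<in> A k. dist (x k \<alpha>) y \<le> r} \<longrightarrow> finite S \<and> real (card S) \<le> K * exp (1 * r / \<delta> powi k)"
    using count_points[of 1] by auto
  have "{\<beta> \<in> A l. Q l \<beta> \<subseteq> Q k \<alpha>} \<subseteq> {\<beta> \<in> A l. dist (x l \<beta>) (x k \<alpha>) \<le> 4 * \<delta> powi k}"
    using center_in_cube[of _ l] cube_subset_ball[OF \<alpha>] by (force simp: dist_commute)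
  then show ?thesis using K by blast
qed

section \<open>Means over cubes and the stopping-time decomposition\<close>

definition avg :: "('a \<Rightarrow> real) \<Rightarrow> 'a set \<Rightarrow> real" where
  "avg h P = (LINT y|M. indicator P y * h y) / measure M P"

lemma H1_le_bounded_on_cube:
  "\<exists>K>0. \<forall>k. \<forall>\<alpha>\<in>A k. \<forall>g c. g \<in> borel_measurable M \<longrightarrow> (\<forall>y. y \<notin> Q k \<alpha> \<longrightarrow> g y = 0) \<longrightarrow> (\<forall>y. \<bar>g y\<bar> \<le> c) \<longrightarrow>
     (LINT y|M. g y) = 0 \<longrightarrow> H1_le M g (K * c * measure M (Q k \<alpha>))"
proof -
  obtain K where K: "K > 0" "\<And>k \<alpha> p. \<alpha> \<in> A k \<Longrightarrow> p \<in> Q k \<alpha> \<Longrightarrow> V M p (4 * \<delta> powi k) \<le> K * measure M (Q k \<alpha>)"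
    using V_le_cube[of 4] by auto
  have "H1_le M g (K * c * measure M (Q k \<alpha>))" if \<alpha>: "\<alpha> \<in> A k" and g: "g \<in> borel_measurable M" "\<forall>y. y \<notin> Q k \<alpha> \<longrightarrow> g y = 0"
    "\<forall>y. \<bar>g y\<bar> \<le> c" "(LINT y|M. g y) = 0" for k \<alpha> g c
  proof -
    have c: "c \<ge> 0" using g(3) abs_ge_zero order_trans by blast
    have "H1_le M g (c * V M (x k \<alpha>) (4 * \<delta> powi k))"
      using g cube_subset_ball[OF \<alpha>] by (intro H1_le_bounded) auto
    moreover have "c * V M (x k \<alpha>) (4 * \<delta> powi k) \<le> c * (K * measure M (Q k \<alpha>))"
      using c K(2)[OF \<alpha> center_in_cube[OF \<alpha>]] by (rule mult_left_mono[rotated])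
    ultimately show ?thesis using H1_le_mono by (metis mult.commute mult.left_commute)
  qed
  then show ?thesis using K(1) by blast
qed

definition osc_part :: "('a \<Rightarrow> real) \<Rightarrow> 'a set \<Rightarrow> 'a \<Rightarrow> real" where
  "osc_part h P y = indicator P y * (h y - avg h P)"

lemma osc_part_props:
  assumes \<alpha>: "\<alpha> \<in> A k" and h [measurable]: "h \<in> borel_measurable M" and c: "\<And>y. \<bar>h y\<bar> \<le> c"
  shows "integrable M (osc_part h (Q k \<alpha>))" "(LINT y|M. osc_part h (Q k \<alpha>) y) = 0"
    "integrable M (\<lambda>y. indicator (Q k \<alpha>) y * (h y)\<^sup>2)" "integrable M (\<lambda>y. indicator (Q k \<alpha>) y * h y)"
    "(avg h (Q k \<alpha>))\<^sup>2 \<le> avg (\<lambda>y. (h y)\<^sup>2) (Q k \<alpha>)"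
proof -
  have [measurable]: "Q k \<alpha> \<in> sets M" by (rule cube_sets[OF \<alpha>])
  have i0: "integrable M (\<lambda>y. indicator (Q k \<alpha>) y :: real)"
    using cube_finite[OF \<alpha>] by (intro integrable_real_indicator) auto
  show i1: "integrable M (\<lambda>y. indicator (Q k \<alpha>) y * h y)"
    by (rule integrable_indicator_bounded[OF _ cube_subset_ball[OF \<alpha>] h c]) measurable
  have e: "osc_part h (Q k \<alpha>) = (\<lambda>y. indicator (Q k \<alpha>) y * h y - avg h (Q k \<alpha>) * indicator (Q k \<alpha>) y)"
    by (auto simp: osc_part_def algebra_simps)
  show "integrable M (osc_part h (Q k \<alpha>))" unfolding e using i0 i1 by auto
  show "(LINT y|M. osc_part h (Q k \<alpha>) y) = 0"
    unfolding e using i0 i1 cube_pos[OF \<alpha>] by (simp add: avg_def)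
  show "integrable M (\<lambda>y. indicator (Q k \<alpha>) y * (h y)\<^sup>2)"
    by (rule integrable_indicator_bounded[OF _ cube_subset_ball[OF \<alpha>], of _ "c\<^sup>2"])
       (use c in \<open>auto simp: abs_le_square_iff[symmetric] intro: order_trans[OF c abs_ge_self]\<close>)
  have "(LINT y|M. indicator (Q k \<alpha>) y * h y)\<^sup>2 \<le> measure M (Q k \<alpha>) * (LINT y|M. indicator (Q k \<alpha>) y * (h y)\<^sup>2)"
    by (rule integral_square_le[OF _ cube_subset_ball[OF \<alpha>] h c]) measurable
  then show "(avg h (Q k \<alpha>))\<^sup>2 \<le> avg (\<lambda>y. (h y)\<^sup>2) (Q k \<alpha>)"
    using cube_pos[OF \<alpha>] by (simp add: avg_def power_divide power2_eq_square divide_simps mult_ac)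
qed

lemma sum_disjoint_cubes_le:
  assumes fin: "finite \<P>" and mem: "\<And>l \<beta>. (l, \<beta>) \<in> \<P> \<Longrightarrow> \<beta> \<in> A l \<and> Q l \<beta> \<subseteq> R"
    and disj: "\<And>l \<beta> l' \<beta>' y. (l, \<beta>) \<in> \<P> \<Longrightarrow> (l', \<beta>') \<in> \<P> \<Longrightarrow> y \<in> Q l \<beta> \<Longrightarrow> y \<in> Q l' \<beta>' \<Longrightarrow> (l, \<beta>) = (l', \<beta>')"
  shows "(\<Sum>(l, \<beta>)\<in>\<P>. indicator (Q l \<beta>) y :: real) \<le> indicator R y"
proof (cases "\<exists>l \<beta>. (l, \<beta>) \<in> \<P> \<and> y \<in> Q l \<beta>")
  case True
  then obtain l \<beta> where p: "(l, \<beta>) \<in> \<P>" "y \<in> Q l \<beta>" by blast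
  have "(\<Sum>(l, \<beta>)\<in>\<P>. indicator (Q l \<beta>) y :: real) = (\<Sum>p\<in>\<P>. if p = (l, \<beta>) then 1 else 0)"
  proof (intro sum.cong refl)
    fix q assume q: "q \<in> \<P>"
    obtain l' \<beta>' where "q = (l', \<beta>')" by (cases q)
    then show "(case q of (l, \<beta>) \<Rightarrow> indicat_real (Q l \<beta>) y) = (if q = (l, \<beta>) then 1 else 0)"
      using disj[OF p(1) _ p(2), of l' \<beta>'] q p by (cases "y \<in> Q l' \<beta>'") auto
  qed
  also have "\<dots> = 1" using fin p by simp
  finally show ?thesis using mem[OF p(1)] p(2) by (auto simp: indicator_def)
next
  case False
  then have "(\<Sum>(l, \<beta>)\<in>\<P>. indicator (Q l \<beta>) y :: real) = 0" by (intro sum.neutral) (auto simp: indicator_def)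
  then show ?thesis by simp
qed

text \<open>Stopping the first time the mean of \<open>h\<^sup>2\<close> exceeds \<open>\<lambda>\<^sup>2\<close> with \<open>\<lambda> = 2 L + \<epsilon>\<close> makes the
  bad part carry at most half of the budget, so the induction on the number of generations closes
  with a constant independent of it.\<close>

lemma H1_le_osc_part_approx:
  "\<exists>K>0. \<forall>N k \<alpha> h c \<epsilon> L. k \<le> N \<longrightarrow> \<alpha> \<in> A k \<longrightarrow> h \<in> borel_measurable M \<longrightarrow> (\<forall>y. \<bar>h y\<bar> \<le> c) \<longrightarrow>
     (\<forall>\<beta>\<in>A N. \<forall>y\<in>Q N \<beta>. \<forall>z\<in>Q N \<beta>. \<bar>h y - h z\<bar> \<le> \<epsilon>) \<longrightarrow> 0 < \<epsilon> \<longrightarrow> 0 \<le> L \<longrightarrow>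
     avg (\<lambda>y. (h y)\<^sup>2) (Q k \<alpha>) \<le> L\<^sup>2 \<longrightarrow>
     H1_le M (osc_part h (Q k \<alpha>)) (K * (L + \<epsilon>) * measure M (Q k \<alpha>))"
proof -
  obtain K0 where K0: "K0 > 0" "\<And>k \<alpha> g c. \<alpha> \<in> A k \<Longrightarrow> g \<in> borel_measurable M \<Longrightarrow> (\<And>y. y \<notin> Q k \<alpha> \<Longrightarrow> g y = 0) \<Longrightarrow> (\<And>y. \<bar>g y\<bar> \<le> c) \<Longrightarrow>
     (LINT y|M. g y) = 0 \<Longrightarrow> H1_le M g (K0 * c * measure M (Q k \<alpha>))"
    using H1_le_bounded_on_cube by blast
  obtain D where D: "D \<ge> 1" "\<And>k \<alpha> \<beta>. \<alpha> \<in> A k \<Longrightarrow> \<beta> \<in> A (k + 1) \<Longrightarrow> Q (k + 1) \<beta> \<subseteq> Q k \<alpha> \<Longrightarrow> measure M (Q k \<alpha>) \<le> D * measure M (Q (k + 1) \<beta>)"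
    using parent_measure by blast
  \<comment> \<open>Twice the constant of the good part: that part uses half of K (L + \<epsilon>)
    times the measure, and the stopping cubes may use the other half.\<close>
  define K where "K = 2 * K0 * (2 * D + 1)"
  have K: "K > 0" using K0 D by (simp add: K_def)
  have main: "H1_le M (osc_part h (Q k \<alpha>)) (K * (L + \<epsilon>) * measure M (Q k \<alpha>))"
    if h [measurable]: "h \<in> borel_measurable M" and c: "\<And>y. \<bar>h y\<bar> \<le> c"
     and osc: "\<And>\<beta> y z. \<beta> \<in> A N \<Longrightarrow> y \<in> Q N \<beta> \<Longrightarrow> z \<in> Q N \<beta> \<Longrightarrow> \<bar>h y - h z\<bar> \<le> \<epsilon>" and \<epsilon>: "0 < \<epsilon>"
     and "k \<le> N" "\<alpha> \<in> A k" "0 \<le> L" "avg (\<lambda>y. (h y)\<^sup>2) (Q k \<alpha>) \<le> L\<^sup>2"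
    for N h c \<epsilon> k \<alpha> L
    using that(5-)
  proof (induction "nat (N - k)" arbitrary: k \<alpha> L rule: less_induct)
    case less
    note kN = less.prems(1) and \<alpha> = less.prems(2) and L = less.prems(3) and avgL = less.prems(4)
    define R where "R = Q k \<alpha>"
    have [measurable]: "R \<in> sets M" unfolding R_def by (rule cube_sets[OF \<alpha>])
    define lam where "lam = 2 * L + \<epsilon>"
    have lam: "lam > 0" "2 * L \<le> lam" "L \<le> lam" using L \<epsilon> by (auto simp: lam_def)
    define bad where "bad l \<beta> \<longleftrightarrow> lam\<^sup>2 < avg (\<lambda>y. (h y)\<^sup>2) (Q l \<beta>)" for l \<beta>
    \<comment> \<open>The maximal bad cubes below R, kept as pairs of generation and label. One set
      can be a cube of several generations; the condition on all earlier generations selects the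
      first of them.\<close>
    define \<P> where "\<P> = {(l, \<beta>). k < l \<and> l \<le> N \<and> \<beta> \<in> A l \<and> Q l \<beta> \<subseteq> R \<and> bad l \<beta> \<and>
       (\<forall>l' \<beta>'. k \<le> l' \<longrightarrow> l' < l \<longrightarrow> \<beta>' \<in> A l' \<longrightarrow> Q l \<beta> \<subseteq> Q l' \<beta>' \<longrightarrow> \<not> bad l' \<beta>')}"
    have fin: "finite \<P>"
    proof (rule finite_subset)
      show "\<P> \<subseteq> (SIGMA l:{k..N}. {\<beta> \<in> A l. Q l \<beta> \<subseteq> Q k \<alpha>})" unfolding \<P>_def R_def by auto
      show "finite (SIGMA l:{k..N}. {\<beta> \<in> A l. Q l \<beta> \<subseteq> Q k \<alpha>})" using finite_subcubes[OF \<alpha>] by auto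
    qed
    have mem: "\<beta> \<in> A l \<and> Q l \<beta> \<subseteq> R" if "(l, \<beta>) \<in> \<P>" for l \<beta> using that by (auto simp: \<P>_def)
    have disj: "(l, \<beta>) = (l', \<beta>')" if p: "(l, \<beta>) \<in> \<P>" "(l', \<beta>') \<in> \<P>" "y \<in> Q l \<beta>" "y \<in> Q l' \<beta>'" for l \<beta> l' \<beta>' y
    proof -
      have nl: "\<not> l < l'" if p: "(l, \<beta>) \<in> \<P>" "(l', \<beta>') \<in> \<P>" "y \<in> Q l \<beta>" "y \<in> Q l' \<beta>'" for l \<beta> l' \<beta>'
      proof
        assume "l < l'"
        then have "Q l' \<beta>' \<subseteq> Q l \<beta>" using p by (intro cube_nested[of l l' \<beta> \<beta>' y]) (auto simp: \<P>_def)
        then show False using p \<open>l < l'\<close> unfolding \<P>_def by auto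
      qed
      have "l = l'" using nl[OF p] nl[OF p(2,1,4,3)] by simp
      then show ?thesis using p cube_unique[of \<beta> l \<beta>' y] by (auto simp: \<P>_def)
    qed
    \<comment> \<open>The parent of a selected cube is not bad, and passing to the child loses only
      the factor D.\<close>
    have up: "avg (\<lambda>y. (h y)\<^sup>2) (Q l \<beta>) \<le> D * lam\<^sup>2" if p: "(l, \<beta>) \<in> \<P>" for l \<beta>
    proof -
      have l: "k \<le> l - 1" "\<beta> \<in> A l" using p by (auto simp: \<P>_def)
      obtain \<alpha>' where \<alpha>': "\<alpha>' \<in> A (l - 1)" "Q l \<beta> \<subseteq> Q (l - 1) \<alpha>'" using ancestor[of "l - 1" l \<beta>] l by auto
      have "\<not> bad (l - 1) \<alpha>'" using p \<alpha>' l unfolding \<P>_def by auto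
      then have 1: "(LINT y|M. indicator (Q (l-1) \<alpha>') y * (h y)\<^sup>2) \<le> lam\<^sup>2 * measure M (Q (l-1) \<alpha>')"
        using cube_pos[OF \<alpha>'(1)] by (simp add: bad_def avg_def field_simps not_less)
      have "(LINT y|M. indicator (Q l \<beta>) y * (h y)\<^sup>2) \<le> (LINT y|M. indicator (Q (l-1) \<alpha>') y * (h y)\<^sup>2)"
        using \<alpha>' osc_part_props(3)[OF l(2) h c] osc_part_props(3)[OF \<alpha>'(1) h c]
        by (intro integral_mono) (auto simp: indicator_def)
      also note 1
      also have "lam\<^sup>2 * measure M (Q (l-1) \<alpha>') \<le> lam\<^sup>2 * (D * measure M (Q l \<beta>))"
        using D(2)[of \<alpha>' "l - 1" \<beta>] \<alpha>' l by (intro mult_left_mono) auto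
      finally show ?thesis using cube_pos[OF l(2)] by (simp add: avg_def field_simps)
    qed
    \<comment> \<open>Off the selected cubes no cube around y down to generation N is bad. On the
      one of generation N the function varies by at most \<epsilon>, so its mean square there bounds
      |h y|. This takes the place of differentiation of integrals.\<close>
    have good: "\<bar>h y\<bar> \<le> lam + \<epsilon>" if y: "y \<in> R" and off: "\<And>l \<beta>. (l, \<beta>) \<in> \<P> \<Longrightarrow> y \<notin> Q l \<beta>" for y
    proof (rule ccontr)
      assume hy: "\<not> ?thesis"
      have nb: "\<not> bad l \<beta>" if "k \<le> l" "l \<le> N" "\<beta> \<in> A l" "y \<in> Q l \<beta>" for l \<beta>
        using that
      proof (induction "nat (l - k)" arbitrary: l \<beta> rule: less_induct)
        case (less l)
        show ?case
        proof
          assume b: "bad l \<beta>"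
          have "Q l \<beta> \<subseteq> R" unfolding R_def using cube_nested[OF less.prems(1) \<alpha> less.prems(3) _ less.prems(4)] y by (auto simp: R_def)
          \<comment> \<open>R itself is not bad, because L \<le> lam.\<close>
          have "l \<noteq> k"
          proof
            assume "l = k"
            then have "\<beta> = \<alpha>" using cube_unique less.prems \<alpha> y unfolding R_def by blast
            then have "lam\<^sup>2 < L\<^sup>2" using b avgL \<open>l = k\<close> by (auto simp: bad_def)
            then show False using lam L by (simp add: power2_less_imp_less leD power_mono)
          qed
          then have "(l, \<beta>) \<in> \<P>"
            unfolding \<P>_def using less.prems b \<open>Q l \<beta> \<subseteq> R\<close> less.hyps by (auto 0 3)
          then show False using off less.prems by blast
        qed
      qed
      obtain \<beta> where \<beta>: "\<beta> \<in> A N" "y \<in> Q N \<beta>" using cube_cover by blast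
      have i0: "integrable M (\<lambda>y. indicator (Q N \<beta>) y :: real)"
        using cube_finite[OF \<beta>(1)] cube_sets[OF \<beta>(1)] by (intro integrable_real_indicator) auto
      have "(LINT z|M. indicator (Q N \<beta>) z * (\<bar>h y\<bar> - \<epsilon>)\<^sup>2) \<le> (LINT z|M. indicator (Q N \<beta>) z * (h z)\<^sup>2)"
      proof (rule integral_mono)
        fix z
        show "indicator (Q N \<beta>) z * (\<bar>h y\<bar> - \<epsilon>)\<^sup>2 \<le> indicator (Q N \<beta>) z * (h z)\<^sup>2"
        proof (cases "z \<in> Q N \<beta>")
          case True
          have "0 \<le> \<bar>h y\<bar> - \<epsilon>" "\<bar>h y\<bar> - \<epsilon> \<le> \<bar>h z\<bar>" using osc[OF \<beta> True] hy lam by linarith+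
          then have "(\<bar>h y\<bar> - \<epsilon>)\<^sup>2 \<le> \<bar>h z\<bar>\<^sup>2" by (intro power_mono)
          then show ?thesis using True by simp
        qed simp
        show "integrable M (\<lambda>z. indicator (Q N \<beta>) z * (\<bar>h y\<bar> - \<epsilon>)\<^sup>2)"
          by (rule integrable_indicator_bounded[OF cube_sets cube_subset_ball, OF \<beta>(1) \<beta>(1), of _ "(\<bar>h y\<bar> - \<epsilon>)\<^sup>2"]) simp_all
        show "integrable M (\<lambda>z. indicator (Q N \<beta>) z * (h z)\<^sup>2)" by (rule osc_part_props(3)[OF \<beta>(1) h c])
      qed
      moreover have "(LINT z|M. indicator (Q N \<beta>) z * (\<bar>h y\<bar> - \<epsilon>)\<^sup>2) = (\<bar>h y\<bar> - \<epsilon>)\<^sup>2 * measure M (Q N \<beta>)"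
        using cube_sets[OF \<beta>(1)] by simp
      ultimately have "(\<bar>h y\<bar> - \<epsilon>)\<^sup>2 \<le> avg (\<lambda>y. (h y)\<^sup>2) (Q N \<beta>)"
        unfolding avg_def by (simp only: pos_le_divide_eq[OF cube_pos[OF \<beta>(1)]])
      also have "\<dots> \<le> lam\<^sup>2" using nb[OF kN order_refl \<beta>] by (simp add: bad_def)
      finally have "\<bar>h y\<bar> - \<epsilon> \<le> lam" by (rule power2_le_imp_le) (use lam in auto)
      then show False using hy by simp
    qed
    have outside: "(\<Sum>(l, \<beta>)\<in>\<P>. osc_part h (Q l \<beta>) y) = 0" if "y \<notin> R" for y
    proof (intro sum.neutral ballI)
      fix q assume "q \<in> \<P>"
      then show "(case q of (l, \<beta>) \<Rightarrow> osc_part h (Q l \<beta>) y) = 0"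
        using mem[of "fst q" "snd q"] that by (cases q) (auto simp: osc_part_def indicator_def)
    qed
    \<comment> \<open>The good part: on R it is h off the selected cubes and the mean of h on each
      of them, minus the mean over R.\<close>
    define g where "g y = osc_part h R y - (\<Sum>(l, \<beta>)\<in>\<P>. osc_part h (Q l \<beta>) y)" for y
    have ip: "integrable M (osc_part h (Q l \<beta>))" "(LINT y|M. osc_part h (Q l \<beta>) y) = 0" if "(l, \<beta>) \<in> \<P>" for l \<beta>
      using osc_part_props(1,2)[OF _ h c, of \<beta> l] mem[OF that] by auto
    have iR: "integrable M (osc_part h R)" "(LINT y|M. osc_part h R y) = 0"
      using osc_part_props(1,2)[OF \<alpha> h c] unfolding R_def by auto
    have iS: "integrable M (\<lambda>y. \<Sum>(l, \<beta>)\<in>\<P>. osc_part h (Q l \<beta>) y)"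
      using ip by (intro Bochner_Integration.integrable_sum) auto
    have g0: "(LINT y|M. g y) = 0"
    proof -
      have "(LINT y|M. (\<Sum>(l, \<beta>)\<in>\<P>. osc_part h (Q l \<beta>) y)) = (\<Sum>p\<in>\<P>. LINT y|M. (case p of (l, \<beta>) \<Rightarrow> osc_part h (Q l \<beta>) y))"
        using ip by (intro Bochner_Integration.integral_sum) auto
      also have "\<dots> = 0" using ip by (intro sum.neutral) auto
      finally show ?thesis unfolding g_def using iS iR by simp
    qed
    have avgR: "\<bar>avg h R\<bar> \<le> L"
    proof (rule power2_le_imp_le)
      show "\<bar>avg h R\<bar>\<^sup>2 \<le> L\<^sup>2" using osc_part_props(5)[OF \<alpha> h c] avgL unfolding R_def by simp
    qed (rule L)
    \<comment> \<open>The selected cubes are disjoint, so y is in exactly one of them or in none;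
      the factor 2 D + 1 dominates both cases.\<close>
    have gb: "\<bar>g y\<bar> \<le> (2 * D + 1) * (L + \<epsilon>)" for y
    proof (cases "y \<in> R")
      case False
      then have "g y = 0" using outside[of y] by (simp add: g_def osc_part_def)
      then show ?thesis using D L \<epsilon> by simp
    next
      case True
      have DL: "lam + \<epsilon> + L \<le> (2 * D + 1) * (L + \<epsilon>)" "D * lam + L \<le> (2 * D + 1) * (L + \<epsilon>)"
      proof -
        have "0 \<le> (D - 1) * (L + \<epsilon>)" "0 \<le> D * \<epsilon>" using D L \<epsilon> by auto
        then show "lam + \<epsilon> + L \<le> (2 * D + 1) * (L + \<epsilon>)" "D * lam + L \<le> (2 * D + 1) * (L + \<epsilon>)"
          using \<epsilon> unfolding lam_def by (auto simp: algebra_simps)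
      qed
      show ?thesis
      proof (cases "\<exists>l \<beta>. (l, \<beta>) \<in> \<P> \<and> y \<in> Q l \<beta>")
        case True
        then obtain l \<beta> where p: "(l, \<beta>) \<in> \<P>" "y \<in> Q l \<beta>" by blast
        have "(\<Sum>(l, \<beta>)\<in>\<P>. osc_part h (Q l \<beta>) y) = (\<Sum>p\<in>\<P>. if p = (l, \<beta>) then osc_part h (Q l \<beta>) y else 0)"
        proof (intro sum.cong refl)
          fix q assume q: "q \<in> \<P>"
          obtain l' \<beta>' where "q = (l', \<beta>')" by (cases q)
          then show "(case q of (l, \<beta>) \<Rightarrow> osc_part h (Q l \<beta>) y) = (if q = (l, \<beta>) then osc_part h (Q l \<beta>) y else 0)"
            using disj[OF p(1) _ p(2), of l' \<beta>'] q p by (cases "y \<in> Q l' \<beta>'") (auto simp: osc_part_def)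
        qed
        also have "\<dots> = osc_part h (Q l \<beta>) y" using fin p by simp
        finally have "g y = avg h (Q l \<beta>) - avg h R"
          using p \<open>y \<in> R\<close> by (simp add: g_def osc_part_def)
        moreover have "\<bar>avg h (Q l \<beta>)\<bar> \<le> D * lam"
        proof (rule power2_le_imp_le)
          have "\<bar>avg h (Q l \<beta>)\<bar>\<^sup>2 \<le> D * lam\<^sup>2"
            using osc_part_props(5)[OF _ h c, of \<beta> l] up[OF p(1)] mem[OF p(1)] by auto
          also have "\<dots> \<le> D\<^sup>2 * lam\<^sup>2" using D by (intro mult_right_mono) (auto simp: self_le_power)
          finally show "\<bar>avg h (Q l \<beta>)\<bar>\<^sup>2 \<le> (D * lam)\<^sup>2" by (simp add: power_mult_distrib)
        qed (use D lam in auto)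
        ultimately show ?thesis using avgR DL by linarith
      next
        case False
        then have "(\<Sum>(l, \<beta>)\<in>\<P>. osc_part h (Q l \<beta>) y) = 0" by (intro sum.neutral) (auto simp: osc_part_def)
        then have "g y = h y - avg h R" using \<open>y \<in> R\<close> by (simp add: g_def osc_part_def)
        moreover have "\<bar>h y\<bar> \<le> lam + \<epsilon>" using good[OF \<open>y \<in> R\<close>] False by blast
        ultimately show ?thesis using avgR DL by linarith
      qed
    qed
    have gm: "g \<in> borel_measurable M" unfolding g_def using iR iS by (intro borel_measurable_diff) auto
    have g1: "H1_le M g (K0 * ((2 * D + 1) * (L + \<epsilon>)) * measure M R)"
      unfolding R_def
    proof (rule K0(2)[OF \<alpha> gm _ gb g0])
      show "g y = 0" if "y \<notin> Q k \<alpha>" for y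
        using that outside[of y] by (simp add: g_def osc_part_def R_def)
    qed
    \<comment> \<open>The induction hypothesis is applied with the root mean square over the
      selected cube in the role of L.\<close>
    define LP where "LP l \<beta> = sqrt (avg (\<lambda>y. (h y)\<^sup>2) (Q l \<beta>))" for l \<beta>
    have bP: "H1_le M (osc_part h (Q l \<beta>)) (K * (LP l \<beta> + \<epsilon>) * measure M (Q l \<beta>))" if p: "(l, \<beta>) \<in> \<P>" for l \<beta>
    proof (rule less.hyps)
      have "0 \<le> avg (\<lambda>y. (h y)\<^sup>2) (Q l \<beta>)" unfolding avg_def by simp
      then show "0 \<le> LP l \<beta>" "avg (\<lambda>y. (h y)\<^sup>2) (Q l \<beta>) \<le> (LP l \<beta>)\<^sup>2" by (auto simp: LP_def)
    qed (use p in \<open>auto simp: \<P>_def\<close>)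
    \<comment> \<open>Badness gives lam \<le> \<open>LP l \<beta>\<close>, hence LP \<le> LP^2 / lam
      and \<epsilon> \<le> \<epsilon> LP^2 / lam^2. The cost, linear in LP, becomes an integral of
      h^2, which can be added over disjoint cubes.\<close>
    have Le: "K * (LP l \<beta> + \<epsilon>) * measure M (Q l \<beta>) \<le> K * (1 / lam + \<epsilon> / lam\<^sup>2) * (LINT y|M. indicator (Q l \<beta>) y * (h y)\<^sup>2)"
      if p: "(l, \<beta>) \<in> \<P>" for l \<beta>
    proof -
      let ?a = "avg (\<lambda>y. (h y)\<^sup>2) (Q l \<beta>)"
      have a: "lam\<^sup>2 < ?a" using p by (auto simp: \<P>_def bad_def)
      then have a0: "0 \<le> ?a" using order_trans[OF zero_le_power2, of lam ?a] by simp
      have "lam \<le> LP l \<beta>" unfolding LP_def using a by (intro real_le_rsqrt) auto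
      then have "lam * LP l \<beta> \<le> LP l \<beta> * LP l \<beta>" using lam by (intro mult_right_mono) auto
      also have "\<dots> = ?a" using a0 by (simp add: LP_def)
      finally have 1: "LP l \<beta> \<le> 1 / lam * ?a" using lam by (simp add: field_simps)
      have "1 \<le> ?a / lam\<^sup>2" using a lam by (simp add: field_simps)
      then have "\<epsilon> * 1 \<le> \<epsilon> * (?a / lam\<^sup>2)" using \<epsilon> by (intro mult_left_mono) auto
      with 1 have "LP l \<beta> + \<epsilon> \<le> (1 / lam + \<epsilon> / lam\<^sup>2) * ?a" by (simp add: algebra_simps)
      then have "K * (LP l \<beta> + \<epsilon>) * measure M (Q l \<beta>) \<le> K * ((1 / lam + \<epsilon> / lam\<^sup>2) * ?a) * measure M (Q l \<beta>)"
        using K by (intro mult_right_mono mult_left_mono) auto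
      also have "\<dots> = K * (1 / lam + \<epsilon> / lam\<^sup>2) * (LINT y|M. indicator (Q l \<beta>) y * (h y)\<^sup>2)"
        using cube_pos[of \<beta> l] p by (auto simp: avg_def \<P>_def)
      finally show ?thesis .
    qed
    have I_R: "(\<Sum>(l, \<beta>)\<in>\<P>. LINT y|M. indicator (Q l \<beta>) y * (h y)\<^sup>2) \<le> L\<^sup>2 * measure M R"
    proof -
      have ih: "integrable M (\<lambda>y. indicator (Q l \<beta>) y * (h y)\<^sup>2)" if "(l, \<beta>) \<in> \<P>" for l \<beta>
        using osc_part_props(3)[OF _ h c] mem[OF that] by auto
      have "(\<Sum>(l, \<beta>)\<in>\<P>. LINT y|M. indicator (Q l \<beta>) y * (h y)\<^sup>2) = (\<Sum>p\<in>\<P>. LINT y|M. (case p of (l, \<beta>) \<Rightarrow> indicator (Q l \<beta>) y * (h y)\<^sup>2))"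
        by (intro sum.cong) auto
      also have "\<dots> = (LINT y|M. (\<Sum>(l, \<beta>)\<in>\<P>. indicator (Q l \<beta>) y * (h y)\<^sup>2))"
        using ih by (intro Bochner_Integration.integral_sum[symmetric]) auto
      also have "\<dots> \<le> (LINT y|M. indicator R y * (h y)\<^sup>2)"
      proof (rule integral_mono)
        show "integrable M (\<lambda>y. \<Sum>(l, \<beta>)\<in>\<P>. indicator (Q l \<beta>) y * (h y)\<^sup>2)"
          using ih by (intro Bochner_Integration.integrable_sum) auto
        show "integrable M (\<lambda>y. indicator R y * (h y)\<^sup>2)" unfolding R_def by (rule osc_part_props(3)[OF \<alpha> h c])
        fix y
        have "(\<Sum>(l, \<beta>)\<in>\<P>. indicator (Q l \<beta>) y * (h y)\<^sup>2) = (\<Sum>(l, \<beta>)\<in>\<P>. indicator (Q l \<beta>) y) * (h y)\<^sup>2"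
          by (simp add: sum_distrib_right case_prod_unfold)
        also have "\<dots> \<le> indicator R y * (h y)\<^sup>2"
          by (intro mult_right_mono sum_disjoint_cubes_le[OF fin mem disj]) auto
        finally show "(\<Sum>(l, \<beta>)\<in>\<P>. indicator (Q l \<beta>) y * (h y)\<^sup>2) \<le> indicator R y * (h y)\<^sup>2" .
      qed
      also have "\<dots> \<le> L\<^sup>2 * measure M R"
        using avgL cube_pos[OF \<alpha>] by (simp add: avg_def R_def field_simps)
      finally show ?thesis .
    qed
    have "H1_le M (\<lambda>y. \<Sum>p\<in>\<P>. (case p of (l, \<beta>) \<Rightarrow> osc_part h (Q l \<beta>)) y)
        (\<Sum>p\<in>\<P>. case p of (l, \<beta>) \<Rightarrow> K * (LP l \<beta> + \<epsilon>) * measure M (Q l \<beta>))"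
    proof (rule H1_le_sum[OF fin])
      fix p assume "p \<in> \<P>"
      then show "H1_le M (case p of (l, \<beta>) \<Rightarrow> osc_part h (Q l \<beta>)) (case p of (l, \<beta>) \<Rightarrow> K * (LP l \<beta> + \<epsilon>) * measure M (Q l \<beta>))"
        using bP by (cases p) auto
    qed
    from H1_le_add[OF g1 this]
    have "H1_le M (\<lambda>y. g y + (\<Sum>p\<in>\<P>. (case p of (l, \<beta>) \<Rightarrow> osc_part h (Q l \<beta>)) y))
        (K0 * ((2 * D + 1) * (L + \<epsilon>)) * measure M R + (\<Sum>p\<in>\<P>. case p of (l, \<beta>) \<Rightarrow> K * (LP l \<beta> + \<epsilon>) * measure M (Q l \<beta>)))" .
    moreover have "(\<lambda>y. g y + (\<Sum>p\<in>\<P>. (case p of (l, \<beta>) \<Rightarrow> osc_part h (Q l \<beta>)) y)) = osc_part h (Q k \<alpha>)"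
      unfolding g_def R_def by (rule ext) (simp add: case_prod_unfold)
    ultimately have fin: "H1_le M (osc_part h (Q k \<alpha>)) (K0 * ((2 * D + 1) * (L + \<epsilon>)) * measure M R + (\<Sum>p\<in>\<P>. case p of (l, \<beta>) \<Rightarrow> K * (LP l \<beta> + \<epsilon>) * measure M (Q l \<beta>)))"
      by simp
    have "(\<Sum>p\<in>\<P>. case p of (l, \<beta>) \<Rightarrow> K * (LP l \<beta> + \<epsilon>) * measure M (Q l \<beta>))
       \<le> (\<Sum>p\<in>\<P>. case p of (l, \<beta>) \<Rightarrow> K * (1 / lam + \<epsilon> / lam\<^sup>2) * (LINT y|M. indicator (Q l \<beta>) y * (h y)\<^sup>2))"
      using Le by (intro sum_mono) auto
    also have "\<dots> = K * (1 / lam + \<epsilon> / lam\<^sup>2) * (\<Sum>(l, \<beta>)\<in>\<P>. LINT y|M. indicator (Q l \<beta>) y * (h y)\<^sup>2)"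
      by (simp add: sum_distrib_left case_prod_unfold)
    also have "\<dots> \<le> K * (1 / lam + \<epsilon> / lam\<^sup>2) * (L\<^sup>2 * measure M R)"
      using K lam \<epsilon> by (intro mult_left_mono I_R) auto
    also have "\<dots> = K * (L * (L / lam) + \<epsilon> * (L / lam)\<^sup>2) * measure M R"
      by (simp add: power2_eq_square algebra_simps)
    \<comment> \<open>Here the choice lam \<ge> 2 L pays: L / lam \<le> 1/2, so at most half of K (L
      + \<epsilon>) is spent on the selected cubes.\<close>
    also have "\<dots> \<le> K * (L * (1 / 2) + \<epsilon> * (1 / 2)) * measure M R"
    proof -
      have q: "L / lam \<le> 1 / 2" "0 \<le> L / lam" using lam L by (auto simp: field_simps)
      have "(L / lam)\<^sup>2 \<le> (1 / 2)\<^sup>2" using q by (intro power_mono) auto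
      also have "(1 / 2 :: real)\<^sup>2 \<le> 1 / 2" by (simp add: power2_eq_square)
      finally have "(L / lam)\<^sup>2 \<le> 1 / 2" .
      then show ?thesis using q K L \<epsilon> by (intro mult_right_mono mult_left_mono add_mono) auto
    qed
    finally have "(\<Sum>p\<in>\<P>. case p of (l, \<beta>) \<Rightarrow> K * (LP l \<beta> + \<epsilon>) * measure M (Q l \<beta>)) \<le> K * (L * (1 / 2) + \<epsilon> * (1 / 2)) * measure M R" .
    then have "K0 * ((2 * D + 1) * (L + \<epsilon>)) * measure M R + (\<Sum>p\<in>\<P>. case p of (l, \<beta>) \<Rightarrow> K * (LP l \<beta> + \<epsilon>) * measure M (Q l \<beta>))
       \<le> K * (L + \<epsilon>) * measure M R"
      unfolding K_def by (simp add: algebra_simps)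
    then show ?case using fin H1_le_mono unfolding R_def by blast
  qed
  show ?thesis
    by (intro exI[of _ K] conjI K allI impI) (rule main, auto)
qed

lemma small_scale: "0 < r \<Longrightarrow> \<exists>N\<ge>k. \<delta> powi N < r"
proof -
  assume r: "0 < r"
  obtain n :: nat where n: "\<delta> ^ n < r" using real_arch_pow_inv[OF r, of \<delta>] \<delta>_le by auto
  have "\<delta> powi (max k (int n)) \<le> \<delta> powi (int n)" by (rule scale_mono) simp
  also have "\<dots> < r" using n by simp
  finally show ?thesis by (intro exI[of _ "max k (int n)"]) auto
qed

text \<open>Uniform continuity supplies a generation on whose cubes h oscillates by at most its root
  mean square L over the given cube; with \<epsilon> = L the approximate bound becomes 2 K L times
  the measure. The case L = 0 is treated apart, since \<epsilon> must be positive; there h vanishes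
  almost everywhere on the cube.\<close>

lemma H1_le_osc_part:
  "\<exists>K>0. \<forall>k \<alpha> h c. \<alpha> \<in> A k \<longrightarrow> uniformly_continuous_on UNIV h \<longrightarrow> (\<forall>y. \<bar>h y\<bar> \<le> c) \<longrightarrow>
     H1_le M (osc_part h (Q k \<alpha>)) (K * sqrt (measure M (Q k \<alpha>) * (LINT y|M. indicator (Q k \<alpha>) y * (h y)\<^sup>2)))"
proof -
  obtain K where K: "K > 0" "\<And>N k \<alpha> h c \<epsilon> L. k \<le> N \<Longrightarrow> \<alpha> \<in> A k \<Longrightarrow> h \<in> borel_measurable M \<Longrightarrow> (\<forall>y. \<bar>h y\<bar> \<le> c) \<Longrightarrow>
     (\<forall>\<beta>\<in>A N. \<forall>y\<in>Q N \<beta>. \<forall>z\<in>Q N \<beta>. \<bar>h y - h z\<bar> \<le> \<epsilon>) \<Longrightarrow> 0 < \<epsilon> \<Longrightarrow> 0 \<le> L \<Longrightarrow>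
     avg (\<lambda>y. (h y)\<^sup>2) (Q k \<alpha>) \<le> L\<^sup>2 \<Longrightarrow>
     H1_le M (osc_part h (Q k \<alpha>)) (K * (L + \<epsilon>) * measure M (Q k \<alpha>))"
    using H1_le_osc_part_approx by blast
  have "H1_le M (osc_part h (Q k \<alpha>)) (2 * K * sqrt (measure M (Q k \<alpha>) * (LINT y|M. indicator (Q k \<alpha>) y * (h y)\<^sup>2)))"
    if \<alpha>: "\<alpha> \<in> A k" and uc: "uniformly_continuous_on UNIV h" and c: "\<forall>y. \<bar>h y\<bar> \<le> c" for k \<alpha> and h :: "'a \<Rightarrow> real" and c
  proof -
    have hm: "h \<in> borel_measurable M" by (rule continuous_measurable_M[OF uniformly_continuous_imp_continuous[OF uc]])
    let ?m = "measure M (Q k \<alpha>)" and ?I = "LINT y|M. indicator (Q k \<alpha>) y * (h y)\<^sup>2"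
    have m: "?m > 0" by (rule cube_pos[OF \<alpha>])
    have I: "?I \<ge> 0" by simp
    note op = osc_part_props[OF \<alpha> hm c[rule_format]]
    show ?thesis
    proof (cases "?I = 0")
      case True
      then have ae: "AE y in M. indicator (Q k \<alpha>) y * (h y)\<^sup>2 = 0"
        by (subst (asm) integral_nonneg_eq_0_iff_AE[OF op(3)]) auto
      have "(avg h (Q k \<alpha>))\<^sup>2 \<le> 0" using op(5) True by (simp add: avg_def)
      then have "avg h (Q k \<alpha>) = 0" by simp
      then have "AE y in M. 0 = osc_part h (Q k \<alpha>) y"
        using ae by (auto simp: osc_part_def elim!: eventually_mono)
      then show ?thesis using H1_le_cong_AE[OF H1_le_zero[of 0]] True op(1) by auto
    next
      case False
      define L where "L = sqrt (?I / ?m)"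
      have L: "L > 0" using False I m by (simp add: L_def less_le)
      obtain d where d: "d > 0" "\<And>y z. dist z y < d \<Longrightarrow> dist (h z) (h y) < L"
        using uc L unfolding uniformly_continuous_on_def by (metis UNIV_I)
      obtain N where N: "N \<ge> k" "\<delta> powi N < d / 8" using small_scale[of "d/8" k] d(1) by auto
      have "H1_le M (osc_part h (Q k \<alpha>)) (K * (L + L) * ?m)"
      proof (rule K(2)[OF N(1) \<alpha> hm c _ L])
        show "\<forall>\<beta>\<in>A N. \<forall>y\<in>Q N \<beta>. \<forall>z\<in>Q N \<beta>. \<bar>h y - h z\<bar> \<le> L"
        proof (intro ballI)
          fix \<beta> y z assume "\<beta> \<in> A N" "y \<in> Q N \<beta>" "z \<in> Q N \<beta>"
          then have "dist y z < d" using cube_diam[of \<beta> N y z] N(2) by simp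
          then show "\<bar>h y - h z\<bar> \<le> L" using d(2) by (force simp: dist_real_def)
        qed
        show "avg (\<lambda>y. (h y)\<^sup>2) (Q k \<alpha>) \<le> L\<^sup>2" using I m by (simp add: L_def avg_def)
      qed (use L in auto)
      also have "K * (L + L) * ?m = 2 * K * (L * ?m)" by simp
      also have "L * ?m = sqrt (?m * ?I)"
        unfolding L_def using m I by (simp add: real_sqrt_divide real_sqrt_mult real_div_sqrt field_simps)
      finally show ?thesis .
    qed
  qed
  then show ?thesis using K(1) by (intro exI[of _ "2 * K"]) auto
qed

end

section \<open>Wavelets and molecules\<close>

text \<open>Distinct exponents make the sum a part of the geometric series.\<close>

lemma sum_power_inj_le:
  fixes q :: real
  assumes "finite S" "inj_on g S" "0 < q" "q < 1"
  shows "(\<Sum>k\<in>S. q ^ g k) \<le> 1 / (1 - q)"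
proof -
  have "(\<Sum>k\<in>S. q ^ g k) = (\<Sum>n\<in>g ` S. q ^ n)" using assms(2) by (simp add: sum.reindex)
  also have "\<dots> \<le> (\<Sum>n. q ^ n)"
    using assms by (intro sum_le_suminf summable_geometric) auto
  also have "\<dots> = 1 / (1 - q)" using assms by (intro suminf_geometric) auto
  finally show ?thesis .
qed

text \<open>The constants whose existence \<open>AH_wavelets\<close> asserts are fixed as
  parameters, so that all later bounds can name the same ones. Orthonormality, completeness and
  cancellation are read off from the predicate itself.\<close>

locale wavelet_space = dyadic_space M Cd \<delta> A x Q
  for M :: "'a::metric_space measure" and Cd \<delta> and A :: "int \<Rightarrow> 'i set" and x Q +
  fixes \<psi> :: "int \<Rightarrow> 'i \<Rightarrow> 'i \<Rightarrow> 'a \<Rightarrow> real" and \<epsilon>0 \<eta> \<nu> C c0 :: real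
  assumes AH: "AH_wavelets M \<delta> A x Q \<psi> \<epsilon>0"
    and par_pos: "0 < \<eta>" "\<eta> \<le> 1" "0 < \<nu>" "0 < C" "0 < c0"
    and size0: "\<forall>(k, \<alpha>, \<beta>)\<in>wav_index A Q. \<forall>z.
           \<bar>\<psi> k \<alpha> \<beta> z\<bar> \<le> C / sqrt (V M (x (k + 1) \<beta>) (\<delta> powi k))
              * exp (- \<nu> * dist (x (k + 1) \<beta>) z / \<delta> powi k)"
    and reg0: "\<forall>(k, \<alpha>, \<beta>)\<in>wav_index A Q. \<forall>z w. dist z w \<le> \<delta> powi k \<longrightarrow>
           \<bar>\<psi> k \<alpha> \<beta> z - \<psi> k \<alpha> \<beta> w\<bar> \<le> C / sqrt (V M (x (k + 1) \<beta>) (\<delta> powi k))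
              * (dist z w / \<delta> powi k) powr \<eta> * exp (- \<nu> * dist (x (k + 1) \<beta>) z / \<delta> powi k)"
    and low0: "\<forall>(k, \<alpha>, \<beta>)\<in>wav_index A Q.
        ball (x (k + 1) \<beta>) (\<epsilon>0 * \<delta> powi k) \<subseteq> Q k \<alpha> \<and>
        (\<forall>z\<in>ball (x (k + 1) \<beta>) (\<epsilon>0 * \<delta> powi k). \<bar>\<psi> k \<alpha> \<beta> z\<bar> \<ge> c0 / sqrt (measure M (Q k \<alpha>)))"
begin

text \<open>For an index \<open>(k, \<alpha>, \<beta>)\<close> the functions \<open>gen\<close>, \<open>scl\<close>, \<open>pt\<close>, \<open>cub\<close>, \<open>wb\<close> and \<open>w\<close> give \<open>k\<close>, \<open>\<delta>\<^sup>k\<close>,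
  \<open>y\<^sup>k\<^sub>\<beta>\<close>, \<open>Q\<^sup>k\<^sub>\<alpha>\<close>, \<open>W\<^sup>k\<^sub>\<alpha>\<^sub>,\<^sub>\<beta>\<close> and the wavelet.\<close>

definition I :: "(int \<times> 'i \<times> 'i) set" where "I = wav_index A Q"
definition gen :: "int \<times> 'i \<times> 'i \<Rightarrow> int" where "gen i = fst i"
definition scl :: "int \<times> 'i \<times> 'i \<Rightarrow> real" where "scl i = \<delta> powi gen i"
definition pt :: "int \<times> 'i \<times> 'i \<Rightarrow> 'a" where "pt i = x (gen i + 1) (snd (snd i))"
definition cub :: "int \<times> 'i \<times> 'i \<Rightarrow> 'a set" where "cub i = Q (gen i) (fst (snd i))"
definition wb :: "int \<times> 'i \<times> 'i \<Rightarrow> 'a set" where "wb i = ball (pt i) (\<epsilon>0 * scl i)"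
definition w :: "int \<times> 'i \<times> 'i \<Rightarrow> 'a \<Rightarrow> real" where "w = wav \<psi>"

lemma scl_pos [simp]: "0 < scl i" by (simp add: scl_def)

lemma eps: "0 < \<epsilon>0" "\<epsilon>0 < 1"
  using AH unfolding AH_wavelets_def by blast+

lemma index:
  assumes "i \<in> I"
  shows "fst (snd i) \<in> A (gen i)" "snd (snd i) \<in> A (gen i + 1)"
    "Q (gen i + 1) (snd (snd i)) \<subseteq> cub i" "pt i \<in> cub i"
proof -
  show "fst (snd i) \<in> A (gen i)" and 1: "snd (snd i) \<in> A (gen i + 1)" and 2: "Q (gen i + 1) (snd (snd i)) \<subseteq> cub i"
    using assms by (auto simp: I_def wav_index_def Lset_def gen_def cub_def)
  show "pt i \<in> cub i" using center_in_cube[OF 1] 2 by (auto simp: pt_def)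
qed

lemma w_size: "i \<in> I \<Longrightarrow> \<bar>w i z\<bar> \<le> C / sqrt (V M (pt i) (scl i)) * exp (- \<nu> * dist (pt i) z / scl i)"
  using size0 unfolding I_def w_def wav_def pt_def scl_def gen_def by fastforce

lemma w_reg: "i \<in> I \<Longrightarrow> dist z y \<le> scl i \<Longrightarrow>
  \<bar>w i z - w i y\<bar> \<le> C / sqrt (V M (pt i) (scl i)) * (dist z y / scl i) powr \<eta> * exp (- \<nu> * dist (pt i) z / scl i)"
  using reg0 unfolding I_def w_def wav_def pt_def scl_def gen_def by fastforce

lemma wb_sub: "i \<in> I \<Longrightarrow> wb i \<subseteq> cub i"
  and w_low: "i \<in> I \<Longrightarrow> z \<in> wb i \<Longrightarrow> c0 / sqrt (measure M (cub i)) \<le> \<bar>w i z\<bar>"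
  using low0 unfolding I_def w_def wav_def pt_def scl_def gen_def wb_def cub_def by fastforce+

lemma w_measurable [measurable]: "i \<in> I \<Longrightarrow> w i \<in> borel_measurable M"
  and w_orth: "i \<in> I \<Longrightarrow> j \<in> I \<Longrightarrow> (LINT y|M. w i y * w j y) = (if i = j then 1 else 0)"
  and w_integrable: "i \<in> I \<Longrightarrow> integrable M (w i)"
  and w_integral: "i \<in> I \<Longrightarrow> (LINT y|M. w i y) = 0"
  and w_complete: "g \<in> borel_measurable M \<Longrightarrow> integrable M (\<lambda>y. (g y)\<^sup>2) \<Longrightarrow>
        (\<And>i. i \<in> I \<Longrightarrow> (LINT y|M. g y * w i y) = 0) \<Longrightarrow> (AE y in M. g y = 0)"
  using AH unfolding AH_wavelets_def I_def w_def by blast+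

lemma cub_pos: "i \<in> I \<Longrightarrow> 0 < measure M (cub i)"
  and cub_sets [measurable]: "i \<in> I \<Longrightarrow> cub i \<in> sets M"
  unfolding cub_def using cube_pos cube_sets index(1) by blast+

lemma wb_sets [measurable, simp]: "wb i \<in> sets M"
  by (simp add: wb_def)

lemma wb_pos: "0 < measure M (wb i)"
  using V_pos[of "\<epsilon>0 * scl i" "pt i"] eps by (simp add: wb_def V_def)

lemma cub_diam: "i \<in> I \<Longrightarrow> y \<in> cub i \<Longrightarrow> z \<in> cub i \<Longrightarrow> dist y z < 8 * scl i"
  using cube_diam[OF index(1)] unfolding cub_def scl_def by blast

lemma cub_sub_ball: "i \<in> I \<Longrightarrow> cub i \<subseteq> ball (pt i) (8 * scl i)"
  using cub_diam[of i "pt i"] index(4)[of i] by auto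

lemma Vpos [simp]: "0 < V M (pt i) (scl i)"
  by (rule V_pos) simp

lemma Vne [simp]: "V M (pt i) (scl i) \<noteq> 0"
  using Vpos[of i] by linarith

text \<open>The cube lies in the ball of radius 8 \<open>scl i\<close> around \<open>pt i\<close>,
  which doubling compares with the concentric balls of radius \<open>scl i\<close> and \<epsilon>0
  \<open>scl i\<close>. Comparability with \<open>wb i\<close> is what makes the square function
  built from the small balls as strong as the others.\<close>

lemma cub_measure:
  "\<exists>K>0. \<forall>i\<in>I. V M (pt i) (scl i) \<le> K * measure M (cub i) \<and> measure M (cub i) \<le> K * V M (pt i) (scl i)
     \<and> measure M (cub i) \<le> K * measure M (wb i)"
proof -
  obtain K1 where K1: "K1 > 0" "\<And>k \<alpha> p. \<alpha> \<in> A k \<Longrightarrow> p \<in> Q k \<alpha> \<Longrightarrow> V M p (1 * \<delta> powi k) \<le> K1 * measure M (Q k \<alpha>)"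
    using V_le_cube[of 1] by auto
  obtain K2 where K2: "K2 > 0" "\<And>z \<rho> t. 0 < \<rho> \<Longrightarrow> 0 \<le> t \<Longrightarrow> V M z (t * \<rho>) \<le> K2 * exp (1 * t) * V M z \<rho>"
    using V_growth[of 1] by auto
  define K where "K = K1 + K2 * exp (8 / \<epsilon>0) + K2 * exp 8"
  have K: "K > 0" "K1 \<le> K" "K2 * exp (8 / \<epsilon>0) \<le> K" "K2 * exp 8 \<le> K"
    using K1 K2 by (auto simp: K_def add_pos_pos)
  show ?thesis
  proof (intro exI[of _ K] conjI ballI K(1))
    fix i assume i: "i \<in> I"
    have "V M (pt i) (scl i) \<le> K1 * measure M (cub i)"
      using K1(2)[OF index(1)[OF i], of "pt i"] index(4)[OF i] by (simp add: cub_def scl_def)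
    also have "\<dots> \<le> K * measure M (cub i)" using K by (intro mult_right_mono) auto
    finally show "V M (pt i) (scl i) \<le> K * measure M (cub i)" .
    have m: "measure M (cub i) \<le> V M (pt i) (8 * scl i)"
      using i cub_sub_ball by (intro measure_subset_ball) auto
    also have "\<dots> \<le> K2 * exp (1 * 8) * V M (pt i) (scl i)" by (intro K2) auto
    also have "\<dots> \<le> K * V M (pt i) (scl i)" using K by (intro mult_right_mono) auto
    finally show "measure M (cub i) \<le> K * V M (pt i) (scl i)" .
    have "V M (pt i) (8 * scl i) = V M (pt i) (8 / \<epsilon>0 * (\<epsilon>0 * scl i))" using eps by simp
    also have "\<dots> \<le> K2 * exp (1 * (8 / \<epsilon>0)) * V M (pt i) (\<epsilon>0 * scl i)" using eps by (intro K2) auto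
    also have "\<dots> \<le> K * V M (pt i) (\<epsilon>0 * scl i)" using K by (intro mult_right_mono) auto
    finally show "measure M (cub i) \<le> K * measure M (wb i)" using m by (simp add: wb_def V_def)
  qed
qed

text \<open>Within a generation \<beta> determines \<alpha>, because the cubes of that generation
  are disjoint. Distinct indices therefore have distinct points, and these are separated by \<delta>
  times the scale.\<close>

lemma sum_exp_dist_gen:
  assumes "s > 0"
  shows "\<exists>K>0. \<forall>k F y. finite F \<longrightarrow> F \<subseteq> I \<longrightarrow> (\<forall>i\<in>F. gen i = k) \<longrightarrow>
     (\<Sum>i\<in>F. exp (- s * dist (pt i) y / scl i)) \<le> K"
proof -
  obtain K where K: "K > 0" "\<And>\<rho> S (pt :: int \<times> 'i \<times> 'i \<Rightarrow> 'a) y. 0 < \<rho> \<Longrightarrow> finite S \<Longrightarrow>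
     (\<forall>i\<in>S. \<forall>j\<in>S. i \<noteq> j \<longrightarrow> \<delta> * \<rho> \<le> dist (pt i) (pt j)) \<Longrightarrow>
     (\<Sum>i\<in>S. exp (- s * dist (pt i) y / \<rho>)) \<le> K"
    using sum_exp_dist_separated[OF assms \<delta>_pos, where ?'j = "int \<times> 'i \<times> 'i"] by auto
  have "(\<Sum>i\<in>F. exp (- s * dist (pt i) y / scl i)) \<le> K" if F: "finite F" "F \<subseteq> I" "\<forall>i\<in>F. gen i = k" for k F y
  proof -
    have "(\<Sum>i\<in>F. exp (- s * dist (pt i) y / scl i)) = (\<Sum>i\<in>F. exp (- s * dist (pt i) y / \<delta> powi k))"
      using F by (intro sum.cong) (auto simp: scl_def)
    also have "\<dots> \<le> K"
    proof (intro K(2) F ballI impI)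
      fix i j assume ij: "i \<in> F" "j \<in> F" "i \<noteq> j"
      have i: "i \<in> I" "gen i = k" "j \<in> I" "gen j = k" using ij F by auto
      have ne: "snd (snd i) \<noteq> snd (snd j)"
      proof
        assume e: "snd (snd i) = snd (snd j)"
        then have "pt i = pt j" using i by (simp add: pt_def)
        then have "fst (snd i) = fst (snd j)"
          using cube_unique[of "fst (snd i)" k "fst (snd j)" "pt i"] index[OF i(1)] index[OF i(3)] i by (simp add: cub_def)
        then have "i = j" using e i by (simp add: prod_eq_iff gen_def)
        then show False using ij by simp
      qed
      have "\<delta> powi (k + 1) \<le> dist (x (k + 1) (snd (snd i))) (x (k + 1) (snd (snd j)))"
        using index(2)[OF i(1)] index(2)[OF i(3)] i ne by (intro separated) auto
      then show "\<delta> * \<delta> powi k \<le> dist (pt i) (pt j)" using i by (simp add: pt_def scale_Suc)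
    qed simp
    finally show ?thesis .
  qed
  then show ?thesis using K(1) by blast
qed

text \<open>The common pattern of the summations over scales: each generation contributes a
  geometrically small amount, with g counting generations from a reference generation.\<close>

lemma sum_by_gen_le:
  assumes F: "finite F" "F \<subseteq> I" and K: "0 \<le> K"
    and le: "\<And>k G. G \<subseteq> F \<Longrightarrow> (\<And>i. i \<in> G \<Longrightarrow> gen i = k) \<Longrightarrow> G \<noteq> {} \<Longrightarrow> (\<Sum>i\<in>G. f i) \<le> K * q ^ g k"
    and q: "0 < q" "q < 1" and g: "inj_on g (gen ` F)"
  shows "(\<Sum>i\<in>F. f i) \<le> K / (1 - q :: real)"
proof -
  have "(\<Sum>i\<in>F. f i) = (\<Sum>k\<in>gen ` F. \<Sum>i\<in>{i \<in> F. gen i = k}. f i)" by (rule sum.image_gen[OF F(1)])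
  also have "\<dots> \<le> (\<Sum>k\<in>gen ` F. K * q ^ g k)" by (intro sum_mono le) auto
  also have "\<dots> = K * (\<Sum>k\<in>gen ` F. q ^ g k)" by (simp add: sum_distrib_left)
  also have "\<dots> \<le> K * (1 / (1 - q))" using F q g K by (intro mult_left_mono sum_power_inj_le) auto
  finally show ?thesis by simp
qed

lemma w_bounded: "i \<in> I \<Longrightarrow> \<bar>w i z\<bar> \<le> C / sqrt (V M (pt i) (scl i))"
proof -
  assume i: "i \<in> I"
  have "exp (- \<nu> * dist (pt i) z / scl i) \<le> 1" using par_pos by (simp add: less_imp_le)
  then have "C / sqrt (V M (pt i) (scl i)) * exp (- \<nu> * dist (pt i) z / scl i) \<le> C / sqrt (V M (pt i) (scl i)) * 1"
    using par_pos by (intro mult_left_mono) (auto simp: less_imp_le)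
  then show ?thesis using w_size[OF i, of z] by simp
qed

lemma w_uniformly_continuous: assumes i: "i \<in> I" shows "uniformly_continuous_on UNIV (w i)"
  unfolding uniformly_continuous_on_def
proof (intro allI impI)
  fix e :: real assume e: "0 < e"
  define B where "B = C / sqrt (V M (pt i) (scl i))"
  have B: "B > 0" using par_pos by (simp add: B_def)
  define t where "t = (e / (2 * B)) powr (1 / \<eta>)"
  have t: "t > 0" "t powr \<eta> = e / (2 * B)" using e B par_pos by (auto simp: t_def powr_powr)
  define d where "d = scl i * min 1 t"
  have d: "d > 0" using t by (simp add: d_def)
  show "\<exists>d>0. \<forall>y\<in>UNIV. \<forall>z\<in>UNIV. dist z y < d \<longrightarrow> dist (w i z) (w i y) < e"
  proof (intro exI[of _ d] conjI d ballI impI)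
    fix y z :: 'a assume zy: "dist z y < d"
    have d1: "d \<le> scl i * 1" "d \<le> scl i * t" unfolding d_def by (intro mult_left_mono; simp add: less_imp_le)+
    have 1: "dist z y \<le> scl i" "dist z y / scl i \<le> t" using zy d1 by (auto simp: field_simps)
    have "\<bar>w i z - w i y\<bar> \<le> B * (dist z y / scl i) powr \<eta> * exp (- \<nu> * dist (pt i) z / scl i)"
      using w_reg[OF i 1(1)] by (simp add: B_def)
    also have "\<dots> \<le> B * (dist z y / scl i) powr \<eta> * 1"
      using B par_pos by (intro mult_left_mono) (auto simp: less_imp_le)
    also have "\<dots> \<le> B * (t powr \<eta>)" using B 1 par_pos by (simp add: powr_mono2 less_imp_le)
    also have "\<dots> = e / 2" using t B by simp
    also have "\<dots> < e" using e by simp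
    finally show "dist (w i z) (w i y) < e" by (simp add: dist_real_def)
  qed
qed

lemma integrable_mult_w: "integrable M f \<Longrightarrow> i \<in> I \<Longrightarrow> integrable M (\<lambda>y. f y * w i y)"
proof -
  assume f: "integrable M f" and i: "i \<in> I"
  show ?thesis
  proof (rule Bochner_Integration.integrable_bound[of M "\<lambda>y. (C / sqrt (V M (pt i) (scl i))) * f y"])
    show "AE y in M. norm (f y * w i y) \<le> norm (C / sqrt (V M (pt i) (scl i)) * f y)"
    proof (rule AE_I2)
      fix y
      have "\<bar>f y\<bar> * \<bar>w i y\<bar> \<le> \<bar>f y\<bar> * \<bar>C / sqrt (V M (pt i) (scl i))\<bar>"
        using order_trans[OF w_bounded[OF i, of y] abs_ge_self] by (intro mult_left_mono) auto
      then show "norm (f y * w i y) \<le> norm (C / sqrt (V M (pt i) (scl i)) * f y)"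
        by (simp only: real_norm_def abs_mult) (simp only: mult.commute)
    qed
  qed (use f i in auto)
qed

section \<open>Finite wavelet sums and their localisation\<close>

abbreviation wsum :: "(int \<times> 'i \<times> 'i) set \<Rightarrow> (int \<times> 'i \<times> 'i \<Rightarrow> real) \<Rightarrow> 'a \<Rightarrow> real" where
  "wsum F c y \<equiv> (\<Sum>i\<in>F. c i * w i y)"

lemma wsum_integrable: "F \<subseteq> I \<Longrightarrow> integrable M (wsum F c)"
  using w_integrable by (intro Bochner_Integration.integrable_sum integrable_mult_right) auto

lemma wsum_integral: "F \<subseteq> I \<Longrightarrow> (LINT y|M. wsum F c y) = 0"
proof -
  assume F: "F \<subseteq> I"
  have "(LINT y|M. wsum F c y) = (\<Sum>i\<in>F. LINT y|M. c i * w i y)"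
    using F w_integrable by (intro Bochner_Integration.integral_sum integrable_mult_right) auto
  also have "\<dots> = 0" using F w_integral by (intro sum.neutral) auto
  finally show ?thesis .
qed

lemma wsum_bounded: "F \<subseteq> I \<Longrightarrow> \<exists>B. \<forall>y. \<bar>wsum F c y\<bar> \<le> B"
proof -
  assume F: "F \<subseteq> I"
  have "\<bar>wsum F c y\<bar> \<le> (\<Sum>i\<in>F. \<bar>c i\<bar> * (C / sqrt (V M (pt i) (scl i))))" for y
  proof -
    have "\<bar>wsum F c y\<bar> \<le> (\<Sum>i\<in>F. \<bar>c i * w i y\<bar>)" by (rule sum_abs)
    also have "\<dots> \<le> (\<Sum>i\<in>F. \<bar>c i\<bar> * (C / sqrt (V M (pt i) (scl i))))"
      unfolding abs_mult using F w_bounded by (intro sum_mono mult_left_mono) auto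
    finally show ?thesis .
  qed
  then show ?thesis by blast
qed

lemma wsum_uniformly_continuous: "finite F \<Longrightarrow> F \<subseteq> I \<Longrightarrow> uniformly_continuous_on UNIV (wsum F c)"
proof (induction rule: finite_induct)
  case (insert i F)
  have "uniformly_continuous_on UNIV (\<lambda>y. c i * w i y + wsum F c y)"
    using insert w_uniformly_continuous[of i]
    by (intro uniformly_continuous_on_add bounded_linear.uniformly_continuous_on[OF bounded_linear_mult_right]) auto
  then show ?case using insert by simp
qed (simp add: uniformly_continuous_on_const)

lemma wsum_sq:
  assumes F: "finite F" "F \<subseteq> I"
  shows "integrable M (\<lambda>y. (wsum F c y)\<^sup>2)" "(LINT y|M. (wsum F c y)\<^sup>2) = (\<Sum>i\<in>F. (c i)\<^sup>2)"
proof -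
  have e: "(\<lambda>y. (wsum F c y)\<^sup>2) = (\<lambda>y. \<Sum>i\<in>F. \<Sum>j\<in>F. c i * c j * (w i y * w j y))"
    by (simp add: power2_eq_square sum_product mult_ac)
  have int: "integrable M (\<lambda>y. c i * c j * (w i y * w j y))" if "i \<in> F" "j \<in> F" for i j
  proof (intro integrable_mult_right)
    show "integrable M (\<lambda>y. w i y * w j y)" using that F by (intro integrable_mult_w w_integrable) blast+
  qed
  show "integrable M (\<lambda>y. (wsum F c y)\<^sup>2)"
    unfolding e using int by (intro Bochner_Integration.integrable_sum) auto
  have "(LINT y|M. (wsum F c y)\<^sup>2) = (\<Sum>i\<in>F. LINT y|M. (\<Sum>j\<in>F. c i * c j * (w i y * w j y)))"
    unfolding e using int by (intro Bochner_Integration.integral_sum Bochner_Integration.integrable_sum) auto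
  also have "\<dots> = (\<Sum>i\<in>F. \<Sum>j\<in>F. LINT y|M. c i * c j * (w i y * w j y))"
    using int by (intro sum.cong refl Bochner_Integration.integral_sum) auto
  also have "\<dots> = (\<Sum>i\<in>F. \<Sum>j\<in>F. if i = j then (c i)\<^sup>2 else 0)"
  proof (intro sum.cong refl)
    fix i j assume "i \<in> F" "j \<in> F"
    then show "(LINT y|M. c i * c j * (w i y * w j y)) = (if i = j then (c i)\<^sup>2 else 0)"
      using w_orth[of i j] subsetD[OF F(2)] by (simp add: power2_eq_square)
  qed
  also have "\<dots> = (\<Sum>i\<in>F. (c i)\<^sup>2)" using F by simp
  finally show "(LINT y|M. (wsum F c y)\<^sup>2) = (\<Sum>i\<in>F. (c i)\<^sup>2)" .
qed

text \<open>Near the cube the weight is bounded, and orthonormality gives the L2 norm. Farther out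
  the tools are Cauchy-Schwarz over F and the pointwise decay. F may contain very many indices of
  fine generations, but their wavelets are exponentially small in the distance measured in their own
  scale, and this outweighs the number.\<close>

lemma wsum_weighted_L2:
  "\<exists>K>0. \<forall>k \<alpha> F c. \<alpha> \<in> A k \<longrightarrow> finite F \<longrightarrow> F \<subseteq> I \<longrightarrow> (\<forall>i\<in>F. k \<le> gen i \<and> cub i \<subseteq> Q k \<alpha>) \<longrightarrow>
     (\<integral>\<^sup>+ y. ennreal (exp (\<nu> / 4 * dist (x k \<alpha>) y / \<delta> powi k) * (wsum F c y)\<^sup>2) \<partial>M) \<le> ennreal (K * (\<Sum>i\<in>F. (c i)\<^sup>2))"
proof -
  have \<nu>: "\<nu> > 0" by (rule par_pos)
  obtain K3 where K3: "K3 > 0" "\<And>p \<rho>. 0 < \<rho> \<Longrightarrow>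
    (\<integral>\<^sup>+ y. ennreal (exp (- \<nu> * dist p y / \<rho>)) \<partial>M) \<le> ennreal (K3 * V M p \<rho>)"
    using nn_integral_exp_dist[OF \<nu>] by auto
  have "\<nu> / 4 > 0" using \<nu> by simp
  from sum_exp_dist_gen[OF this] obtain K4 where K4: "K4 > 0" "\<And>k F y. finite F \<Longrightarrow> F \<subseteq> I \<Longrightarrow> (\<forall>i\<in>F. gen i = k) \<Longrightarrow>
     (\<Sum>i\<in>F. exp (- (\<nu> / 4) * dist (pt i) y / scl i)) \<le> K4"
    by blast
  define q where "q = exp (- \<nu>)"
  have q: "0 < q" "q < 1" using \<nu> by (auto simp: q_def)
  \<comment> \<open>\<open>exp (2 * \<nu>)\<close> bounds the weight within 8 scales of the centre,
    as 8 \<nu> / 4 = 2 \<nu>; the second summand comes from the region beyond.\<close>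
  define K where "K = exp (2 * \<nu>) + C\<^sup>2 * K3 * (K4 / (1 - q))"
  have K: "K > 0" unfolding K_def using par_pos K3 K4 q by (intro add_pos_nonneg) auto
  have "(\<integral>\<^sup>+ y. ennreal (exp (\<nu> / 4 * dist (x k \<alpha>) y / \<delta> powi k) * (wsum F c y)\<^sup>2) \<partial>M) \<le> ennreal (K * (\<Sum>i\<in>F. (c i)\<^sup>2))"
    if \<alpha>: "\<alpha> \<in> A k" and F: "finite F" "F \<subseteq> I" and sub: "\<forall>i\<in>F. k \<le> gen i \<and> cub i \<subseteq> Q k \<alpha>" for k \<alpha> F c
  proof -
    define \<rho> where "\<rho> = \<delta> powi k"
    have \<rho>: "\<rho> > 0" by (simp add: \<rho>_def)
    define T where "T i = \<rho> / scl i" for i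
    have T: "T i \<ge> 1" if "i \<in> F" for i
      using scale_mono[of k "gen i"] sub that by (simp add: T_def scl_def \<rho>_def)
    have near_pt: "dist (pt i) (x k \<alpha>) \<le> 4 * \<rho>" if "i \<in> F" for i
      using index(4)[of i] F sub that cube_subset_ball[OF \<alpha>] by (force simp: \<rho>_def dist_commute less_imp_le)
    define S where "S = (\<Sum>i\<in>F. (c i)\<^sup>2)"
    have S: "S \<ge> 0" by (simp add: S_def sum_nonneg)
    define W where "W y = exp (\<nu> / 4 * dist (x k \<alpha>) y / \<rho>)" for y
    have [measurable]: "wsum F c \<in> borel_measurable M" using wsum_integrable[OF F(2)] by auto
    have [measurable]: "W \<in> borel_measurable M" unfolding W_def by measurable
    have wm: "w i \<in> borel_measurable M" if "i \<in> F" for i using that F by auto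
    \<comment> \<open>Majorant of the weight times the squared wavelet away from the cube. Of the
      decay at rate 2 \<nu> in the square, one half absorbs the weight and yields
      \<open>exp (- 2 * \<nu> * T i)\<close>, the other half stays for the integration.\<close>
    define E where "E i y = exp (- 2 * \<nu> * T i) * (C\<^sup>2 / V M (pt i) (scl i)) * exp (- \<nu> * dist (pt i) y / scl i)" for i y
    have [measurable]: "E i \<in> borel_measurable M" for i unfolding E_def by measurable
    have far: "W y * (w i y)\<^sup>2 \<le> E i y" if i: "i \<in> F" and y: "8 * \<rho> \<le> dist (x k \<alpha>) y" for i y
    proof -
      define D where "D = dist (x k \<alpha>) y / \<rho>"
      have D: "D \<ge> 8" using y \<rho> by (simp add: D_def field_simps)
      have "dist (x k \<alpha>) y \<le> dist (pt i) y + 4 * \<rho>"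
        using dist_triangle[of "x k \<alpha>" y "pt i"] near_pt[OF i] by (simp add: dist_commute)
      then have "D * \<rho> / 2 \<le> dist (pt i) y" using y \<rho> by (simp add: D_def)
      then have dd: "D / 2 * T i \<le> dist (pt i) y / scl i" by (simp add: T_def field_simps)
      \<comment> \<open>With D \<ge> 8 and T \<ge> 1: D / 4 \<le> D T / 4, while the distance in
        units of \<open>scl i\<close> is at least D T / 2. The difference is at most - D T / 4 \<le>
        - 2 T.\<close>
      have "8 * T i \<le> D * T i" using D T[OF i] by (intro mult_right_mono) auto
      moreover have "D * 1 \<le> D * T i" using D T[OF i] by (intro mult_left_mono) auto
      ultimately have ex: "D / 4 - dist (pt i) y / scl i \<le> - 2 * T i" using dd by linarith
      have "(w i y)\<^sup>2 \<le> (C / sqrt (V M (pt i) (scl i)) * exp (- \<nu> * dist (pt i) y / scl i))\<^sup>2"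
        using w_size[of i y] i F by (intro power2_le_iff_abs_le[THEN iffD2]) (auto intro: order_trans)
      also have "\<dots> = C\<^sup>2 / V M (pt i) (scl i) * (exp (- \<nu> * dist (pt i) y / scl i) * exp (- \<nu> * dist (pt i) y / scl i))"
        by (simp add: power_mult_distrib power_divide power2_eq_square)
      finally have "W y * (w i y)\<^sup>2 \<le> W y * (C\<^sup>2 / V M (pt i) (scl i) * (exp (- \<nu> * dist (pt i) y / scl i) * exp (- \<nu> * dist (pt i) y / scl i)))"
        by (intro mult_left_mono) (auto simp: W_def)
      also have "\<dots> = exp (\<nu> * (D / 4 - dist (pt i) y / scl i)) * (C\<^sup>2 / V M (pt i) (scl i)) * exp (- \<nu> * dist (pt i) y / scl i)"
        by (simp add: W_def D_def exp_add[symmetric] algebra_simps)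
      also have "\<dots> \<le> exp (- 2 * \<nu> * T i) * (C\<^sup>2 / V M (pt i) (scl i)) * exp (- \<nu> * dist (pt i) y / scl i)"
      proof (intro mult_right_mono)
        show "exp (\<nu> * (D / 4 - dist (pt i) y / scl i)) \<le> exp (- 2 * \<nu> * T i)"
          using mult_left_mono[OF ex, of \<nu>] \<nu> by (simp add: algebra_simps)
      qed auto
      finally show ?thesis by (simp add: E_def)
    qed
    have pw: "W y * (wsum F c y)\<^sup>2 \<le> exp (2 * \<nu>) * (wsum F c y)\<^sup>2 + S * (\<Sum>i\<in>F. E i y)" for y
    proof (cases "8 * \<rho> \<le> dist (x k \<alpha>) y")
      case True
      have "(wsum F c y)\<^sup>2 \<le> S * (\<Sum>i\<in>F. (w i y)\<^sup>2)" unfolding S_def by (rule Cauchy_Schwarz_ineq_sum)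
      then have "W y * (wsum F c y)\<^sup>2 \<le> W y * (S * (\<Sum>i\<in>F. (w i y)\<^sup>2))"
        by (intro mult_left_mono) (auto simp: W_def)
      also have "\<dots> = S * (\<Sum>i\<in>F. W y * (w i y)\<^sup>2)" by (simp add: sum_distrib_left mult_ac)
      also have "\<dots> \<le> S * (\<Sum>i\<in>F. E i y)" using S True by (intro mult_left_mono sum_mono far) auto
      finally show ?thesis by (simp add: add_increasing)
    next
      case False
      then have "dist (x k \<alpha>) y / \<rho> \<le> 8" using \<rho> by (simp add: field_simps)
      then have "W y \<le> exp (2 * \<nu>)" using \<nu> mult_left_mono[of "dist (x k \<alpha>) y / \<rho>" 8 "\<nu>/4"] by (simp add: W_def)
      then have "W y * (wsum F c y)\<^sup>2 \<le> exp (2 * \<nu>) * (wsum F c y)\<^sup>2" by (intro mult_right_mono) auto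
      moreover have "0 \<le> S * (\<Sum>i\<in>F. E i y)" using S by (intro mult_nonneg_nonneg sum_nonneg) (auto simp: E_def)
      ultimately show ?thesis by linarith
    qed
    have iE: "(\<integral>\<^sup>+ y. ennreal (E i y) \<partial>M) \<le> ennreal (C\<^sup>2 * K3 * exp (- 2 * \<nu> * T i))" for i
    proof -
      have "(\<integral>\<^sup>+ y. ennreal (E i y) \<partial>M) = ennreal (exp (- 2 * \<nu> * T i) * (C\<^sup>2 / V M (pt i) (scl i))) * (\<integral>\<^sup>+ y. ennreal (exp (- \<nu> * dist (pt i) y / scl i)) \<partial>M)"
        unfolding E_def by (subst nn_integral_cmult[symmetric]) (auto simp: ennreal_mult[symmetric])
      also have "\<dots> \<le> ennreal (exp (- 2 * \<nu> * T i) * (C\<^sup>2 / V M (pt i) (scl i))) * ennreal (K3 * V M (pt i) (scl i))"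
        by (intro mult_left_mono K3) auto
      also have "\<dots> = ennreal (exp (- 2 * \<nu> * T i) * (C\<^sup>2 / V M (pt i) (scl i)) * (K3 * V M (pt i) (scl i)))"
        using K3(1) by (subst ennreal_mult) auto
      also have "exp (- 2 * \<nu> * T i) * (C\<^sup>2 / V M (pt i) (scl i)) * (K3 * V M (pt i) (scl i)) = C\<^sup>2 * K3 * exp (- 2 * \<nu> * T i)"
        using Vpos[of i] by simp
      finally show ?thesis .
    qed
    \<comment> \<open>Of the rate 2 \<nu>, one \<nu> pays for the number of points of generation l
      in the cube, which is at most K4 exp (\<nu> t). The other gives the geometric factor, because
      t = \<delta>^(k - l) \<ge> l - k.\<close>
    have sT: "(\<Sum>i\<in>F. exp (- 2 * \<nu> * T i)) \<le> K4 / (1 - q)"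
    proof (rule sum_by_gen_le[OF F, where g = "\<lambda>l. nat (l - k)"])
      have "k \<le> a" if "a \<in> gen ` F" for a using that sub by fastforce
      then show "inj_on (\<lambda>l. nat (l - k)) (gen ` F)"
        by (intro inj_onI) (metis eq_nat_nat_iff diff_ge_0_iff_ge add_diff_cancel_left' diff_add_cancel)
      fix l G assume G: "G \<subseteq> F" "\<And>i. i \<in> G \<Longrightarrow> gen i = l" "G \<noteq> {}"
      then obtain i0 where i0: "i0 \<in> G" by blast
      have l: "k \<le> l" using G(2)[OF i0] subsetD[OF G(1) i0] sub by blast
      define n where "n = nat (l - k)"
      have ln: "l = k + int n" using l by (simp add: n_def)
      define t where "t = \<rho> / \<delta> powi l"
      have Tt: "T i = t" if "i \<in> G" for i using G(2)[OF that] by (simp add: T_def t_def scl_def)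
      have "real (card G) * exp (- \<nu> * t) = (\<Sum>i\<in>G. exp (- \<nu> * t))" by simp
      also have "\<dots> \<le> (\<Sum>i\<in>G. exp (- (\<nu> / 4) * dist (pt i) (x k \<alpha>) / scl i))"
      proof (rule sum_mono)
        fix i assume i: "i \<in> G"
        have "dist (pt i) (x k \<alpha>) / scl i \<le> 4 * \<rho> / scl i" using near_pt[of i] i G(1) by (intro divide_right_mono) (auto simp: less_imp_le)
        also have "\<dots> = 4 * t" using Tt[OF i] by (simp add: T_def)
        finally have "(\<nu> / 4) * (dist (pt i) (x k \<alpha>) / scl i) \<le> (\<nu> / 4) * (4 * t)" using \<nu> by (intro mult_left_mono) auto
        then show "exp (- \<nu> * t) \<le> exp (- (\<nu> / 4) * dist (pt i) (x k \<alpha>) / scl i)" by simp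
      qed
      also have "\<dots> \<le> K4" using G F finite_subset[OF G(1) F(1)] by (intro K4(2)) auto
      finally have cd: "real (card G) * exp (- \<nu> * t) \<le> K4" .
      have "(\<Sum>i\<in>G. exp (- 2 * \<nu> * T i)) = real (card G) * exp (- \<nu> * t) * exp (- \<nu> * t)"
        using Tt by (simp add: exp_add[symmetric])
      also have "\<dots> \<le> K4 * exp (- \<nu> * t)" using cd by (intro mult_right_mono) auto
      also have "\<dots> \<le> K4 * q ^ nat (l - k)"
      proof (intro mult_left_mono)
        have "real n \<le> 2 ^ n" using of_nat_less_two_power[of n, where ?'a = real] by linarith
        also have "\<dots> \<le> (1 / \<delta>) ^ n" using \<delta>_pos \<delta>_le by (intro power_mono) (auto simp: field_simps)
        also have "\<dots> = t"
          unfolding t_def \<rho>_def ln using \<delta>_pos by (simp add: power_int_add power_divide)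
        finally have "\<nu> * real n \<le> \<nu> * t" using \<nu> by (intro mult_left_mono) auto
        then show "exp (- \<nu> * t) \<le> q ^ nat (l - k)" unfolding q_def n_def[symmetric] by (simp add: exp_of_nat_mult[symmetric] mult.commute)
      qed (use K4 in auto)
      finally show "(\<Sum>i\<in>G. exp (- 2 * \<nu> * T i)) \<le> K4 * q ^ nat (l - k)" .
    qed (use q K4 in auto)
    have "(\<integral>\<^sup>+ y. ennreal (W y * (wsum F c y)\<^sup>2) \<partial>M) \<le> (\<integral>\<^sup>+ y. ennreal (exp (2 * \<nu>)) * ennreal ((wsum F c y)\<^sup>2) + ennreal S * (\<Sum>i\<in>F. ennreal (E i y)) \<partial>M)"
    proof (rule nn_integral_mono)
      fix y
      have "ennreal (W y * (wsum F c y)\<^sup>2) \<le> ennreal (exp (2 * \<nu>) * (wsum F c y)\<^sup>2 + S * (\<Sum>i\<in>F. E i y))"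
        by (intro ennreal_leI pw)
      also have "\<dots> = ennreal (exp (2 * \<nu>)) * ennreal ((wsum F c y)\<^sup>2) + ennreal S * (\<Sum>i\<in>F. ennreal (E i y))"
        using S by (subst sum_ennreal) (auto simp: E_def ennreal_mult[symmetric] ennreal_plus[symmetric] sum_nonneg simp del: ennreal_plus)
      finally show "ennreal (W y * (wsum F c y)\<^sup>2) \<le> ennreal (exp (2 * \<nu>)) * ennreal ((wsum F c y)\<^sup>2) + ennreal S * (\<Sum>i\<in>F. ennreal (E i y))" .
    qed
    also have "\<dots> = ennreal (exp (2 * \<nu>)) * (\<integral>\<^sup>+ y. ennreal ((wsum F c y)\<^sup>2) \<partial>M) + ennreal S * (\<Sum>i\<in>F. \<integral>\<^sup>+ y. ennreal (E i y) \<partial>M)"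
      by (subst nn_integral_add) (auto simp: nn_integral_cmult nn_integral_sum)
    also have "\<dots> \<le> ennreal (exp (2 * \<nu>)) * ennreal S + ennreal S * (\<Sum>i\<in>F. ennreal (C\<^sup>2 * K3 * exp (- 2 * \<nu> * T i)))"
    proof (intro add_mono mult_left_mono sum_mono iE)
      show "(\<integral>\<^sup>+ y. ennreal ((wsum F c y)\<^sup>2) \<partial>M) \<le> ennreal S"
        using wsum_sq[OF F, of c] by (subst nn_integral_eq_integral) (auto simp: S_def)
    qed auto
    also have "\<dots> = ennreal (exp (2 * \<nu>) * S + S * (C\<^sup>2 * K3 * (\<Sum>i\<in>F. exp (- 2 * \<nu> * T i))))"
      using S K3(1) by (subst sum_ennreal) (auto simp: ennreal_mult[symmetric] ennreal_plus[symmetric] sum_nonneg sum_distrib_left simp del: ennreal_plus)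
    also have "\<dots> \<le> ennreal (K * S)"
    proof (rule ennreal_leI)
      have "C\<^sup>2 * K3 * (\<Sum>i\<in>F. exp (- 2 * \<nu> * T i)) \<le> C\<^sup>2 * K3 * (K4 / (1 - q))"
        using K3(1) by (intro mult_left_mono sT) auto
      then have "S * (C\<^sup>2 * K3 * (\<Sum>i\<in>F. exp (- 2 * \<nu> * T i))) \<le> S * (C\<^sup>2 * K3 * (K4 / (1 - q)))"
        using S by (rule mult_left_mono)
      then show "exp (2 * \<nu>) * S + S * (C\<^sup>2 * K3 * (\<Sum>i\<in>F. exp (- 2 * \<nu> * T i))) \<le> K * S"
        unfolding K_def by (simp add: ring_distribs mult.commute[of _ S])
    qed
    finally show ?thesis by (simp add: W_def S_def \<rho>_def)
  qed
  then show ?thesis using K by blast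
qed

section \<open>Cutting along a generation and moving mass between cubes\<close>

lemma subset_ball_le: "dist p q + r \<le> s \<Longrightarrow> y \<in> ball p r \<Longrightarrow> y \<in> ball q s" for p q y :: "'b::metric_space"
  using dist_triangle[of q y p] by (simp add: dist_commute)

lemma sum_disjoint_integrals_sums:
  assumes P: "\<And>n. P n \<in> sets M" "disjoint_family P" "(\<Union>n. P n) = UNIV" and b: "integrable M b"
  shows "(\<lambda>n. LINT y|M. indicator (P n) y * b y) sums (LINT y|M. b y :: real)"
    and "\<And>y. (\<lambda>n. indicator (P n) y * b y) sums b y"
proof -
  show pw: "(\<lambda>n. indicator (P n) y * b y) sums b y" for y
  proof -
    obtain m where m: "y \<in> P m" using P(3) by blast
    have other: "y \<notin> P n" if "n \<noteq> m" for n using P(2) m that by (auto simp: disjoint_family_on_def)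
    have "(\<lambda>n. indicator (P n) y * b y) sums (\<Sum>n\<in>{m}. indicator (P n) y * b y)"
      using other by (intro sums_finite) auto
    then show ?thesis using m by simp
  qed
  have [measurable]: "P n \<in> sets M" "b \<in> borel_measurable M" for n using P b by auto
  have int: "integrable M (\<lambda>y. indicator (P n) y * b y)" for n
    using integrable_mult_indicator[OF P(1) b] by simp
  have le: "\<bar>\<Sum>n<N. indicator (P n) y * b y\<bar> \<le> \<bar>b y\<bar>" for N y
  proof -
    have "indicat_real (\<Union>n\<in>{..<N}. P n) y = (\<Sum>n<N. indicat_real (P n) y)"
      by (rule indicator_UN_disjoint) (use P(2) in \<open>auto simp: disjoint_family_on_def\<close>)
    moreover have "(\<Sum>n<N. indicator (P n) y * b y) = (\<Sum>n<N. indicat_real (P n) y) * b y"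
      by (rule sum_distrib_right[symmetric])
    ultimately have "(\<Sum>n<N. indicator (P n) y * b y) = indicat_real (\<Union>n\<in>{..<N}. P n) y * b y"
      by (simp only:)
    moreover have "\<bar>indicat_real R y * t\<bar> \<le> \<bar>t\<bar>" for R t by (simp add: indicator_def)
    ultimately show ?thesis by (simp only:)
  qed
  have "(\<lambda>N. LINT y|M. (\<Sum>n<N. indicator (P n) y * b y)) \<longlonglongrightarrow> (LINT y|M. b y)"
  proof (rule integral_dominated_convergence[where w = "\<lambda>y. \<bar>b y\<bar>"])
    show "AE y in M. (\<lambda>N. \<Sum>n<N. indicator (P n) y * b y) \<longlonglongrightarrow> b y" using pw by (auto simp: sums_def)
  qed (use b le in auto)
  moreover have "(LINT y|M. (\<Sum>n<N. indicator (P n) y * b y)) = (\<Sum>n<N. LINT y|M. indicator (P n) y * b y)" for N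
    using int by (intro Bochner_Integration.integral_sum) auto
  ultimately show "(\<lambda>n. LINT y|M. indicator (P n) y * b y) sums (LINT y|M. b y)"
    by (simp add: sums_def)
qed

text \<open>The bound grows with the distance of the cubes; the exponential decay of the wavelets absorbs this.\<close>

lemma H1_le_indicator_diff:
  assumes s: "s > 0"
  shows "\<exists>K>0. \<forall>k \<alpha> \<beta>. \<alpha> \<in> A k \<longrightarrow> \<beta> \<in> A k \<longrightarrow>
    H1_le M (\<lambda>y. indicator (Q k \<alpha>) y / measure M (Q k \<alpha>) - indicator (Q k \<beta>) y / measure M (Q k \<beta>))
      (K * exp (s * dist (x k \<alpha>) (x k \<beta>) / \<delta> powi k))"
proof -
  \<comment> \<open>Rate s / 2, because the volumes are compared at radius (2 d + 4) \<rho>, which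
    contains twice the distance.\<close>
  have "s / 2 > 0" using s by simp
  from V_growth[OF this] obtain K1 where K1: "K1 > 0" "\<And>z \<rho> t. 0 < \<rho> \<Longrightarrow> 0 \<le> t \<Longrightarrow> V M z (t * \<rho>) \<le> K1 * exp (s / 2 * t) * V M z \<rho>"
    by blast
  obtain K2 where K2: "K2 > 0" "\<And>k \<alpha> p. \<alpha> \<in> A k \<Longrightarrow> p \<in> Q k \<alpha> \<Longrightarrow> V M p (1 * \<delta> powi k) \<le> K2 * measure M (Q k \<alpha>)"
    using V_le_cube[of 1] by auto
  define K where "K = 2 * (K1 * exp (2 * s) * K2)"
  have K: "K > 0" using K1 K2 by (simp add: K_def)
  have "H1_le M (\<lambda>y. indicator (Q k \<alpha>) y / measure M (Q k \<alpha>) - indicator (Q k \<beta>) y / measure M (Q k \<beta>))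
      (K * exp (s * dist (x k \<alpha>) (x k \<beta>) / \<delta> powi k))" if \<alpha>: "\<alpha> \<in> A k" and \<beta>: "\<beta> \<in> A k" for k \<alpha> \<beta>
  proof -
    define \<rho> where "\<rho> = \<delta> powi k"
    have \<rho>: "\<rho> > 0" by (simp add: \<rho>_def)
    define d where "d = dist (x k \<alpha>) (x k \<beta>) / \<rho>"
    have d: "d \<ge> 0" using \<rho> by (simp add: d_def)
    let ?a = "measure M (Q k \<alpha>)" and ?b = "measure M (Q k \<beta>)"
    have ab: "?a > 0" "?b > 0" using cube_pos \<alpha> \<beta> by auto
    \<comment> \<open>The ball of this radius around \<open>x k \<beta>\<close> contains both
      cubes.\<close>
    define r where "r = (d + 4) * \<rho>"
    have r: "r > 0" using d \<rho> by (simp add: r_def)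
    have bound: "V M (x k \<gamma>) ((2 * d + 4) * \<rho>) \<le> K1 * exp (2 * s) * K2 * exp (s * d) * measure M (Q k \<gamma>)" if \<gamma>: "\<gamma> \<in> A k" for \<gamma>
    proof -
      have "V M (x k \<gamma>) ((2 * d + 4) * \<rho>) \<le> K1 * exp (s / 2 * (2 * d + 4)) * V M (x k \<gamma>) \<rho>"
        using \<rho> d by (intro K1) auto
      also have "\<dots> \<le> K1 * exp (s / 2 * (2 * d + 4)) * (K2 * measure M (Q k \<gamma>))"
        using K2(2)[OF \<gamma> center_in_cube[OF \<gamma>]] K1(1) by (intro mult_left_mono) (auto simp: \<rho>_def)
      also have "exp (s / 2 * (2 * d + 4)) = exp (s * d) * exp (2 * s)" by (simp add: exp_add[symmetric] algebra_simps)
      finally show ?thesis by (simp add: mult_ac)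
    qed
    have Va: "V M (x k \<beta>) r \<le> K1 * exp (2 * s) * K2 * exp (s * d) * ?a"
    proof -
      have "V M (x k \<beta>) r \<le> V M (x k \<alpha>) ((2 * d + 4) * \<rho>)"
        using \<rho> by (intro V_mono_ball) (simp add: d_def r_def dist_commute field_simps)
      with bound[OF \<alpha>] show ?thesis by linarith
    qed
    have Vb: "V M (x k \<beta>) r \<le> K1 * exp (2 * s) * K2 * exp (s * d) * ?b"
    proof -
      have "V M (x k \<beta>) r \<le> V M (x k \<beta>) ((2 * d + 4) * \<rho>)"
        using \<rho> d by (intro V_mono_ball) (simp add: r_def)
      with bound[OF \<beta>] show ?thesis by linarith
    qed
    have sub: "Q k \<alpha> \<subseteq> ball (x k \<beta>) r" "Q k \<beta> \<subseteq> ball (x k \<beta>) r"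
    proof -
      have "4 * \<rho> \<le> r" "dist (x k \<alpha>) (x k \<beta>) + 4 * \<rho> \<le> r" using d \<rho> by (auto simp: r_def d_def field_simps)
      then have "ball (x k \<alpha>) (4 * \<rho>) \<subseteq> ball (x k \<beta>) r" "ball (x k \<beta>) (4 * \<rho>) \<subseteq> ball (x k \<beta>) r"
        using subset_ball_le[of "x k \<alpha>" "x k \<beta>" "4 * \<rho>" r] subset_ball[of "4 * \<rho>" r "x k \<beta>"] by blast+
      then show "Q k \<alpha> \<subseteq> ball (x k \<beta>) r" "Q k \<beta> \<subseteq> ball (x k \<beta>) r"
        using cube_subset_ball[OF \<alpha>] cube_subset_ball[OF \<beta>] unfolding \<rho>_def by auto
    qed
    have [measurable]: "Q k \<alpha> \<in> sets M" "Q k \<beta> \<in> sets M" using \<alpha> \<beta> by auto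
    let ?g = "\<lambda>y. indicator (Q k \<alpha>) y / ?a - indicator (Q k \<beta>) y / ?b"
    have "H1_le M ?g ((1 / ?a + 1 / ?b) * V M (x k \<beta>) r)"
    proof (rule H1_le_bounded[OF r])
      show "?g \<in> borel_measurable M" by measurable
      show "?g y = 0" if "y \<notin> ball (x k \<beta>) r" for y using that sub by (auto simp: indicator_def)
      show "\<bar>?g y\<bar> \<le> 1 / ?a + 1 / ?b" for y using ab by (auto simp: indicator_def abs_if add_increasing2)
      have "integrable M (\<lambda>y. indicator (Q k \<alpha>) y :: real)" "integrable M (\<lambda>y. indicator (Q k \<beta>) y :: real)"
        using cube_finite \<alpha> \<beta> by (auto intro: integrable_real_indicator)
      then show "(LINT y|M. ?g y) = 0" using ab by (subst Bochner_Integration.integral_diff) auto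
    qed
    moreover have "(1 / ?a + 1 / ?b) * V M (x k \<beta>) r \<le> K * exp (s * d)"
    proof -
      have "V M (x k \<beta>) r / ?a \<le> K1 * exp (2 * s) * K2 * exp (s * d)" using Va ab by (simp add: pos_divide_le_eq)
      moreover have "V M (x k \<beta>) r / ?b \<le> K1 * exp (2 * s) * K2 * exp (s * d)" using Vb ab by (simp add: pos_divide_le_eq)
      ultimately show ?thesis by (simp add: K_def distrib_right)
    qed
    ultimately show ?thesis using H1_le_mono by (simp add: d_def \<rho>_def)
  qed
  then show ?thesis using K by blast
qed

text \<open>The mean removed from each piece is carried over to the reference cube by a difference
  of normalised indicators. There all these masses add up to the integral of the wavelet sum, which
  is zero. The price of the transport grows exponentially with the distance; Cauchy-Schwarz over the
  cubes lets the weighted L2 bound pay for it.\<close>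

lemma H1_le_wsum_cube:
  "\<exists>K>0. \<forall>k \<alpha> F c. \<alpha> \<in> A k \<longrightarrow> finite F \<longrightarrow> F \<subseteq> I \<longrightarrow> (\<forall>i\<in>F. k \<le> gen i \<and> cub i \<subseteq> Q k \<alpha>) \<longrightarrow>
     H1_le M (wsum F c) (K * sqrt (measure M (Q k \<alpha>) * (\<Sum>i\<in>F. (c i)\<^sup>2)))"
proof -
  \<comment> \<open>Exponents in units of s: the transport costs 2 s d, the square root of the
    volume ratio s d. With 3 s = 7 s / 2 - s / 2, Cauchy-Schwarz produces the summable exp (- s d)
    and the weight exp (7 s d), and 7 s = \<nu> / 4 is the rate in the weighted L2 bound.\<close>
  define s where "s = \<nu> / 28"
  have s: "s > 0" using par_pos by (simp add: s_def)
  obtain K1 where K1: "K1 > 0" "\<And>k \<alpha> h c. \<alpha> \<in> A k \<Longrightarrow> uniformly_continuous_on UNIV h \<Longrightarrow> (\<forall>y. \<bar>h y\<bar> \<le> c) \<Longrightarrow>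
     H1_le M (osc_part h (Q k \<alpha>)) (K1 * sqrt (measure M (Q k \<alpha>) * (LINT y|M. indicator (Q k \<alpha>) y * (h y)\<^sup>2)))"
    using H1_le_osc_part by blast
  have "2 * s > 0" using s by simp
  from H1_le_indicator_diff[OF this] obtain K2 where K2: "K2 > 0" "\<And>k \<alpha> \<beta>. \<alpha> \<in> A k \<Longrightarrow> \<beta> \<in> A k \<Longrightarrow>
    H1_le M (\<lambda>y. indicator (Q k \<alpha>) y / measure M (Q k \<alpha>) - indicator (Q k \<beta>) y / measure M (Q k \<beta>))
      (K2 * exp (2 * s * dist (x k \<alpha>) (x k \<beta>) / \<delta> powi k))"
    by blast
  obtain K3 where K3: "K3 > 0" "\<And>k \<alpha> F c. \<alpha> \<in> A k \<Longrightarrow> finite F \<Longrightarrow> F \<subseteq> I \<Longrightarrow> (\<forall>i\<in>F. k \<le> gen i \<and> cub i \<subseteq> Q k \<alpha>) \<Longrightarrow>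
     (\<integral>\<^sup>+ y. ennreal (exp (\<nu> / 4 * dist (x k \<alpha>) y / \<delta> powi k) * (wsum F c y)\<^sup>2) \<partial>M) \<le> ennreal (K3 * (\<Sum>i\<in>F. (c i)\<^sup>2))"
    using wsum_weighted_L2 by blast
  from sum_exp_dist_points[OF s] obtain K4 where K4: "K4 > 0" "\<And>k S y. finite S \<Longrightarrow> S \<subseteq> A k \<Longrightarrow> (\<Sum>\<alpha>\<in>S. exp (- s * dist (x k \<alpha>) y / \<delta> powi k)) \<le> K4"
    by blast
  have "2 * s > 0" using s by simp
  from V_shift[OF this] obtain K5 where K5: "K5 > 0" "\<And>p q \<rho>. 0 < \<rho> \<Longrightarrow> V M p \<rho> \<le> K5 * exp (2 * s * dist p q / \<rho>) * V M q \<rho>"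
    by blast
  obtain K6 where K6: "K6 > 0" "\<And>k \<alpha> p. \<alpha> \<in> A k \<Longrightarrow> p \<in> Q k \<alpha> \<Longrightarrow> V M p (1 * \<delta> powi k) \<le> K6 * measure M (Q k \<alpha>)"
    using V_le_cube[of 1] by auto
  obtain K7 where K7: "K7 > 0" "\<And>z \<rho> t. 0 < \<rho> \<Longrightarrow> 0 \<le> t \<Longrightarrow> V M z (t * \<rho>) \<le> K7 * exp (1 * t) * V M z \<rho>"
    using V_growth[of 1] by auto
  define B1 where "B1 = K7 * exp 4 * K5 * K6"
  define B2 where "B2 = (K1 + K2) * sqrt B1"
  define K where "K = B2 * (sqrt K4 * sqrt (exp (28 * s) * K3))"
  have B1: "B1 > 0" using K5 K6 K7 by (simp add: B1_def)
  have B2: "B2 > 0" using B1 K1 K2 by (simp add: B2_def)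
  have K: "K > 0" using B2 K3 K4 by (simp add: K_def)
  have "H1_le M (wsum F c) (K * sqrt (measure M (Q k \<alpha>0) * (\<Sum>i\<in>F. (c i)\<^sup>2)))"
    if \<alpha>0: "\<alpha>0 \<in> A k" and F: "finite F" "F \<subseteq> I" and sub: "\<forall>i\<in>F. k \<le> gen i \<and> cub i \<subseteq> Q k \<alpha>0" for k \<alpha>0 F c
  proof -
    define \<rho> where "\<rho> = \<delta> powi k"
    have \<rho>: "\<rho> > 0" by (simp add: \<rho>_def)
    define S where "S = (\<Sum>i\<in>F. (c i)\<^sup>2)"
    have S: "S \<ge> 0" by (simp add: S_def sum_nonneg)
    define b where "b = wsum F c"
    define m where "m \<alpha> = measure M (Q k \<alpha>)" for \<alpha>
    define d where "d \<alpha> = dist (x k \<alpha>) (x k \<alpha>0) / \<rho>" for \<alpha>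
    define J where "J \<alpha> = (LINT y|M. indicator (Q k \<alpha>) y * (b y)\<^sup>2)" for \<alpha>
    have J: "J \<alpha> \<ge> 0" for \<alpha> by (simp add: J_def)
    have mp: "m \<alpha> > 0" if "\<alpha> \<in> A k" for \<alpha> using cube_pos that by (simp add: m_def)
    have ib: "integrable M b" using wsum_integrable[OF F(2)] by (simp add: b_def)
    have ib2: "integrable M (\<lambda>y. (b y)\<^sup>2)" using wsum_sq(1)[OF F] by (simp add: b_def)
    have [measurable]: "b \<in> borel_measurable M" using ib by auto
    obtain Bd where Bd: "\<And>y. \<bar>b y\<bar> \<le> Bd" using wsum_bounded[OF F(2), of c] unfolding b_def by blast
    have ucb: "uniformly_continuous_on UNIV b" using wsum_uniformly_continuous[OF F] by (simp add: b_def)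
    \<comment> \<open>A piece without its mean, plus its mass moved away from the reference cube and
      onto its own; the factor \<open>avg b (Q k \<alpha>) * m \<alpha>\<close> is the integral of b
      over the cube.\<close>
    define f where "f \<alpha> y = osc_part b (Q k \<alpha>) y + avg b (Q k \<alpha>) * m \<alpha> * (indicator (Q k \<alpha>) y / m \<alpha> - indicator (Q k \<alpha>0) y / m \<alpha>0)" for \<alpha> y
    define L where "L \<alpha> = B2 * sqrt (m \<alpha>0) * (exp (- s * d \<alpha> / 2) * (exp (7 * s * d \<alpha> / 2) * sqrt (J \<alpha>)))" for \<alpha>
    have L0: "L \<alpha> \<ge> 0" for \<alpha> using B2 J by (simp add: L_def m_def)
    have fL: "H1_le M (f \<alpha>) (L \<alpha>)" if \<alpha>: "\<alpha> \<in> A k" for \<alpha>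
    proof -
      have "(LINT y|M. indicator (Q k \<alpha>) y * b y)\<^sup>2 \<le> measure M (Q k \<alpha>) * (LINT y|M. indicator (Q k \<alpha>) y * (b y)\<^sup>2)"
        using \<alpha> by (intro integral_square_le[OF _ cube_subset_ball[OF \<alpha>] _ Bd]) auto
      then have "\<bar>LINT y|M. indicator (Q k \<alpha>) y * b y\<bar> \<le> sqrt (m \<alpha> * J \<alpha>)"
        by (intro real_le_rsqrt) (simp add: m_def J_def)
      then have am: "\<bar>avg b (Q k \<alpha>) * m \<alpha>\<bar> \<le> sqrt (m \<alpha> * J \<alpha>)"
        using mp[OF \<alpha>] by (simp add: avg_def m_def)
      have "H1_le M (f \<alpha>) (K1 * sqrt (m \<alpha> * J \<alpha>) + \<bar>avg b (Q k \<alpha>) * m \<alpha>\<bar> * (K2 * exp (2 * s * d \<alpha>)))"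
        unfolding f_def using K1(2)[OF \<alpha> ucb, of Bd] Bd H1_le_cmult[OF K2(2)[OF \<alpha> \<alpha>0], of "avg b (Q k \<alpha>) * m \<alpha>"]
        by (intro H1_le_add) (auto simp: m_def J_def d_def \<rho>_def)
      moreover have "K1 * sqrt (m \<alpha> * J \<alpha>) + \<bar>avg b (Q k \<alpha>) * m \<alpha>\<bar> * (K2 * exp (2 * s * d \<alpha>)) \<le> L \<alpha>"
      proof -
        have d0: "d \<alpha> \<ge> 0" using \<rho> by (simp add: d_def)
        have "m \<alpha> \<le> V M (x k \<alpha>) (4 * \<rho>)"
          unfolding m_def \<rho>_def using \<alpha> cube_subset_ball[OF \<alpha>] by (intro measure_subset_ball) auto
        also have "\<dots> \<le> K7 * exp (1 * 4) * V M (x k \<alpha>) \<rho>" using \<rho> by (intro K7) auto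
        also have "\<dots> \<le> K7 * exp (1 * 4) * (K5 * exp (2 * s * dist (x k \<alpha>) (x k \<alpha>0) / \<rho>) * V M (x k \<alpha>0) \<rho>)"
          using K7 \<rho> by (intro mult_left_mono K5) auto
        also have "\<dots> \<le> K7 * exp (1 * 4) * (K5 * exp (2 * s * dist (x k \<alpha>) (x k \<alpha>0) / \<rho>) * (K6 * m \<alpha>0))"
          using K7 K5 K6(2)[OF \<alpha>0 center_in_cube[OF \<alpha>0]] by (intro mult_left_mono) (auto simp: m_def \<rho>_def)
        also have "\<dots> = B1 * exp (2 * s * d \<alpha>) * m \<alpha>0" by (simp add: B1_def d_def)
        finally have "sqrt (m \<alpha>) \<le> sqrt (B1 * exp (2 * s * d \<alpha>) * m \<alpha>0)" by (rule real_sqrt_le_mono)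
        also have "\<dots> = sqrt B1 * exp (s * d \<alpha>) * sqrt (m \<alpha>0)"
        proof -
          have "exp (2 * s * d \<alpha>) = (exp (s * d \<alpha>))\<^sup>2" by (simp add: power2_eq_square exp_add[symmetric])
          then show ?thesis by (simp add: real_sqrt_mult)
        qed
        finally have sm: "sqrt (m \<alpha>) \<le> sqrt B1 * exp (s * d \<alpha>) * sqrt (m \<alpha>0)" .
        have "K1 * sqrt (m \<alpha> * J \<alpha>) + \<bar>avg b (Q k \<alpha>) * m \<alpha>\<bar> * (K2 * exp (2 * s * d \<alpha>))
            \<le> K1 * sqrt (m \<alpha> * J \<alpha>) * exp (2 * s * d \<alpha>) + sqrt (m \<alpha> * J \<alpha>) * (K2 * exp (2 * s * d \<alpha>))"
        proof (intro add_mono mult_right_mono am)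
          have "1 \<le> exp (2 * s * d \<alpha>)" using s d0 by simp
          moreover have "0 \<le> K1 * sqrt (m \<alpha> * J \<alpha>)" using K1 J mp[OF \<alpha>] by simp
          ultimately show "K1 * sqrt (m \<alpha> * J \<alpha>) \<le> K1 * sqrt (m \<alpha> * J \<alpha>) * exp (2 * s * d \<alpha>)"
            using mult_left_mono[of 1 "exp (2 * s * d \<alpha>)" "K1 * sqrt (m \<alpha> * J \<alpha>)"] by simp
        qed (use K2 in auto)
        also have "\<dots> = (K1 + K2) * exp (2 * s * d \<alpha>) * sqrt (J \<alpha>) * sqrt (m \<alpha>)"
          by (simp add: real_sqrt_mult algebra_simps)
        also have "\<dots> \<le> (K1 + K2) * exp (2 * s * d \<alpha>) * sqrt (J \<alpha>) * (sqrt B1 * exp (s * d \<alpha>) * sqrt (m \<alpha>0))"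
          using K1 K2 J by (intro mult_left_mono sm) auto
        also have "\<dots> = B2 * sqrt (m \<alpha>0) * (exp (2 * s * d \<alpha>) * exp (s * d \<alpha>)) * sqrt (J \<alpha>)"
          by (simp add: B2_def)
        also have "exp (2 * s * d \<alpha>) * exp (s * d \<alpha>) = exp (- s * d \<alpha> / 2) * exp (7 * s * d \<alpha> / 2)"
          by (simp add: exp_add[symmetric])
        finally show ?thesis by (simp add: L_def mult_ac)
      qed
      ultimately show ?thesis by (rule H1_le_mono)
    qed
    have sumJ: "(\<Sum>\<alpha>\<in>T. exp (7 * s * d \<alpha>) * J \<alpha>) \<le> exp (28 * s) * K3 * S" if T: "finite T" "T \<subseteq> A k" for T
    proof -
      have iJ: "integrable M (\<lambda>y. indicator (Q k \<alpha>) y * (b y)\<^sup>2)" if "\<alpha> \<in> T" for \<alpha>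
        using integrable_mult_indicator[OF cube_sets ib2, of \<alpha> k] that T by auto
      have "ennreal (\<Sum>\<alpha>\<in>T. exp (7 * s * d \<alpha>) * J \<alpha>) = (\<Sum>\<alpha>\<in>T. ennreal (exp (7 * s * d \<alpha>) * J \<alpha>))"
        using J by (subst sum_ennreal) auto
      also have "\<dots> = (\<Sum>\<alpha>\<in>T. \<integral>\<^sup>+ y. ennreal (exp (7 * s * d \<alpha>) * (indicator (Q k \<alpha>) y * (b y)\<^sup>2)) \<partial>M)"
        using iJ by (intro sum.cong refl, subst nn_integral_eq_integral) (auto simp: J_def)
      also have "\<dots> = (\<integral>\<^sup>+ y. (\<Sum>\<alpha>\<in>T. ennreal (exp (7 * s * d \<alpha>) * (indicator (Q k \<alpha>) y * (b y)\<^sup>2))) \<partial>M)"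
        using T by (intro nn_integral_sum[symmetric]) auto
      also have "\<dots> \<le> (\<integral>\<^sup>+ y. ennreal (exp (28 * s)) * ennreal (exp (\<nu> / 4 * dist (x k \<alpha>0) y / \<rho>) * (b y)\<^sup>2) \<partial>M)"
      proof (rule nn_integral_mono)
        fix y
        show "(\<Sum>\<alpha>\<in>T. ennreal (exp (7 * s * d \<alpha>) * (indicator (Q k \<alpha>) y * (b y)\<^sup>2))) \<le> ennreal (exp (28 * s)) * ennreal (exp (\<nu> / 4 * dist (x k \<alpha>0) y / \<rho>) * (b y)\<^sup>2)"
        proof (cases "\<exists>\<alpha>\<in>T. y \<in> Q k \<alpha>")
          case True
          then obtain \<alpha> where \<alpha>: "\<alpha> \<in> T" "y \<in> Q k \<alpha>" by blast
          have "(\<Sum>\<alpha>'\<in>T. ennreal (exp (7 * s * d \<alpha>') * (indicator (Q k \<alpha>') y * (b y)\<^sup>2))) = (\<Sum>\<alpha>'\<in>T. if \<alpha>' = \<alpha> then ennreal (exp (7 * s * d \<alpha>) * (b y)\<^sup>2) else 0)"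
          proof (intro sum.cong refl)
            fix \<alpha>' assume "\<alpha>' \<in> T"
            then show "ennreal (exp (7 * s * d \<alpha>') * (indicator (Q k \<alpha>') y * (b y)\<^sup>2)) = (if \<alpha>' = \<alpha> then ennreal (exp (7 * s * d \<alpha>) * (b y)\<^sup>2) else 0)"
              using cube_unique[of \<alpha>' k \<alpha> y] \<alpha> T by (cases "y \<in> Q k \<alpha>'") auto
          qed
          also have "\<dots> = ennreal (exp (7 * s * d \<alpha>) * (b y)\<^sup>2)" using T \<alpha> by simp
          also have "\<dots> \<le> ennreal (exp (28 * s) * (exp (\<nu> / 4 * dist (x k \<alpha>0) y / \<rho>) * (b y)\<^sup>2))"
          proof (rule ennreal_leI)
            \<comment> \<open>Points of a cube are within 4 \<rho> of its centre, which accounts for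
              the factor exp (4 * 7 s) = exp (28 s).\<close>
            have "dist (x k \<alpha>) y \<le> 4 * \<rho>" using \<alpha> T cube_subset_ball[of \<alpha> k] by (force simp: \<rho>_def less_imp_le)
            then have "dist (x k \<alpha>) (x k \<alpha>0) \<le> 4 * \<rho> + dist (x k \<alpha>0) y"
              using dist_triangle2[of "x k \<alpha>" "x k \<alpha>0" y] by linarith
            then have "d \<alpha> \<le> 4 + dist (x k \<alpha>0) y / \<rho>" using \<rho> by (simp add: d_def field_simps)
            then have "7 * s * d \<alpha> \<le> 7 * s * (4 + dist (x k \<alpha>0) y / \<rho>)" using s by (intro mult_left_mono) auto
            also have "\<dots> = 28 * s + \<nu> / 4 * dist (x k \<alpha>0) y / \<rho>" by (simp add: s_def field_simps)
            finally have "exp (7 * s * d \<alpha>) \<le> exp (28 * s) * exp (\<nu> / 4 * dist (x k \<alpha>0) y / \<rho>)"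
              by (simp add: exp_add[symmetric])
            then show "exp (7 * s * d \<alpha>) * (b y)\<^sup>2 \<le> exp (28 * s) * (exp (\<nu> / 4 * dist (x k \<alpha>0) y / \<rho>) * (b y)\<^sup>2)"
              by (simp add: mult_right_mono mult.assoc[symmetric])
          qed
          finally show ?thesis by (simp add: ennreal_mult)
        next
          case False
          then have "(\<Sum>\<alpha>\<in>T. ennreal (exp (7 * s * d \<alpha>) * (indicator (Q k \<alpha>) y * (b y)\<^sup>2))) = 0"
            by (intro sum.neutral) auto
          then show ?thesis by simp
        qed
      qed
      also have "\<dots> = ennreal (exp (28 * s)) * (\<integral>\<^sup>+ y. ennreal (exp (\<nu> / 4 * dist (x k \<alpha>0) y / \<rho>) * (b y)\<^sup>2) \<partial>M)"
        by (intro nn_integral_cmult) measurable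
      also have "\<dots> \<le> ennreal (exp (28 * s)) * ennreal (K3 * S)"
        unfolding b_def S_def \<rho>_def by (intro mult_left_mono K3(2) \<alpha>0 F sub) auto
      also have "\<dots> = ennreal (exp (28 * s) * K3 * S)"
        using K3 S by (simp add: ennreal_mult[symmetric] mult.assoc)
      finally show ?thesis using K3 S by (subst (asm) ennreal_le_iff) auto
    qed
    have sumL: "(\<Sum>\<alpha>\<in>T. L \<alpha>) \<le> K * sqrt (m \<alpha>0 * S)" if T: "finite T" "T \<subseteq> A k" for T
    proof -
      have "(\<Sum>\<alpha>\<in>T. exp (- s * d \<alpha> / 2) * (exp (7 * s * d \<alpha> / 2) * sqrt (J \<alpha>)))\<^sup>2
          \<le> (\<Sum>\<alpha>\<in>T. (exp (- s * d \<alpha> / 2))\<^sup>2) * (\<Sum>\<alpha>\<in>T. (exp (7 * s * d \<alpha> / 2) * sqrt (J \<alpha>))\<^sup>2)"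
        by (rule Cauchy_Schwarz_ineq_sum)
      also have "(\<Sum>\<alpha>\<in>T. (exp (- s * d \<alpha> / 2))\<^sup>2) = (\<Sum>\<alpha>\<in>T. exp (- s * dist (x k \<alpha>) (x k \<alpha>0) / \<delta> powi k))"
        by (intro sum.cong refl) (simp add: power2_eq_square exp_add[symmetric] d_def \<rho>_def)
      also have "(\<Sum>\<alpha>\<in>T. (exp (7 * s * d \<alpha> / 2) * sqrt (J \<alpha>))\<^sup>2) = (\<Sum>\<alpha>\<in>T. exp (7 * s * d \<alpha>) * J \<alpha>)"
      proof (intro sum.cong refl)
        fix \<alpha> assume "\<alpha> \<in> T"
        have "(exp (7 * s * d \<alpha> / 2))\<^sup>2 = exp (7 * s * d \<alpha>)" by (simp add: power2_eq_square exp_add[symmetric])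
        then show "(exp (7 * s * d \<alpha> / 2) * sqrt (J \<alpha>))\<^sup>2 = exp (7 * s * d \<alpha>) * J \<alpha>" using J by (simp add: power_mult_distrib)
      qed
      also have "(\<Sum>\<alpha>\<in>T. exp (- s * dist (x k \<alpha>) (x k \<alpha>0) / \<delta> powi k)) * (\<Sum>\<alpha>\<in>T. exp (7 * s * d \<alpha>) * J \<alpha>) \<le> K4 * (exp (28 * s) * K3 * S)"
        using K4 J by (intro mult_mono K4(2) sumJ T sum_nonneg) auto
      finally have "(\<Sum>\<alpha>\<in>T. exp (- s * d \<alpha> / 2) * (exp (7 * s * d \<alpha> / 2) * sqrt (J \<alpha>))) \<le> sqrt (K4 * (exp (28 * s) * K3 * S))"
        by (rule real_le_rsqrt)
      then have "B2 * sqrt (m \<alpha>0) * (\<Sum>\<alpha>\<in>T. exp (- s * d \<alpha> / 2) * (exp (7 * s * d \<alpha> / 2) * sqrt (J \<alpha>))) \<le> B2 * sqrt (m \<alpha>0) * sqrt (K4 * (exp (28 * s) * K3 * S))"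
        using B2 by (intro mult_left_mono) (auto simp: m_def)
      also have "\<dots> = K * sqrt (m \<alpha>0 * S)" by (simp add: K_def real_sqrt_mult)
      finally show ?thesis by (simp add: L_def sum_distrib_left)
    qed
    \<comment> \<open>The cubes of the generation as a sequence. Numbers outside N, which exist if
      \<open>A k\<close> is finite, receive the empty set and the zero function.\<close>
    define N where "N = to_nat_on (A k) ` A k"
    define al where "al n = from_nat_into (A k) n" for n
    have al: "al n \<in> A k" if "n \<in> N" for n using that unfolding al_def N_def by (intro from_nat_into) auto
    have al_inj: "n = n'" if "n \<in> N" "n' \<in> N" "al n = al n'" for n n'
      using that countable_points unfolding al_def N_def by auto
    have al_surj: "\<exists>n\<in>N. al n = \<alpha>" if "\<alpha> \<in> A k" for \<alpha>
      using that countable_points unfolding al_def N_def by (intro bexI[of _ "to_nat_on (A k) \<alpha>"]) auto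
    define P where "P n = (if n \<in> N then Q k (al n) else {})" for n
    have P: "P n \<in> sets M" for n using al by (simp add: P_def)
    have Pd: "disjoint_family P"
      unfolding disjoint_family_on_def P_def using al al_inj cube_unique[of _ k] by (auto 0 3 split: if_splits)
    have PU: "(\<Union>n. P n) = UNIV"
    proof (intro set_eqI iffI UNIV_I)
      fix y :: 'a
      obtain \<alpha> where "\<alpha> \<in> A k" "y \<in> Q k \<alpha>" using cube_cover by blast
      moreover then obtain n where "n \<in> N" "al n = \<alpha>" using al_surj by blast
      ultimately show "y \<in> (\<Union>n. P n)" by (auto simp: P_def)
    qed
    note si = sum_disjoint_integrals_sums[OF P Pd PU ib]
    define g where "g n = (if n \<in> N then f (al n) else (\<lambda>_. 0))" for n
    define G where "G n = (if n \<in> N then L (al n) else 0)" for n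
    have gG: "H1_le M (g n) (G n)" for n
      using fL al H1_le_zero[of 0] by (auto simp: g_def G_def)
    have sG: "(\<Sum>n<n0. G n) \<le> K * sqrt (m \<alpha>0 * S)" for n0
    proof -
      have "(\<Sum>n<n0. G n) = (\<Sum>n\<in>{..<n0} \<inter> N. L (al n))"
        unfolding G_def by (simp add: sum.inter_restrict)
      also have "\<dots> = (\<Sum>\<alpha>\<in>al ` ({..<n0} \<inter> N). L \<alpha>)"
        using al_inj by (subst sum.reindex) (auto simp: inj_on_def)
      also have "\<dots> \<le> K * sqrt (m \<alpha>0 * S)" using al by (intro sumL) auto
      finally show ?thesis .
    qed
    have G0: "G n \<ge> 0" for n using L0 by (simp add: G_def)
    have Gs: "summable G" by (rule summableI_nonneg_bounded[OF G0 sG])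
    have int0: "(LINT y|M. b y) = 0" using wsum_integral[OF F(2)] by (simp add: b_def)
    have gs: "(\<lambda>n. g n y) sums b y" for y
    proof -
      have ge: "g n y = indicator (P n) y * b y - (LINT y|M. indicator (P n) y * b y) * (indicator (Q k \<alpha>0) y / m \<alpha>0)" for n
      proof (cases "n \<in> N")
        case True
        then have mpn: "m (al n) > 0" using mp al by auto
        have av: "avg b (Q k (al n)) = (LINT y|M. indicator (Q k (al n)) y * b y) / m (al n)"
          by (simp add: avg_def m_def)
        show ?thesis using True mpn unfolding g_def P_def f_def osc_part_def if_P[OF True] av
          by (simp add: right_diff_distrib)
      qed (simp add: g_def P_def)
      \<comment> \<open>The moved masses sum to the integral of b, which is zero, so only the pieces
        of b survive.\<close>
      have "(\<lambda>n. indicator (P n) y * b y - (LINT y|M. indicator (P n) y * b y) * (indicator (Q k \<alpha>0) y / m \<alpha>0)) sums (b y - (LINT y|M. b y) * (indicator (Q k \<alpha>0) y / m \<alpha>0))"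
        by (intro sums_diff sums_mult2 si)
      then show ?thesis using int0 by (simp add: ge)
    qed
    have "H1_le M b (\<Sum>n. G n)"
      by (rule H1_le_sums[OF gG Gs]) (use gs in auto)
    moreover have "(\<Sum>n. G n) \<le> K * sqrt (m \<alpha>0 * S)" by (rule suminf_le_const[OF Gs sG])
    ultimately show ?thesis using H1_le_mono unfolding b_def m_def S_def by blast
  qed
  then show ?thesis using K by blast
qed

end

section \<open>Atomic decomposition of finite wavelet sums\<close>

text \<open>W stands for the squares of the functions that occur in (iii), (iv) and (v), so that one
  definition serves all three norms; a finite F keeps the values real.\<close>

definition sqfun :: "('j \<Rightarrow> real) \<Rightarrow> ('j \<Rightarrow> 'a \<Rightarrow> real) \<Rightarrow> 'j set \<Rightarrow> 'a \<Rightarrow> real" where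
  "sqfun c W F y = sqrt (\<Sum>i\<in>F. (c i)\<^sup>2 * W i y)"

text \<open>The powers of two below s are part of a geometric series whose largest term is less than
  s.\<close>

lemma sum_dyadic_below:
  assumes "finite J" "0 \<le> s"
  shows "(\<Sum>j\<in>J. if (2::real) powi j < s then 2 powi j else 0) \<le> 2 * s"
proof -
  define J' where "J' = {j \<in> J. (2::real) powi j < s}"
  have "(\<Sum>j\<in>J. if (2::real) powi j < s then 2 powi j else 0) = (\<Sum>j\<in>J'. 2 powi j)"
    unfolding J'_def using assms(1) by (simp add: sum.inter_filter)
  also have "\<dots> \<le> 2 * s"
  proof (cases "J' = {}")
    case False
    have fin: "finite J'" using assms by (simp add: J'_def)
    define m where "m = Max J'"
    have m: "m \<in> J'" "\<And>j. j \<in> J' \<Longrightarrow> j \<le> m" using fin False by (auto simp: m_def)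
    have "(\<Sum>j\<in>J'. (2::real) powi j) = (\<Sum>j\<in>J'. 2 powi m * (1 / 2) ^ nat (m - j))"
    proof (rule sum.cong)
      fix j assume "j \<in> J'"
      define n where "n = nat (m - j)"
      have "m = j + int n" using m(2)[OF \<open>j \<in> J'\<close>] by (simp add: n_def)
      then show "(2::real) powi j = 2 powi m * (1 / 2) ^ nat (m - j)"
        unfolding n_def[symmetric] by (simp add: power_int_add power_divide)
    qed simp
    also have "\<dots> = 2 powi m * (\<Sum>j\<in>J'. (1 / 2) ^ nat (m - j))" by (simp add: sum_distrib_left)
    also have "\<dots> \<le> 2 powi m * (1 / (1 - 1 / 2))"
    proof (intro mult_left_mono sum_power_inj_le fin)
      show "inj_on (\<lambda>j. nat (m - j)) J'"
        using m(2) by (intro inj_onI) (metis eq_nat_nat_iff diff_ge_0_iff_ge diff_left_imp_eq)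
    qed auto
    also have "\<dots> \<le> 2 * s" using m(1) by (simp add: J'_def)
    finally show ?thesis .
  qed (use assms in simp)
  finally show ?thesis .
qed

context wavelet_space
begin

text \<open>An index cube has at least two children. If \<open>cub j\<close>, which contains
  \<open>cub i\<close>, belonged to a finer generation, it would lie in one child of
  \<open>cub i\<close> and miss the other. Inclusion of index cubes as sets thus orders their
  generations, although one set may be a cube of several generations.\<close>

lemma cub_gen_le:
  assumes i: "i \<in> I" and j: "j \<in> I" and sub: "cub i \<subseteq> cub j"
  shows "gen j \<le> gen i"
proof (rule ccontr)
  assume "\<not> ?thesis"
  then have l: "gen i + 1 \<le> gen j" by simp
  have "more_than_one (Lset A Q (gen i) (fst (snd i)))"
    using i by (auto simp: I_def wav_index_def gen_def)
  then obtain a b where ab: "a \<noteq> b" "a \<in> A (gen i + 1)" "b \<in> A (gen i + 1)" "Q (gen i + 1) a \<subseteq> cub i" "Q (gen i + 1) b \<subseteq> cub i"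
    by (auto simp: more_than_one_def Lset_def cub_def)
  have ca: "x (gen i + 1) a \<in> Q (gen i + 1) a" and cb: "x (gen i + 1) b \<in> Q (gen i + 1) b" using ab center_in_cube by auto
  have "cub j \<subseteq> Q (gen i + 1) a"
    unfolding cub_def using cube_nested[OF l ab(2) index(1)[OF j] ca] ca ab sub by (auto simp: cub_def)
  then have "x (gen i + 1) b \<in> Q (gen i + 1) a" using cb ab sub by auto
  then show False using cube_unique[OF ab(2,3) _ cb] ab(1) by blast
qed

lemma cub_nested:
  assumes "i \<in> I" "j \<in> I" "y \<in> cub i" "y \<in> cub j"
  shows "cub i \<subseteq> cub j \<or> cub j \<subseteq> cub i"
  using cube_nested[OF _ index(1)[OF assms(1)] index(1)[OF assms(2)], of y]
    cube_nested[OF _ index(1)[OF assms(2)] index(1)[OF assms(1)], of y] assms(3,4)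
  unfolding cub_def by linarith

text \<open>The square of R, the smallest of the three weights up to constants.\<close>

definition WV :: "int \<times> 'i \<times> 'i \<Rightarrow> 'a \<Rightarrow> real" where
  "WV i y = indicator (wb i) y / measure M (cub i)"

lemma WV_nonneg [simp]: "0 \<le> WV i y"
  by (simp add: WV_def)

lemma WV_integrable: "integrable M (WV i)"
  unfolding WV_def wb_def using ball_finite[of "pt i" "\<epsilon>0 * scl i"]
  by (intro integrable_divide integrable_real_indicator) auto

lemma WV_measurable [measurable]: "WV i \<in> borel_measurable M"
  using WV_integrable by auto

lemma sqfun_WV_bound: "finite F \<Longrightarrow> sqfun c WV F y \<le> sqrt (\<Sum>i\<in>F. (c i)\<^sup>2 / measure M (cub i))"
  unfolding sqfun_def
  by (intro real_sqrt_le_mono sum_mono) (auto simp: WV_def indicator_def divide_right_mono)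

lemma sqfun_WV_integrable:
  assumes "finite F" shows "integrable M (sqfun c WV F)"
proof (rule Bochner_Integration.integrable_bound[of M "\<lambda>y. sqrt (\<Sum>i\<in>F. (c i)\<^sup>2 / measure M (cub i)) * (\<Sum>i\<in>F. indicator (wb i) y)"])
  show "integrable M (\<lambda>y. sqrt (\<Sum>i\<in>F. (c i)\<^sup>2 / measure M (cub i)) * (\<Sum>i\<in>F. indicator (wb i) y))"
    using ball_finite by (intro integrable_mult_right Bochner_Integration.integrable_sum integrable_real_indicator) (auto simp: wb_def)
  show "sqfun c WV F \<in> borel_measurable M" unfolding sqfun_def by measurable
  show "AE y in M. norm (sqfun c WV F y) \<le> norm (sqrt (\<Sum>i\<in>F. (c i)\<^sup>2 / measure M (cub i)) * (\<Sum>i\<in>F. indicator (wb i) y))"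
  proof (rule AE_I2)
    fix y
    have s0: "0 \<le> sqfun c WV F y" unfolding sqfun_def by (simp add: sum_nonneg)
    have i0: "0 \<le> (\<Sum>i\<in>F. indicat_real (wb i) y)" by (simp add: sum_nonneg)
    have b0: "0 \<le> sqrt (\<Sum>i\<in>F. (c i)\<^sup>2 / measure M (cub i))" by (simp add: sum_nonneg)
    show "norm (sqfun c WV F y) \<le> norm (sqrt (\<Sum>i\<in>F. (c i)\<^sup>2 / measure M (cub i)) * (\<Sum>i\<in>F. indicator (wb i) y))"
    proof (cases "\<exists>i\<in>F. y \<in> wb i")
      case True
      then obtain i where i: "i \<in> F" "y \<in> wb i" by blast
      have "1 \<le> (\<Sum>i\<in>F. indicat_real (wb i) y)"
        using member_le_sum[OF i(1), of "\<lambda>i. indicat_real (wb i) y"] assms i by simp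
      then have "sqfun c WV F y * 1 \<le> sqrt (\<Sum>i\<in>F. (c i)\<^sup>2 / measure M (cub i)) * (\<Sum>i\<in>F. indicator (wb i) y)"
        using sqfun_WV_bound[OF assms, of c y] b0 by (intro mult_mono) auto
      then show ?thesis using s0 i0 b0 by (simp add: abs_mult)
    next
      case False
      then have "sqfun c WV F y = 0" unfolding sqfun_def by (auto simp: WV_def intro!: sum.neutral)
      then show ?thesis by simp
    qed
  qed
qed

text \<open>Each index gets a level j at which U j fills more than half of its ball while U (j + 1)
  does not. The former bounds the measure of the maximal cubes by that of U j; the latter bounds the
  coefficients, since the square function is at most 2^(j + 1) on half of the ball. An index with
  vanishing coefficient may have no such level.\<close>

lemma H1_le_wsum_nonzero:
  "\<exists>K>0. \<forall>F c. finite F \<longrightarrow> F \<subseteq> I \<longrightarrow> (\<forall>i\<in>F. c i \<noteq> 0) \<longrightarrow> H1_le M (wsum F c) (K * (LINT y|M. sqfun c WV F y))"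
proof -
  obtain K0 where K0: "K0 > 0" "\<And>i. i \<in> I \<Longrightarrow> measure M (cub i) \<le> K0 * measure M (wb i)"
    using cub_measure by blast
  obtain K1 where K1: "K1 > 0" "\<And>k \<alpha> F c. \<alpha> \<in> A k \<Longrightarrow> finite F \<Longrightarrow> F \<subseteq> I \<Longrightarrow> (\<forall>i\<in>F. k \<le> gen i \<and> cub i \<subseteq> Q k \<alpha>) \<Longrightarrow>
     H1_le M (wsum F c) (K1 * sqrt (measure M (Q k \<alpha>) * (\<Sum>i\<in>F. (c i)\<^sup>2)))"
    using H1_le_wsum_cube by blast
  \<comment> \<open>Origin of the factors: sqrt (2 K0) * 2 from the coefficients, bounded at level j
    + 1; 2 K0 from the measure of the maximal cubes; the last 2 from summing the dyadic
    levels.\<close>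
  define K where "K = K1 * (sqrt (2 * K0) * 2) * (2 * K0) * 2"
  have K: "K > 0" using K0 K1 by (simp add: K_def)
  have "H1_le M (wsum F c) (K * (LINT y|M. sqfun c WV F y))"
    if F: "finite F" "F \<subseteq> I" and nz: "\<forall>i\<in>F. c i \<noteq> 0" for F c
  proof -
    define S where "S = sqfun c WV F"
    have iS: "integrable M S" unfolding S_def by (rule sqfun_WV_integrable[OF F(1)])
    have [measurable]: "S \<in> borel_measurable M" using iS by auto
    have S0: "0 \<le> S y" for y unfolding S_def sqfun_def by (simp add: sum_nonneg)
    have S2: "(S y)\<^sup>2 = (\<Sum>i\<in>F. (c i)\<^sup>2 * WV i y)" for y
      unfolding S_def sqfun_def by (simp add: sum_nonneg)
    define U where "U j = {y. 2 powi j < S y}" for j :: int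
    have US [measurable]: "U j \<in> sets M" for j
    proof -
      have "U j = {y \<in> space M. 2 powi j < S y}" by (simp add: U_def)
      also have "\<dots> \<in> sets M" by measurable
      finally show ?thesis .
    qed
    have Ufin: "emeasure M (U j) < \<infinity>" for j
    proof -
      have "U j \<subseteq> (\<Union>i\<in>F. wb i)"
      proof
        fix y assume "y \<in> U j"
        then have "S y > 0" using zero_less_power_int[of "2::real" j] by (simp add: U_def del: zero_less_power_int)
        then have "(\<Sum>i\<in>F. (c i)\<^sup>2 * WV i y) \<noteq> 0" using S2[of y] by (metis less_irrefl zero_eq_power2)
        then obtain i where "i \<in> F" "(c i)\<^sup>2 * WV i y \<noteq> 0" by (meson sum.neutral)
        then show "y \<in> (\<Union>i\<in>F. wb i)" by (auto simp: WV_def indicator_def split: if_splits)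
      qed
      then have "emeasure M (U j) \<le> emeasure M (\<Union>i\<in>F. wb i)" using F by (intro emeasure_mono) auto
      also have "\<dots> \<le> (\<Sum>i\<in>F. emeasure M (wb i))" using F by (intro emeasure_subadditive_finite) auto
      also have "\<dots> < \<infinity>" using F ball_finite by (auto simp: wb_def less_top[symmetric])
      finally show ?thesis .
    qed
    have wbf: "wb i \<in> fmeasurable M" for i using ball_finite by (simp add: wb_def fmeasurable_def)
    have wbU: "wb i \<inter> U j \<in> fmeasurable M" "wb i - U j \<in> fmeasurable M" for i j
      by (auto intro: fmeasurableI2[OF wbf])
    define good where "good i j \<longleftrightarrow> measure M (wb i) < 2 * measure M (wb i \<inter> U j)" for i j
    \<comment> \<open>At a very low level the whole ball lies in U, because c i \<noteq> 0; at a
      very high level U is empty, because S is bounded. In between the property must be lost at some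
      step.\<close>
    have "\<exists>j. good i j \<and> \<not> good i (j + 1)" if i: "i \<in> F" for i
    proof -
      have iI: "i \<in> I" using i F by auto
      obtain n :: nat where n: "(1 / 2 :: real) ^ n < \<bar>c i\<bar> / sqrt (measure M (cub i))"
        using real_arch_pow_inv[of "\<bar>c i\<bar> / sqrt (measure M (cub i))" "1/2"] nz i cub_pos[OF iI] by auto
      have "wb i \<subseteq> U (- int n)"
      proof
        fix y assume y: "y \<in> wb i"
        have "(c i)\<^sup>2 * WV i y \<le> (S y)\<^sup>2"
          unfolding S2 using i F by (intro member_le_sum) auto
        then have "(\<bar>c i\<bar> / sqrt (measure M (cub i)))\<^sup>2 \<le> (S y)\<^sup>2"
          using y by (simp add: WV_def power_divide)
        then have "\<bar>c i\<bar> / sqrt (measure M (cub i)) \<le> S y" by (rule power2_le_imp_le) (rule S0)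
        then show "y \<in> U (- int n)" using n by (simp add: U_def power_int_minus power_divide inverse_eq_divide)
      qed
      then have g0: "good i (- int n)" using wb_pos[of i] by (simp add: good_def Int_absorb2)
      obtain m :: nat where m: "sqrt (\<Sum>i\<in>F. (c i)\<^sup>2 / measure M (cub i)) < 2 ^ m" using real_arch_pow[of 2] by auto
      have "U j = {}" if "int m \<le> j" for j
      proof -
        have "(2::real) ^ m \<le> 2 powi j" using power_int_increasing[OF that, of "2::real"] by simp
        then have "S y \<le> 2 powi j" for y using sqfun_WV_bound[OF F(1), of c y] m unfolding S_def by linarith
        then show ?thesis by (auto simp: U_def not_less)
      qed
      then have g1: "\<not> good i (max (int m) (- int n))" by (simp add: good_def)
      show ?thesis
      proof (rule ccontr)
        assume "\<not> ?thesis"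
        then have step: "good i j \<Longrightarrow> good i (j + 1)" for j by blast
        have "good i (max (int m) (- int n))"
          by (rule int_ge_induct[of "- int n"]) (use g0 step in auto)
        then show False using g1 by simp
      qed
    qed
    then obtain lev where lev: "\<And>i. i \<in> F \<Longrightarrow> good i (lev i)" "\<And>i. i \<in> F \<Longrightarrow> \<not> good i (lev i + 1)" by metis
    define B where "B j = {i \<in> F. lev i = j}" for j
    \<comment> \<open>Maximality is meant for sets. By \<open>cub_gen_le\<close> it also orders the
      generations, so each group sits in one cube whose generation is not finer than those of its
      members.\<close>
    define Mx where "Mx j = {P \<in> cub ` B j. \<forall>P'\<in>cub ` B j. P \<subseteq> P' \<longrightarrow> P = P'}" for j
    define G where "G j P = {i \<in> B j. cub i \<subseteq> P}" for j P
    have Bfin: "finite (B j)" "B j \<subseteq> F" "B j \<subseteq> I" for j using F by (auto simp: B_def)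
    have Mfin: "finite (Mx j)" for j using Bfin(1)[of j] by (simp add: Mx_def)
    have Mrep: "\<exists>i\<in>B j. P = cub i" if "P \<in> Mx j" for P j using that by (auto simp: Mx_def)
    have Mdis: "P = P'" if p: "P \<in> Mx j" "P' \<in> Mx j" "y \<in> P" "y \<in> P'" for P P' j y
    proof -
      obtain i i' where "i \<in> B j" "P = cub i" "i' \<in> B j" "P' = cub i'" using Mrep p(1,2) by blast
      then have "P \<subseteq> P' \<or> P' \<subseteq> P" using cub_nested[of i i' y] Bfin(3)[of j] p(3,4) by blast
      then show ?thesis using p(1,2) by (auto simp: Mx_def)
    qed
    have Mcov: "\<exists>P\<in>Mx j. cub i \<subseteq> P" if i: "i \<in> B j" for i j
    proof -
      have "finite {P \<in> cub ` B j. cub i \<subseteq> P}" using Bfin(1)[of j] by simp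
      moreover have "cub i \<in> {P \<in> cub ` B j. cub i \<subseteq> P}" using i by auto
      ultimately obtain P where P: "P \<in> {P \<in> cub ` B j. cub i \<subseteq> P}" "\<forall>P'\<in>{P \<in> cub ` B j. cub i \<subseteq> P}. P \<subseteq> P' \<longrightarrow> P = P'"
        by (metis (no_types, lifting) finite_has_maximal2)
      then have "P \<in> Mx j" by (auto simp: Mx_def)
      then show ?thesis using P by blast
    qed
    have Mcube: "\<exists>k \<alpha>. \<alpha> \<in> A k \<and> P = Q k \<alpha> \<and> (\<forall>i\<in>G j P. k \<le> gen i \<and> cub i \<subseteq> Q k \<alpha>)" if P: "P \<in> Mx j" for P j
    proof -
      obtain i where i: "i \<in> B j" "P = cub i" using Mrep[OF P] by blast
      have iI: "i \<in> I" using i Bfin(3) by auto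
      have "gen i \<le> gen i'" if "i' \<in> G j P" for i'
        using cub_gen_le[of i' i] that i iI Bfin(3)[of j] by (auto simp: G_def)
      then show ?thesis using i index(1)[OF iI]
        by (intro exI[of _ "gen i"] exI[of _ "fst (snd i)"]) (auto simp: G_def cub_def)
    qed
    have Mset: "P \<in> sets M" "emeasure M P < \<infinity>" if "P \<in> Mx j" for P j
      using Mcube[OF that] cube_sets cube_finite by auto
    have part: "(\<Sum>i\<in>B j. h i) = (\<Sum>P\<in>Mx j. \<Sum>i\<in>G j P. h i)" for j and h :: "_ \<Rightarrow> real"
    proof -
      have "B j = (\<Union>P\<in>Mx j. G j P)" using Mcov by (auto simp: G_def)
      moreover have "G j P \<inter> G j P' = {}" if "P \<in> Mx j" "P' \<in> Mx j" "P \<noteq> P'" for P P'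
      proof (rule ccontr)
        assume "G j P \<inter> G j P' \<noteq> {}"
        then obtain i where i: "i \<in> B j" "cub i \<subseteq> P" "cub i \<subseteq> P'" by (auto simp: G_def)
        then have "pt i \<in> P" "pt i \<in> P'" using index(4)[of i] Bfin(3)[of j] by auto
        then show False using Mdis[OF that(1,2)] that(3) by blast
      qed
      ultimately show ?thesis
        using sum.UNION_disjoint[OF Mfin, of j "G j" h] Bfin(1)[of j] by (auto simp: G_def)
    qed
    define m where "m j = (\<Sum>P\<in>Mx j. measure M P)" for j
    have m0: "m j \<ge> 0" for j by (simp add: m_def sum_nonneg)
    have indM: "(\<Sum>P\<in>Mx j. indicat_real P y) = indicator (\<Union>(Mx j)) y" for j y
    proof -
      have "disjoint_family_on (\<lambda>P. P) (Mx j)" unfolding disjoint_family_on_def using Mdis by blast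
      then have "indicat_real (\<Union>P\<in>Mx j. P) y = (\<Sum>P\<in>Mx j. indicat_real P y)" by (rule indicator_UN_disjoint[OF Mfin])
      then show ?thesis by simp
    qed
    have UM: "\<Union>(Mx j) \<in> fmeasurable M" for j
      using Mset Mfin by (intro fmeasurable.finite_Union) (auto simp: fmeasurable_def)
    have mU: "measure M (\<Union>(Mx j)) = m j" for j
    proof -
      have "measure M (\<Union>(Mx j)) = (LINT y|M. (\<Sum>P\<in>Mx j. indicat_real P y))" using UM[of j] by (simp add: indM fmeasurable_def)
      also have "\<dots> = m j" unfolding m_def using Mset by (subst Bochner_Integration.integral_sum) (auto intro!: integrable_real_indicator)
      finally show ?thesis .
    qed
    \<comment> \<open>A maximal cube belongs to an index of level j, whose ball is more than half
      filled by U j and is comparable to the cube.\<close>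
    have m_le: "m j \<le> 2 * K0 * measure M (U j)" for j
    proof -
      have one: "measure M P \<le> 2 * K0 * measure M (P \<inter> U j)" if P: "P \<in> Mx j" for P
      proof -
        obtain i where i: "i \<in> B j" "P = cub i" using Mrep[OF P] by blast
        have iI: "i \<in> I" "i \<in> F" "lev i = j" using i Bfin(3) by (auto simp: B_def)
        have "measure M (wb i) \<le> 2 * measure M (wb i \<inter> U j)" using lev(1)[OF iI(2)] iI by (simp add: good_def)
        also have "measure M (wb i \<inter> U j) \<le> measure M (P \<inter> U j)"
        proof (rule measure_mono_fmeasurable)
          show "wb i \<inter> U j \<subseteq> P \<inter> U j" using wb_sub[OF iI(1)] i by auto
          have "P \<in> fmeasurable M" using Mset[OF P] by (simp add: fmeasurable_def)
          then show "P \<inter> U j \<in> fmeasurable M" using Mset[OF P] by (rule_tac fmeasurableI2) auto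
        qed (use wbU in auto)
        finally have "K0 * measure M (wb i) \<le> K0 * (2 * measure M (P \<inter> U j))" using K0 by (intro mult_left_mono) auto
        with K0(2)[OF iI(1)] show ?thesis by (simp add: i)
      qed
      have "m j \<le> (\<Sum>P\<in>Mx j. 2 * K0 * measure M (P \<inter> U j))" unfolding m_def by (intro sum_mono one)
      also have "\<dots> = 2 * K0 * (\<Sum>P\<in>Mx j. measure M (P \<inter> U j))" by (simp add: sum_distrib_left)
      also have "(\<Sum>P\<in>Mx j. measure M (P \<inter> U j)) = measure M (\<Union>P\<in>Mx j. P \<inter> U j)"
      proof (rule measure_finite_Union[symmetric])
        show "disjoint_family_on (\<lambda>P. P \<inter> U j) (Mx j)" unfolding disjoint_family_on_def using Mdis by blast
        show "emeasure M (P \<inter> U j) \<noteq> \<infinity>" if "P \<in> Mx j" for P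
          using emeasure_mono[of "P \<inter> U j" "U j" M] Ufin[of j] by auto
      qed (use Mfin Mset in auto)
      also have "\<dots> \<le> measure M (U j)" using Ufin[of j] fmeasurableD[OF UM[of j]] by (intro measure_mono_fmeasurable) (auto simp: fmeasurable_def)
      finally show ?thesis using K0 by simp
    qed
    \<comment> \<open>At least half of each ball lies outside U (j + 1), where S is at most 2^(j +
      1). Integrating S^2 over the maximal cubes minus U (j + 1) therefore recovers the
      coefficients.\<close>
    have cB: "(\<Sum>i\<in>B j. (c i)\<^sup>2) \<le> 2 * K0 * (2 powi (j + 1))\<^sup>2 * m j" for j
    proof -
      have one: "(c i)\<^sup>2 \<le> 2 * K0 * (LINT y|M. (c i)\<^sup>2 * (indicator (wb i - U (j + 1)) y / measure M (cub i)))" if i: "i \<in> B j" for i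
      proof -
        have iI: "i \<in> I" "i \<in> F" "lev i = j" using i Bfin(3) by (auto simp: B_def)
        have "measure M (wb i) = measure M (wb i \<inter> U (j + 1)) + measure M (wb i - U (j + 1))"
        proof -
          have "wb i \<inter> U (j + 1) \<inter> (wb i - U (j + 1)) = {}" by auto
          from measure_Union[OF _ _ _ _ this, of M] wbU[of i "j + 1"] show ?thesis by (simp add: fmeasurable_def Int_Diff_Un)
        qed
        then have "measure M (wb i) \<le> 2 * measure M (wb i - U (j + 1))"
          using lev(2)[OF iI(2)] iI(3) by (simp add: good_def)
        then have "K0 * measure M (wb i) \<le> K0 * (2 * measure M (wb i - U (j + 1)))" using K0 by (intro mult_left_mono) auto
        with K0(2)[OF iI(1)] have "1 \<le> 2 * K0 * (measure M (wb i - U (j + 1)) / measure M (cub i))"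
          using cub_pos[OF iI(1)] by (simp add: field_simps)
        then have "(c i)\<^sup>2 * 1 \<le> (c i)\<^sup>2 * (2 * K0 * (measure M (wb i - U (j + 1)) / measure M (cub i)))"
          by (intro mult_left_mono) auto
        also have "\<dots> = 2 * K0 * (LINT y|M. (c i)\<^sup>2 * (indicator (wb i - U (j + 1)) y / measure M (cub i)))"
          using wbU(2)[of i "j + 1"] by (simp add: fmeasurable_def)
        finally show ?thesis by simp
      qed
      have int: "integrable M (\<lambda>y. (c i)\<^sup>2 * (indicator (wb i - U (j + 1)) y / measure M (cub i)))" for i
        using wbU(2)[of i "j + 1"] by (intro integrable_mult_right integrable_divide integrable_real_indicator) (auto simp: fmeasurable_def)
      have "(\<Sum>i\<in>B j. (c i)\<^sup>2) \<le> (\<Sum>i\<in>B j. 2 * K0 * (LINT y|M. (c i)\<^sup>2 * (indicator (wb i - U (j + 1)) y / measure M (cub i))))"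
        by (intro sum_mono one)
      also have "\<dots> = 2 * K0 * (LINT y|M. (\<Sum>i\<in>B j. (c i)\<^sup>2 * (indicator (wb i - U (j + 1)) y / measure M (cub i))))"
        using int by (subst Bochner_Integration.integral_sum) (auto simp: sum_distrib_left)
      also have "\<dots> \<le> 2 * K0 * (LINT y|M. (2 powi (j + 1))\<^sup>2 * indicator (\<Union>(Mx j)) y)"
      proof (intro mult_left_mono integral_mono)
        show "integrable M (\<lambda>y. \<Sum>i\<in>B j. (c i)\<^sup>2 * (indicator (wb i - U (j + 1)) y / measure M (cub i)))"
          using int by (intro Bochner_Integration.integrable_sum) auto
        show "integrable M (\<lambda>y. (2 powi (j + 1))\<^sup>2 * indicat_real (\<Union>(Mx j)) y)"
          using UM[of j] by (intro integrable_mult_right integrable_real_indicator) (auto simp: fmeasurable_def)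
        fix y
        show "(\<Sum>i\<in>B j. (c i)\<^sup>2 * (indicator (wb i - U (j + 1)) y / measure M (cub i))) \<le> (2 powi (j + 1))\<^sup>2 * indicator (\<Union>(Mx j)) y"
        proof (cases "y \<in> \<Union>(Mx j) \<and> y \<notin> U (j + 1)")
          case True
          have "(\<Sum>i\<in>B j. (c i)\<^sup>2 * (indicator (wb i - U (j + 1)) y / measure M (cub i))) = (\<Sum>i\<in>B j. (c i)\<^sup>2 * WV i y)"
            using True by (intro sum.cong) (auto simp: WV_def indicator_def)
          also have "\<dots> \<le> (\<Sum>i\<in>F. (c i)\<^sup>2 * WV i y)"
            using F Bfin(2)[of j] by (intro sum_mono2) auto
          also have "\<dots> = (S y)\<^sup>2" by (rule S2[symmetric])
          also have "\<dots> \<le> (2 powi (j + 1))\<^sup>2" using True S0[of y] by (intro power_mono) (auto simp: U_def not_less)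
          finally show ?thesis using True by simp
        next
          case False
          have "indicat_real (wb i - U (j + 1)) y = 0" if "i \<in> B j" for i
          proof -
            have "y \<notin> wb i \<or> y \<in> U (j + 1)"
              using False Mcov[OF that] wb_sub[of i] Bfin(3)[of j] that by blast
            then show ?thesis by (auto simp: indicator_def)
          qed
          then have "(\<Sum>i\<in>B j. (c i)\<^sup>2 * (indicator (wb i - U (j + 1)) y / measure M (cub i))) = 0" by (intro sum.neutral) auto
          then show ?thesis by simp
        qed
      qed (use K0 in auto)
      also have "\<dots> = 2 * K0 * (2 powi (j + 1))\<^sup>2 * m j" using UM[of j] by (simp add: mU fmeasurable_def)
      finally show ?thesis .
    qed
    \<comment> \<open>Cauchy-Schwarz over the maximal cubes combines both bounds into 2^j times the
      measure of U j.\<close>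
    have Bj: "H1_le M (wsum (B j) c) (K1 * (sqrt (2 * K0) * 2) * (2 * K0) * (2 powi j * measure M (U j)))" for j
    proof -
      have h1: "H1_le M (\<lambda>y. \<Sum>P\<in>Mx j. wsum (G j P) c y) (\<Sum>P\<in>Mx j. K1 * sqrt (measure M P * (\<Sum>i\<in>G j P. (c i)\<^sup>2)))"
      proof (rule H1_le_sum[OF Mfin])
        fix P assume P: "P \<in> Mx j"
        obtain k \<alpha> where ka: "\<alpha> \<in> A k" "P = Q k \<alpha>" "\<forall>i\<in>G j P. k \<le> gen i \<and> cub i \<subseteq> Q k \<alpha>" using Mcube[OF P] by blast
        show "H1_le M (wsum (G j P) c) (K1 * sqrt (measure M P * (\<Sum>i\<in>G j P. (c i)\<^sup>2)))"
          unfolding ka(2) using ka Bfin[of j] by (intro K1(2)) (auto simp: G_def)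
      qed
      have h2: "(\<lambda>y. \<Sum>P\<in>Mx j. wsum (G j P) c y) = wsum (B j) c" by (simp add: part)
      have h3: "(\<Sum>P\<in>Mx j. K1 * sqrt (measure M P * (\<Sum>i\<in>G j P. (c i)\<^sup>2))) \<le> K1 * (sqrt (2 * K0) * 2) * (2 * K0) * (2 powi j * measure M (U j))"
      proof -
        have "(\<Sum>P\<in>Mx j. sqrt (measure M P) * sqrt (\<Sum>i\<in>G j P. (c i)\<^sup>2))\<^sup>2
            \<le> (\<Sum>P\<in>Mx j. (sqrt (measure M P))\<^sup>2) * (\<Sum>P\<in>Mx j. (sqrt (\<Sum>i\<in>G j P. (c i)\<^sup>2))\<^sup>2)"
          by (rule Cauchy_Schwarz_ineq_sum)
        also have "\<dots> = m j * (\<Sum>i\<in>B j. (c i)\<^sup>2)" by (simp add: m_def part sum_nonneg)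
        also have "\<dots> \<le> m j * (2 * K0 * (2 powi (j + 1))\<^sup>2 * m j)" using m0 by (intro mult_left_mono cB) auto
        finally have "(\<Sum>P\<in>Mx j. sqrt (measure M P) * sqrt (\<Sum>i\<in>G j P. (c i)\<^sup>2)) \<le> sqrt (m j * (2 * K0 * (2 powi (j + 1))\<^sup>2 * m j))"
          by (rule real_le_rsqrt)
        also have "m j * (2 * K0 * (2 powi (j + 1))\<^sup>2 * m j) = (2 * K0) * (2 powi (j + 1) * m j)\<^sup>2" by (simp add: power_mult_distrib power2_eq_square)
        also have "sqrt \<dots> = sqrt (2 * K0) * (2 powi (j + 1) * m j)" using m0 by (simp add: real_sqrt_mult)
        also have "\<dots> \<le> sqrt (2 * K0) * (2 powi (j + 1) * (2 * K0 * measure M (U j)))"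
          using K0 by (intro mult_left_mono m_le) auto
        also have "\<dots> = (sqrt (2 * K0) * 2) * (2 * K0) * (2 powi j * measure M (U j))" by (simp add: power_int_add)
        finally have "K1 * (\<Sum>P\<in>Mx j. sqrt (measure M P) * sqrt (\<Sum>i\<in>G j P. (c i)\<^sup>2)) \<le> K1 * ((sqrt (2 * K0) * 2) * (2 * K0) * (2 powi j * measure M (U j)))"
          using K1 by (intro mult_left_mono) auto
        then show ?thesis unfolding real_sqrt_mult by (simp only: sum_distrib_left mult.assoc)
      qed
      from H1_le_mono[OF h1 h3] show ?thesis unfolding h2 .
    qed
    have h1: "H1_le M (\<lambda>y. \<Sum>j\<in>lev ` F. wsum (B j) c y) (\<Sum>j\<in>lev ` F. K1 * (sqrt (2 * K0) * 2) * (2 * K0) * (2 powi j * measure M (U j)))"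
      using F by (intro H1_le_sum Bj) auto
    have h2: "(\<lambda>y. \<Sum>j\<in>lev ` F. wsum (B j) c y) = wsum F c"
      unfolding B_def by (rule ext) (rule sum.image_gen[OF F(1), symmetric])
    \<comment> \<open>A layer-cake sum: at each point the dyadic levels below S add up to at most 2
      S.\<close>
    have h3: "(\<Sum>j\<in>lev ` F. K1 * (sqrt (2 * K0) * 2) * (2 * K0) * (2 powi j * measure M (U j))) \<le> K * (LINT y|M. S y)"
    proof -
      have iU: "integrable M (\<lambda>y. 2 powi j * indicat_real (U j) y)" for j
        using Ufin by (intro integrable_mult_right integrable_real_indicator) auto
      have "(\<Sum>j\<in>lev ` F. 2 powi j * measure M (U j)) = (LINT y|M. (\<Sum>j\<in>lev ` F. 2 powi j * indicat_real (U j) y))"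
        using iU by (subst Bochner_Integration.integral_sum) auto
      also have "\<dots> \<le> (LINT y|M. 2 * S y)"
      proof (rule integral_mono)
        show "integrable M (\<lambda>y. \<Sum>j\<in>lev ` F. 2 powi j * indicat_real (U j) y)" using iU by (intro Bochner_Integration.integrable_sum)
        show "integrable M (\<lambda>y. 2 * S y)" using iS by simp
        fix y
        have "(\<Sum>j\<in>lev ` F. 2 powi j * indicat_real (U j) y) = (\<Sum>j\<in>lev ` F. if 2 powi j < S y then 2 powi j else 0)"
          by (intro sum.cong) (auto simp: U_def indicator_def)
        also have "\<dots> \<le> 2 * S y" using F S0 by (intro sum_dyadic_below) auto
        finally show "(\<Sum>j\<in>lev ` F. 2 powi j * indicat_real (U j) y) \<le> 2 * S y" .
      qed
      finally have "K1 * (sqrt (2 * K0) * 2) * (2 * K0) * (\<Sum>j\<in>lev ` F. 2 powi j * measure M (U j)) \<le> K1 * (sqrt (2 * K0) * 2) * (2 * K0) * (2 * (LINT y|M. S y))"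
        using K0 K1 by (intro mult_left_mono) auto
      then show ?thesis by (simp add: K_def sum_distrib_left mult.assoc)
    qed
    from H1_le_mono[OF h1 h3] show ?thesis unfolding h2 S_def .
  qed
  then show ?thesis using K by blast
qed

text \<open>Indices with vanishing coefficient change neither the wavelet sum nor its square
  function.\<close>

theorem H1_le_wsum:
  "\<exists>K>0. \<forall>F c. finite F \<longrightarrow> F \<subseteq> I \<longrightarrow> H1_le M (wsum F c) (K * (LINT y|M. sqfun c WV F y))"
proof -
  obtain K where K: "K > 0" "\<And>F c. finite F \<Longrightarrow> F \<subseteq> I \<Longrightarrow> (\<forall>i\<in>F. c i \<noteq> 0) \<Longrightarrow> H1_le M (wsum F c) (K * (LINT y|M. sqfun c WV F y))"
    using H1_le_wsum_nonzero by blast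
  have "H1_le M (wsum F c) (K * (LINT y|M. sqfun c WV F y))" if F: "finite F" "F \<subseteq> I" for F c
  proof -
    let ?F = "{i \<in> F. c i \<noteq> 0}"
    have "wsum ?F c = wsum F c" by (rule ext, rule sum.mono_neutral_left) (use F in auto)
    moreover have "sqfun c WV ?F = sqfun c WV F"
      unfolding sqfun_def by (rule ext, rule arg_cong[where f = sqrt], rule sum.mono_neutral_left) (use F in auto)
    moreover have "H1_le M (wsum ?F c) (K * (LINT y|M. sqfun c WV ?F y))" using F by (intro K(2)) auto
    ultimately show ?thesis by simp
  qed
  then show ?thesis using K(1) by blast
qed

end

section \<open>Square functions of atoms\<close>

lemma sqfun_nonneg: "\<forall>i\<in>F. \<forall>y. 0 \<le> W i y \<Longrightarrow> 0 \<le> sqfun c W F y"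
  unfolding sqfun_def by (simp add: sum_nonneg)

lemma sqfun_sq: "\<forall>i\<in>F. \<forall>y. 0 \<le> W i y \<Longrightarrow> (sqfun c W F y)\<^sup>2 = (\<Sum>i\<in>F. (c i)\<^sup>2 * W i y)"
  unfolding sqfun_def by (simp add: sum_nonneg)

text \<open>Brings in Minkowski's inequality in the form of the triangle inequality for
  \<open>L2_set\<close>.\<close>

lemma sqfun_eq_L2_set: "\<forall>i\<in>F. \<forall>y. 0 \<le> W i y \<Longrightarrow> sqfun c W F y = L2_set (\<lambda>i. c i * sqrt (W i y)) F"
  unfolding sqfun_def L2_set_def by (intro arg_cong[where f = sqrt] sum.cong) (auto simp: power_mult_distrib)

lemma sqfun_add_le:
  assumes "\<forall>i\<in>F. \<forall>y. 0 \<le> W i y"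
  shows "sqfun (\<lambda>i. c i + d i) W F y \<le> sqfun c W F y + sqfun d W F y"
proof -
  have "L2_set (\<lambda>i. (c i + d i) * sqrt (W i y)) F \<le> L2_set (\<lambda>i. c i * sqrt (W i y)) F + L2_set (\<lambda>i. d i * sqrt (W i y)) F"
    using L2_set_triangle_ineq[of "\<lambda>i. c i * sqrt (W i y)" "\<lambda>i. d i * sqrt (W i y)" F] by (simp add: distrib_right)
  then show ?thesis using assms by (simp add: sqfun_eq_L2_set)
qed

lemma sqfun_cmult: "sqfun (\<lambda>i. t * c i) W F y = \<bar>t\<bar> * sqfun c W F y"
proof -
  have "(\<Sum>i\<in>F. (t * c i)\<^sup>2 * W i y) = t\<^sup>2 * (\<Sum>i\<in>F. (c i)\<^sup>2 * W i y)"
    by (simp add: sum_distrib_left power_mult_distrib mult.assoc)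
  then show ?thesis unfolding sqfun_def by (simp add: real_sqrt_mult)
qed

lemma sqfun_le_sum:
  assumes "\<forall>i\<in>F. \<forall>y. 0 \<le> W i y"
  shows "sqfun c W F y \<le> (\<Sum>i\<in>F. \<bar>c i\<bar> * sqrt (W i y))"
  using L2_set_le_sum_abs[of "\<lambda>i. c i * sqrt (W i y)" F] assms
  by (simp add: sqfun_eq_L2_set abs_mult)

context doubling_space
begin

lemma integrable_exp_dist:
  assumes "s > 0"
  shows "\<exists>K>0. \<forall>p \<rho>. 0 < \<rho> \<longrightarrow> integrable M (\<lambda>y. exp (- s * dist p y / \<rho>)) \<and> (LINT y|M. exp (- s * dist p y / \<rho>)) \<le> K * V M p \<rho>"
proof -
  obtain K where K: "K > 0" "\<And>p \<rho>. 0 < \<rho> \<Longrightarrow> (\<integral>\<^sup>+ y. ennreal (exp (- s * dist p y / \<rho>)) \<partial>M) \<le> ennreal (K * V M p \<rho>)"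
    using nn_integral_exp_dist[OF assms] by blast
  have "integrable M (\<lambda>y. exp (- s * dist p y / \<rho>)) \<and> (LINT y|M. exp (- s * dist p y / \<rho>)) \<le> K * V M p \<rho>" if \<rho>: "\<rho> > 0" for p \<rho>
  proof
    show i: "integrable M (\<lambda>y. exp (- s * dist p y / \<rho>))"
      unfolding integrable_iff_bounded using K(2)[OF \<rho>, of p] by (auto simp: less_top[symmetric] top_unique)
    have "ennreal (LINT y|M. exp (- s * dist p y / \<rho>)) \<le> ennreal (K * V M p \<rho>)"
      using K(2)[OF \<rho>, of p] i by (subst nn_integral_eq_integral[symmetric]) auto
    then show "(LINT y|M. exp (- s * dist p y / \<rho>)) \<le> K * V M p \<rho>"
      using K(1) by (subst (asm) ennreal_le_iff) auto
  qed
  then show ?thesis using K(1) by blast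
qed

end

context wavelet_space
begin

definition cf :: "('a \<Rightarrow> real) \<Rightarrow> int \<times> 'i \<times> 'i \<Rightarrow> real" where
  "cf f i = (LINT y|M. f y * w i y)"

text \<open>The upper estimate asks of a weight only that its square root decay like a wavelet;
  cancellation enters through the coefficients alone. This lets one proof cover all three
  weights.\<close>

definition adm :: "(int \<times> 'i \<times> 'i \<Rightarrow> 'a \<Rightarrow> real) \<Rightarrow> bool" where
  "adm W \<longleftrightarrow> (\<exists>D>0. \<exists>s>0. \<forall>i\<in>I. W i \<in> borel_measurable M \<and>
     (\<forall>y. 0 \<le> W i y \<and> sqrt (W i y) \<le> D / sqrt (V M (pt i) (scl i)) * exp (- s * dist (pt i) y / scl i)))"

lemma admI:
  assumes "0 < D" "0 < s" "\<And>i. i \<in> I \<Longrightarrow> W i \<in> borel_measurable M" "\<And>i y. i \<in> I \<Longrightarrow> 0 \<le> W i y"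
    "\<And>i y. i \<in> I \<Longrightarrow> sqrt (W i y) \<le> D / sqrt (V M (pt i) (scl i)) * exp (- s * dist (pt i) y / scl i)"
  shows "adm W"
  unfolding adm_def using assms by (intro exI[of _ D] exI[of _ s]) blast

lemma adm_nonneg: "adm W \<Longrightarrow> i \<in> I \<Longrightarrow> 0 \<le> W i y"
  and adm_measurable: "adm W \<Longrightarrow> i \<in> I \<Longrightarrow> W i \<in> borel_measurable M"
  unfolding adm_def by blast+

text \<open>For a function of size V^(-1/2) with exponential decay at its scale, the L1, L2 and
  supremum norms are at most constants times V^(1/2), 1 and V^(-1/2).\<close>

lemma adm_integral:
  assumes W: "adm W"
  shows "\<exists>K>0. \<forall>i\<in>I. integrable M (\<lambda>y. sqrt (W i y)) \<and> (LINT y|M. sqrt (W i y)) \<le> K * sqrt (V M (pt i) (scl i))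
    \<and> integrable M (W i) \<and> (LINT y|M. W i y) \<le> K \<and> (\<forall>y. sqrt (W i y) \<le> K / sqrt (V M (pt i) (scl i)))"
proof -
  obtain D s where D: "D > 0" and s: "s > 0" and Wb: "\<And>i y. i \<in> I \<Longrightarrow> sqrt (W i y) \<le> D / sqrt (V M (pt i) (scl i)) * exp (- s * dist (pt i) y / scl i)"
    using W unfolding adm_def by blast
  obtain K1 where K1: "K1 > 0" "\<And>p \<rho>. 0 < \<rho> \<Longrightarrow> integrable M (\<lambda>y. exp (- s * dist p y / \<rho>))" "\<And>p \<rho>. 0 < \<rho> \<Longrightarrow> (LINT y|M. exp (- s * dist p y / \<rho>)) \<le> K1 * V M p \<rho>"
    using integrable_exp_dist[OF s] by blast
  define K where "K = D * K1 + D\<^sup>2 * K1 + D"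
  have K: "K > 0" "D * K1 \<le> K" "D\<^sup>2 * K1 \<le> K" "D \<le> K" using D K1 by (auto simp: K_def add_pos_pos)
  show ?thesis
  proof (intro exI[of _ K] conjI ballI allI K(1))
    fix i assume i: "i \<in> I"
    have [measurable]: "W i \<in> borel_measurable M" by (rule adm_measurable[OF W i])
    have Wn: "0 \<le> W i y" for y by (rule adm_nonneg[OF W i])
    let ?v = "V M (pt i) (scl i)" and ?e = "\<lambda>y. exp (- s * dist (pt i) y / scl i)"
    have e1: "?e y \<le> 1" for y using s by (simp add: less_imp_le)
    have ie: "integrable M ?e" "(LINT y|M. ?e y) \<le> K1 * ?v" using K1 by auto
    show i1: "integrable M (\<lambda>y. sqrt (W i y))"
    proof (rule Bochner_Integration.integrable_bound)
      show "integrable M (\<lambda>y. D / sqrt ?v * ?e y)" using ie by (intro integrable_mult_right)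
      show "AE y in M. norm (sqrt (W i y)) \<le> norm (D / sqrt ?v * ?e y)"
        using Wb[OF i] Wn D by (intro AE_I2) (simp add: abs_mult)
    qed measurable
    have "(LINT y|M. sqrt (W i y)) \<le> (LINT y|M. D / sqrt ?v * ?e y)"
      using i1 ie Wb[OF i] by (intro integral_mono integrable_mult_right)
    also have "\<dots> = D / sqrt ?v * (LINT y|M. ?e y)" by simp
    also have "\<dots> \<le> D / sqrt ?v * (K1 * ?v)" using D ie(2) by (intro mult_left_mono) (auto simp: less_imp_le)
    also have "\<dots> = D * K1 * sqrt ?v"
    proof -
      have "?v = sqrt ?v * sqrt ?v" by simp
      moreover have "sqrt ?v > 0" by simp
      ultimately show ?thesis by (simp add: divide_simps)
    qed
    also have "\<dots> \<le> K * sqrt ?v" using K by (intro mult_right_mono) auto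
    finally show "(LINT y|M. sqrt (W i y)) \<le> K * sqrt ?v" .
    have Wsq: "W i y \<le> D\<^sup>2 / ?v * ?e y" for y
    proof -
      have "W i y = (sqrt (W i y))\<^sup>2" using Wn by simp
      also have "\<dots> \<le> (D / sqrt ?v * ?e y)\<^sup>2" using Wb[OF i, of y] Wn by (intro power_mono) auto
      also have "\<dots> = D\<^sup>2 / ?v * (?e y * ?e y)" by (simp add: power_mult_distrib power_divide power2_eq_square)
      also have "\<dots> \<le> D\<^sup>2 / ?v * (?e y * 1)" using e1 by (intro mult_left_mono) auto
      finally show ?thesis by simp
    qed
    show i2: "integrable M (W i)"
    proof (rule Bochner_Integration.integrable_bound)
      show "integrable M (\<lambda>y. D\<^sup>2 / ?v * ?e y)" using ie by (intro integrable_mult_right)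
      show "AE y in M. norm (W i y) \<le> norm (D\<^sup>2 / ?v * ?e y)"
        using Wsq Wn by (intro AE_I2) (simp add: abs_mult)
    qed measurable
    have "(LINT y|M. W i y) \<le> (LINT y|M. D\<^sup>2 / ?v * ?e y)"
      using i2 ie Wsq by (intro integral_mono integrable_mult_right)
    also have "\<dots> = D\<^sup>2 / ?v * (LINT y|M. ?e y)" by simp
    also have "\<dots> \<le> D\<^sup>2 / ?v * (K1 * ?v)" using ie(2) by (intro mult_left_mono) auto
    also have "\<dots> \<le> K" using K(3) by simp
    finally show "(LINT y|M. W i y) \<le> K" .
    fix y
    have "D / sqrt ?v * ?e y \<le> D / sqrt ?v * 1" using D e1 by (intro mult_left_mono) (auto simp: less_imp_le)
    also have "\<dots> \<le> K / sqrt ?v" using K by (simp add: divide_right_mono)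
    finally show "sqrt (W i y) \<le> K / sqrt ?v" using Wb[OF i, of y] by linarith
  qed
qed

lemma sqfun_integrable:
  assumes W: "adm W" and F: "finite F" "F \<subseteq> I"
  shows "integrable M (sqfun c W F)" "(LINT y|M. sqfun c W F y) \<le> (\<Sum>i\<in>F. \<bar>c i\<bar> * (LINT y|M. sqrt (W i y)))"
proof -
  obtain K where K: "\<And>i. i \<in> I \<Longrightarrow> integrable M (\<lambda>y. sqrt (W i y))" using adm_integral[OF W] by blast
  have Wn: "\<forall>i\<in>F. \<forall>y. 0 \<le> W i y" using adm_nonneg[OF W] F(2) by blast
  have isum: "integrable M (\<lambda>y. \<Sum>i\<in>F. \<bar>c i\<bar> * sqrt (W i y))"
    using K F by (intro Bochner_Integration.integrable_sum integrable_mult_right) auto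
  show i: "integrable M (sqfun c W F)"
  proof (rule Bochner_Integration.integrable_bound[OF isum])
    have "W i \<in> borel_measurable M" if "i \<in> F" for i using adm_measurable[OF W] subsetD[OF F(2) that] by blast
    then have [measurable]: "(\<lambda>y. \<Sum>i\<in>F. (c i)\<^sup>2 * W i y) \<in> borel_measurable M"
      by (intro borel_measurable_sum borel_measurable_times borel_measurable_const)
    show "sqfun c W F \<in> borel_measurable M" unfolding sqfun_def by measurable
    show "AE y in M. norm (sqfun c W F y) \<le> norm (\<Sum>i\<in>F. \<bar>c i\<bar> * sqrt (W i y))"
      using sqfun_le_sum[OF Wn, where c = c] sqfun_nonneg[OF Wn, where c = c] by (intro AE_I2) (simp add: order_trans[OF _ abs_ge_self])
  qed
  have "(LINT y|M. sqfun c W F y) \<le> (LINT y|M. (\<Sum>i\<in>F. \<bar>c i\<bar> * sqrt (W i y)))"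
    by (rule integral_mono[OF i isum]) (rule sqfun_le_sum[OF Wn])
  also have "\<dots> = (\<Sum>i\<in>F. \<bar>c i\<bar> * (LINT y|M. sqrt (W i y)))"
    using K F by (subst Bochner_Integration.integral_sum) auto
  finally show "(LINT y|M. sqfun c W F y) \<le> (\<Sum>i\<in>F. \<bar>c i\<bar> * (LINT y|M. sqrt (W i y)))" .
qed

text \<open>Expansion of the squared distance between g and its partial sum. Integrability of g
  makes its products with the bounded wavelets integrable.\<close>

lemma bessel:
  assumes g: "integrable M g" and g2: "integrable M (\<lambda>y. (g y)\<^sup>2)" and F: "finite F" "F \<subseteq> I"
  shows "(\<Sum>i\<in>F. (cf g i)\<^sup>2) \<le> (LINT y|M. (g y)\<^sup>2)"
proof -
  have igw: "integrable M (\<lambda>y. g y * wsum F (cf g) y)"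
    unfolding sum_distrib_left mult.left_commute[of "g _"]
    by (intro Bochner_Integration.integrable_sum integrable_mult_right integrable_mult_w[OF g] subsetD[OF F(2)])
  have gw: "(LINT y|M. g y * wsum F (cf g) y) = (\<Sum>i\<in>F. (cf g i)\<^sup>2)"
  proof -
    have "(LINT y|M. g y * wsum F (cf g) y) = (LINT y|M. (\<Sum>i\<in>F. cf g i * (g y * w i y)))"
      by (simp add: sum_distrib_left mult.left_commute)
    also have "\<dots> = (\<Sum>i\<in>F. LINT y|M. cf g i * (g y * w i y))"
      using F integrable_mult_w[OF g] by (intro Bochner_Integration.integral_sum) auto
    also have "\<dots> = (\<Sum>i\<in>F. (cf g i)\<^sup>2)" by (simp add: cf_def power2_eq_square)
    finally show ?thesis .
  qed
  have "0 \<le> (LINT y|M. (g y - wsum F (cf g) y)\<^sup>2)" by simp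
  also have "\<dots> = (LINT y|M. (g y)\<^sup>2 - 2 * (g y * wsum F (cf g) y) + (wsum F (cf g) y)\<^sup>2)"
    by (simp add: power2_diff mult.assoc algebra_simps)
  also have "\<dots> = (LINT y|M. (g y)\<^sup>2) - 2 * (\<Sum>i\<in>F. (cf g i)\<^sup>2) + (\<Sum>i\<in>F. (cf g i)\<^sup>2)"
    using g2 igw wsum_sq[OF F] gw by simp
  finally show ?thesis by simp
qed

lemma atom_sq:
  assumes "a \<in> borel_measurable M" "0 < r" "\<And>y. y \<notin> ball z r \<Longrightarrow> a y = 0" "AE y in M. \<bar>a y\<bar> \<le> 1 / V M z r"
  shows "integrable M (\<lambda>y. (a y)\<^sup>2)" "(LINT y|M. (a y)\<^sup>2) \<le> 1 / V M z r"
proof -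
  have Vp: "V M z r > 0" by (rule V_pos[OF assms(2)])
  have ii: "integrable M (\<lambda>y. (1 / V M z r)\<^sup>2 * indicator (ball z r) y)"
    using ball_finite[of z r] by (intro integrable_mult_right integrable_real_indicator) auto
  have le: "AE y in M. (a y)\<^sup>2 \<le> (1 / V M z r)\<^sup>2 * indicator (ball z r) y"
    using assms(4)
  proof eventually_elim
    case (elim y)
    have "\<bar>a y\<bar>\<^sup>2 \<le> (1 / V M z r)\<^sup>2" using elim by (intro power_mono) auto
    then show ?case using assms(3)[of y] by (cases "y \<in> ball z r") auto
  qed
  show i: "integrable M (\<lambda>y. (a y)\<^sup>2)"
    by (rule Bochner_Integration.integrable_bound[OF ii]) (use assms(1) le in \<open>auto elim!: eventually_mono\<close>)
  have "(LINT y|M. (a y)\<^sup>2) \<le> (LINT y|M. (1 / V M z r)\<^sup>2 * indicator (ball z r) y)"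
    by (rule integral_mono_AE[OF i ii le])
  also have "\<dots> = (1 / V M z r)\<^sup>2 * V M z r" by (simp add: V_def)
  also have "\<dots> = 1 / V M z r" using Vp by (simp add: power2_eq_square)
  finally show "(LINT y|M. (a y)\<^sup>2) \<le> 1 / V M z r" .
qed

text \<open>Near the atom, Bessel's inequality controls the square function in \<open>L\<^sup>2\<close>. Away from it the
  square function is dominated by the sum of its terms: the cancellation of the atom handles the
  scales above its radius, the exponential decay of the wavelets the scales below.\<close>

lemma sqfun_atom:
  assumes W: "adm W"
  shows "\<exists>K>0. \<forall>a F. atom M a \<longrightarrow> finite F \<longrightarrow> F \<subseteq> I \<longrightarrow> (LINT y|M. sqfun (cf a) W F y) \<le> K"
proof -
  obtain D s0 where D: "D > 0" and s0: "s0 > 0" and Wb0: "\<And>i y. i \<in> I \<Longrightarrow> sqrt (W i y) \<le> D / sqrt (V M (pt i) (scl i)) * exp (- s0 * dist (pt i) y / scl i)"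
    using W unfolding adm_def by blast
  \<comment> \<open>One decay rate for the wavelets and for the weights.\<close>
  define b where "b = min \<nu> s0"
  have b: "b > 0" "b \<le> \<nu>" "b \<le> s0" using s0 par_pos by (auto simp: b_def)
  have eb: "exp (- t * dist p y / scl i) \<le> exp (- b * dist p y / scl i)" if "b \<le> t" for t i and p y :: 'a
  proof -
    have "b * (dist p y / scl i) \<le> t * (dist p y / scl i)" using that by (intro mult_right_mono) (auto simp: less_imp_le)
    then show ?thesis by simp
  qed
  have Wb: "sqrt (W i y) \<le> D / sqrt (V M (pt i) (scl i)) * exp (- b * dist (pt i) y / scl i)" if "i \<in> I" for i y
  proof -
    have "D / sqrt (V M (pt i) (scl i)) * exp (- s0 * dist (pt i) y / scl i) \<le> D / sqrt (V M (pt i) (scl i)) * exp (- b * dist (pt i) y / scl i)"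
      using D b by (intro mult_left_mono eb) (auto simp: less_imp_le)
    with Wb0[OF that, of y] show ?thesis by linarith
  qed
  have wbnd: "\<bar>w i y\<bar> \<le> C / sqrt (V M (pt i) (scl i)) * exp (- b * dist (pt i) y / scl i)" if "i \<in> I" for i y
  proof -
    have "C / sqrt (V M (pt i) (scl i)) * exp (- \<nu> * dist (pt i) y / scl i) \<le> C / sqrt (V M (pt i) (scl i)) * exp (- b * dist (pt i) y / scl i)"
      using par_pos b by (intro mult_left_mono eb) (auto simp: less_imp_le)
    with w_size[OF that, of y] show ?thesis by linarith
  qed
  obtain KW where KW: "KW > 0" "\<And>i. i \<in> I \<Longrightarrow> integrable M (\<lambda>y. sqrt (W i y))" "\<And>i. i \<in> I \<Longrightarrow> (LINT y|M. sqrt (W i y)) \<le> KW * sqrt (V M (pt i) (scl i))"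
    "\<And>i. i \<in> I \<Longrightarrow> integrable M (W i)" "\<And>i. i \<in> I \<Longrightarrow> (LINT y|M. W i y) \<le> KW" "\<And>i y. i \<in> I \<Longrightarrow> sqrt (W i y) \<le> KW / sqrt (V M (pt i) (scl i))"
    using adm_integral[OF W] by blast
  have b2: "b / 2 > 0" using b by simp
  obtain K1 where K1: "K1 > 0" "\<And>p \<rho>. 0 < \<rho> \<Longrightarrow> integrable M (\<lambda>y. exp (- (b / 2) * dist p y / \<rho>))" "\<And>p \<rho>. 0 < \<rho> \<Longrightarrow> (LINT y|M. exp (- (b / 2) * dist p y / \<rho>)) \<le> K1 * V M p \<rho>"
    using integrable_exp_dist[OF b2] by blast
  obtain K2 where K2: "K2 > 0" "\<And>k F y. finite F \<Longrightarrow> F \<subseteq> I \<Longrightarrow> (\<forall>i\<in>F. gen i = k) \<Longrightarrow> (\<Sum>i\<in>F. exp (- (b / 2) * dist (pt i) y / scl i)) \<le> K2"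
    using sum_exp_dist_gen[OF b2] by blast
  obtain K3 where K3: "K3 > 0" "\<And>k F y. finite F \<Longrightarrow> F \<subseteq> I \<Longrightarrow> (\<forall>i\<in>F. gen i = k) \<Longrightarrow> (\<Sum>i\<in>F. exp (- \<nu> * dist (pt i) y / scl i)) \<le> K3"
    using sum_exp_dist_gen[OF par_pos(3)] by blast
  define q1 where "q1 = \<delta> powr \<eta>"
  define q2 where "q2 = exp (- (b / 4))"
  have q1: "0 < q1" "q1 < 1" using \<delta>_pos \<delta>_le par_pos by (auto simp: q1_def powr01_less_one)
  have q2: "0 < q2" "q2 < 1" using b by (auto simp: q2_def)
  define E where "E = C * KW + C * (D * K1)"
  have E: "E > 0" "C * KW \<le> E" "C * (D * K1) \<le> E" using par_pos KW(1) D K1(1) by (auto simp: E_def add_pos_pos)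
  \<comment> \<open>Three contributions: the neighbourhood of the atom, the scales of at least its
    radius, and the scales below it.\<close>
  define K where "K = sqrt (Cd * KW) + (C * KW * K3) / (1 - q1) + (E * K2) / (1 - q2)"
  have K: "K > 0"
  proof -
    have "0 < (E * K2) / (1 - q2)" using E K2(1) q2 by simp
    moreover have "0 \<le> sqrt (Cd * KW)" "0 \<le> (C * KW * K3) / (1 - q1)" using par_pos KW(1) K3(1) q1 Cd_ge_1 by auto
    ultimately show ?thesis unfolding K_def by linarith
  qed
  have "(LINT y|M. sqfun (cf a) W F y) \<le> K" if at: "atom M a" and F: "finite F" "F \<subseteq> I" for a F
  proof -
    obtain z r where r: "r > 0" and am [measurable]: "a \<in> borel_measurable M" and supp: "\<And>y. y \<notin> ball z r \<Longrightarrow> a y = 0"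
      and bd: "AE y in M. \<bar>a y\<bar> \<le> 1 / V M z r" and ia: "integrable M a" and a0: "(LINT y|M. a y) = 0"
      using at unfolding atom_def V_def by blast
    have a1: "(LINT y|M. \<bar>a y\<bar>) \<le> 1" by (rule atom_L1[OF at])
    have iaa: "integrable M (\<lambda>y. \<bar>a y\<bar>)" using ia by simp
    define S where "S = sqfun (cf a) W F"
    have Wn: "\<forall>i\<in>F. \<forall>y. 0 \<le> W i y" using adm_nonneg[OF W] F(2) by blast
    have S0: "0 \<le> S y" for y unfolding S_def by (rule sqfun_nonneg[OF Wn])
    have S2: "(S y)\<^sup>2 = (\<Sum>i\<in>F. (cf a i)\<^sup>2 * W i y)" for y unfolding S_def by (rule sqfun_sq[OF Wn])
    have Sle: "S y \<le> (\<Sum>i\<in>F. \<bar>cf a i\<bar> * sqrt (W i y))" for y unfolding S_def by (rule sqfun_le_sum[OF Wn])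
    have iS: "integrable M S" unfolding S_def by (rule sqfun_integrable(1)[OF W F])
    have [measurable]: "S \<in> borel_measurable M" using iS by auto
    let ?N = "ball z (2 * r)"
    define fr where "fr = (indicator (- ?N) :: 'a \<Rightarrow> real)"
    have [measurable]: "fr \<in> borel_measurable M"
    proof -
      have "- ?N = space M - ?N" by auto
      also have "\<dots> \<in> sets M" by (intro sets.compl_sets) simp
      finally show ?thesis unfolding fr_def by simp
    qed
    have fr: "0 \<le> fr y" "fr y \<le> 1" for y by (auto simp: fr_def)
    have inear: "integrable M (\<lambda>y. indicator ?N y * S y)"
      using integrable_mult_indicator[OF ball_sets iS, of z "2 * r"] by simp
    have ifr: "integrable M (\<lambda>y. fr y * S y)"
    proof (rule Bochner_Integration.integrable_bound[OF iS])
      show "AE y in M. norm (fr y * S y) \<le> norm (S y)"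
        using fr by (intro AE_I2) (simp add: abs_mult mult_left_le_one_le)
    qed measurable
    have split: "(LINT y|M. S y) = (LINT y|M. indicator ?N y * S y) + (LINT y|M. fr y * S y)"
    proof -
      have "(LINT y|M. S y) = (LINT y|M. indicator ?N y * S y + fr y * S y)"
        by (intro Bochner_Integration.integral_cong) (auto simp: fr_def indicator_def)
      then show ?thesis using inear ifr by simp
    qed
    \<comment> \<open>Cauchy-Schwarz on the doubled ball: its measure, at most Cd V, meets Bessel's
      bound 1 / V for the coefficients.\<close>
    have near: "(LINT y|M. indicator ?N y * S y) \<le> sqrt (Cd * KW)"
    proof (rule real_le_rsqrt)
      have Sb: "S y \<le> (\<Sum>i\<in>F. \<bar>cf a i\<bar> * (KW / sqrt (V M (pt i) (scl i))))" for y
      proof -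
        have "(\<Sum>i\<in>F. \<bar>cf a i\<bar> * sqrt (W i y)) \<le> (\<Sum>i\<in>F. \<bar>cf a i\<bar> * (KW / sqrt (V M (pt i) (scl i))))"
          using F by (intro sum_mono mult_left_mono KW(6)) auto
        then show ?thesis using Sle[of y] by linarith
      qed
      have iS2: "integrable M (\<lambda>y. \<Sum>i\<in>F. (cf a i)\<^sup>2 * W i y)"
        using KW(4) F by (intro Bochner_Integration.integrable_sum integrable_mult_right) auto
      have "(LINT y|M. indicator ?N y * S y)\<^sup>2 \<le> measure M ?N * (LINT y|M. indicator ?N y * (S y)\<^sup>2)"
        using Sb S0 by (intro integral_square_le[of ?N z "2 * r"]) (auto simp: abs_of_nonneg)
      also have "\<dots> \<le> measure M ?N * (LINT y|M. (\<Sum>i\<in>F. (cf a i)\<^sup>2 * W i y))"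
      proof (intro mult_left_mono)
        have "integrable M (\<lambda>y. indicator ?N y * (S y)\<^sup>2)"
          unfolding S2 using integrable_mult_indicator[OF ball_sets iS2, of z "2 * r"] by simp
        then show "(LINT y|M. indicator ?N y * (S y)\<^sup>2) \<le> (LINT y|M. (\<Sum>i\<in>F. (cf a i)\<^sup>2 * W i y))"
          using iS2 by (intro integral_mono) (auto simp: S2[symmetric] indicator_def)
      qed simp
      also have "(LINT y|M. (\<Sum>i\<in>F. (cf a i)\<^sup>2 * W i y)) = (\<Sum>i\<in>F. (cf a i)\<^sup>2 * (LINT y|M. W i y))"
        using KW(4) F by (subst Bochner_Integration.integral_sum) auto
      also have "measure M ?N * \<dots> \<le> measure M ?N * (\<Sum>i\<in>F. (cf a i)\<^sup>2 * KW)"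
        using F by (intro mult_left_mono sum_mono KW(5)) auto
      also have "\<dots> = measure M ?N * KW * (\<Sum>i\<in>F. (cf a i)\<^sup>2)" by (simp add: sum_distrib_right[symmetric])
      also have "\<dots> \<le> measure M ?N * KW * (1 / V M z r)"
      proof (intro mult_left_mono)
        note sq = atom_sq[OF am r supp bd]
        show "(\<Sum>i\<in>F. (cf a i)\<^sup>2) \<le> 1 / V M z r" using bessel[OF ia sq(1) F] sq(2) by linarith
      qed (use KW in auto)
      also have "\<dots> \<le> Cd * V M z r * KW * (1 / V M z r)"
        using V_double[of z r] KW(1) by (intro mult_right_mono) (auto simp: V_def)
      also have "\<dots> = Cd * KW" using V_pos[OF r, of z] by simp
      finally show "(LINT y|M. indicator ?N y * S y)\<^sup>2 \<le> Cd * KW" .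
    qed
    \<comment> \<open>The L1 mass of one weight function outside the doubled ball.\<close>
    define T where "T i = (LINT y|M. fr y * sqrt (W i y))" for i
    have iT: "integrable M (\<lambda>y. fr y * sqrt (W i y))" if "i \<in> F" for i
    proof (rule Bochner_Integration.integrable_bound[OF KW(2)])
      show "i \<in> I" using that F by auto
      show "AE y in M. norm (fr y * sqrt (W i y)) \<le> norm (sqrt (W i y))"
        using fr by (intro AE_I2) (simp add: abs_mult mult_left_le_one_le)
      have "W i \<in> borel_measurable M" using adm_measurable[OF W] subsetD[OF F(2) that] by blast
      then show "(\<lambda>y. fr y * sqrt (W i y)) \<in> borel_measurable M" by measurable
    qed
    have T0: "0 \<le> T i" if "i \<in> F" for i unfolding T_def using fr Wn that by (intro integral_nonneg_AE AE_I2) auto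
    have T1: "T i \<le> KW * sqrt (V M (pt i) (scl i))" if "i \<in> F" for i
    proof -
      have "T i \<le> (LINT y|M. sqrt (W i y))"
        unfolding T_def using iT[OF that] KW(2)[OF subsetD[OF F(2) that]] that fr Wn by (intro integral_mono) (auto simp: mult_left_le_one_le)
      also have "\<dots> \<le> KW * sqrt (V M (pt i) (scl i))" by (rule KW(3)[OF subsetD[OF F(2) that]])
      finally show ?thesis .
    qed
    have far: "(LINT y|M. fr y * S y) \<le> (\<Sum>i\<in>F. \<bar>cf a i\<bar> * T i)"
    proof -
      have "(LINT y|M. fr y * S y) \<le> (LINT y|M. (\<Sum>i\<in>F. \<bar>cf a i\<bar> * (fr y * sqrt (W i y))))"
      proof (rule integral_mono[OF ifr])
        show "integrable M (\<lambda>y. \<Sum>i\<in>F. \<bar>cf a i\<bar> * (fr y * sqrt (W i y)))"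
          using iT by (intro Bochner_Integration.integrable_sum integrable_mult_right)
        show "fr y * S y \<le> (\<Sum>i\<in>F. \<bar>cf a i\<bar> * (fr y * sqrt (W i y)))" for y
          using mult_left_mono[OF Sle[of y] fr(1)[of y]] by (simp add: sum_distrib_left mult.left_commute)
      qed
      also have "\<dots> = (\<Sum>i\<in>F. \<bar>cf a i\<bar> * T i)"
        using iT by (subst Bochner_Integration.integral_sum) (auto simp: T_def)
      finally show ?thesis .
    qed
    define F1 where "F1 = {i \<in> F. r \<le> scl i}"
    define F2 where "F2 = {i \<in> F. \<not> r \<le> scl i}"
    have F12: "finite F1" "F1 \<subseteq> I" "finite F2" "F2 \<subseteq> I" "F1 \<subseteq> F" "F2 \<subseteq> F" using F by (auto simp: F1_def F2_def)
    \<comment> \<open>As the atom has mean zero, \<open>w i z\<close> may be subtracted from the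
      wavelet, and its regularity gains (r / scl i)^\<eta>. The normalisation V^(-1/2) of the
      coefficient cancels against the factor V^(1/2) in the bound for T.\<close>
    have one: "\<bar>cf a i\<bar> * T i \<le> C * KW * ((r / scl i) powr \<eta> * exp (- \<nu> * dist (pt i) z / scl i))" if i: "i \<in> F1" for i
    proof -
      have iI: "i \<in> I" "i \<in> F" "r \<le> scl i" using i F by (auto simp: F1_def)
      let ?B = "C / sqrt (V M (pt i) (scl i)) * (r / scl i) powr \<eta> * exp (- \<nu> * dist (pt i) z / scl i)"
      have B0: "0 \<le> ?B" using par_pos by (simp add: less_imp_le)
      have "cf a i = (LINT y|M. a y * w i y) - (LINT y|M. a y) * w i z" by (simp add: cf_def a0)
      also have "\<dots> = (LINT y|M. a y * (w i y - w i z))"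
        using integrable_mult_w[OF ia iI(1)] ia by (simp add: right_diff_distrib)
      finally have "\<bar>cf a i\<bar> = \<bar>LINT y|M. a y * (w i y - w i z)\<bar>" by simp
      also have "\<dots> \<le> (LINT y|M. \<bar>a y * (w i y - w i z)\<bar>)" by (rule integral_abs_bound)
      also have "\<dots> \<le> (LINT y|M. \<bar>a y\<bar> * ?B)"
      proof (rule integral_mono)
        have "integrable M (\<lambda>y. a y * (w i y - w i z))"
          using integrable_mult_w[OF ia iI(1)] ia by (simp add: right_diff_distrib)
        then show "integrable M (\<lambda>y. \<bar>a y * (w i y - w i z)\<bar>)" by simp
        show "integrable M (\<lambda>y. \<bar>a y\<bar> * ?B)" using iaa by (rule integrable_mult_left)
        fix y
        show "\<bar>a y * (w i y - w i z)\<bar> \<le> \<bar>a y\<bar> * ?B"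
        proof (cases "y \<in> ball z r")
          case True
          then have zy: "dist z y \<le> r" by simp
          then have "\<bar>w i z - w i y\<bar> \<le> C / sqrt (V M (pt i) (scl i)) * (dist z y / scl i) powr \<eta> * exp (- \<nu> * dist (pt i) z / scl i)"
            using iI by (intro w_reg) auto
          also have "\<dots> \<le> ?B"
            using zy par_pos by (intro mult_right_mono mult_left_mono powr_mono2 divide_right_mono) (auto simp: less_imp_le)
          finally have "\<bar>w i y - w i z\<bar> \<le> ?B" by (simp add: abs_minus_commute)
          then show ?thesis unfolding abs_mult by (rule mult_left_mono) simp
        qed (simp add: supp)
      qed
      also have "\<dots> = (LINT y|M. \<bar>a y\<bar>) * ?B" using iaa by simp
      also have "\<dots> \<le> 1 * ?B" using a1 B0 by (rule mult_right_mono)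
      finally have "\<bar>cf a i\<bar> \<le> ?B" by simp
      then have "\<bar>cf a i\<bar> * T i \<le> ?B * (KW * sqrt (V M (pt i) (scl i)))"
        using T1[OF iI(2)] T0[OF iI(2)] B0 by (intro mult_mono) auto
      also have "\<dots> = C * KW * ((r / scl i) powr \<eta> * exp (- \<nu> * dist (pt i) z / scl i))" by simp
      finally show ?thesis .
    qed
    \<comment> \<open>Generations are counted backwards from the finest one in F1. Its scale is
      still at least r, so r / \<delta>^k \<le> \<delta>^n for the generation k that is n steps
      coarser.\<close>
    have sum1: "(\<Sum>i\<in>F1. \<bar>cf a i\<bar> * T i) \<le> (C * KW * K3) / (1 - q1)"
    proof (rule sum_by_gen_le[OF F12(1,2), where g = "\<lambda>k. nat (Max (gen ` F1) - k)"])
      have mx: "k \<le> Max (gen ` F1)" if "k \<in> gen ` F1" for k using that F12 by auto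
      then show "inj_on (\<lambda>k. nat (Max (gen ` F1) - k)) (gen ` F1)"
        by (intro inj_onI) (metis eq_nat_nat_iff diff_ge_0_iff_ge diff_left_imp_eq)
      fix k G assume G: "G \<subseteq> F1" "\<And>i. i \<in> G \<Longrightarrow> gen i = k" "G \<noteq> {}"
      then obtain i0 where i0: "i0 \<in> G" by blast
      have kF: "k \<in> gen ` F1" using G(1) G(2)[OF i0] i0 by blast
      have "Max (gen ` F1) \<in> gen ` F1" using kF F12 by (intro Max_in) auto
      then obtain i1 where i1: "i1 \<in> F1" "Max (gen ` F1) = gen i1" by blast
      define n where "n = nat (Max (gen ` F1) - k)"
      have nk: "gen i1 = k + int n" using mx[OF kF] i1 by (simp add: n_def)
      have "r \<le> \<delta> powi (k + int n)" using i1 nk by (auto simp: F1_def scl_def)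
      then have rk: "r / \<delta> powi k \<le> \<delta> ^ n" using \<delta>_pos by (simp add: power_int_add field_simps)
      have "(r / \<delta> powi k) powr \<eta> \<le> (\<delta> ^ n) powr \<eta>" using rk r par_pos by (intro powr_mono2) auto
      also have "\<dots> = q1 ^ n" unfolding q1_def using \<delta>_pos by (simp add: powr_realpow[symmetric] powr_powr mult.commute)
      finally have rq: "(r / \<delta> powi k) powr \<eta> \<le> q1 ^ n" .
      have "(\<Sum>i\<in>G. \<bar>cf a i\<bar> * T i) \<le> (\<Sum>i\<in>G. C * KW * (q1 ^ n * exp (- \<nu> * dist (pt i) z / scl i)))"
      proof (rule sum_mono)
        fix i assume i: "i \<in> G"
        have "(r / scl i) powr \<eta> \<le> q1 ^ n" using rq G(2)[OF i] by (simp add: scl_def)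
        then have "C * KW * ((r / scl i) powr \<eta> * exp (- \<nu> * dist (pt i) z / scl i)) \<le> C * KW * (q1 ^ n * exp (- \<nu> * dist (pt i) z / scl i))"
          using par_pos KW(1) by (intro mult_left_mono mult_right_mono) auto
        with one[of i] i G(1) show "\<bar>cf a i\<bar> * T i \<le> C * KW * (q1 ^ n * exp (- \<nu> * dist (pt i) z / scl i))" by fastforce
      qed
      also have "\<dots> = C * KW * q1 ^ n * (\<Sum>i\<in>G. exp (- \<nu> * dist (pt i) z / scl i))" by (simp add: sum_distrib_left mult.assoc)
      also have "\<dots> \<le> C * KW * q1 ^ n * K3"
        using G F12 q1 par_pos KW(1) finite_subset[OF G(1)] by (intro mult_left_mono K3(2)) auto
      finally show "(\<Sum>i\<in>G. \<bar>cf a i\<bar> * T i) \<le> C * KW * K3 * q1 ^ nat (Max (gen ` F1) - k)" by (simp add: n_def mult_ac)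
    qed (use par_pos KW(1) K3(1) q1 in auto)
    \<comment> \<open>What is left of the coefficient once half of the decay has been spent on
      smallness. Summed over one generation it is at most a constant times the L1 norm of a.\<close>
    define H where "H i = (LINT y|M. \<bar>a y\<bar> * exp (- (b / 2) * dist (pt i) y / scl i))" for i
    have iH: "integrable M (\<lambda>y. \<bar>a y\<bar> * exp (- t * dist (pt i) y / scl i))" if "t \<ge> 0" for t i
    proof (rule Bochner_Integration.integrable_bound[OF iaa])
      have "exp (- t * dist (pt i) y / scl i) \<le> 1" for y using that by (simp add: less_imp_le)
      then show "AE y in M. norm (\<bar>a y\<bar> * exp (- t * dist (pt i) y / scl i)) \<le> norm \<bar>a y\<bar>"
        by (intro AE_I2) (simp add: abs_mult mult_left_le)
    qed measurable
    have H0: "0 \<le> H i" for i unfolding H_def by simp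
    have half: "exp (- b * t / scl i) \<le> q2 powr (r / scl i) * exp (- (b / 2) * t / scl i)" if "r / 2 \<le> t" for t i
    proof -
      have "(b / 2) * (r / 2 / scl i) \<le> (b / 2) * (t / scl i)" using b that by (intro mult_left_mono divide_right_mono) (auto simp: less_imp_le)
      then have "- b * t / scl i \<le> - (b / 4) * (r / scl i) + - (b / 2) * t / scl i" by (simp add: field_simps)
      then have "exp (- b * t / scl i) \<le> exp (- (b / 4) * (r / scl i)) * exp (- (b / 2) * t / scl i)" by (simp add: exp_add[symmetric])
      moreover have "q2 powr (r / scl i) = exp (- (b / 4) * (r / scl i))" by (simp add: q2_def powr_def mult.commute)
      ultimately show ?thesis by simp
    qed
    \<comment> \<open>Below the scale r either the coefficient or the mass T is small. If
      \<open>pt i\<close> is at distance at least 3 r / 2 from z, it is at least r / 2 away from the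
      support of the atom; otherwise it is at least r / 2 away from the complement of the doubled
      ball.\<close>
    have two: "\<bar>cf a i\<bar> * T i \<le> E * (q2 powr (r / scl i) * H i)" if i: "i \<in> F2" for i
    proof -
      have iI: "i \<in> I" "i \<in> F" using i F by (auto simp: F2_def)
      let ?v = "sqrt (V M (pt i) (scl i))"
      have vp: "?v > 0" by simp
      have cfH: "\<bar>cf a i\<bar> \<le> C / ?v * (LINT y|M. \<bar>a y\<bar> * exp (- b * dist (pt i) y / scl i))"
      proof -
        have "\<bar>cf a i\<bar> \<le> (LINT y|M. \<bar>a y * w i y\<bar>)" unfolding cf_def by (rule integral_abs_bound)
        also have "\<dots> \<le> (LINT y|M. C / ?v * (\<bar>a y\<bar> * exp (- b * dist (pt i) y / scl i)))"
        proof (rule integral_mono)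
          show "integrable M (\<lambda>y. \<bar>a y * w i y\<bar>)" using integrable_mult_w[OF ia iI(1)] by simp
          show "integrable M (\<lambda>y. C / ?v * (\<bar>a y\<bar> * exp (- b * dist (pt i) y / scl i)))" using iH[of b i] b by (intro integrable_mult_right) auto
          show "\<bar>a y * w i y\<bar> \<le> C / ?v * (\<bar>a y\<bar> * exp (- b * dist (pt i) y / scl i))" for y
            using mult_left_mono[OF wbnd[OF iI(1), of y], of "\<bar>a y\<bar>"] by (simp add: abs_mult mult_ac)
        qed
        finally show ?thesis by simp
      qed
      show ?thesis
      proof (cases "3 / 2 * r \<le> dist (pt i) z")
        case True
        have "(LINT y|M. \<bar>a y\<bar> * exp (- b * dist (pt i) y / scl i)) \<le> (LINT y|M. q2 powr (r / scl i) * (\<bar>a y\<bar> * exp (- (b / 2) * dist (pt i) y / scl i)))"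
        proof (rule integral_mono)
          show "integrable M (\<lambda>y. \<bar>a y\<bar> * exp (- b * dist (pt i) y / scl i))" using iH[of b i] b by simp
          show "integrable M (\<lambda>y. q2 powr (r / scl i) * (\<bar>a y\<bar> * exp (- (b / 2) * dist (pt i) y / scl i)))"
            using iH[of "b / 2" i] b by (intro integrable_mult_right) auto
          fix y
          show "\<bar>a y\<bar> * exp (- b * dist (pt i) y / scl i) \<le> q2 powr (r / scl i) * (\<bar>a y\<bar> * exp (- (b / 2) * dist (pt i) y / scl i))"
          proof (cases "y \<in> ball z r")
            case y: True
            then have "r / 2 \<le> dist (pt i) y" using True dist_triangle[of "pt i" z y] by (simp add: dist_commute)
            from mult_left_mono[OF half[OF this, of i], of "\<bar>a y\<bar>"] show ?thesis by (simp add: mult_ac)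
          qed (simp add: supp)
        qed
        then have "(LINT y|M. \<bar>a y\<bar> * exp (- b * dist (pt i) y / scl i)) \<le> q2 powr (r / scl i) * H i" by (simp add: H_def)
        then have "C / ?v * (LINT y|M. \<bar>a y\<bar> * exp (- b * dist (pt i) y / scl i)) \<le> C / ?v * (q2 powr (r / scl i) * H i)"
          using par_pos by (intro mult_left_mono) (auto simp: less_imp_le)
        with cfH have "\<bar>cf a i\<bar> \<le> C / ?v * (q2 powr (r / scl i) * H i)" by linarith
        then have "\<bar>cf a i\<bar> * T i \<le> C / ?v * (q2 powr (r / scl i) * H i) * (KW * ?v)"
          using T1[OF iI(2)] T0[OF iI(2)] H0 par_pos by (intro mult_mono) (auto simp: less_imp_le)
        also have "\<dots> = C * KW * (q2 powr (r / scl i) * H i)" by simp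
        also have "\<dots> \<le> E * (q2 powr (r / scl i) * H i)" using E H0 by (intro mult_right_mono) auto
        finally show ?thesis .
      next
        case False
        have "T i \<le> (LINT y|M. D / ?v * (q2 powr (r / scl i) * exp (- (b / 2) * dist (pt i) y / scl i)))"
          unfolding T_def
        proof (rule integral_mono[OF iT[OF iI(2)]])
          show "integrable M (\<lambda>y. D / ?v * (q2 powr (r / scl i) * exp (- (b / 2) * dist (pt i) y / scl i)))"
            using K1(2) by (intro integrable_mult_right) auto
          fix y
          have R0: "0 \<le> D / ?v * (q2 powr (r / scl i) * exp (- (b / 2) * dist (pt i) y / scl i))" using D by (simp add: less_imp_le)
          show "fr y * sqrt (W i y) \<le> D / ?v * (q2 powr (r / scl i) * exp (- (b / 2) * dist (pt i) y / scl i))"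
          proof (cases "y \<in> ?N")
            case True then show ?thesis using R0 by (simp add: fr_def)
          next
            case y: False
            then have "r / 2 \<le> dist (pt i) y" using False dist_triangle[of z y "pt i"] by (simp add: dist_commute)
            from mult_left_mono[OF half[OF this, of i], of "D / ?v"] Wb[OF iI(1), of y] D
            have "sqrt (W i y) \<le> D / ?v * (q2 powr (r / scl i) * exp (- (b / 2) * dist (pt i) y / scl i))" by (simp add: less_imp_le)
            then show ?thesis using y by (simp add: fr_def)
          qed
        qed
        also have "\<dots> = D / ?v * q2 powr (r / scl i) * (LINT y|M. exp (- (b / 2) * dist (pt i) y / scl i))" by simp
        also have "\<dots> \<le> D / ?v * q2 powr (r / scl i) * (K1 * V M (pt i) (scl i))"
          using D by (intro mult_left_mono K1(3)) (auto simp: less_imp_le)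
        also have "\<dots> = D * K1 * q2 powr (r / scl i) * ?v"
        proof -
          have "V M (pt i) (scl i) = ?v * ?v" by simp
          then show ?thesis using vp by (simp add: field_simps)
        qed
        finally have T2: "T i \<le> D * K1 * q2 powr (r / scl i) * ?v" .
        have "(LINT y|M. \<bar>a y\<bar> * exp (- b * dist (pt i) y / scl i)) \<le> H i"
          unfolding H_def
        proof (rule integral_mono)
          show "integrable M (\<lambda>y. \<bar>a y\<bar> * exp (- b * dist (pt i) y / scl i))" "integrable M (\<lambda>y. \<bar>a y\<bar> * exp (- (b / 2) * dist (pt i) y / scl i))"
            using iH[of b i] iH[of "b / 2" i] b by auto
          fix y
          have "(b / 2) * (dist (pt i) y / scl i) \<le> b * (dist (pt i) y / scl i)" using b by (intro mult_right_mono) (auto simp: less_imp_le)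
          then show "\<bar>a y\<bar> * exp (- b * dist (pt i) y / scl i) \<le> \<bar>a y\<bar> * exp (- (b / 2) * dist (pt i) y / scl i)"
            by (intro mult_left_mono) auto
        qed
        then have "C / ?v * (LINT y|M. \<bar>a y\<bar> * exp (- b * dist (pt i) y / scl i)) \<le> C / ?v * H i"
          using par_pos by (intro mult_left_mono) (auto simp: less_imp_le)
        with cfH have "\<bar>cf a i\<bar> \<le> C / ?v * H i" by linarith
        then have "\<bar>cf a i\<bar> * T i \<le> C / ?v * H i * (D * K1 * q2 powr (r / scl i) * ?v)"
          using T2 T0[OF iI(2)] H0 par_pos by (intro mult_mono) (auto simp: less_imp_le)
        also have "\<dots> = C * (D * K1) * (q2 powr (r / scl i) * H i)" using vp by simp
        also have "\<dots> \<le> E * (q2 powr (r / scl i) * H i)" using E H0 by (intro mult_right_mono) auto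
        finally show ?thesis .
      qed
    qed
    \<comment> \<open>Generations are counted from the coarsest one in F2, whose scale is below r.
      Hence r / \<delta>^k \<ge> \<delta>^(- n) \<ge> n for the generation k that is n steps
      finer.\<close>
    have sum2: "(\<Sum>i\<in>F2. \<bar>cf a i\<bar> * T i) \<le> (E * K2) / (1 - q2)"
    proof (rule sum_by_gen_le[OF F12(3,4), where g = "\<lambda>k. nat (k - Min (gen ` F2))"])
      have mn: "Min (gen ` F2) \<le> k" if "k \<in> gen ` F2" for k using that F12 by auto
      then show "inj_on (\<lambda>k. nat (k - Min (gen ` F2))) (gen ` F2)"
        by (intro inj_onI) (metis eq_nat_nat_iff diff_ge_0_iff_ge add_diff_cancel_left' diff_add_cancel)
      fix k G assume G: "G \<subseteq> F2" "\<And>i. i \<in> G \<Longrightarrow> gen i = k" "G \<noteq> {}"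
      then obtain i0 where i0: "i0 \<in> G" by blast
      have kF: "k \<in> gen ` F2" using G(1) G(2)[OF i0] i0 by blast
      have "Min (gen ` F2) \<in> gen ` F2" using kF F12 by (intro Min_in) auto
      then obtain i1 where i1: "i1 \<in> F2" "Min (gen ` F2) = gen i1" by blast
      define n where "n = nat (k - Min (gen ` F2))"
      have nk: "k = gen i1 + int n" using mn[OF kF] i1 by (simp add: n_def)
      have "\<delta> powi (gen i1) \<le> r" using i1 by (auto simp: F2_def scl_def)
      moreover have "real n \<le> (1 / \<delta>) ^ n"
      proof -
        have "real n \<le> 2 ^ n" using of_nat_less_two_power[of n, where ?'a = real] by linarith
        also have "\<dots> \<le> (1 / \<delta>) ^ n" using \<delta>_pos \<delta>_le by (intro power_mono) (auto simp: field_simps)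
        finally show ?thesis .
      qed
      moreover have "(1 / \<delta>) ^ n = \<delta> powi (gen i1) / \<delta> powi k" unfolding nk using \<delta>_pos by (simp add: power_int_add power_divide)
      moreover have "\<delta> powi (gen i1) / \<delta> powi k \<le> r / \<delta> powi k" using calculation(1) by (intro divide_right_mono) auto
      ultimately have rn: "real n \<le> r / \<delta> powi k" by linarith
      have "q2 powr (r / \<delta> powi k) \<le> q2 powr (real n)" using q2 rn by (intro powr_mono') auto
      also have "\<dots> = q2 ^ n" using q2 by (simp add: powr_realpow)
      finally have rq: "q2 powr (r / \<delta> powi k) \<le> q2 ^ n" .
      have "(\<Sum>i\<in>G. \<bar>cf a i\<bar> * T i) \<le> (\<Sum>i\<in>G. E * (q2 ^ n * H i))"
      proof (rule sum_mono)
        fix i assume i: "i \<in> G"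
        have "q2 powr (r / scl i) \<le> q2 ^ n" using rq G(2)[OF i] by (simp add: scl_def)
        then have "E * (q2 powr (r / scl i) * H i) \<le> E * (q2 ^ n * H i)" using E H0 by (intro mult_left_mono mult_right_mono) auto
        with two[of i] i G(1) show "\<bar>cf a i\<bar> * T i \<le> E * (q2 ^ n * H i)" by fastforce
      qed
      also have "\<dots> = E * q2 ^ n * (\<Sum>i\<in>G. H i)" by (simp add: sum_distrib_left mult.assoc)
      also have "\<dots> \<le> E * q2 ^ n * K2"
      proof (intro mult_left_mono)
        have b20: "0 \<le> b / 2" using b by simp
        have "(\<Sum>i\<in>G. H i) = (LINT y|M. (\<Sum>i\<in>G. \<bar>a y\<bar> * exp (- (b / 2) * dist (pt i) y / scl i)))"
          unfolding H_def by (intro Bochner_Integration.integral_sum[symmetric] iH b20)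
        also have "\<dots> \<le> (LINT y|M. \<bar>a y\<bar> * K2)"
        proof (rule integral_mono)
          show "integrable M (\<lambda>y. \<Sum>i\<in>G. \<bar>a y\<bar> * exp (- (b / 2) * dist (pt i) y / scl i))"
            by (intro Bochner_Integration.integrable_sum iH b20)
          show "integrable M (\<lambda>y. \<bar>a y\<bar> * K2)" using iaa by (rule integrable_mult_left)
          fix y
          have "(\<Sum>i\<in>G. exp (- (b / 2) * dist (pt i) y / scl i)) \<le> K2"
            using G F12 finite_subset[OF G(1)] by (intro K2(2)) auto
          from mult_left_mono[OF this, of "\<bar>a y\<bar>"]
          show "(\<Sum>i\<in>G. \<bar>a y\<bar> * exp (- (b / 2) * dist (pt i) y / scl i)) \<le> \<bar>a y\<bar> * K2" by (simp add: sum_distrib_left)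
        qed
        also have "\<dots> = (LINT y|M. \<bar>a y\<bar>) * K2" by simp
        also have "\<dots> \<le> 1 * K2" using a1 K2(1) by (intro mult_right_mono) auto
        finally show "(\<Sum>i\<in>G. H i) \<le> K2" by simp
      qed (use E q2 in auto)
      finally show "(\<Sum>i\<in>G. \<bar>cf a i\<bar> * T i) \<le> E * K2 * q2 ^ nat (k - Min (gen ` F2))" by (simp add: n_def mult_ac)
    qed (use E K2(1) q2 in auto)
    have "(\<Sum>i\<in>F. \<bar>cf a i\<bar> * T i) = (\<Sum>i\<in>F1. \<bar>cf a i\<bar> * T i) + (\<Sum>i\<in>F2. \<bar>cf a i\<bar> * T i)"
    proof -
      have "F = F1 \<union> F2" "F1 \<inter> F2 = {}" by (auto simp: F1_def F2_def)
      then show ?thesis using F12 by (simp add: sum.union_disjoint)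
    qed
    then show ?thesis using split near far sum1 sum2 unfolding S_def K_def by linarith
  qed
  then show ?thesis using K by blast
qed

section \<open>From atoms to the Hardy space\<close>

lemma cf_add: "integrable M f \<Longrightarrow> integrable M g \<Longrightarrow> i \<in> I \<Longrightarrow> cf (\<lambda>y. f y + g y) i = cf f i + cf g i"
  unfolding cf_def using integrable_mult_w by (simp add: distrib_right)

lemma cf_cmult: "cf (\<lambda>y. t * f y) i = t * cf f i"
  unfolding cf_def by (simp add: mult.assoc)

lemma cf_diff: "integrable M f \<Longrightarrow> integrable M g \<Longrightarrow> i \<in> I \<Longrightarrow> cf (\<lambda>y. f y - g y) i = cf f i - cf g i"
  unfolding cf_def using integrable_mult_w by (simp add: left_diff_distrib)

lemma cf_le: 
  assumes "integrable M f" "i \<in> I"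
  shows "\<bar>cf f i\<bar> \<le> C / sqrt (V M (pt i) (scl i)) * (LINT y|M. \<bar>f y\<bar>)"
proof -
  have "\<bar>cf f i\<bar> \<le> (LINT y|M. \<bar>f y * w i y\<bar>)" unfolding cf_def by (rule integral_abs_bound)
  also have "\<dots> \<le> (LINT y|M. C / sqrt (V M (pt i) (scl i)) * \<bar>f y\<bar>)"
  proof (rule integral_mono)
    show "integrable M (\<lambda>y. \<bar>f y * w i y\<bar>)" using integrable_mult_w[OF assms] by (rule integrable_abs)
    show "integrable M (\<lambda>y. C / sqrt (V M (pt i) (scl i)) * \<bar>f y\<bar>)" using assms(1) by (intro integrable_mult_right integrable_abs)
    show "\<bar>f y * w i y\<bar> \<le> C / sqrt (V M (pt i) (scl i)) * \<bar>f y\<bar>" for y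
      using mult_left_mono[OF w_bounded[OF assms(2), of y], of "\<bar>f y\<bar>"] by (simp add: abs_mult mult.commute)
  qed
  finally show ?thesis by simp
qed

lemma sqfun_cong: "(\<And>i. i \<in> F \<Longrightarrow> c i = d i) \<Longrightarrow> sqfun c W F = sqfun d W F"
  unfolding sqfun_def by auto

text \<open>Sublinearity gives the bound for partial atomic sums. As F is finite and each
  coefficient is continuous in L1, the bound passes to the limit, with a constant independent of
  F.\<close>

theorem sqfun_H1_le:
  assumes W: "adm W"
  shows "\<exists>K>0. \<forall>f L F. H1_le M f L \<longrightarrow> finite F \<longrightarrow> F \<subseteq> I \<longrightarrow> (LINT y|M. sqfun (cf f) W F y) \<le> K * L"
proof -
  obtain K where K: "K > 0" "\<And>a F. atom M a \<Longrightarrow> finite F \<Longrightarrow> F \<subseteq> I \<Longrightarrow> (LINT y|M. sqfun (cf a) W F y) \<le> K"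
    using sqfun_atom[OF W] by blast
  have "(LINT y|M. sqfun (cf f) W F y) \<le> K * L" if f: "H1_le M f L" and F: "finite F" "F \<subseteq> I" for f L F
  proof -
    have Wn: "\<forall>i\<in>F. \<forall>y. 0 \<le> W i y" using adm_nonneg[OF W] F(2) by blast
    note si = sqfun_integrable[OF W F]
    obtain lam a where rep: "H1_repr M f lam a" and L: "(\<Sum>j. \<bar>lam j\<bar>) \<le> L" using H1_le_props(5)[OF f] by blast
    have at: "\<And>j. atom M (a j)" and su: "summable (\<lambda>j. \<bar>lam j\<bar>)" and conv: "L1_conv M (\<lambda>n y. \<Sum>j<n. lam j * a j y) f"
      using rep unfolding H1_repr_def by auto
    have fi: "integrable M f" by (rule H1_le_props(1)[OF f])
    have ai: "integrable M (\<lambda>y. lam j * a j y)" for j using atom_integrable[OF at[of j]] by simp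
    define p where "p n y = (\<Sum>j<n. lam j * a j y)" for n y
    have pi: "integrable M (p n)" for n unfolding p_def using ai by (intro Bochner_Integration.integrable_sum)
    have part: "(LINT y|M. sqfun (cf (p n)) W F y) \<le> (\<Sum>j<n. \<bar>lam j\<bar> * K)" for n
    proof (induction n)
      case 0
      have "cf (p 0) i = 0" for i by (simp add: cf_def p_def)
      then have "sqfun (cf (p 0)) W F = (\<lambda>_. 0)" unfolding sqfun_def by auto
      then show ?case by simp
    next
      case (Suc n)
      have e: "p (Suc n) = (\<lambda>y. p n y + lam n * a n y)" by (auto simp: p_def)
      have "sqfun (cf (p (Suc n))) W F = sqfun (\<lambda>i. cf (p n) i + lam n * cf (a n) i) W F"
        unfolding e using cf_add[OF pi ai] F by (intro sqfun_cong) (auto simp: cf_cmult)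
      then have "(LINT y|M. sqfun (cf (p (Suc n))) W F y) \<le> (LINT y|M. sqfun (cf (p n)) W F y + \<bar>lam n\<bar> * sqfun (cf (a n)) W F y)"
        using si sqfun_add_le[OF Wn, where c = "cf (p n)" and d = "\<lambda>i. lam n * cf (a n) i"]
        by (intro integral_mono) (auto simp: sqfun_cmult)
      also have "\<dots> = (LINT y|M. sqfun (cf (p n)) W F y) + \<bar>lam n\<bar> * (LINT y|M. sqfun (cf (a n)) W F y)"
        using si by simp
      also have "\<dots> \<le> (\<Sum>j<n. \<bar>lam j\<bar> * K) + \<bar>lam n\<bar> * K"
        using Suc by (intro add_mono mult_left_mono K(2) at F) auto
      finally show ?case by simp
    qed
    have le: "(LINT y|M. sqfun (cf f) W F y) \<le> K * L + (\<Sum>i\<in>F. \<bar>cf (\<lambda>y. f y - p n y) i\<bar> * (LINT y|M. sqrt (W i y)))" for n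
    proof -
      have fe: "f = (\<lambda>y. p n y + (f y - p n y))" by auto
      have di: "integrable M (\<lambda>y. f y - p n y)" using fi pi by simp
      have "sqfun (cf f) W F = sqfun (\<lambda>i. cf (p n) i + cf (\<lambda>y. f y - p n y) i) W F"
        using F by (intro sqfun_cong, subst fe, subst cf_add[OF pi di]) auto
      then have "(LINT y|M. sqfun (cf f) W F y) \<le> (LINT y|M. sqfun (cf (p n)) W F y + sqfun (cf (\<lambda>y. f y - p n y)) W F y)"
        using si sqfun_add_le[OF Wn, where c = "cf (p n)" and d = "cf (\<lambda>y. f y - p n y)"] by (intro integral_mono) auto
      also have "\<dots> = (LINT y|M. sqfun (cf (p n)) W F y) + (LINT y|M. sqfun (cf (\<lambda>y. f y - p n y)) W F y)" using si by simp
      also have "(LINT y|M. sqfun (cf (p n)) W F y) \<le> K * L"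
      proof -
        have "(\<Sum>j<n. \<bar>lam j\<bar> * K) = K * (\<Sum>j<n. \<bar>lam j\<bar>)" by (simp add: sum_distrib_left mult.commute)
        also have "\<dots> \<le> K * (\<Sum>j. \<bar>lam j\<bar>)" using K su by (intro mult_left_mono sum_le_suminf) auto
        also have "\<dots> \<le> K * L" using K L by (intro mult_left_mono) auto
        finally show ?thesis using part[of n] by linarith
      qed
      finally show ?thesis using si(2)[of "cf (\<lambda>y. f y - p n y)"] by linarith
    qed
    have "(\<lambda>n. \<bar>cf (\<lambda>y. f y - p n y) i\<bar>) \<longlonglongrightarrow> 0" if i: "i \<in> F" for i
    proof -
      have iI: "i \<in> I" using i F by auto
      have c0: "(\<lambda>n. (LINT y|M. \<bar>f y - p n y\<bar>)) \<longlonglongrightarrow> 0"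
      proof -
        have "(\<lambda>n. ennreal (LINT y|M. \<bar>f y - p n y\<bar>)) \<longlonglongrightarrow> ennreal 0"
        proof -
          have "ennreal (LINT y|M. \<bar>f y - p n y\<bar>) = (\<integral>\<^sup>+ y. ennreal \<bar>(\<Sum>j<n. lam j * a j y) - f y\<bar> \<partial>M)" for n
          proof -
            have "integrable M (\<lambda>y. \<bar>f y - p n y\<bar>)" using fi pi by simp
            from nn_integral_eq_integral[OF this] show ?thesis by (simp add: p_def abs_minus_commute)
          qed
          then show ?thesis using conv by (simp add: L1_conv_def)
        qed
        then show ?thesis by (subst (asm) tendsto_ennreal_iff) auto
      qed
      show ?thesis
      proof (rule tendsto_sandwich[OF _ _ tendsto_const])
        show "(\<lambda>n. C / sqrt (V M (pt i) (scl i)) * (LINT y|M. \<bar>f y - p n y\<bar>)) \<longlonglongrightarrow> 0"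
          using tendsto_mult_left[OF c0, of "C / sqrt (V M (pt i) (scl i))"] by simp
        show "\<forall>\<^sub>F n in sequentially. \<bar>cf (\<lambda>y. f y - p n y) i\<bar> \<le> C / sqrt (V M (pt i) (scl i)) * (LINT y|M. \<bar>f y - p n y\<bar>)"
          using fi pi by (intro always_eventually allI cf_le iI) auto
      qed auto
    qed
    then have "(\<lambda>n. K * L + (\<Sum>i\<in>F. \<bar>cf (\<lambda>y. f y - p n y) i\<bar> * (LINT y|M. sqrt (W i y)))) \<longlonglongrightarrow> K * L + (\<Sum>i\<in>F. 0 * (LINT y|M. sqrt (W i y)))"
      by (intro tendsto_add tendsto_const tendsto_sum tendsto_mult)
    then have "(\<lambda>n. K * L + (\<Sum>i\<in>F. \<bar>cf (\<lambda>y. f y - p n y) i\<bar> * (LINT y|M. sqrt (W i y)))) \<longlonglongrightarrow> K * L" by simp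
    then show ?thesis by (rule LIMSEQ_le_const) (use le in auto)
  qed
  then show ?thesis using K(1) by blast
qed

end

section \<open>Wavelet series and equivalent norms\<close>

lemma L1_conv_iff:
  assumes "\<And>n. integrable M (S n)" "integrable M f"
  shows "L1_conv M S f \<longleftrightarrow> (\<lambda>n. LINT y|M. \<bar>S n y - f y\<bar>) \<longlonglongrightarrow> (0::real)"
proof -
  have "(\<integral>\<^sup>+ y. ennreal \<bar>S n y - f y\<bar> \<partial>M) = ennreal (LINT y|M. \<bar>S n y - f y\<bar>)" for n
    using assms by (intro nn_integral_eq_integral) auto
  then have "L1_conv M S f \<longleftrightarrow> (\<lambda>n. ennreal (LINT y|M. \<bar>S n y - f y\<bar>)) \<longlonglongrightarrow> ennreal 0"
    by (simp add: L1_conv_def)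
  also have "\<dots> \<longleftrightarrow> (\<lambda>n. LINT y|M. \<bar>S n y - f y\<bar>) \<longlonglongrightarrow> 0"
    by (rule tendsto_ennreal_iff) auto
  finally show ?thesis .
qed

lemma sqfun_mono_set:
  assumes "\<forall>i\<in>G. \<forall>y. 0 \<le> W i y" "finite G" "F \<subseteq> G"
  shows "sqfun c W F y \<le> sqfun c W G y"
  unfolding sqfun_def using assms by (intro real_sqrt_le_mono sum_mono2) auto

context wavelet_space
begin

definition Ssup :: "(int \<times> 'i \<times> 'i \<Rightarrow> real) \<Rightarrow> (int \<times> 'i \<times> 'i \<Rightarrow> 'a \<Rightarrow> real) \<Rightarrow> 'a \<Rightarrow> ennreal" where
  "Ssup c W y = (SUP F\<in>{F. finite F \<and> F \<subseteq> I}. ennreal (sqfun c W F y))"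

lemma sq_norm_eq: "sq_norm M I c W = (\<integral>\<^sup>+ y. Ssup c W y \<partial>M)"
  unfolding sq_norm_def Ssup_def sqfun_def ..

lemma Ssup_upper: "finite F \<Longrightarrow> F \<subseteq> I \<Longrightarrow> ennreal (sqfun c W F y) \<le> Ssup c W y"
  unfolding Ssup_def by (rule SUP_upper) auto

lemma enum_cover:
  assumes e: "bij_betw e (UNIV :: nat set) I" and F: "finite F" "F \<subseteq> I"
  shows "\<exists>n. F \<subseteq> e ` {..<n}"
proof -
  have "\<exists>m. e m = i" if "i \<in> F" for i using e that F by (metis bij_betw_imp_surj_on imageE subsetD)
  then obtain g where g: "\<And>i. i \<in> F \<Longrightarrow> e (g i) = i" by metis
  have "F \<subseteq> e ` {..<Suc (Max (g ` F))}"
  proof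
    fix i assume "i \<in> F"
    then show "i \<in> e ` {..<Suc (Max (g ` F))}" using g[of i] F by (intro image_eqI[of _ _ "g i"]) (auto simp: less_Suc_eq_le)
  qed
  then show ?thesis by blast
qed

lemma enum_subset: "bij_betw e (UNIV :: nat set) I \<Longrightarrow> e ` X \<subseteq> I"
  by (auto simp: bij_betw_def)

text \<open>Along an enumeration the supremum over all finite sets becomes that of an increasing
  sequence, which brings measurability and monotone convergence.\<close>

lemma Ssup_eq:
  assumes e: "bij_betw e (UNIV :: nat set) I" and W: "adm W"
  shows "Ssup c W y = (SUP n. ennreal (sqfun c W (e ` {..<n}) y))"
proof (rule antisym)
  show "Ssup c W y \<le> (SUP n. ennreal (sqfun c W (e ` {..<n}) y))"
    unfolding Ssup_def
  proof (rule SUP_least)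
    fix F assume F: "F \<in> {F. finite F \<and> F \<subseteq> I}"
    then obtain n where n: "F \<subseteq> e ` {..<n}" using enum_cover[OF e] by blast
    have "\<forall>i\<in>e ` {..<n}. \<forall>y. 0 \<le> W i y" using adm_nonneg[OF W] enum_subset[OF e] by blast
    then have "ennreal (sqfun c W F y) \<le> ennreal (sqfun c W (e ` {..<n}) y)"
      by (intro ennreal_leI sqfun_mono_set n) auto
    also have "\<dots> \<le> (SUP n. ennreal (sqfun c W (e ` {..<n}) y))" by (rule SUP_upper) simp
    finally show "ennreal (sqfun c W F y) \<le> (SUP n. ennreal (sqfun c W (e ` {..<n}) y))" .
  qed
  show "(SUP n. ennreal (sqfun c W (e ` {..<n}) y)) \<le> Ssup c W y"
    by (intro SUP_least Ssup_upper enum_subset[OF e]) auto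
qed

lemma Ssup_measurable:
  assumes e: "bij_betw e (UNIV :: nat set) I" and W: "adm W"
  shows "Ssup c W \<in> borel_measurable M"
proof -
  have [measurable]: "sqfun c W (e ` {..<n}) \<in> borel_measurable M" for n
    using sqfun_integrable(1)[OF W, of "e ` {..<n}" c] enum_subset[OF e] by auto
  have "(\<lambda>y. SUP n. ennreal (sqfun c W (e ` {..<n}) y)) \<in> borel_measurable M" by measurable
  moreover have "Ssup c W = (\<lambda>y. SUP n. ennreal (sqfun c W (e ` {..<n}) y))" by (rule ext) (rule Ssup_eq[OF e W])
  ultimately show ?thesis by simp
qed

lemma sq_norm_least:
  assumes e: "bij_betw e (UNIV :: nat set) I" and W: "adm W"
    and le: "\<And>F. finite F \<Longrightarrow> F \<subseteq> I \<Longrightarrow> (LINT y|M. sqfun c W F y) \<le> K"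
  shows "sq_norm M I c W \<le> ennreal K"
proof -
  have Wn: "\<forall>i\<in>e ` {..<n}. \<forall>y. 0 \<le> W i y" for n using adm_nonneg[OF W] enum_subset[OF e] by blast
  have int: "integrable M (sqfun c W (e ` {..<n}))" for n
    using sqfun_integrable(1)[OF W, of "e ` {..<n}" c] enum_subset[OF e] by auto
  have "sq_norm M I c W = (\<integral>\<^sup>+ y. (SUP n. ennreal (sqfun c W (e ` {..<n}) y)) \<partial>M)"
    unfolding sq_norm_eq Ssup_eq[OF e W] ..
  also have "\<dots> = (SUP n. \<integral>\<^sup>+ y. ennreal (sqfun c W (e ` {..<n}) y) \<partial>M)"
  proof (rule nn_integral_monotone_convergence_SUP)
    show "incseq (\<lambda>n y. ennreal (sqfun c W (e ` {..<n}) y))"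
      by (intro incseq_SucI le_funI ennreal_leI sqfun_mono_set Wn) auto
    show "(\<lambda>y. ennreal (sqfun c W (e ` {..<n}) y)) \<in> borel_measurable M" for n
      using int[of n] by measurable
  qed
  also have "\<dots> \<le> ennreal K"
  proof (rule SUP_least)
    fix n
    have "(\<integral>\<^sup>+ y. ennreal (sqfun c W (e ` {..<n}) y) \<partial>M) = ennreal (LINT y|M. sqfun c W (e ` {..<n}) y)"
      by (rule nn_integral_eq_integral[OF int]) (simp add: sqfun_nonneg[OF Wn])
    also have "\<dots> \<le> ennreal K" by (intro ennreal_leI le enum_subset[OF e]) auto
    finally show "(\<integral>\<^sup>+ y. ennreal (sqfun c W (e ` {..<n}) y) \<partial>M) \<le> ennreal K" .
  qed
  finally show ?thesis .
qed

definition WIV :: "int \<times> 'i \<times> 'i \<Rightarrow> 'a \<Rightarrow> real" where "WIV i y = indicator (cub i) y / measure M (cub i)"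

lemma adm_WIV: "adm WIV"
proof -
  obtain K where K: "K > 0" "\<And>i. i \<in> I \<Longrightarrow> V M (pt i) (scl i) \<le> K * measure M (cub i)"
    using cub_measure by blast
  show ?thesis
  proof (rule admI[of "sqrt K * exp 8" 1])
    show "sqrt (WIV i y) \<le> sqrt K * exp 8 / sqrt (V M (pt i) (scl i)) * exp (- 1 * dist (pt i) y / scl i)"
      if i: "i \<in> I" for i y
    proof (cases "y \<in> cub i")
      case True
      then have "dist (pt i) y < 8 * scl i" using cub_sub_ball[OF i] by auto
      \<comment> \<open>The cube lies within 8 \<open>scl i\<close> of \<open>pt i\<close>, so with
        the constant exp 8 an exponential dominates its indicator.\<close>
      then have d: "1 \<le> exp 8 * exp (- 1 * dist (pt i) y / scl i)" by (simp add: exp_add[symmetric] field_simps)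
      have "sqrt (WIV i y) = sqrt (1 / measure M (cub i))" using True by (simp add: WIV_def)
      also have "\<dots> \<le> sqrt (K / V M (pt i) (scl i))"
        using K(2)[OF i] cub_pos[OF i] by (intro real_sqrt_le_mono) (simp add: field_simps)
      also have "\<dots> = sqrt K / sqrt (V M (pt i) (scl i)) * 1" by (simp add: real_sqrt_divide)
      also have "\<dots> \<le> sqrt K / sqrt (V M (pt i) (scl i)) * (exp 8 * exp (- 1 * dist (pt i) y / scl i))"
        using d K(1) by (intro mult_left_mono) auto
      finally show ?thesis by (simp add: mult_ac)
    next
      case False
      then show ?thesis using K(1) by (simp add: WIV_def)
    qed
    show "WIV i \<in> borel_measurable M" if "i \<in> I" for i
      using that unfolding WIV_def[abs_def] by measurable
    show "0 \<le> WIV i y" for i y by (simp add: WIV_def)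
  qed (use K(1) in auto)
qed

lemma WV_le_WIV: "i \<in> I \<Longrightarrow> WV i y \<le> WIV i y"
  using wb_sub[of i] by (auto simp: WV_def WIV_def indicator_def)

lemma adm_WV: "adm WV"
proof -
  obtain D s where D: "D > 0" "s > 0" "\<And>i y. i \<in> I \<Longrightarrow> sqrt (WIV i y) \<le> D / sqrt (V M (pt i) (scl i)) * exp (- s * dist (pt i) y / scl i)"
    using adm_WIV unfolding adm_def by blast
  show ?thesis
  proof (rule admI[OF D(1,2)])
    show "sqrt (WV i y) \<le> D / sqrt (V M (pt i) (scl i)) * exp (- s * dist (pt i) y / scl i)" if "i \<in> I" for i y
      using real_sqrt_le_mono[OF WV_le_WIV[OF that, of y]] D(3)[OF that, of y] by linarith
  qed auto
qed

text \<open>The square functions of the tails tend to zero almost everywhere and are dominated by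
  the full one, so their integrals \<open>t n\<close> tend to zero. They bound every finite sum that
  avoids the first n indices, whatever its terms; this is the source of unconditional
  convergence.\<close>

lemma square_tail:
  assumes e: "bij_betw e (UNIV :: nat set) I" and fin: "sq_norm M I c WV < \<infinity>"
  shows "\<exists>t. t \<longlonglongrightarrow> 0 \<and> ennreal (t 0) \<le> sq_norm M I c WV \<and> (\<forall>n. 0 \<le> t n) \<and>
    (\<forall>n F. finite F \<longrightarrow> F \<subseteq> I - e ` {..<n} \<longrightarrow> (LINT y|M. sqfun c WV F y) \<le> t n)"
proof -
  have inj: "inj e" using e by (simp add: bij_betw_def)
  define g where "g y m = (c (e m))\<^sup>2 * WV (e m) y" for y m
  have g0: "0 \<le> g y m" for y m by (simp add: g_def)
  have [measurable]: "(\<lambda>y. g y m) \<in> borel_measurable M" for m unfolding g_def by measurable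
  define \<tau> where "\<tau> n y = sqrt (\<Sum>m. g y (m + n))" for n y
  have [measurable]: "\<tau> n \<in> borel_measurable M" for n unfolding \<tau>_def by measurable
  have sg: "sqfun c WV (e ` {..<n}) y = sqrt (\<Sum>m<n. g y m)" for n y
    unfolding sqfun_def g_def using inj by (subst sum.reindex) (auto simp: inj_on_def)
  have ae: "AE y in M. Ssup c WV y \<noteq> \<infinity>"
    using fin unfolding sq_norm_eq by (intro nn_integral_PInf_AE Ssup_measurable[OF e adm_WV]) auto
  \<comment> \<open>Wherever the full square function is finite, its square bounds all partial sums,
    and the pointwise series of squares converges.\<close>
  have bd: "(\<Sum>m<n. g y m) \<le> (enn2real (Ssup c WV y))\<^sup>2" if "Ssup c WV y \<noteq> \<infinity>" for y n
  proof -
    have "ennreal (sqrt (\<Sum>m<n. g y m)) \<le> Ssup c WV y"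
      using Ssup_upper[of "e ` {..<n}" c WV y] enum_subset[OF e] by (simp add: sg)
    then have "sqrt (\<Sum>m<n. g y m) \<le> enn2real (Ssup c WV y)"
      using enn2real_mono[of "ennreal (sqrt (\<Sum>m<n. g y m))" "Ssup c WV y"] that g0
      by (auto simp: sum_nonneg less_top)
    then have "(sqrt (\<Sum>m<n. g y m))\<^sup>2 \<le> (enn2real (Ssup c WV y))\<^sup>2" using g0 by (intro power_mono) (auto simp: sum_nonneg)
    then show ?thesis using g0 by (simp add: sum_nonneg)
  qed
  have summ: "AE y in M. summable (g y)"
    using ae by eventually_elim (rule summableI_nonneg_bounded[OF g0 bd])
  have \<tau>0: "AE y in M. ennreal (\<tau> 0 y) \<le> Ssup c WV y"
    using ae summ
  proof eventually_elim
    case (elim y)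
    have "suminf (g y) \<le> (enn2real (Ssup c WV y))\<^sup>2" by (rule suminf_le_const[OF elim(2) bd[OF elim(1)]])
    then have "\<tau> 0 y \<le> enn2real (Ssup c WV y)" unfolding \<tau>_def by (intro real_le_lsqrt) (auto intro: suminf_nonneg elim g0)
    then have "ennreal (\<tau> 0 y) \<le> ennreal (enn2real (Ssup c WV y))" by (rule ennreal_leI)
    also have "\<dots> = Ssup c WV y" using elim by (intro ennreal_enn2real) (simp add: less_top)
    finally show ?case .
  qed
  have i0: "integrable M (\<tau> 0)"
  proof (unfold integrable_iff_bounded, intro conjI)
    have "AE y in M. ennreal (norm (\<tau> 0 y)) \<le> Ssup c WV y"
      using \<tau>0 summ by eventually_elim (simp add: \<tau>_def suminf_nonneg g0)
    then have "(\<integral>\<^sup>+ y. ennreal (norm (\<tau> 0 y)) \<partial>M) \<le> sq_norm M I c WV"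
      unfolding sq_norm_eq by (rule nn_integral_mono_AE)
    then show "(\<integral>\<^sup>+ y. ennreal (norm (\<tau> 0 y)) \<partial>M) < \<infinity>" using fin by (simp add: order_le_less_trans)
  qed measurable
  have \<tau>n: "0 \<le> \<tau> n y" "\<tau> n y \<le> \<tau> 0 y" if "summable (g y)" for n y
  proof -
    have s: "summable (\<lambda>m. g y (m + n))" using that by (simp add: summable_iff_shift)
    show "0 \<le> \<tau> n y" unfolding \<tau>_def using s g0 by (simp add: suminf_nonneg)
    have "(\<Sum>m. g y (m + n)) \<le> (\<Sum>m. g y m)"
      using suminf_split_initial_segment[OF that, of n] g0 by (simp add: sum_nonneg)
    then show "\<tau> n y \<le> \<tau> 0 y" unfolding \<tau>_def by simp
  qed
  have i: "integrable M (\<tau> n)" for n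
  proof (rule Bochner_Integration.integrable_bound[OF i0])
    show "AE y in M. norm (\<tau> n y) \<le> norm (\<tau> 0 y)" using summ by eventually_elim (use \<tau>n in \<open>auto simp: abs_of_nonneg\<close>)
  qed measurable
  define t where "t n = (LINT y|M. \<tau> n y)" for n
  have "t \<longlonglongrightarrow> (LINT y|M. 0)"
    unfolding t_def
  proof (rule integral_dominated_convergence[OF _ _ i0])
    show "AE y in M. (\<lambda>n. \<tau> n y) \<longlonglongrightarrow> 0"
      using summ
    proof eventually_elim
      case (elim y)
      have "(\<lambda>n. \<Sum>m. g y (m + n)) \<longlonglongrightarrow> 0" by (rule suminf_exist_split2[OF elim])
      then have "(\<lambda>n. sqrt (\<Sum>m. g y (m + n))) \<longlonglongrightarrow> sqrt 0" by (rule tendsto_real_sqrt)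
      then show ?case by (simp add: \<tau>_def)
    qed
    show "AE y in M. norm (\<tau> n y) \<le> \<tau> 0 y" for n using summ by eventually_elim (use \<tau>n in \<open>auto simp: abs_of_nonneg\<close>)
  qed measurable
  then have "t \<longlonglongrightarrow> 0" by simp
  moreover have "ennreal (t 0) \<le> sq_norm M I c WV"
  proof -
    have "AE y in M. 0 \<le> \<tau> 0 y" using summ by eventually_elim (use \<tau>n in auto)
    then have "ennreal (t 0) = (\<integral>\<^sup>+ y. ennreal (\<tau> 0 y) \<partial>M)" unfolding t_def by (rule nn_integral_eq_integral[OF i0, symmetric])
    also have "\<dots> \<le> sq_norm M I c WV" unfolding sq_norm_eq by (rule nn_integral_mono_AE[OF \<tau>0])
    finally show ?thesis .
  qed
  moreover have "0 \<le> t n" for n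
    unfolding t_def by (rule integral_nonneg_AE) (use summ in eventually_elim, use \<tau>n in auto)
  moreover have "(LINT y|M. sqfun c WV F y) \<le> t n" if F: "finite F" "F \<subseteq> I - e ` {..<n}" for n F
  proof -
    have "AE y in M. sqfun c WV F y \<le> \<tau> n y"
      using summ
    proof eventually_elim
      case (elim y)
      have s: "summable (\<lambda>m. g y (m + n))" using elim by (simp add: summable_iff_shift)
      obtain N where N: "F \<subseteq> e ` {..<N}" using enum_cover[OF e F(1)] F(2) by blast
      have "F \<subseteq> e ` ({..<N} - {..<n})" using N F(2) unfolding image_set_diff[OF inj] by blast
      also have "\<dots> \<subseteq> (\<lambda>m. e (m + n)) ` {..<N}"
      proof
        fix i assume "i \<in> e ` ({..<N} - {..<n})"
        then obtain m where "m < N" "n \<le> m" "i = e m" by auto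
        then show "i \<in> (\<lambda>m. e (m + n)) ` {..<N}" by (intro image_eqI[of _ _ "m - n"]) auto
      qed
      finally have "(\<Sum>i\<in>F. (c i)\<^sup>2 * WV i y) \<le> (\<Sum>i\<in>(\<lambda>m. e (m + n)) ` {..<N}. (c i)\<^sup>2 * WV i y)"
        by (intro sum_mono2) auto
      also have "\<dots> = (\<Sum>m<N. g y (m + n))"
        by (subst sum.reindex) (auto simp: inj_on_def inj_eq[OF inj] g_def)
      also have "\<dots> \<le> (\<Sum>m. g y (m + n))" using s g0 by (intro sum_le_suminf) auto
      finally show ?case unfolding sqfun_def \<tau>_def by simp
    qed
    then show ?thesis unfolding t_def using F sqfun_integrable(1)[OF adm_WV, of F c] i by (intro integral_mono_AE) auto
  qed
  ultimately show ?thesis by blast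
qed

lemma series_wsum:
  assumes "bij_betw e (UNIV :: nat set) I"
  shows "series_L1 M (\<lambda>i y. c i * w i y) e f \<longleftrightarrow> L1_conv M (\<lambda>n. wsum (e ` {..<n}) c) f"
proof -
  have "inj_on e {..<n}" for n using assms by (auto simp: bij_betw_def intro: inj_on_subset)
  then have "(\<lambda>n y. \<Sum>j<n. c (e j) * w (e j) y) = (\<lambda>n. wsum (e ` {..<n}) c)"
    by (auto simp: sum.reindex)
  then show ?thesis by (simp add: series_L1_def)
qed

text \<open>Grouping the series into blocks with summable atomic norms gives a limit h: the first
  block costs K T, the later ones together \<epsilon>. Any other enumeration eventually contains the
  first blocks of e, and what it contains besides is a finite sum in the tail, hence small in
  L1.\<close>

lemma series_H1_le_aux:
  "\<exists>K>0. \<forall>e c T \<epsilon>. bij_betw e (UNIV :: nat set) I \<longrightarrow> 0 \<le> T \<longrightarrow> sq_norm M I c WV \<le> ennreal T \<longrightarrow> 0 < \<epsilon> \<longrightarrow>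
     (\<exists>h. H1_le M h (K * T + \<epsilon>) \<and>
        (\<forall>e'. bij_betw e' (UNIV :: nat set) I \<longrightarrow> series_L1 M (\<lambda>i y. c i * w i y) e' h))"
proof -
  obtain K where K: "K > 0" "\<And>F c. finite F \<Longrightarrow> F \<subseteq> I \<Longrightarrow> H1_le M (wsum F c) (K * (LINT y|M. sqfun c WV F y))"
    using H1_le_wsum by blast
  have "\<exists>h. H1_le M h (K * T + \<epsilon>) \<and>
        (\<forall>e'. bij_betw e' (UNIV :: nat set) I \<longrightarrow> series_L1 M (\<lambda>i y. c i * w i y) e' h)"
    if e: "bij_betw e (UNIV :: nat set) I" and T: "0 \<le> T" "sq_norm M I c WV \<le> ennreal T" and \<epsilon>: "0 < \<epsilon>" for e c T \<epsilon>
  proof -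
    have inj: "inj e" using e by (simp add: bij_betw_def)
    have "sq_norm M I c WV < \<infinity>" using T(2) by (simp add: order_le_less_trans)
    from square_tail[OF e this] obtain t where t: "t \<longlonglongrightarrow> 0" "ennreal (t 0) \<le> sq_norm M I c WV" "\<And>n. 0 \<le> t n"
      "\<And>n F. finite F \<Longrightarrow> F \<subseteq> I - e ` {..<n} \<Longrightarrow> (LINT y|M. sqfun c WV F y) \<le> t n" by blast
    have t0: "t 0 \<le> T" using order_trans[OF t(2) T(2)] T(1) by (simp add: ennreal_le_iff)
    \<comment> \<open>Division by K compensates the constant of \<open>H1_le_wsum\<close>, so the
      blocks after the first add up to \<epsilon>.\<close>
    define ep where "ep l = \<epsilon> / K * (1 / 2) ^ Suc l" for l
    have ep: "ep l > 0" for l using \<epsilon> K by (simp add: ep_def)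
    have "\<exists>n. \<forall>m\<ge>n. t m \<le> ep l" for l
      using order_tendstoD(2)[OF t(1) ep[of l]] by (auto simp: eventually_sequentially intro: less_imp_le)
    then obtain n0 where n0: "\<And>l m. n0 l \<le> m \<Longrightarrow> t m \<le> ep l" by metis
    \<comment> \<open>The summand \<open>n0 l\<close> makes the tail from \<open>N (Suc l)\<close>
      on at most \<open>ep l\<close>, and the summand 1 makes N strictly increasing.\<close>
    define N where "N = rec_nat 0 (\<lambda>l m. m + n0 l + 1)"
    have N0: "N 0 = 0" and NS: "N (Suc l) = N l + n0 l + 1" for l by (simp_all add: N_def)
    have Nge: "l \<le> N l" for l by (induction l) (auto simp: NS)
    define fl where "fl l = wsum (e ` {N l..<N (Suc l)}) c" for l
    define Kl where "Kl l = K * (case l of 0 \<Rightarrow> T | Suc l \<Rightarrow> ep l)" for l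
    have part: "(\<Sum>l<n. fl l y) = wsum (e ` {..<N n}) c y" for n y
    proof (induction n)
      case (Suc n)
      have "{..<N (Suc n)} = {..<N n} \<union> {N n..<N (Suc n)}" by (auto simp: NS)
      then have "e ` {..<N (Suc n)} = e ` {..<N n} \<union> e ` {N n..<N (Suc n)}" by auto
      moreover have "e ` {..<N n} \<inter> e ` {N n..<N (Suc n)} = {}" by (auto simp: inj_eq[OF inj])
      ultimately have "wsum (e ` {..<N (Suc n)}) c y = wsum (e ` {..<N n}) c y + fl n y"
        unfolding fl_def by (simp add: sum.union_disjoint)
      then show ?case using Suc by simp
    qed (simp add: N0)
    have flK: "H1_le M (fl l) (Kl l)" for l
    proof -
      have "H1_le M (fl l) (K * (LINT y|M. sqfun c WV (e ` {N l..<N (Suc l)}) y))"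
        unfolding fl_def by (intro K(2) enum_subset[OF e]) auto
      moreover have "(LINT y|M. sqfun c WV (e ` {N l..<N (Suc l)}) y) \<le> t (N l)"
        using enum_subset[OF e, of "{N l..<N (Suc l)}"] by (intro t(4)) (auto simp: inj_eq[OF inj])
      moreover have "t (N l) \<le> (case l of 0 \<Rightarrow> T | Suc l \<Rightarrow> ep l)"
        using t0 n0[of "l - 1" "N l"] by (cases l) (auto simp: N0 NS)
      ultimately show ?thesis unfolding Kl_def using K(1)
        by (elim H1_le_mono) (intro mult_left_mono, auto)
    qed
    have Ksum: "Kl sums (K * T + \<epsilon>)"
    proof -
      have "(\<lambda>l. (1 / 2 :: real) ^ Suc l) sums 1" by (rule power_half_series)
      then have "(\<lambda>l. \<epsilon> * (1 / 2) ^ Suc l) sums (\<epsilon> * 1)" by (rule sums_mult)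
      then have "(\<lambda>l. Kl (Suc l)) sums \<epsilon>" using K(1) by (simp add: Kl_def ep_def)
      then have "Kl sums (\<epsilon> + Kl 0)" by (subst (asm) sums_Suc_iff) simp
      then show ?thesis by (simp add: Kl_def add.commute)
    qed
    have fli: "integrable M (fl l)" for l by (rule H1_le_props(1)[OF flK])
    have su: "summable (\<lambda>l. LINT y|M. \<bar>fl l y\<bar>)"
      by (rule summable_nonneg_le[OF sums_summable[OF Ksum] _ H1_le_props(2)[OF flK]]) simp
    define h where "h y = (\<Sum>l. fl l y)" for y
    have [measurable]: "fl l \<in> borel_measurable M" for l using fli[of l] by auto
    have hm [measurable]: "h \<in> borel_measurable M" unfolding h_def by measurable
    have hs: "AE y in M. (\<lambda>l. fl l y) sums h y"
      using AE_summable_of_L1[OF fli su] by eventually_elim (auto simp: h_def intro!: summable_sums summable_rabs_cancel)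
    have "H1_le M h (\<Sum>l. Kl l)" by (rule H1_le_sums[OF flK sums_summable[OF Ksum] hm hs])
    then have H: "H1_le M h (K * T + \<epsilon>)" using Ksum by (simp add: sums_iff)
    have hi: "integrable M h" by (rule H1_le_props(1)[OF H])
    have "L1_conv M (\<lambda>n y. \<Sum>l<n. fl l y) h" by (rule L1_conv_of_AE_sums[OF fli su hs hm])
    then have cN: "(\<lambda>n. LINT y|M. \<bar>wsum (e ` {..<N n}) c y - h y\<bar>) \<longlonglongrightarrow> 0"
      unfolding part using wsum_integrable[OF enum_subset[OF e]] hi by (subst (asm) L1_conv_iff) auto
    have "series_L1 M (\<lambda>i y. c i * w i y) e' h" if e': "bij_betw e' (UNIV :: nat set) I" for e'
    proof -
      have wi: "integrable M (wsum F c)" if "F \<subseteq> I" for F using wsum_integrable[OF that] .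
      have "(\<lambda>n. LINT y|M. \<bar>wsum (e' ` {..<n}) c y - h y\<bar>) \<longlonglongrightarrow> 0"
      proof (rule LIMSEQ_I)
        fix r :: real assume r: "0 < r"
        have "\<forall>\<^sub>F l in sequentially. (LINT y|M. \<bar>wsum (e ` {..<N l}) c y - h y\<bar>) < r / 2"
          using order_tendstoD(2)[OF cN, of "r / 2"] r by simp
        moreover have "\<forall>\<^sub>F l in sequentially. K * t (N l) < r / 2"
        proof -
          have "filterlim N at_top sequentially" using Nge by (intro filterlim_at_top_mono[OF filterlim_ident]) auto
          then have "(\<lambda>l. K * t (N l)) \<longlonglongrightarrow> K * 0" by (intro tendsto_mult tendsto_const filterlim_compose[OF t(1)])
          then show ?thesis using order_tendstoD(2)[of _ "K * 0" sequentially "r / 2"] r by simp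
        qed
        ultimately have "\<forall>\<^sub>F l in sequentially. (LINT y|M. \<bar>wsum (e ` {..<N l}) c y - h y\<bar>) < r / 2 \<and> K * t (N l) < r / 2"
          by (rule eventually_conj)
        then obtain l where l: "(LINT y|M. \<bar>wsum (e ` {..<N l}) c y - h y\<bar>) < r / 2" "K * t (N l) < r / 2"
          by (auto simp: eventually_sequentially)
        obtain m where m: "e ` {..<N l} \<subseteq> e' ` {..<m}" using enum_cover[OF e', of "e ` {..<N l}"] enum_subset[OF e] by auto
        show "\<exists>no. \<forall>n\<ge>no. norm ((LINT y|M. \<bar>wsum (e' ` {..<n}) c y - h y\<bar>) - 0) < r"
        proof (intro exI[of _ m] allI impI)
          fix n assume "m \<le> n"
          then have sub: "e ` {..<N l} \<subseteq> e' ` {..<n}" using m by (auto dest!: subsetD)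
          define F where "F = e' ` {..<n} - e ` {..<N l}"
          have F: "finite F" "F \<subseteq> I - e ` {..<N l}" "F \<subseteq> I" using enum_subset[OF e', of "{..<n}"] by (auto simp: F_def)
          have sp: "wsum (e' ` {..<n}) c y = wsum F c y + wsum (e ` {..<N l}) c y" for y
            unfolding F_def by (rule sum.subset_diff[OF sub]) simp
          have "(LINT y|M. \<bar>wsum F c y\<bar>) \<le> K * (LINT y|M. sqfun c WV F y)"
            by (rule H1_le_props(2)[OF K(2)[OF F(1,3)]])
          also have "\<dots> \<le> K * t (N l)" using K(1) by (intro mult_left_mono t(4) F) auto
          finally have 1: "(LINT y|M. \<bar>wsum F c y\<bar>) < r / 2" using l by linarith
          have "(LINT y|M. \<bar>wsum (e' ` {..<n}) c y - h y\<bar>) \<le> (LINT y|M. \<bar>wsum F c y\<bar> + \<bar>wsum (e ` {..<N l}) c y - h y\<bar>)"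
          proof (rule integral_mono)
            show "integrable M (\<lambda>y. \<bar>wsum (e' ` {..<n}) c y - h y\<bar>)"
              by (intro integrable_abs Bochner_Integration.integrable_diff wi hi enum_subset[OF e'])
            show "integrable M (\<lambda>y. \<bar>wsum F c y\<bar> + \<bar>wsum (e ` {..<N l}) c y - h y\<bar>)"
              by (intro Bochner_Integration.integrable_add integrable_abs Bochner_Integration.integrable_diff wi hi enum_subset[OF e] F)
          qed (simp add: sp)
          also have "\<dots> = (LINT y|M. \<bar>wsum F c y\<bar>) + (LINT y|M. \<bar>wsum (e ` {..<N l}) c y - h y\<bar>)"
            by (intro Bochner_Integration.integral_add integrable_abs Bochner_Integration.integrable_diff wi hi enum_subset[OF e] F)
          finally show "norm ((LINT y|M. \<bar>wsum (e' ` {..<n}) c y - h y\<bar>) - 0) < r" using 1 l by simp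
        qed
      qed
      then show ?thesis unfolding series_wsum[OF e'] using wi[OF enum_subset[OF e']] hi by (subst L1_conv_iff) auto
    qed
    then show ?thesis using H by blast
  qed
  then show ?thesis using K(1) by blast
qed

section \<open>Identification of the limit of the series\<close>

lemma cf_wsum:
  assumes F: "finite F" "F \<subseteq> I" and i: "i \<in> I"
  shows "cf (wsum F c) i = (if i \<in> F then c i else 0)"
proof -
  have "cf (wsum F c) i = (LINT y|M. (\<Sum>j\<in>F. c j * (w j y * w i y)))"
    by (simp add: cf_def sum_distrib_right mult.assoc)
  also have "\<dots> = (\<Sum>j\<in>F. LINT y|M. c j * (w j y * w i y))"
    by (intro Bochner_Integration.integral_sum integrable_mult_right integrable_mult_w w_integrable subsetD[OF F(2)] i)
  also have "\<dots> = (\<Sum>j\<in>F. if j = i then c i else 0)"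
  proof (rule sum.cong)
    fix j assume "j \<in> F"
    then show "(LINT y|M. c j * (w j y * w i y)) = (if j = i then c i else 0)"
      using w_orth[OF subsetD[OF F(2)] i, of j] by simp
  qed simp
  also have "\<dots> = (if i \<in> F then c i else 0)" using F by simp
  finally show ?thesis .
qed

lemma series_L1_cong_AE:
  assumes "series_L1 M u e h" "AE y in M. f y = h y"
  shows "series_L1 M u e f"
proof -
  have "(\<integral>\<^sup>+ y. ennreal \<bar>(\<Sum>j<n. u (e j) y) - f y\<bar> \<partial>M) = (\<integral>\<^sup>+ y. ennreal \<bar>(\<Sum>j<n. u (e j) y) - h y\<bar> \<partial>M)" for n
    by (rule nn_integral_cong_AE) (use assms(2) in eventually_elim, simp)
  then show ?thesis using assms(1) by (simp add: series_L1_def L1_conv_def)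
qed

lemma series_L1_unique:
  assumes e: "bij_betw e (UNIV :: nat set) I" and "series_L1 M (\<lambda>i y. c i * w i y) e f" "series_L1 M (\<lambda>i y. c i * w i y) e g"
    and "integrable M f" "integrable M g"
  shows "AE y in M. f y = g y"
proof (rule L1_conv_unique)
  show "L1_conv M (\<lambda>n. wsum (e ` {..<n}) c) f" "L1_conv M (\<lambda>n. wsum (e ` {..<n}) c) g"
    using assms(2,3) by (simp_all add: series_wsum[OF e])
  show "wsum (e ` {..<n}) c \<in> borel_measurable M" for n using wsum_integrable[OF enum_subset[OF e]] by blast
qed (use assms in auto)

lemma integrable_square_add:
  assumes "f \<in> borel_measurable M" "g \<in> borel_measurable M" "integrable M (\<lambda>y. (f y)\<^sup>2)" "integrable M (\<lambda>y. (g y)\<^sup>2)"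
  shows "integrable M (\<lambda>y. (f y + g y :: real)\<^sup>2)"
proof (rule Bochner_Integration.integrable_bound)
  show "integrable M (\<lambda>y. 2 * (f y)\<^sup>2 + 2 * (g y)\<^sup>2)" using assms by simp
  show "AE y in M. norm ((f y + g y)\<^sup>2) \<le> norm (2 * (f y)\<^sup>2 + 2 * (g y)\<^sup>2)"
  proof (rule AE_I2)
    fix y
    have "0 \<le> (f y - g y)\<^sup>2" by simp
    then have "(f y + g y)\<^sup>2 \<le> 2 * (f y)\<^sup>2 + 2 * (g y)\<^sup>2" by (simp add: power2_eq_square algebra_simps)
    then show "norm ((f y + g y)\<^sup>2) \<le> norm (2 * (f y)\<^sup>2 + 2 * (g y)\<^sup>2)"
      unfolding real_norm_def abs_power2 using abs_ge_self[of "2 * (f y)\<^sup>2 + 2 * (g y)\<^sup>2"] by linarith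
  qed
qed (use assms in measurable)

text \<open>Bessel bounds the partial sums in L2, so their L1 limit h is square integrable by Fatou
  along an almost everywhere convergent subsequence. It has the same coefficients as f, and
  completeness of the wavelets forces h = f.\<close>

lemma series_of_L2:
  assumes e: "bij_betw e (UNIV :: nat set) I" and f: "integrable M f" and f2: "integrable M (\<lambda>y. (f y)\<^sup>2)"
    and T: "0 \<le> T" "sq_norm M I (cf f) WV \<le> ennreal T"
  shows "series_L1 M (\<lambda>i y. cf f i * w i y) e f"
proof -
  obtain K where K: "\<And>e c T \<epsilon>. bij_betw e (UNIV :: nat set) I \<Longrightarrow> 0 \<le> T \<Longrightarrow> sq_norm M I c WV \<le> ennreal T \<Longrightarrow> 0 < \<epsilon> \<Longrightarrow>
     (\<exists>h. H1_le M h (K * T + \<epsilon>) \<and> (\<forall>e'. bij_betw e' (UNIV :: nat set) I \<longrightarrow> series_L1 M (\<lambda>i y. c i * w i y) e' h))"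
    using series_H1_le_aux by blast
  obtain h where "H1_le M h (K * T + 1)" and hs: "series_L1 M (\<lambda>i y. cf f i * w i y) e h"
    using K[OF e T zero_less_one] e by blast
  have hi: "integrable M h" by (rule H1_le_props(1)) fact
  define S where "S n = wsum (e ` {..<n}) (cf f)" for n
  have Si: "integrable M (S n)" for n unfolding S_def by (rule wsum_integrable[OF enum_subset[OF e]])
  have [measurable]: "S n \<in> borel_measurable M" "f \<in> borel_measurable M" "h \<in> borel_measurable M" for n using Si[of n] f hi by auto
  have Sc: "(\<lambda>n. LINT y|M. \<bar>S n y - h y\<bar>) \<longlonglongrightarrow> 0"
    using hs Si hi unfolding series_wsum[OF e] S_def[symmetric] by (subst (asm) L1_conv_iff) auto
  have S2: "(\<integral>\<^sup>+ y. ennreal ((S n y)\<^sup>2) \<partial>M) \<le> ennreal (LINT y|M. (f y)\<^sup>2)" for n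
  proof -
    have F: "finite (e ` {..<n})" "e ` {..<n} \<subseteq> I" using enum_subset[OF e] by auto
    have "(\<integral>\<^sup>+ y. ennreal ((S n y)\<^sup>2) \<partial>M) = ennreal (\<Sum>i\<in>e ` {..<n}. (cf f i)\<^sup>2)"
      unfolding S_def wsum_sq(2)[OF F, symmetric] by (rule nn_integral_eq_integral[OF wsum_sq(1)[OF F]]) simp
    also have "\<dots> \<le> ennreal (LINT y|M. (f y)\<^sup>2)" by (intro ennreal_leI bessel f f2 F)
    finally show ?thesis .
  qed
  have h2: "integrable M (\<lambda>y. (h y)\<^sup>2)"
  proof -
    have "\<exists>r::nat\<Rightarrow>nat. strict_mono r \<and> (AE y in M. (\<lambda>n. S (r n) y - h y) \<longlonglongrightarrow> 0)"
      using Sc Si hi by (intro tendsto_L1_AE_subseq) auto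
    then obtain r :: "nat \<Rightarrow> nat" where r: "AE y in M. (\<lambda>n. S (r n) y - h y) \<longlonglongrightarrow> 0" by blast
    have "(\<integral>\<^sup>+ y. ennreal ((h y)\<^sup>2) \<partial>M) = (\<integral>\<^sup>+ y. liminf (\<lambda>n. ennreal ((S (r n) y)\<^sup>2)) \<partial>M)"
    proof (rule nn_integral_cong_AE, use r in eventually_elim)
      case (elim y)
      have "(\<lambda>n. S (r n) y) \<longlonglongrightarrow> h y" using elim by (simp add: LIM_zero_iff)
      then have "(\<lambda>n. ennreal ((S (r n) y)\<^sup>2)) \<longlonglongrightarrow> ennreal ((h y)\<^sup>2)" by (intro tendsto_ennrealI tendsto_power)
      then show ?case using lim_imp_Liminf[OF sequentially_bot] by metis
    qed
    also have "\<dots> \<le> liminf (\<lambda>n. \<integral>\<^sup>+ y. ennreal ((S (r n) y)\<^sup>2) \<partial>M)" by (rule nn_integral_liminf) measurable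
    also have "\<dots> \<le> ennreal (LINT y|M. (f y)\<^sup>2)"
      using Liminf_le_Limsup[OF sequentially_bot] by (rule order_trans) (intro Limsup_bounded always_eventually allI S2)
    finally show ?thesis by (intro integrableI_bounded) (auto simp: order_le_less_trans)
  qed
  \<comment> \<open>Coefficients are continuous in L1, and that of the partial sum equals
    \<open>cf f i\<close> as soon as i has been enumerated.\<close>
  have coef: "cf h i = cf f i" if i: "i \<in> I" for i
  proof -
    have "(\<lambda>n. C / sqrt (V M (pt i) (scl i)) * (LINT y|M. \<bar>S n y - h y\<bar>)) \<longlonglongrightarrow> C / sqrt (V M (pt i) (scl i)) * 0"
      by (intro tendsto_mult tendsto_const Sc)
    moreover have "\<forall>\<^sub>F n in sequentially. \<bar>cf f i - cf h i\<bar> \<le> C / sqrt (V M (pt i) (scl i)) * (LINT y|M. \<bar>S n y - h y\<bar>)"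
    proof -
      obtain m where m: "i \<in> e ` {..<m}" using enum_cover[OF e, of "{i}"] i by auto
      have "\<bar>cf f i - cf h i\<bar> \<le> C / sqrt (V M (pt i) (scl i)) * (LINT y|M. \<bar>S n y - h y\<bar>)" if "m \<le> n" for n
      proof -
        have "i \<in> e ` {..<n}" using m that by auto
        then have "cf (S n) i = cf f i" unfolding S_def using cf_wsum[OF _ enum_subset[OF e] i] by auto
        then have "cf (\<lambda>y. S n y - h y) i = cf f i - cf h i" using cf_diff[OF Si hi i] by simp
        then show ?thesis using cf_le[OF _ i, of "\<lambda>y. S n y - h y"] Si[of n] hi by simp
      qed
      then show ?thesis by (auto simp: eventually_sequentially)
    qed
    ultimately have "\<bar>cf f i - cf h i\<bar> \<le> 0" using tendsto_lowerbound[of _ "C / sqrt (V M (pt i) (scl i)) * 0" sequentially] by fastforce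
    then show ?thesis by simp
  qed
  have g2: "integrable M (\<lambda>y. (f y - h y)\<^sup>2)"
    using integrable_square_add[of f "\<lambda>y. - h y"] f2 h2 by simp
  have "AE y in M. f y - h y = 0"
  proof (rule w_complete[OF _ g2])
    show "(LINT y|M. (f y - h y) * w i y) = 0" if "i \<in> I" for i
      using cf_diff[OF f hi that] coef[OF that] by (simp add: cf_def)
  qed measurable
  then have "AE y in M. f y = h y" by eventually_elim simp
  then show ?thesis by (rule series_L1_cong_AE[OF hs])
qed

text \<open>Density of the square-integrable functions in the atomic norm: finite sums of atoms are
  square integrable, and the remaining atoms carry a small total weight.\<close>

lemma H1_le_atomic_approx:
  assumes "H1_le M f L"
  shows "\<exists>p tl. tl \<longlonglongrightarrow> 0 \<and> (\<forall>n. 0 \<le> tl n \<and> integrable M (\<lambda>y. (p n y)\<^sup>2) \<and> H1_le M (\<lambda>y. f y - p n y) (tl n) \<and> H1_le M (p n) (L + tl n))"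
proof -
  obtain lam a where at: "\<And>j. atom M (a j)" and su: "summable (\<lambda>j. \<bar>lam j\<bar>)"
    and ae: "AE y in M. (\<lambda>j. lam j * a j y) sums f y" and f [measurable]: "f \<in> borel_measurable M"
    using assms unfolding H1_le_def by blast
  have [measurable]: "a j \<in> borel_measurable M" for j using at[of j] unfolding atom_def by auto
  have a2: "integrable M (\<lambda>y. (a j y)\<^sup>2)" for j
    using at[of j] atom_sq(1)[of "a j"] unfolding atom_def V_def by blast
  define p where "p n y = (\<Sum>j<n. lam j * a j y)" for n y
  define tl where "tl n = (\<Sum>j. \<bar>lam (j + n)\<bar>)" for n
  have [measurable]: "p n \<in> borel_measurable M" for n unfolding p_def by measurable
  have p2: "integrable M (\<lambda>y. (p n y)\<^sup>2)" for n
  proof (induction n)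
    case (Suc n)
    have "integrable M (\<lambda>y. (lam n * a n y)\<^sup>2)" using a2 by (simp add: power_mult_distrib)
    then have "integrable M (\<lambda>y. (p n y + lam n * a n y)\<^sup>2)" using Suc by (intro integrable_square_add) measurable
    then show ?case by (simp add: p_def)
  qed (simp add: p_def)
  have su': "summable (\<lambda>j. \<bar>lam (j + n)\<bar>)" for n using su summable_iff_shift[of "\<lambda>j. \<bar>lam j\<bar>" n] by simp
  have d: "H1_le M (\<lambda>y. f y - p n y) (tl n)" for n
    unfolding H1_le_def
  proof (intro conjI exI[of _ "\<lambda>j. lam (j + n)"] exI[of _ "\<lambda>j. a (j + n)"])
    show "AE y in M. (\<lambda>j. lam (j + n) * a (j + n) y) sums (f y - p n y)"
      using ae unfolding p_def by eventually_elim (rule sums_split_initial_segment)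
  qed (use at su' in \<open>auto simp: tl_def\<close>)
  have "H1_le M (p n) (L + tl n)" for n
  proof -
    have "H1_le M (\<lambda>y. f y + (-1) * (f y - p n y)) (L + \<bar>-1\<bar> * tl n)" by (intro H1_le_add assms H1_le_cmult d)
    then show ?thesis by simp
  qed
  moreover have "tl \<longlonglongrightarrow> 0" unfolding tl_def by (rule suminf_exist_split2[OF su])
  moreover have "0 \<le> tl n" for n unfolding tl_def using su' by (simp add: suminf_nonneg)
  ultimately show ?thesis using p2 d by blast
qed

text \<open>The series has a limit h, but completeness identifies limits only for square-integrable
  functions. Subtracting such an approximation p n, for which the expansion holds, leaves the
  expansion of f - p n, which is small together with its limit. The equivalence of norms rests on
  this, since it speaks of all of H1 and not only of functions with a given expansion.\<close>

theorem H1_series: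
  assumes e: "bij_betw e (UNIV :: nat set) I" and f: "in_H1 M f"
  shows "series_L1 M (\<lambda>i y. cf f i * w i y) e f"
proof -
  obtain K where K: "K > 0" "\<And>e c T \<epsilon>. bij_betw e (UNIV :: nat set) I \<Longrightarrow> 0 \<le> T \<Longrightarrow> sq_norm M I c WV \<le> ennreal T \<Longrightarrow> 0 < \<epsilon> \<Longrightarrow>
     (\<exists>h. H1_le M h (K * T + \<epsilon>) \<and> (\<forall>e'. bij_betw e' (UNIV :: nat set) I \<longrightarrow> series_L1 M (\<lambda>i y. c i * w i y) e' h))"
    using series_H1_le_aux by blast
  obtain K' where K': "K' > 0" "\<And>f L F. H1_le M f L \<Longrightarrow> finite F \<Longrightarrow> F \<subseteq> I \<Longrightarrow> (LINT y|M. sqfun (cf f) WV F y) \<le> K' * L"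
    using sqfun_H1_le[OF adm_WV] by blast
  have sq: "sq_norm M I (cf f) WV \<le> ennreal (K' * L)" if "H1_le M f L" for f L
    by (rule sq_norm_least[OF e adm_WV K'(2)[OF that]])
  define L where "L = H1_norm M f + 1"
  have fL: "H1_le M f L" unfolding L_def by (rule in_H1_imp_H1_le[OF f]) simp
  have fi: "integrable M f" by (rule H1_le_props(1)[OF fL])
  have "0 \<le> K' * L" using K'(1) H1_le_props(4)[OF fL] by simp
  then obtain h where hH: "H1_le M h (K * (K' * L) + 1)" and hs: "series_L1 M (\<lambda>i y. cf f i * w i y) e h"
    using K(2)[OF e _ sq[OF fL] zero_less_one] e by blast
  have hi: "integrable M h" by (rule H1_le_props(1)[OF hH])
  obtain p tl where tl: "tl \<longlonglongrightarrow> 0" and pt': "\<And>n. 0 \<le> tl n" "\<And>n. integrable M (\<lambda>y. (p n y)\<^sup>2)"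
    "\<And>n. H1_le M (\<lambda>y. f y - p n y) (tl n)" "\<And>n. H1_le M (p n) (L + tl n)"
    using H1_le_atomic_approx[OF fL] by blast
  \<comment> \<open>The bracket bounds the limit h' of the expansion of f - p n, with slack 1 / (n +
    1); the last summand bounds f - p n itself.\<close>
  have est: "(LINT y|M. \<bar>f y - h y\<bar>) \<le> (K * (K' * tl n) + 1 / real (Suc n)) + tl n" for n
  proof -
    have pi: "integrable M (p n)" and di: "integrable M (\<lambda>y. f y - p n y)" using H1_le_props(1) pt' by blast+
    have "0 \<le> K' * (L + tl n)" using K'(1) H1_le_props(4)[OF pt'(4)] by simp
    then have ps: "series_L1 M (\<lambda>i y. cf (p n) i * w i y) e (p n)"
      by (intro series_of_L2[OF e pi pt'(2) _ sq[OF pt'(4)]])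
    have "0 \<le> K' * tl n" using K'(1) pt'(1) by simp
    then obtain h' where h': "H1_le M h' (K * (K' * tl n) + 1 / real (Suc n))"
      and hs': "series_L1 M (\<lambda>i y. cf (\<lambda>y. f y - p n y) i * w i y) e h'"
      using K(2)[OF e _ sq[OF pt'(3)], where \<epsilon> = "1 / real (Suc n)"] e by auto
    have hi': "integrable M h'" by (rule H1_le_props(1)[OF h'])
    have "series_L1 M (\<lambda>i y. cf f i * w i y) e (\<lambda>y. p n y + h' y)"
    proof -
      let ?E = "\<lambda>m. e ` {..<m}"
      have sp: "wsum (?E m) (cf f) y = wsum (?E m) (cf (p n)) y + wsum (?E m) (cf (\<lambda>y. f y - p n y)) y" for m y
      proof -
        have "cf f i = cf (p n) i + cf (\<lambda>y. f y - p n y) i" if "i \<in> I" for i using cf_diff[OF fi pi that] by simp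
        then have "wsum (?E m) (cf f) y = (\<Sum>i\<in>?E m. cf (p n) i * w i y + cf (\<lambda>y. f y - p n y) i * w i y)"
          using enum_subset[OF e, of "{..<m}"] by (intro sum.cong refl) (auto simp: distrib_right[symmetric] dest!: subsetD)
        then show ?thesis by (simp add: sum.distrib)
      qed
      have wi: "integrable M (wsum (?E m) c)" for m c by (rule wsum_integrable[OF enum_subset[OF e]])
      have l1: "(\<lambda>m. LINT y|M. \<bar>wsum (?E m) (cf (p n)) y - p n y\<bar>) \<longlonglongrightarrow> 0"
        using ps wi pi unfolding series_wsum[OF e] by (subst (asm) L1_conv_iff) auto
      have l2: "(\<lambda>m. LINT y|M. \<bar>wsum (?E m) (cf (\<lambda>y. f y - p n y)) y - h' y\<bar>) \<longlonglongrightarrow> 0"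
        using hs' wi hi' unfolding series_wsum[OF e] by (subst (asm) L1_conv_iff) auto
      have "(\<lambda>m. LINT y|M. \<bar>wsum (?E m) (cf f) y - (p n y + h' y)\<bar>) \<longlonglongrightarrow> 0"
      proof (rule tendsto_sandwich[OF _ _ tendsto_const])
        show "(\<lambda>m. (LINT y|M. \<bar>wsum (?E m) (cf (p n)) y - p n y\<bar>) + (LINT y|M. \<bar>wsum (?E m) (cf (\<lambda>y. f y - p n y)) y - h' y\<bar>)) \<longlonglongrightarrow> 0"
          using tendsto_add[OF l1 l2] by simp
        show "\<forall>\<^sub>F m in sequentially. (LINT y|M. \<bar>wsum (?E m) (cf f) y - (p n y + h' y)\<bar>) \<le> (LINT y|M. \<bar>wsum (?E m) (cf (p n)) y - p n y\<bar>) + (LINT y|M. \<bar>wsum (?E m) (cf (\<lambda>y. f y - p n y)) y - h' y\<bar>)"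
        proof (intro always_eventually allI)
          fix m
          have i1: "integrable M (\<lambda>y. \<bar>wsum (?E m) (cf (p n)) y - p n y\<bar>)"
            and i2: "integrable M (\<lambda>y. \<bar>wsum (?E m) (cf (\<lambda>y. f y - p n y)) y - h' y\<bar>)"
            by (intro integrable_abs Bochner_Integration.integrable_diff wi pi hi')+
          have "(LINT y|M. \<bar>wsum (?E m) (cf f) y - (p n y + h' y)\<bar>) \<le> (LINT y|M. \<bar>wsum (?E m) (cf (p n)) y - p n y\<bar> + \<bar>wsum (?E m) (cf (\<lambda>y. f y - p n y)) y - h' y\<bar>)"
          proof (rule integral_mono)
            show "integrable M (\<lambda>y. \<bar>wsum (?E m) (cf f) y - (p n y + h' y)\<bar>)"
              by (intro integrable_abs Bochner_Integration.integrable_diff Bochner_Integration.integrable_add wi pi hi')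
            show "integrable M (\<lambda>y. \<bar>wsum (?E m) (cf (p n)) y - p n y\<bar> + \<bar>wsum (?E m) (cf (\<lambda>y. f y - p n y)) y - h' y\<bar>)"
              by (rule Bochner_Integration.integrable_add[OF i1 i2])
            fix y
            show "\<bar>wsum (?E m) (cf f) y - (p n y + h' y)\<bar> \<le> \<bar>wsum (?E m) (cf (p n)) y - p n y\<bar> + \<bar>wsum (?E m) (cf (\<lambda>y. f y - p n y)) y - h' y\<bar>"
              using sp[where m = m and y = y] by linarith
          qed
          then show "(LINT y|M. \<bar>wsum (?E m) (cf f) y - (p n y + h' y)\<bar>) \<le> (LINT y|M. \<bar>wsum (?E m) (cf (p n)) y - p n y\<bar>) + (LINT y|M. \<bar>wsum (?E m) (cf (\<lambda>y. f y - p n y)) y - h' y\<bar>)"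
            using Bochner_Integration.integral_add[OF i1 i2] by simp
        qed
      qed auto
      then show ?thesis unfolding series_wsum[OF e] using wi pi hi' by (subst L1_conv_iff) auto
    qed
    \<comment> \<open>Both sides are sums of the same series along e.\<close>
    then have ae: "AE y in M. h y = p n y + h' y" by (rule series_L1_unique[OF e hs]) (use hi pi hi' in auto)
    have i1: "integrable M (\<lambda>y. \<bar>h' y\<bar>)" and i2: "integrable M (\<lambda>y. \<bar>f y - p n y\<bar>)" using hi' di by auto
    have "(LINT y|M. \<bar>f y - h y\<bar>) \<le> (LINT y|M. \<bar>h' y\<bar> + \<bar>f y - p n y\<bar>)"
    proof (rule integral_mono_AE)
      show "AE y in M. \<bar>f y - h y\<bar> \<le> \<bar>h' y\<bar> + \<bar>f y - p n y\<bar>" using ae by eventually_elim linarith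
    qed (use fi hi i1 i2 in auto)
    also have "\<dots> = (LINT y|M. \<bar>h' y\<bar>) + (LINT y|M. \<bar>f y - p n y\<bar>)" by (rule Bochner_Integration.integral_add[OF i1 i2])
    also have "\<dots> \<le> (K * (K' * tl n) + 1 / real (Suc n)) + tl n"
      by (intro add_mono H1_le_props(2)[OF h'] H1_le_props(2)[OF pt'(3)])
    finally show ?thesis .
  qed
  have "(\<lambda>n. (K * (K' * tl n) + 1 / real (Suc n)) + tl n) \<longlonglongrightarrow> (K * (K' * 0) + 0) + 0"
    by (intro tendsto_add tendsto_mult tendsto_const tl LIMSEQ_Suc[OF lim_1_over_n])
  then have "(LINT y|M. \<bar>f y - h y\<bar>) \<le> (K * (K' * 0) + 0) + 0" by (rule LIMSEQ_le_const) (use est in auto)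
  then have "(LINT y|M. \<bar>f y - h y\<bar>) = 0" by (intro antisym integral_nonneg_AE) auto
  moreover have "integrable M (\<lambda>y. \<bar>f y - h y\<bar>)" using fi hi by auto
  ultimately have "AE y in M. \<bar>f y - h y\<bar> = 0" by (subst (asm) integral_nonneg_eq_0_iff_AE) auto
  then have "AE y in M. f y = h y" by eventually_elim simp
  then show ?thesis by (rule series_L1_cong_AE[OF hs])
qed

section \<open>Comparison of the square functions with the atomic norm\<close>

definition dominates :: "(int \<times> 'i \<times> 'i \<Rightarrow> 'a \<Rightarrow> real) \<Rightarrow> bool" where
  "dominates W \<longleftrightarrow> (\<exists>D>0. \<forall>i\<in>I. \<forall>y. WV i y \<le> D\<^sup>2 * W i y)"

text \<open>Transfers the lower estimate, proved for the smallest weight, to every weight that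
  dominates it.\<close>

lemma sq_norm_WV_le:
  assumes e: "bij_betw e (UNIV :: nat set) I" and W: "adm W" and dom: "dominates W"
  shows "\<exists>D>0. \<forall>c. sq_norm M I c WV \<le> ennreal D * sq_norm M I c W"
proof -
  obtain D where D: "D > 0" "\<And>i y. i \<in> I \<Longrightarrow> WV i y \<le> D\<^sup>2 * W i y" using dom unfolding dominates_def by blast
  have le: "sqfun c WV F y \<le> D * sqfun c W F y" if F: "F \<subseteq> I" for c F y
  proof -
    have "(\<Sum>i\<in>F. (c i)\<^sup>2 * WV i y) \<le> (\<Sum>i\<in>F. (c i)\<^sup>2 * (D\<^sup>2 * W i y))"
      using F D(2) by (intro sum_mono mult_left_mono) auto
    also have "\<dots> = D\<^sup>2 * (\<Sum>i\<in>F. (c i)\<^sup>2 * W i y)" by (simp add: sum_distrib_left mult.left_commute)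
    finally have "sqfun c WV F y \<le> sqrt (D\<^sup>2 * (\<Sum>i\<in>F. (c i)\<^sup>2 * W i y))" unfolding sqfun_def by (rule real_sqrt_le_mono)
    then show ?thesis using D(1) by (simp add: real_sqrt_mult sqfun_def)
  qed
  have "Ssup c WV y \<le> ennreal D * Ssup c W y" for c y
    unfolding Ssup_def[of c WV]
  proof (rule SUP_least)
    fix F assume F: "F \<in> {F. finite F \<and> F \<subseteq> I}"
    have "ennreal (sqfun c WV F y) \<le> ennreal (D * sqfun c W F y)" using le F by (intro ennreal_leI) auto
    also have "\<dots> = ennreal D * ennreal (sqfun c W F y)" using D(1) by (intro ennreal_mult') simp
    also have "\<dots> \<le> ennreal D * Ssup c W y" using F by (intro mult_left_mono Ssup_upper) auto
    finally show "ennreal (sqfun c WV F y) \<le> ennreal D * Ssup c W y" .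
  qed
  then have "sq_norm M I c WV \<le> (\<integral>\<^sup>+ y. ennreal D * Ssup c W y \<partial>M)" for c
    unfolding sq_norm_eq by (rule nn_integral_mono)
  moreover have "(\<integral>\<^sup>+ y. ennreal D * Ssup c W y \<partial>M) = ennreal D * sq_norm M I c W" for c
    unfolding sq_norm_eq by (rule nn_integral_cmult[OF Ssup_measurable[OF e W]])
  ultimately show ?thesis using D(1) by auto
qed

theorem sq_norm_le_H1:
  assumes e: "bij_betw e (UNIV :: nat set) I" and W: "adm W"
  shows "\<exists>K>0. \<forall>f. in_H1 M f \<longrightarrow> sq_norm M I (cf f) W \<le> ennreal (K * H1_norm M f)"
proof -
  obtain K where K: "K > 0" "\<And>f L F. H1_le M f L \<Longrightarrow> finite F \<Longrightarrow> F \<subseteq> I \<Longrightarrow> (LINT y|M. sqfun (cf f) W F y) \<le> K * L"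
    using sqfun_H1_le[OF W] by blast
  have "sq_norm M I (cf f) W \<le> ennreal (K * H1_norm M f)" if f: "in_H1 M f" for f
  proof (rule sq_norm_least[OF e W])
    fix F assume F: "finite F" "F \<subseteq> I"
    show "(LINT y|M. sqfun (cf f) W F y) \<le> K * H1_norm M f"
    proof (rule field_le_epsilon)
      fix \<epsilon> :: real assume \<epsilon>: "0 < \<epsilon>"
      have "(LINT y|M. sqfun (cf f) W F y) \<le> K * (H1_norm M f + \<epsilon> / K)"
        using \<epsilon> K(1) by (intro K(2) in_H1_imp_H1_le f F) auto
      also have "\<dots> = K * H1_norm M f + \<epsilon>" using K(1) by (simp add: distrib_left)
      finally show "(LINT y|M. sqfun (cf f) W F y) \<le> K * H1_norm M f + \<epsilon>" .
    qed
  qed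
  then show ?thesis using K(1) by blast
qed

text \<open>The limit h provided by the square function and the given f are sums of the same series
  along e, hence equal. Keeping the convergence along all e' in the conclusion yields unconditional
  convergence.\<close>

theorem series_imp_H1:
  assumes e: "bij_betw e (UNIV :: nat set) I" and W: "adm W" and dom: "dominates W"
  shows "\<exists>K>0. \<forall>f. integrable M f \<longrightarrow> series_L1 M (\<lambda>i y. cf f i * w i y) e f \<longrightarrow> sq_norm M I (cf f) W < \<infinity> \<longrightarrow>
    in_H1 M f \<and> ennreal (H1_norm M f) \<le> ennreal K * sq_norm M I (cf f) W \<and>
    (\<forall>e'. bij_betw e' (UNIV :: nat set) I \<longrightarrow> series_L1 M (\<lambda>i y. cf f i * w i y) e' f)"
proof -
  obtain K where K: "K > 0" "\<And>e c T \<epsilon>. bij_betw e (UNIV :: nat set) I \<Longrightarrow> 0 \<le> T \<Longrightarrow> sq_norm M I c WV \<le> ennreal T \<Longrightarrow> 0 < \<epsilon> \<Longrightarrow>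
     (\<exists>h. H1_le M h (K * T + \<epsilon>) \<and> (\<forall>e'. bij_betw e' (UNIV :: nat set) I \<longrightarrow> series_L1 M (\<lambda>i y. c i * w i y) e' h))"
    using series_H1_le_aux by blast
  obtain D where D: "D > 0" "\<And>c. sq_norm M I c WV \<le> ennreal D * sq_norm M I c W" using sq_norm_WV_le[OF e W dom] by blast
  have "in_H1 M f \<and> ennreal (H1_norm M f) \<le> ennreal (K * D) * sq_norm M I (cf f) W \<and>
    (\<forall>e'. bij_betw e' (UNIV :: nat set) I \<longrightarrow> series_L1 M (\<lambda>i y. cf f i * w i y) e' f)"
    if fi: "integrable M f" and fs: "series_L1 M (\<lambda>i y. cf f i * w i y) e f" and fin: "sq_norm M I (cf f) W < \<infinity>" for f
  proof -
    define T where "T = D * enn2real (sq_norm M I (cf f) W)"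
    have T0: "0 \<le> T" using D(1) by (simp add: T_def)
    have Te: "ennreal T = ennreal D * sq_norm M I (cf f) W"
      using fin D(1) by (simp add: T_def ennreal_mult)
    have T: "sq_norm M I (cf f) WV \<le> ennreal T" unfolding Te by (rule D(2))
    have fH: "H1_le M f (K * T + \<epsilon>) \<and> (\<forall>e'. bij_betw e' (UNIV :: nat set) I \<longrightarrow> series_L1 M (\<lambda>i y. cf f i * w i y) e' f)" if \<epsilon>: "0 < \<epsilon>" for \<epsilon>
    proof -
      obtain h where h: "H1_le M h (K * T + \<epsilon>)" "\<And>e'. bij_betw e' (UNIV :: nat set) I \<Longrightarrow> series_L1 M (\<lambda>i y. cf f i * w i y) e' h"
        using K(2)[OF e T0 T \<epsilon>] by blast
      have ae: "AE y in M. h y = f y"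
        by (rule series_L1_unique[OF e h(2)[OF e] fs H1_le_props(1)[OF h(1)] fi])
      have "H1_le M f (K * T + \<epsilon>)" using fi by (intro H1_le_cong_AE[OF h(1) _ ae]) auto
      moreover have "AE y in M. f y = h y" using ae by eventually_elim simp
      ultimately show ?thesis using series_L1_cong_AE h(2) by blast
    qed
    have "H1_norm M f \<le> K * T"
      by (rule field_le_epsilon) (use fH H1_norm_le in blast)
    then have "ennreal (H1_norm M f) \<le> ennreal (K * T)" by (rule ennreal_leI)
    also have "\<dots> = ennreal (K * D) * sq_norm M I (cf f) W"
      using K(1) D(1) T0 Te by (simp add: ennreal_mult mult.assoc)
    finally show ?thesis using fH[OF zero_less_one] H1_le_imp_in_H1 by blast
  qed
  then show ?thesis using K(1) D(1) by (intro exI[of _ "K * D"]) auto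
qed

text \<open>Subadditivity and homogeneity hold pointwise, the former by Minkowski. Definiteness
  follows from the lower estimate, because the atomic norm dominates the L1 norm.\<close>

theorem equiv_H1_norm_sq_norm:
  assumes e: "bij_betw e (UNIV :: nat set) I" and W: "adm W" and dom: "dominates W"
  shows "equiv_H1_norm M (\<lambda>f. sq_norm M I (cf f) W)"
proof -
  obtain K1 where K1: "K1 > 0" "\<And>f. in_H1 M f \<Longrightarrow> sq_norm M I (cf f) W \<le> ennreal (K1 * H1_norm M f)"
    using sq_norm_le_H1[OF e W] by blast
  obtain K2 where K2: "K2 > 0" "\<And>f. integrable M f \<Longrightarrow> series_L1 M (\<lambda>i y. cf f i * w i y) e f \<Longrightarrow> sq_norm M I (cf f) W < \<infinity> \<Longrightarrow>
    ennreal (H1_norm M f) \<le> ennreal K2 * sq_norm M I (cf f) W"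
    using series_imp_H1[OF e W dom] by blast
  have low: "ennreal (H1_norm M f) \<le> ennreal K2 * sq_norm M I (cf f) W" if f: "in_H1 M f" for f
  proof (rule K2(2))
    show "integrable M f" using f by (simp add: in_H1_def)
    show "series_L1 M (\<lambda>i y. cf f i * w i y) e f" by (rule H1_series[OF e f])
    show "sq_norm M I (cf f) W < \<infinity>" using K1(2)[OF f] by (simp add: order_le_less_trans)
  qed
  note Sm = Ssup_measurable[OF e W]
  have Wn: "\<forall>i\<in>F. \<forall>y. 0 \<le> W i y" if "F \<subseteq> I" for F using adm_nonneg[OF W] that by blast
  show ?thesis unfolding equiv_H1_norm_def
  proof (intro conjI allI impI)
    fix f g assume f: "in_H1 M f" and g: "in_H1 M g"
    have fi: "integrable M f" and gi: "integrable M g" using f g by (auto simp: in_H1_def)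
    have "Ssup (cf (\<lambda>y. f y + g y)) W y \<le> Ssup (cf f) W y + Ssup (cf g) W y" for y
      unfolding Ssup_def[of "cf (\<lambda>y. f y + g y)"]
    proof (rule SUP_least)
      fix F assume F: "F \<in> {F. finite F \<and> F \<subseteq> I}"
      have "sqfun (cf (\<lambda>y. f y + g y)) W F y = sqfun (\<lambda>i. cf f i + cf g i) W F y"
        using F cf_add[OF fi gi] by (intro fun_cong[OF sqfun_cong]) blast
      also have "\<dots> \<le> sqfun (cf f) W F y + sqfun (cf g) W F y" by (rule sqfun_add_le[OF Wn]) (use F in auto)
      finally have "ennreal (sqfun (cf (\<lambda>y. f y + g y)) W F y) \<le> ennreal (sqfun (cf f) W F y + sqfun (cf g) W F y)" by (rule ennreal_leI)
      also have "\<dots> = ennreal (sqfun (cf f) W F y) + ennreal (sqfun (cf g) W F y)"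
        using F by (intro ennreal_plus sqfun_nonneg Wn) auto
      also have "\<dots> \<le> Ssup (cf f) W y + Ssup (cf g) W y" using F by (intro add_mono Ssup_upper) auto
      finally show "ennreal (sqfun (cf (\<lambda>y. f y + g y)) W F y) \<le> Ssup (cf f) W y + Ssup (cf g) W y" .
    qed
    then have "sq_norm M I (cf (\<lambda>y. f y + g y)) W \<le> (\<integral>\<^sup>+ y. Ssup (cf f) W y + Ssup (cf g) W y \<partial>M)"
      unfolding sq_norm_eq by (rule nn_integral_mono)
    also have "\<dots> = sq_norm M I (cf f) W + sq_norm M I (cf g) W"
      unfolding sq_norm_eq by (rule nn_integral_add[OF Sm Sm])
    finally show "sq_norm M I (cf (\<lambda>y. f y + g y)) W \<le> sq_norm M I (cf f) W + sq_norm M I (cf g) W" .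
  next
    fix f :: "'a \<Rightarrow> real" and t :: real
    have "cf (\<lambda>y. t * f y) = (\<lambda>i. t * cf f i)" by (rule ext) (rule cf_cmult)
    then have "Ssup (cf (\<lambda>y. t * f y)) W y = ennreal \<bar>t\<bar> * Ssup (cf f) W y" for y
      unfolding Ssup_def by (simp add: sqfun_cmult ennreal_mult' SUP_mult_left_ennreal)
    then have "Ssup (cf (\<lambda>y. t * f y)) W = (\<lambda>y. ennreal \<bar>t\<bar> * Ssup (cf f) W y)" by (rule ext)
    then show "sq_norm M I (cf (\<lambda>y. t * f y)) W = ennreal \<bar>t\<bar> * sq_norm M I (cf f) W"
      unfolding sq_norm_eq by (simp add: nn_integral_cmult[OF Sm])
  next
    fix f assume f: "in_H1 M f"
    have fi: "integrable M f" using f by (simp add: in_H1_def)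
    show "sq_norm M I (cf f) W = 0 \<longleftrightarrow> (AE y in M. f y = 0)"
    proof
      assume "sq_norm M I (cf f) W = 0"
      then have n0: "H1_norm M f \<le> 0" using low[OF f] by (simp add: ennreal_eq_0_iff)
      have "(LINT y|M. \<bar>f y\<bar>) \<le> 0"
      proof (rule field_le_epsilon)
        fix \<epsilon> :: real assume "0 < \<epsilon>"
        then show "(LINT y|M. \<bar>f y\<bar>) \<le> 0 + \<epsilon>" using H1_le_props(2)[OF in_H1_imp_H1_le[OF f]] n0 by fastforce
      qed
      then have "(LINT y|M. \<bar>f y\<bar>) = 0" by (intro antisym integral_nonneg_AE) auto
      then have "AE y in M. \<bar>f y\<bar> = 0" using fi by (subst (asm) integral_nonneg_eq_0_iff_AE) auto
      then show "AE y in M. f y = 0" by eventually_elim simp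
    next
      assume ae: "AE y in M. f y = 0"
      have "cf f i = 0" for i
        unfolding cf_def by (rule integral_eq_zero_AE) (use ae in eventually_elim, simp)
      then have "sqfun (cf f) W F y = 0" for F y by (simp add: sqfun_def)
      then have "Ssup (cf f) W y = 0" for y unfolding Ssup_def by (simp add: bot_ennreal[symmetric])
      then have "Ssup (cf f) W = (\<lambda>_. 0)" by (rule ext)
      then show "sq_norm M I (cf f) W = 0" unfolding sq_norm_eq by simp
    qed
  next
    show "\<exists>C>0. \<forall>f. in_H1 M f \<longrightarrow> ennreal (H1_norm M f) \<le> ennreal C * sq_norm M I (cf f) W \<and>
      sq_norm M I (cf f) W \<le> ennreal C * ennreal (H1_norm M f)"
    proof (intro exI[of _ "max K1 K2"] conjI allI impI)
      fix f assume f: "in_H1 M f"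
      have "ennreal K2 * sq_norm M I (cf f) W \<le> ennreal (max K1 K2) * sq_norm M I (cf f) W"
        by (intro mult_right_mono ennreal_leI) auto
      then show "ennreal (H1_norm M f) \<le> ennreal (max K1 K2) * sq_norm M I (cf f) W" using low[OF f] by (rule order_trans[rotated])
      have "sq_norm M I (cf f) W \<le> ennreal (K1 * H1_norm M f)" by (rule K1(2)[OF f])
      also have "\<dots> \<le> ennreal (max K1 K2 * H1_norm M f)" using H1_norm_nonneg[OF f] by (intro ennreal_leI mult_right_mono) auto
      also have "\<dots> = ennreal (max K1 K2) * ennreal (H1_norm M f)"
        using H1_norm_nonneg[OF f] by (rule ennreal_mult'')
      finally show "sq_norm M I (cf f) W \<le> ennreal (max K1 K2) * ennreal (H1_norm M f)" .
    qed (use K1(1) in auto)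
  qed
qed

end

section \<open>Unconditional convergence\<close>

text \<open>A Rademacher sum. The signs are encoded by the set T of indices with a plus sign, so an
  average over signs is a sum over \<open>Pow F\<close>.\<close>

definition signed_sum :: "'j set \<Rightarrow> ('j \<Rightarrow> real) \<Rightarrow> 'j set \<Rightarrow> real" where
  "signed_sum F a T = (\<Sum>i\<in>F. if i \<in> T then a i else - a i)"

text \<open>Conditioning on the sign of the new index j.\<close>

lemma sum_Pow_insert:
  fixes g :: "'j set \<Rightarrow> real"
  assumes "finite F" "j \<notin> F"
  shows "(\<Sum>T\<in>Pow (insert j F). g T) = (\<Sum>T\<in>Pow F. g T + g (insert j T))"
proof -
  have inj: "inj_on (insert j) (Pow F)" using assms(2) by (intro inj_onI) (auto simp: insert_ident)
  have "Pow F \<inter> insert j ` Pow F = {}" using assms(2) by auto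
  then have "(\<Sum>T\<in>Pow (insert j F). g T) = (\<Sum>T\<in>Pow F. g T) + (\<Sum>T\<in>insert j ` Pow F. g T)"
    unfolding Pow_insert using assms(1) by (intro sum.union_disjoint) auto
  also have "(\<Sum>T\<in>insert j ` Pow F. g T) = (\<Sum>T\<in>Pow F. g (insert j T))" by (simp add: sum.reindex[OF inj])
  finally show ?thesis by (simp add: sum.distrib)
qed

lemma signed_sum_insert:
  assumes "finite F" "j \<notin> F" "T \<in> Pow F"
  shows "signed_sum (insert j F) a T = signed_sum F a T - a j"
    and "signed_sum (insert j F) a (insert j T) = signed_sum F a T + a j"
proof -
  have "j \<notin> T" using assms by auto
  then show "signed_sum (insert j F) a T = signed_sum F a T - a j" using assms by (simp add: signed_sum_def)
  have "(\<Sum>i\<in>F. if i \<in> insert j T then a i else - a i) = signed_sum F a T"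
    unfolding signed_sum_def using assms(2) by (intro sum.cong) auto
  then show "signed_sum (insert j F) a (insert j T) = signed_sum F a T + a j"
    using assms by (simp add: signed_sum_def)
qed

text \<open>Induction over F: the two signs of the new term cancel its odd powers. The constant 3 is
  that of the fourth moment of a Gaussian variable.\<close>

lemma signed_sum_moments:
  assumes "finite F"
  shows "(\<Sum>T\<in>Pow F. (signed_sum F a T)\<^sup>2) = 2 ^ card F * (\<Sum>i\<in>F. (a i)\<^sup>2)"
    and "(\<Sum>T\<in>Pow F. (signed_sum F a T) ^ 4) \<le> 2 ^ card F * (3 * (\<Sum>i\<in>F. (a i)\<^sup>2)\<^sup>2)"
  using assms
proof (induction F rule: finite_induct)
  case (insert j F)
  let ?X = "signed_sum F a" and ?s = "\<Sum>i\<in>F. (a i)\<^sup>2"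
  have "(\<Sum>T\<in>Pow (insert j F). (signed_sum (insert j F) a T)\<^sup>2) = (\<Sum>T\<in>Pow F. (?X T - a j)\<^sup>2 + (?X T + a j)\<^sup>2)"
    unfolding sum_Pow_insert[OF insert.hyps] using signed_sum_insert[OF insert.hyps] by (intro sum.cong) auto
  also have "\<dots> = (\<Sum>T\<in>Pow F. 2 * (?X T)\<^sup>2 + 2 * (a j)\<^sup>2)" by (intro sum.cong) (auto simp: power2_eq_square algebra_simps)
  also have "\<dots> = 2 * (\<Sum>T\<in>Pow F. (?X T)\<^sup>2) + 2 ^ card F * (2 * (a j)\<^sup>2)"
    using insert.hyps(1) by (simp add: sum.distrib sum_distrib_left card_Pow)
  finally show "(\<Sum>T\<in>Pow (insert j F). (signed_sum (insert j F) a T)\<^sup>2) = 2 ^ card (insert j F) * (\<Sum>i\<in>insert j F. (a i)\<^sup>2)"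
    using insert by (simp add: distrib_left)
  have "(\<Sum>T\<in>Pow (insert j F). (signed_sum (insert j F) a T) ^ 4) = (\<Sum>T\<in>Pow F. (?X T - a j) ^ 4 + (?X T + a j) ^ 4)"
    unfolding sum_Pow_insert[OF insert.hyps] using signed_sum_insert[OF insert.hyps] by (intro sum.cong) auto
  also have "\<dots> = (\<Sum>T\<in>Pow F. 2 * (?X T) ^ 4 + 12 * (a j)\<^sup>2 * (?X T)\<^sup>2 + 2 * (a j) ^ 4)"
    by (intro sum.cong) (auto simp: power2_eq_square power4_eq_xxxx algebra_simps)
  also have "\<dots> = 2 * (\<Sum>T\<in>Pow F. (?X T) ^ 4) + 12 * (a j)\<^sup>2 * (\<Sum>T\<in>Pow F. (?X T)\<^sup>2) + 2 ^ card F * (2 * (a j) ^ 4)"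
    using insert.hyps(1) by (simp add: sum.distrib sum_distrib_left card_Pow)
  \<comment> \<open>The fourth power of the new term is tripled in order to complete the square of
    the sum.\<close>
  also have "\<dots> \<le> 2 * (2 ^ card F * (3 * ?s\<^sup>2)) + 12 * (a j)\<^sup>2 * (2 ^ card F * ?s) + 2 ^ card F * (2 * (3 * (a j) ^ 4))"
    using insert.IH by (intro add_mono mult_left_mono) auto
  also have "\<dots> = 2 ^ card (insert j F) * (3 * (\<Sum>i\<in>insert j F. (a i)\<^sup>2)\<^sup>2)"
    using insert.hyps by (simp add: power2_sum power_mult[symmetric] algebra_simps power2_eq_square power4_eq_xxxx)
  finally show "(\<Sum>T\<in>Pow (insert j F). (signed_sum (insert j F) a T) ^ 4) \<le> 2 ^ card (insert j F) * (3 * (\<Sum>i\<in>insert j F. (a i)\<^sup>2)\<^sup>2)" .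
qed (auto simp: signed_sum_def)

text \<open>With u = |t| this reduces to u - u^3 / 4 \<le> 1. The product in the first inequality is
  the tangent-line inequality for 216 u^3 at u = 7/6, a rational number close to the maximiser 2 /
  sqrt 3 of the left side.\<close>

lemma abs_ge_square_minus_fourth: "t\<^sup>2 - t ^ 4 / 4 \<le> \<bar>t\<bar>" for t :: real
proof -
  define u where "u = \<bar>t\<bar>"
  have u: "u \<ge> 0" by (simp add: u_def)
  have "0 \<le> (6 * u - 7)\<^sup>2 * (6 * u + 14)" using u by simp
  then have "0 \<le> 216 * u ^ 3 - 882 * u + 686" by (simp add: power2_eq_square power3_eq_cube algebra_simps)
  then have "u - u ^ 3 / 4 \<le> 1" using u by simp
  then have "u * (u - u ^ 3 / 4) \<le> u * 1" using u by (rule mult_left_mono)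
  then have "u\<^sup>2 - u ^ 4 / 4 \<le> u" by (simp add: power2_eq_square power3_eq_cube power4_eq_xxxx algebra_simps)
  moreover have "u\<^sup>2 = t\<^sup>2" "u ^ 4 = t ^ 4" by (simp_all add: u_def)
  ultimately show ?thesis by (simp add: u_def)
qed

text \<open>The lower Khinchine inequality follows from the second and fourth moments by applying the
  elementary inequality above to the normalised signed sums.\<close>

lemma khinchine:
  assumes F: "finite F"
  shows "sqrt (\<Sum>i\<in>F. (a i)\<^sup>2) \<le> 4 / 2 ^ card F * (\<Sum>T\<in>Pow F. \<bar>signed_sum F a T\<bar>)"
proof -
  define s where "s = sqrt (\<Sum>i\<in>F. (a i)\<^sup>2)"
  have s2: "s\<^sup>2 = (\<Sum>i\<in>F. (a i)\<^sup>2)" unfolding s_def by (simp add: sum_nonneg)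
  have s0: "s \<ge> 0" unfolding s_def by (simp add: sum_nonneg)
  show ?thesis
  proof (cases "s = 0")
    case True
    then show ?thesis unfolding s_def[symmetric] by (simp add: sum_nonneg)
  next
    case False
    then have s: "s > 0" using s0 by simp
    let ?X = "signed_sum F a"
    \<comment> \<open>After normalisation the mean of the squares is 1 and that of the fourth powers
      at most 3; 1 - 3/4 = 1/4 is the origin of the constant 4.\<close>
    have "2 ^ card F * s\<^sup>2 / s\<^sup>2 - 2 ^ card F * (3 * (s\<^sup>2)\<^sup>2) / (4 * s ^ 4) \<le> (\<Sum>T\<in>Pow F. (?X T)\<^sup>2) / s\<^sup>2 - (\<Sum>T\<in>Pow F. (?X T) ^ 4) / (4 * s ^ 4)"
      using signed_sum_moments[OF F, of a] unfolding s2[symmetric]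
      by (intro diff_mono divide_right_mono) auto
    also have "\<dots> = (\<Sum>T\<in>Pow F. (?X T / s)\<^sup>2 - (?X T / s) ^ 4 / 4)"
      by (simp add: sum_subtractf power_divide sum_divide_distrib mult.commute)
    also have "\<dots> \<le> (\<Sum>T\<in>Pow F. \<bar>?X T / s\<bar>)" by (intro sum_mono abs_ge_square_minus_fourth)
    also have "\<dots> = (\<Sum>T\<in>Pow F. \<bar>?X T\<bar>) / s" using s by (simp add: sum_divide_distrib)
    finally have "2 ^ card F * s\<^sup>2 / s\<^sup>2 - 2 ^ card F * (3 * (s\<^sup>2)\<^sup>2) / (4 * s ^ 4) \<le> (\<Sum>T\<in>Pow F. \<bar>?X T\<bar>) / s" .
    moreover have "2 ^ card F * s\<^sup>2 / s\<^sup>2 - 2 ^ card F * (3 * (s\<^sup>2)\<^sup>2) / (4 * s ^ 4) = 2 ^ card F / 4"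
      using s by (simp add: power_mult[symmetric])
    ultimately have "2 ^ card F / 4 * s \<le> (\<Sum>T\<in>Pow F. \<bar>?X T\<bar>)" using s by (simp add: pos_le_divide_eq)
    then show ?thesis unfolding s_def[symmetric] by (simp add: field_simps)
  qed
qed

text \<open>Finite lists are extended in turns: by a block with property P that avoids everything
  listed so far, then by the next element of e if it is still missing. The latter ensures that all
  of J is enumerated.\<close>

lemma enumeration_with_blocks:
  assumes e: "bij_betw e (UNIV :: nat set) J"
    and blocks: "\<And>S. finite S \<Longrightarrow> S \<subseteq> J \<Longrightarrow> \<exists>F. finite F \<and> F \<subseteq> J - S \<and> F \<noteq> {} \<and> P F"
  shows "\<exists>e'. bij_betw e' (UNIV :: nat set) J \<and> (\<forall>N. \<exists>m n. N \<le> m \<and> m \<le> n \<and> P (e' ` {m..<n}))"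
proof -
  have "\<exists>l. distinct l \<and> set l \<subseteq> J - S \<and> l \<noteq> [] \<and> P (set l)" if "finite S" "S \<subseteq> J" for S
    using blocks[OF that] finite_distinct_list by (metis set_empty)
  then obtain blk where blk: "\<And>S. finite S \<Longrightarrow> S \<subseteq> J \<Longrightarrow> distinct (blk S) \<and> set (blk S) \<subseteq> J - S \<and> blk S \<noteq> [] \<and> P (set (blk S))"
    by metis
  define L where "L = rec_nat [] (\<lambda>n l. (l @ blk (set l)) @ (if e n \<in> set (l @ blk (set l)) then [] else [e n]))"
  have L0: "L 0 = []" and LS: "L (Suc n) = (L n @ blk (set (L n))) @ (if e n \<in> set (L n @ blk (set (L n))) then [] else [e n])" for n
    by (simp_all add: L_def)
  have eJ: "e n \<in> J" for n using e by (auto simp: bij_betw_def)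
  have inv: "distinct (L n) \<and> set (L n) \<subseteq> J" for n
  proof (induction n)
    case (Suc n)
    then show ?case using blk[of "set (L n)"] eJ[of n] unfolding LS by auto
  qed (simp add: L0)
  have len: "length (L n) < length (L (Suc n))" for n
    using blk[of "set (L n)"] inv[of n] unfolding LS by auto
  have len_ge: "n \<le> length (L n)" for n
    by (induction n) (use len in \<open>auto simp: less_eq_Suc_le intro: le_trans\<close>)
  have pre: "\<exists>r. L m = L n @ r" if "n \<le> m" for n m
    using that by (induction m rule: dec_induct) (auto simp: LS)
  \<comment> \<open>After m + 1 turns the list has more than m entries, since every block is
    nonempty; later turns only append to it.\<close>
  define e' where "e' m = L (Suc m) ! m" for m
  have e'_eq: "e' m = L n ! m" if "m < length (L n)" for m n
  proof -
    have 1: "m < length (L (Suc m))" using len_ge[of "Suc m"] by simp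
    show ?thesis
    proof (cases "n \<le> Suc m")
      case True
      then obtain r where "L (Suc m) = L n @ r" using pre by blast
      then show ?thesis using that by (simp add: e'_def nth_append)
    next
      case False
      then obtain r where "L n = L (Suc m) @ r" using pre[of "Suc m" n] by auto
      then show ?thesis using 1 by (simp add: e'_def nth_append)
    qed
  qed
  have in_L: "m < length (L (Suc m))" for m using len_ge[of "Suc m"] by simp
  have bij: "bij_betw e' UNIV J"
    unfolding bij_betw_def
  proof
    show "inj e'"
    proof (rule injI)
      fix m n assume eq: "e' m = e' n"
      let ?k = "Suc (max m n)"
      have "m < length (L ?k)" "n < length (L ?k)" using len_ge[of ?k] by auto
      then show "m = n" using eq e'_eq inv[of ?k] by (metis nth_eq_iff_index_eq)
    qed
    show "range e' = J"
    proof
      show "range e' \<subseteq> J"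
      proof
        fix i assume "i \<in> range e'"
        then obtain m where "i = L (Suc m) ! m" by (auto simp: e'_def)
        then have "i \<in> set (L (Suc m))" using in_L[of m] by simp
        then show "i \<in> J" using inv by blast
      qed
      show "J \<subseteq> range e'"
      proof
        fix i assume "i \<in> J"
        then obtain n where "i = e n" using e by (auto simp: bij_betw_def)
        then have "i \<in> set (L (Suc n))" unfolding LS by auto
        then obtain m where "m < length (L (Suc n))" "L (Suc n) ! m = i" by (auto simp: in_set_conv_nth)
        then show "i \<in> range e'" using e'_eq by (metis rangeI)
      qed
    qed
  qed
  \<comment> \<open>The block appended to \<open>L N\<close> occupies the positions from
    \<open>length (L N)\<close> on, and this length is at least N.\<close>
  have "\<exists>m n. N \<le> m \<and> m \<le> n \<and> P (e' ` {m..<n})" for N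
  proof -
    let ?b = "blk (set (L N))" and ?m = "length (L N)"
    have "e' (?m + j) = ?b ! j" if "j < length ?b" for j
    proof -
      have "?m + j < length (L (Suc N))" using that unfolding LS by simp
      then have "e' (?m + j) = L (Suc N) ! (?m + j)" by (rule e'_eq)
      then show ?thesis using that unfolding LS by (simp add: nth_append)
    qed
    then have "(\<lambda>j. e' (?m + j)) ` {..<length ?b} = (\<lambda>j. ?b ! j) ` {..<length ?b}" by (intro image_cong) auto
    also have "\<dots> = set ?b" by (auto simp: set_conv_nth)
    also have "(\<lambda>j. e' (?m + j)) ` {..<length ?b} = e' ` {?m..<?m + length ?b}"
    proof -
      have "{?m..<?m + length ?b} = (+) ?m ` {..<length ?b}"
        using image_add_atLeastLessThan[of ?m 0 "length ?b"] by (simp add: lessThan_atLeast0 add.commute)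
      then show ?thesis by (simp only: image_image)
    qed
    finally have "e' ` {?m..<?m + length ?b} = set ?b" .
    moreover have "P (set ?b)" using blk[of "set (L N)"] inv[of N] by simp
    ultimately show ?thesis using len_ge[of N] by (intro exI[of _ ?m] exI[of _ "?m + length ?b"]) auto
  qed
  with bij show ?thesis by blast
qed

context wavelet_space
begin

definition WIII :: "int \<times> 'i \<times> 'i \<Rightarrow> 'a \<Rightarrow> real" where "WIII i y = \<bar>w i y\<bar>\<^sup>2"

lemma adm_WIII: "adm WIII"
proof (rule admI[OF par_pos(4,3)])
  show "0 \<le> WIII i y" "sqrt (WIII i y) \<le> C / sqrt (V M (pt i) (scl i)) * exp (- \<nu> * dist (pt i) y / scl i)" if "i \<in> I" for i y
    using w_size[OF that, of y] by (simp_all add: WIII_def)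
  show "WIII i \<in> borel_measurable M" if "i \<in> I" for i
    using that unfolding WIII_def[abs_def] by measurable
qed

text \<open>Here the lower bound for the wavelet on the small ball enters, which is the purpose of
  \<epsilon>0.\<close>

lemma dominates_WIII: "dominates WIII"
proof -
  have "WV i y \<le> (1 / c0)\<^sup>2 * WIII i y" if i: "i \<in> I" for i y
  proof (cases "y \<in> wb i")
    case True
    have "(c0 / sqrt (measure M (cub i)))\<^sup>2 \<le> \<bar>w i y\<bar>\<^sup>2"
      using w_low[OF i True] par_pos by (intro power_mono) auto
    then have "c0\<^sup>2 * (1 / measure M (cub i)) \<le> WIII i y" by (simp add: WIII_def power_divide)
    then have "(1 / c0)\<^sup>2 * (c0\<^sup>2 * (1 / measure M (cub i))) \<le> (1 / c0)\<^sup>2 * WIII i y" by (intro mult_left_mono) auto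
    then show ?thesis using True par_pos by (simp add: WV_def power_divide)
  qed (simp add: WV_def WIII_def)
  then show ?thesis unfolding dominates_def using par_pos by (intro exI[of _ "1 / c0"]) auto
qed

lemma dominates_WIV: "dominates WIV" and dominates_WV: "dominates WV"
  unfolding dominates_def using WV_le_WIV by (auto intro!: exI[of _ 1])

text \<open>A gliding hump: if no finite set S keeps the sums off S bounded by 1, some enumeration
  contains blocks of norm above 1 arbitrarily late, and its series is not Cauchy. Given such an S,
  the terms inside S add a fixed constant.\<close>

lemma uncond_imp_bounded:
  assumes e: "bij_betw e (UNIV :: nat set) I" and unc: "uncond_L1 M I (\<lambda>i y. c i * w i y)"
  shows "\<exists>B. \<forall>F. finite F \<longrightarrow> F \<subseteq> I \<longrightarrow> (LINT y|M. \<bar>wsum F c y\<bar>) \<le> B"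
proof -
  have wi: "integrable M (wsum F c)" if "F \<subseteq> I" for F by (rule wsum_integrable[OF that])
  have "\<exists>S. finite S \<and> S \<subseteq> I \<and> (\<forall>F. finite F \<longrightarrow> F \<subseteq> I - S \<longrightarrow> (LINT y|M. \<bar>wsum F c y\<bar>) \<le> 1)"
  proof (rule ccontr)
    assume neg: "\<not> ?thesis"
    have blocks: "\<exists>F. finite F \<and> F \<subseteq> I - S \<and> F \<noteq> {} \<and> 1 < (LINT y|M. \<bar>wsum F c y\<bar>)" if "finite S" "S \<subseteq> I" for S
    proof -
      have "\<not> (\<forall>F. finite F \<longrightarrow> F \<subseteq> I - S \<longrightarrow> (LINT y|M. \<bar>wsum F c y\<bar>) \<le> 1)"
        using neg[unfolded not_ex, rule_format, of S] that by simp
      then obtain F where F: "finite F" "F \<subseteq> I - S" "\<not> (LINT y|M. \<bar>wsum F c y\<bar>) \<le> 1" by auto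
      then have "F \<noteq> {}" by auto
      then show ?thesis using F by (auto simp: not_le)
    qed
    from enumeration_with_blocks[OF e, where P = "\<lambda>F. 1 < (LINT y|M. \<bar>wsum F c y\<bar>)", OF blocks]
    obtain e' where e': "bij_betw e' (UNIV :: nat set) I"
      and bl: "\<And>N. \<exists>m n. N \<le> m \<and> m \<le> n \<and> 1 < (LINT y|M. \<bar>wsum (e' ` {m..<n}) c y\<bar>)" by blast
    obtain g where g: "integrable M g" "series_L1 M (\<lambda>i y. c i * w i y) e' g" using unc e' unfolding uncond_L1_def by blast
    have wi': "integrable M (wsum (e' ` X) c)" for X by (rule wi[OF enum_subset[OF e']])
    have "(\<lambda>n. LINT y|M. \<bar>wsum (e' ` {..<n}) c y - g y\<bar>) \<longlonglongrightarrow> 0"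
      using g wi' unfolding series_wsum[OF e'] by (subst (asm) L1_conv_iff) auto
    then have "\<forall>\<^sub>F n in sequentially. (LINT y|M. \<bar>wsum (e' ` {..<n}) c y - g y\<bar>) < 1 / 2"
      by (rule order_tendstoD) simp
    then obtain N where N: "\<And>n. N \<le> n \<Longrightarrow> (LINT y|M. \<bar>wsum (e' ` {..<n}) c y - g y\<bar>) < 1 / 2"
      by (auto simp: eventually_sequentially)
    obtain m n where mn: "N \<le> m" "m \<le> n" "1 < (LINT y|M. \<bar>wsum (e' ` {m..<n}) c y\<bar>)" using bl by blast
    have inj: "inj e'" using e' by (simp add: bij_betw_def)
    have sp: "wsum (e' ` {..<n}) c y = wsum (e' ` {..<m}) c y + wsum (e' ` {m..<n}) c y" for y
    proof -
      have "{..<n} = {..<m} \<union> {m..<n}" using mn by auto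
      then have "e' ` {..<n} = e' ` {..<m} \<union> e' ` {m..<n}" by auto
      moreover have "e' ` {..<m} \<inter> e' ` {m..<n} = {}" by (auto simp: inj_eq[OF inj])
      ultimately show ?thesis by (simp add: sum.union_disjoint)
    qed
    have i1: "integrable M (\<lambda>y. \<bar>wsum (e' ` {..<k}) c y - g y\<bar>)" for k
      by (intro integrable_abs Bochner_Integration.integrable_diff wi' g)
    have "(LINT y|M. \<bar>wsum (e' ` {m..<n}) c y\<bar>) \<le> (LINT y|M. \<bar>wsum (e' ` {..<n}) c y - g y\<bar> + \<bar>wsum (e' ` {..<m}) c y - g y\<bar>)"
    proof (rule integral_mono)
      show "integrable M (\<lambda>y. \<bar>wsum (e' ` {m..<n}) c y\<bar>)" by (intro integrable_abs wi')
      show "integrable M (\<lambda>y. \<bar>wsum (e' ` {..<n}) c y - g y\<bar> + \<bar>wsum (e' ` {..<m}) c y - g y\<bar>)"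
        by (intro Bochner_Integration.integrable_add i1)
      show "\<bar>wsum (e' ` {m..<n}) c y\<bar> \<le> \<bar>wsum (e' ` {..<n}) c y - g y\<bar> + \<bar>wsum (e' ` {..<m}) c y - g y\<bar>" for y
        using sp[of y] by linarith
    qed
    also have "\<dots> = (LINT y|M. \<bar>wsum (e' ` {..<n}) c y - g y\<bar>) + (LINT y|M. \<bar>wsum (e' ` {..<m}) c y - g y\<bar>)"
      by (intro Bochner_Integration.integral_add i1)
    also have "\<dots> < 1 / 2 + 1 / 2" using mn by (intro add_strict_mono N) auto
    finally show False using mn by simp
  qed
  then obtain S where S: "finite S" "S \<subseteq> I" "\<And>F. finite F \<Longrightarrow> F \<subseteq> I - S \<Longrightarrow> (LINT y|M. \<bar>wsum F c y\<bar>) \<le> 1" by blast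
  have "(LINT y|M. \<bar>wsum F c y\<bar>) \<le> (\<Sum>i\<in>S. \<bar>c i\<bar> * (LINT y|M. \<bar>w i y\<bar>)) + 1" if F: "finite F" "F \<subseteq> I" for F
  proof -
    have ia: "integrable M (\<lambda>y. \<bar>c i\<bar> * \<bar>w i y\<bar>)" if "i \<in> S" for i
      using w_integrable[OF subsetD[OF S(2) that]] by simp
    have is1: "integrable M (\<lambda>y. \<Sum>i\<in>S. \<bar>c i\<bar> * \<bar>w i y\<bar>)" using ia by (rule Bochner_Integration.integrable_sum)
    have FS: "F - S \<subseteq> I" "F - S \<subseteq> I - S" "finite (F - S)" using F by auto
    have is2: "integrable M (\<lambda>y. \<bar>wsum (F - S) c y\<bar>)" by (intro integrable_abs wi FS)
    have "(LINT y|M. \<bar>wsum F c y\<bar>) \<le> (LINT y|M. (\<Sum>i\<in>S. \<bar>c i\<bar> * \<bar>w i y\<bar>) + \<bar>wsum (F - S) c y\<bar>)"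
    proof (rule integral_mono)
      show "integrable M (\<lambda>y. \<bar>wsum F c y\<bar>)" by (intro integrable_abs wi F)
      show "integrable M (\<lambda>y. (\<Sum>i\<in>S. \<bar>c i\<bar> * \<bar>w i y\<bar>) + \<bar>wsum (F - S) c y\<bar>)" by (rule Bochner_Integration.integrable_add[OF is1 is2])
      fix y
      have "wsum F c y = wsum (F \<inter> S) c y + wsum (F - S) c y"
        using F(1) by (rule sum.Int_Diff)
      moreover have "\<bar>wsum (F \<inter> S) c y\<bar> \<le> (\<Sum>i\<in>F \<inter> S. \<bar>c i\<bar> * \<bar>w i y\<bar>)"
        unfolding abs_mult[symmetric] by (rule sum_abs)
      moreover have "(\<Sum>i\<in>F \<inter> S. \<bar>c i\<bar> * \<bar>w i y\<bar>) \<le> (\<Sum>i\<in>S. \<bar>c i\<bar> * \<bar>w i y\<bar>)"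
        using S(1) by (intro sum_mono2) auto
      ultimately show "\<bar>wsum F c y\<bar> \<le> (\<Sum>i\<in>S. \<bar>c i\<bar> * \<bar>w i y\<bar>) + \<bar>wsum (F - S) c y\<bar>" by linarith
    qed
    also have "\<dots> = (LINT y|M. (\<Sum>i\<in>S. \<bar>c i\<bar> * \<bar>w i y\<bar>)) + (LINT y|M. \<bar>wsum (F - S) c y\<bar>)"
      by (rule Bochner_Integration.integral_add[OF is1 is2])
    also have "(LINT y|M. (\<Sum>i\<in>S. \<bar>c i\<bar> * \<bar>w i y\<bar>)) = (\<Sum>i\<in>S. \<bar>c i\<bar> * (LINT y|M. \<bar>w i y\<bar>))"
      using Bochner_Integration.integral_sum[of S M "\<lambda>i y. \<bar>c i\<bar> * \<bar>w i y\<bar>", OF ia] by simp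
    finally show ?thesis using S(3)[OF FS(3,2)] by linarith
  qed
  then show ?thesis by blast
qed

text \<open>A signed sum is the difference of two sums over subsets, each of norm at most B. With
  the constant 4 of Khinchine's inequality this gives 4 * 2 B = 8 B.\<close>

lemma uncond_imp_sq_norm:
  assumes e: "bij_betw e (UNIV :: nat set) I" and unc: "uncond_L1 M I (\<lambda>i y. c i * w i y)"
  shows "sq_norm M I c WIII < \<infinity>"
proof -
  obtain B where B: "\<And>F. finite F \<Longrightarrow> F \<subseteq> I \<Longrightarrow> (LINT y|M. \<bar>wsum F c y\<bar>) \<le> B" using uncond_imp_bounded[OF assms] by blast
  have "sq_norm M I c WIII \<le> ennreal (8 * B)"
  proof (rule sq_norm_least[OF e adm_WIII])
    fix F assume F: "finite F" "F \<subseteq> I"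
    have wi: "integrable M (\<lambda>y. \<bar>wsum G c y\<bar>)" if "G \<subseteq> F" for G
      using wsum_integrable[of G c] F that by (intro integrable_abs) auto
    have pw: "sqfun c WIII F y \<le> 4 / 2 ^ card F * (\<Sum>T\<in>Pow F. \<bar>wsum T c y\<bar> + \<bar>wsum (F - T) c y\<bar>)" for y
    proof -
      have "sqfun c WIII F y = sqrt (\<Sum>i\<in>F. (c i * w i y)\<^sup>2)"
        unfolding sqfun_def WIII_def by (simp add: power_mult_distrib)
      also have "\<dots> \<le> 4 / 2 ^ card F * (\<Sum>T\<in>Pow F. \<bar>signed_sum F (\<lambda>i. c i * w i y) T\<bar>)" by (rule khinchine[OF F(1)])
      also have "\<dots> \<le> 4 / 2 ^ card F * (\<Sum>T\<in>Pow F. \<bar>wsum T c y\<bar> + \<bar>wsum (F - T) c y\<bar>)"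
      proof (intro mult_left_mono sum_mono)
        fix T assume T: "T \<in> Pow F"
        have "signed_sum F (\<lambda>i. c i * w i y) T = (\<Sum>i\<in>T. if i \<in> T then c i * w i y else - (c i * w i y)) + (\<Sum>i\<in>F - T. if i \<in> T then c i * w i y else - (c i * w i y))"
          unfolding signed_sum_def using T F(1) by (subst add.commute) (intro sum.subset_diff, auto)
        also have "\<dots> = wsum T c y - wsum (F - T) c y" by (simp add: sum_negf)
        finally show "\<bar>signed_sum F (\<lambda>i. c i * w i y) T\<bar> \<le> \<bar>wsum T c y\<bar> + \<bar>wsum (F - T) c y\<bar>" by linarith
      qed simp
      finally show ?thesis .
    qed
    have iT: "integrable M (\<lambda>y. \<bar>wsum T c y\<bar> + \<bar>wsum (F - T) c y\<bar>)" if "T \<in> Pow F" for T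
      using that by (intro Bochner_Integration.integrable_add wi) auto
    have "(LINT y|M. sqfun c WIII F y) \<le> (LINT y|M. 4 / 2 ^ card F * (\<Sum>T\<in>Pow F. \<bar>wsum T c y\<bar> + \<bar>wsum (F - T) c y\<bar>))"
      using pw sqfun_integrable(1)[OF adm_WIII F] iT by (intro integral_mono integrable_mult_right Bochner_Integration.integrable_sum) auto
    also have "\<dots> = 4 / 2 ^ card F * (\<Sum>T\<in>Pow F. LINT y|M. \<bar>wsum T c y\<bar> + \<bar>wsum (F - T) c y\<bar>)"
      using Bochner_Integration.integral_sum[of "Pow F" M "\<lambda>T y. \<bar>wsum T c y\<bar> + \<bar>wsum (F - T) c y\<bar>", OF iT] by simp
    also have "\<dots> \<le> 4 / 2 ^ card F * (\<Sum>T\<in>Pow F. 2 * B)"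
    proof (intro mult_left_mono sum_mono)
      fix T assume T: "T \<in> Pow F"
      then have T': "finite T" "T \<subseteq> I" "finite (F - T)" "F - T \<subseteq> I" using F finite_subset by auto
      have "(LINT y|M. \<bar>wsum T c y\<bar> + \<bar>wsum (F - T) c y\<bar>) = (LINT y|M. \<bar>wsum T c y\<bar>) + (LINT y|M. \<bar>wsum (F - T) c y\<bar>)"
        using T by (intro Bochner_Integration.integral_add wi) auto
      then show "(LINT y|M. \<bar>wsum T c y\<bar> + \<bar>wsum (F - T) c y\<bar>) \<le> 2 * B" using B[OF T'(1,2)] B[OF T'(3,4)] by linarith
    qed simp
    also have "\<dots> = 8 * B" using F(1) by (simp add: card_Pow)
    finally show "(LINT y|M. sqfun c WIII F y) \<le> 8 * B" .
  qed
  then show ?thesis by (simp add: order_le_less_trans)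
qed

theorem wavelet_characterization:
  assumes fi: "integrable M f"
    and ser: "\<exists>e. bij_betw e (UNIV :: nat set) (wav_index A Q) \<and> series_L1 M (\<lambda>i y. coeff M \<psi> f i * wav \<psi> i y) e f"
  shows "(in_H1 M f \<longleftrightarrow> uncond_L1 M (wav_index A Q) (\<lambda>i y. coeff M \<psi> f i * wav \<psi> i y)) \<and>
         (in_H1 M f \<longleftrightarrow> normIII M A Q \<psi> f < \<infinity>) \<and>
         (in_H1 M f \<longleftrightarrow> normIV M A Q \<psi> f < \<infinity>) \<and>
         (in_H1 M f \<longleftrightarrow> normV M \<delta> A x Q \<psi> \<epsilon>0 f < \<infinity>) \<and>
         equiv_H1_norm M (normIII M A Q \<psi>) \<and>
         equiv_H1_norm M (normIV M A Q \<psi>) \<and>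
         equiv_H1_norm M (normV M \<delta> A x Q \<psi> \<epsilon>0)"
proof -
  have cf_coeff: "coeff M \<psi> g = cf g" for g
    by (rule ext) (simp add: coeff_def cf_def w_def)
  have n3: "normIII M A Q \<psi> = (\<lambda>g. sq_norm M I (cf g) WIII)"
    by (rule ext) (simp add: normIII_def I_def cf_coeff WIII_def[abs_def] w_def)
  have n4: "normIV M A Q \<psi> = (\<lambda>g. sq_norm M I (cf g) WIV)"
    by (rule ext) (simp add: normIV_def I_def cf_coeff WIV_def[abs_def] cub_def gen_def case_prod_unfold)
  have "(Rfun M \<delta> x Q \<epsilon>0 i y)\<^sup>2 = WV i y" for i y
    by (cases i) (simp add: Rfun_def WV_def wb_def pt_def scl_def gen_def cub_def power_divide indicator_def)
  then have n5: "normV M \<delta> A x Q \<psi> \<epsilon>0 = (\<lambda>g. sq_norm M I (cf g) WV)"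
    by (intro ext) (simp add: normV_def I_def cf_coeff)
  \<comment> \<open>The enumeration serves twice: f is the sum of its series along it, and it
    exhibits the index set as countable, on which the equivalences of norms rely.\<close>
  obtain e where e: "bij_betw e (UNIV :: nat set) I" and fs: "series_L1 M (\<lambda>i y. cf f i * w i y) e f"
    using ser by (auto simp: I_def cf_coeff w_def)
  \<comment> \<open>The upper estimate for \<open>adm\<close> and the lower one for
    \<open>dominates\<close> settle (iii), (iv) and (v) alike.\<close>
  have iff: "in_H1 M f \<longleftrightarrow> sq_norm M I (cf f) W < \<infinity>" if W: "adm W" and dom: "dominates W" for W
  proof
    assume f: "in_H1 M f"
    obtain K where "\<And>f. in_H1 M f \<Longrightarrow> sq_norm M I (cf f) W \<le> ennreal (K * H1_norm M f)" using sq_norm_le_H1[OF e W] by blast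
    from this[OF f] show "sq_norm M I (cf f) W < \<infinity>" by (simp add: order_le_less_trans)
  next
    assume "sq_norm M I (cf f) W < \<infinity>"
    then show "in_H1 M f" using series_imp_H1[OF e W dom] fi fs by blast
  qed
  have unc: "in_H1 M f \<longleftrightarrow> uncond_L1 M I (\<lambda>i y. cf f i * w i y)"
  proof
    assume "in_H1 M f"
    then have "sq_norm M I (cf f) WV < \<infinity>" using iff[OF adm_WV dominates_WV] by blast
    then have "\<And>e'. bij_betw e' (UNIV :: nat set) I \<Longrightarrow> series_L1 M (\<lambda>i y. cf f i * w i y) e' f"
      using series_imp_H1[OF e adm_WV dominates_WV] fi fs by blast
    then show "uncond_L1 M I (\<lambda>i y. cf f i * w i y)" unfolding uncond_L1_def using fi by blast
  next
    assume "uncond_L1 M I (\<lambda>i y. cf f i * w i y)"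
    then show "in_H1 M f" using uncond_imp_sq_norm[OF e] iff[OF adm_WIII dominates_WIII] by blast
  qed
  show ?thesis
    unfolding n3 n4 n5 cf_coeff I_def[symmetric] w_def[symmetric]
    using unc iff[OF adm_WIII dominates_WIII] iff[OF adm_WIV dominates_WIV] iff[OF adm_WV dominates_WV]
      equiv_H1_norm_sq_norm[OF e adm_WIII dominates_WIII] equiv_H1_norm_sq_norm[OF e adm_WIV dominates_WIV]
      equiv_H1_norm_sq_norm[OF e adm_WV dominates_WV]
    by blast
qed

end

section \<open>Passage from the assumptions to the locales\<close>

lemma homogeneous_type_doubling_space:
  assumes "homogeneous_type M"
  shows "\<exists>Cd. doubling_space M Cd"
proof -
  have s: "sets M = sets borel" and pos: "\<And>z r. r > 0 \<Longrightarrow> 0 < emeasure M (ball z r) \<and> emeasure M (ball z r) < \<infinity>"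
    using assms unfolding homogeneous_type_def by blast+
  obtain C where C: "\<And>z r. emeasure M (ball z (2 * r)) \<le> ennreal C * emeasure M (ball z r)"
    using assms unfolding homogeneous_type_def by blast
  have fin: "emeasure M (ball z r) < \<infinity>" for z r
    using pos[of r z] by (cases "r > 0") (auto simp: not_less ball_empty)
  have em: "emeasure M (ball z r) = ennreal (V M z r)" for z r
    unfolding V_def using fin[of z r] by (intro emeasure_eq_ennreal_measure) (simp add: less_top)
  show ?thesis
  \<comment> \<open>C is an arbitrary real under \<open>ennreal\<close>; the maximum with 1 provides
    the lower bound required of the doubling constant.\<close>
  proof (intro exI[of _ "max 1 C"] doubling_space.intro s fin)
    show "0 < V M z r" if "r > 0" for z r using pos[OF that, of z] by (simp add: em)
    fix z r
    have "ennreal (V M z (2 * r)) \<le> ennreal C * ennreal (V M z r)" using C[of z r] by (simp add: em)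
    also have "\<dots> \<le> ennreal (max 1 C) * ennreal (V M z r)" by (intro mult_right_mono ennreal_leI) auto
    also have "\<dots> = ennreal (max 1 C * V M z r)" by (simp add: ennreal_mult V_def)
    finally show "V M z (2 * r) \<le> max 1 C * V M z r" by (subst (asm) ennreal_le_iff) (auto simp: V_def)
  qed simp
qed

theorem theorem4p4:
  fixes M :: "'a::metric_space measure" and \<delta> \<epsilon>0 :: real
    and A :: "int \<Rightarrow> 'i set" and x :: "int \<Rightarrow> 'i \<Rightarrow> 'a" and Q :: "int \<Rightarrow> 'i \<Rightarrow> 'a set"
    and \<psi> :: "int \<Rightarrow> 'i \<Rightarrow> 'i \<Rightarrow> 'a \<Rightarrow> real" and f :: "'a \<Rightarrow> real"
  assumes "homogeneous_type M"
    and "0 < \<delta>" and "\<delta> \<le> 1 / 1000"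
    and "dyadic_points \<delta> A x"
    and "dyadic_cubes M \<delta> A x Q"
    and "AH_wavelets M \<delta> A x Q \<psi> \<epsilon>0"
    and "integrable M f"
    and "\<exists>e. bij_betw e (UNIV :: nat set) (wav_index A Q) \<and>
           series_L1 M (\<lambda>i y. coeff M \<psi> f i * wav \<psi> i y) e f"
  shows "(in_H1 M f \<longleftrightarrow> uncond_L1 M (wav_index A Q) (\<lambda>i y. coeff M \<psi> f i * wav \<psi> i y)) \<and>
         (in_H1 M f \<longleftrightarrow> normIII M A Q \<psi> f < \<infinity>) \<and>
         (in_H1 M f \<longleftrightarrow> normIV M A Q \<psi> f < \<infinity>) \<and>
         (in_H1 M f \<longleftrightarrow> normV M \<delta> A x Q \<psi> \<epsilon>0 f < \<infinity>) \<and>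
         equiv_H1_norm M (normIII M A Q \<psi>) \<and>
         equiv_H1_norm M (normIV M A Q \<psi>) \<and>
         equiv_H1_norm M (normV M \<delta> A x Q \<psi> \<epsilon>0)"
proof -
  obtain Cd where Cd: "doubling_space M Cd" using homogeneous_type_doubling_space[OF assms(1)] by blast
  note AH = assms(6)[unfolded AH_wavelets_def]
  from AH[THEN conjunct2, THEN conjunct2, THEN conjunct2, THEN conjunct1]
  obtain \<eta> \<nu> C where k: "0 < \<eta>" "\<eta> \<le> 1" "0 < \<nu>" "0 < C"
    and s: "\<forall>(k, \<alpha>, \<beta>)\<in>wav_index A Q. \<forall>z.
           \<bar>\<psi> k \<alpha> \<beta> z\<bar> \<le> C / sqrt (V M (x (k + 1) \<beta>) (\<delta> powi k))
              * exp (- \<nu> * dist (x (k + 1) \<beta>) z / \<delta> powi k)"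
    and r: "\<forall>(k, \<alpha>, \<beta>)\<in>wav_index A Q. \<forall>z w. dist z w \<le> \<delta> powi k \<longrightarrow>
           \<bar>\<psi> k \<alpha> \<beta> z - \<psi> k \<alpha> \<beta> w\<bar> \<le> C / sqrt (V M (x (k + 1) \<beta>) (\<delta> powi k))
              * (dist z w / \<delta> powi k) powr \<eta> * exp (- \<nu> * dist (x (k + 1) \<beta>) z / \<delta> powi k)"
    by (elim exE conjE) (rule that)
  obtain c where c: "c > 0" "\<forall>(k, \<alpha>, \<beta>)\<in>wav_index A Q.
        ball (x (k + 1) \<beta>) (\<epsilon>0 * \<delta> powi k) \<subseteq> Q k \<alpha> \<and>
        (\<forall>z\<in>ball (x (k + 1) \<beta>) (\<epsilon>0 * \<delta> powi k). \<bar>\<psi> k \<alpha> \<beta> z\<bar> \<ge> c / sqrt (measure M (Q k \<alpha>)))"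
    using assms(6) unfolding AH_wavelets_def by blast
  have "wavelet_space M Cd \<delta> A x Q \<psi> \<epsilon>0 \<eta> \<nu> C c"
    by (intro wavelet_space.intro wavelet_space_axioms.intro dyadic_space.intro dyadic_space_axioms.intro
        Cd assms(2-6) k c s r)
  then show ?thesis by (rule wavelet_space.wavelet_characterization[OF _ assms(7,8)])
qed

end
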